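(* Let $\beta\ge 0$, $\eta>0$ and $s>-\tfrac12$. Then for any $\phi\in H^s(\mathbb{T})$ there exist $T=T(\|\phi\|_{H^s})>0$ and a unique solution $u$ of the integral equation $$u(t)=S(t)\phi-\int_0^t S(t-t')[u(t')u_x(t')]\,dt',\qquad t\in[0,T],$$ satisfying $$u\in C([0,T],H^s(\mathbb{T}))\cap C((0,T),H^{\infty}(\mathbb{T})).$$ Moreover, the flow map $\phi\mapsto u(t)$ is smooth from $H^s(\mathbb{T})$ to $C([0,T],H^s(\mathbb{T}))\cap C((0,T],H^{\infty}(\mathbb{T}))\cap \mathfrak{X}_T^s$.
   Context: $\mathbb{T}$ is the circle; functions and distributions are $2\pi$-periodic. Fourier coefficients: $\widehat f(k)=\frac1{2\pi}\int_{-\pi}^{\pi}e^{-ikz}f(z)\,dz$, $k\in\mathbb{Z}$ (extended to periodic distributions). $H^s(\mathbb{T})$ has norm $\|\phi\|_{H^s}=(2\pi)^{1/2}\|(1+k^2)^{s/2}\widehat\phi(k)\|_{l^2(\mathbb{Z})}$, and $H^\infty(\mathbb{T})=\bigcap_{r}H^r(\mathbb{T})$ with its Fréchet topology. For $t\ge0$, $S(t)$ is the operator $\widehat{S(t)f}(k)=e^{i q(k)t-p(k)t}\widehat f(k)$ with $q(k)=\beta k|k|$, $p(k)=\eta(k^2-|k|)$, $k\in\mathbb{Z}$. The product $u u_x$ is understood as $\frac12\partial_x(u^2)$. For $s<0$ and $0<T\le1$, $X_T^s$ is the space of all $u\in C([0,T];H^s(\mathbb{T}))$ such that $\|u\|_{X_T^s}:=\sup_{t\in(0,T]}\big(\|u(t)\|_{H^s}+t^{|s|/2}\|u(t)\|_{L^2}\big)<\infty$.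 The space $\mathfrak{X}_T^s$ is $X_T^s$ if $-\frac12<s<0$, and $C([0,T];H^s(\mathbb{T}))$ if $s\ge0$ (with $0<T\le1$). Since $T$ depends on the initial datum, the statement on the flow map is understood locally, in accordance with the paper's notion of local well-posedness: for any $\phi^*\in H^s(\mathbb{T})$ there are a time $T>0$ and an open ball $B\ni\phi^*$ in $H^s(\mathbb{T})$ such that the solution with datum $\phi$ exists on $[0,T]$ for every $\phi\in B$, and the flow map is considered on $B$. *)

theory Defs
  imports "HOL-Analysis.Analysis" "HOL-Library.Function_Algebras"
begin

section \<open>Periodic distributions\<close>

definition nderiv :: "nat \<Rightarrow> (real \<Rightarrow> complex) \<Rightarrow> real \<Rightarrow> complex" where
  "nderiv n f = ((\<lambda>g x. vector_derivative g (at x)) ^^ n) f"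

definition periodic :: "(real \<Rightarrow> complex) \<Rightarrow> bool" where
  "periodic f \<longleftrightarrow> (\<forall>x. f (x + 2 * pi) = f x)"

definition test_functions :: "(real \<Rightarrow> complex) set" where
  "test_functions = {f. periodic f \<and> (\<forall>n x. nderiv n f differentiable at x)}"

text \<open>Continuity of a functional on test functions is expressed by a bound through some
  \<open>C\<^sup>N\<close>-norm: \<open>M\<close> ranges over the upper bounds of \<open>\<bar>f\<^sup>(\<^sup>n\<^sup>)(x)\<bar>\<close>, \<open>n \<le> N\<close>. The value \<open>0\<close> off the test
  functions makes equality of functionals agree with equality of distributions.\<close>

definition is_pdist :: "((real \<Rightarrow> complex) \<Rightarrow> complex) \<Rightarrow> bool" where
  "is_pdist L \<longleftrightarrow>
     (\<forall>f\<in>test_functions. \<forall>g\<in>test_functions. L (\<lambda>x. f x + g x) = L f + L g) \<and>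
     (\<forall>c. \<forall>f\<in>test_functions. L (\<lambda>x. c * f x) = c * L f) \<and>
     (\<exists>C N. \<forall>f\<in>test_functions. \<forall>M.
        (\<forall>n\<le>N. \<forall>x. cmod (nderiv n f x) \<le> M) \<longrightarrow> cmod (L f) \<le> C * M) \<and>
     (\<forall>f. f \<notin> test_functions \<longrightarrow> L f = 0)"

lemma is_pdist_zero: "is_pdist (\<lambda>f. 0)"
proof -
  have "\<exists>C N. \<forall>f\<in>test_functions. \<forall>M.
      (\<forall>n\<le>(N::nat). \<forall>x. cmod (nderiv n f x) \<le> M) \<longrightarrow> cmod 0 \<le> C * M"
    by (rule exI[of _ 0]) simp
  then show ?thesis by (simp add: is_pdist_def)
qed

lemma is_pdist_lincomb:
  assumes K: "is_pdist K" and L: "is_pdist L"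
  shows "is_pdist (\<lambda>f. a * K f + b * L f)"
proof -
  obtain C1 N1 where 1: "\<And>f M. f \<in> test_functions \<Longrightarrow>
      (\<forall>n\<le>N1. \<forall>x. cmod (nderiv n f x) \<le> M) \<Longrightarrow> cmod (K f) \<le> C1 * M"
    using K unfolding is_pdist_def by metis
  obtain C2 N2 where 2: "\<And>f M. f \<in> test_functions \<Longrightarrow>
      (\<forall>n\<le>N2. \<forall>x. cmod (nderiv n f x) \<le> M) \<Longrightarrow> cmod (L f) \<le> C2 * M"
    using L unfolding is_pdist_def by metis
  have "cmod (a * K f + b * L f) \<le> (cmod a * C1 + cmod b * C2) * M"
    if f: "f \<in> test_functions" and M: "\<forall>n\<le>max N1 N2. \<forall>x. cmod (nderiv n f x) \<le> M" for f M
  proof -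
    have "cmod (K f) \<le> C1 * M" "cmod (L f) \<le> C2 * M"
      using 1[OF f] 2[OF f] M by auto
    then have "cmod a * cmod (K f) + cmod b * cmod (L f) \<le> cmod a * (C1 * M) + cmod b * (C2 * M)"
      by (intro add_mono mult_left_mono) auto
    then show ?thesis
      using norm_triangle_ineq[of "a * K f" "b * L f"] by (simp add: norm_mult algebra_simps)
  qed
  then have "\<exists>C N. \<forall>f\<in>test_functions. \<forall>M.
      (\<forall>n\<le>N. \<forall>x. cmod (nderiv n f x) \<le> M) \<longrightarrow> cmod (a * K f + b * L f) \<le> C * M"
    by blast
  then show ?thesis
    using K L unfolding is_pdist_def by (simp add: algebra_simps)
qed

typedef pdist = "{L. is_pdist L}" morphisms pairing Abs_pdist
  using is_pdist_zero by blast

setup_lifting type_definition_pdist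

instantiation pdist :: real_vector
begin

lift_definition zero_pdist :: pdist is "\<lambda>f. 0"
  by (rule is_pdist_zero)

lift_definition plus_pdist :: "pdist \<Rightarrow> pdist \<Rightarrow> pdist" is "\<lambda>K L f. K f + L f"
  using is_pdist_lincomb[of _ _ 1 1] by simp

lift_definition minus_pdist :: "pdist \<Rightarrow> pdist \<Rightarrow> pdist" is "\<lambda>K L f. K f - L f"
  using is_pdist_lincomb[of _ _ 1 "-1"] by simp

lift_definition uminus_pdist :: "pdist \<Rightarrow> pdist" is "\<lambda>K f. - K f"
  using is_pdist_lincomb[of _ "\<lambda>f. 0" "-1" 0] is_pdist_zero by simp

lift_definition scaleR_pdist :: "real \<Rightarrow> pdist \<Rightarrow> pdist" is "\<lambda>c K f. complex_of_real c * K f"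
  using is_pdist_lincomb[of _ "\<lambda>f. 0" _ 0] is_pdist_zero by simp

instance
  by standard (transfer; simp add: algebra_simps fun_eq_iff)+

end

lemma nderiv_deriv: "nderiv n (\<lambda>x. vector_derivative f (at x)) = nderiv (Suc n) f"
  by (simp add: nderiv_def funpow_Suc_right del: funpow.simps)

lemma test_function_differentiable: "f \<in> test_functions \<Longrightarrow> f differentiable at x"
  unfolding test_functions_def by (auto simp: nderiv_def dest: spec[of _ "0::nat"])

lemma test_functions_deriv:
  assumes "f \<in> test_functions"
  shows "(\<lambda>x. vector_derivative f (at x)) \<in> test_functions"
proof -
  have per: "f (x + 2 * pi) = f x" for x
    using assms by (simp add: test_functions_def periodic_def)
  have D: "(f has_vector_derivative vector_derivative f (at y)) (at y)" for y
    using test_function_differentiable[OF assms] by (simp add: vector_derivative_works)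
  have "vector_derivative f (at (x + 2 * pi)) = vector_derivative f (at x)" for x
  proof -
    have "((\<lambda>x. x + 2 * pi) has_vector_derivative 1) (at x)"
      by (auto intro!: derivative_eq_intros)
    from vector_diff_chain_at[OF this D]
    have "(f has_vector_derivative vector_derivative f (at (x + 2 * pi))) (at x)"
      by (simp add: o_def per)
    then show ?thesis
      by (rule vector_derivative_at[symmetric])
  qed
  then show ?thesis
    using assms unfolding test_functions_def periodic_def mem_Collect_eq nderiv_deriv by blast
qed

lift_definition dderiv :: "pdist \<Rightarrow> pdist" is
  "\<lambda>L f. if f \<in> test_functions then - L (\<lambda>x. vector_derivative f (at x)) else 0"
proof -
  fix L assume L: "is_pdist L"
  let ?D = "\<lambda>f x. vector_derivative f (at x) :: complex"
  let ?L = "\<lambda>f. if f \<in> test_functions then - L (?D f) else 0"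
  have D: "(f has_vector_derivative ?D f y) (at y)" if "f \<in> test_functions" for f y
    using test_function_differentiable[OF that] by (simp add: vector_derivative_works)
  have nadd: "nderiv n (\<lambda>x. f x + g x) = (\<lambda>x. nderiv n f x + nderiv n g x)"
    if "f \<in> test_functions" "g \<in> test_functions" for f g n
    using that
  proof (induction n arbitrary: f g)
    case 0 then show ?case by (simp add: nderiv_def)
  next
    case (Suc n)
    have "?D (\<lambda>x. f x + g x) = (\<lambda>x. ?D f x + ?D g x)"
      using Suc.prems by (auto intro!: ext vector_derivative_at has_vector_derivative_add D)
    then show ?case
      using Suc.IH[OF Suc.prems[THEN test_functions_deriv]] by (simp flip: nderiv_deriv)
  qed
  have nmul: "nderiv n (\<lambda>x. c * f x) = (\<lambda>x. c * nderiv n f x)"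
    if "f \<in> test_functions" for f c n
    using that
  proof (induction n arbitrary: f)
    case 0 then show ?case by (simp add: nderiv_def)
  next
    case (Suc n)
    have "?D (\<lambda>x. c * f x) = (\<lambda>x. c * ?D f x)"
      using Suc.prems by (auto intro!: ext vector_derivative_at has_vector_derivative_mult_right D)
    then show ?case
      using Suc.IH[OF Suc.prems[THEN test_functions_deriv]] by (simp flip: nderiv_deriv)
  qed
  have add: "(\<lambda>x. f x + g x) \<in> test_functions"
    if "f \<in> test_functions" "g \<in> test_functions" for f g
    using that nadd[OF that] by (auto simp: test_functions_def periodic_def)
  have mul: "(\<lambda>x. c * f x) \<in> test_functions" if "f \<in> test_functions" for f c
    using that nmul[OF that] by (auto simp: test_functions_def periodic_def)
  have Dadd: "?D (\<lambda>x. f x + g x) = (\<lambda>x. ?D f x + ?D g x)"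
    if "f \<in> test_functions" "g \<in> test_functions" for f g
    using nadd[OF that, of "Suc 0"] by (simp add: nderiv_def)
  have Dmul: "?D (\<lambda>x. c * f x) = (\<lambda>x. c * ?D f x)" if "f \<in> test_functions" for f c
    using nmul[OF that, of "Suc 0"] by (simp add: nderiv_def)
  obtain C N where CN: "\<And>f M. f \<in> test_functions \<Longrightarrow>
      (\<forall>n\<le>N. \<forall>x. cmod (nderiv n f x) \<le> M) \<Longrightarrow> cmod (L f) \<le> C * M"
    using L unfolding is_pdist_def by metis
  have "cmod (?L f) \<le> C * M"
    if f: "f \<in> test_functions" and M: "\<forall>n\<le>Suc N. \<forall>x. cmod (nderiv n f x) \<le> M" for f M
    using CN[OF test_functions_deriv[OF f], of M] M f by (simp add: nderiv_deriv)
  then have "\<exists>C N. \<forall>f\<in>test_functions. \<forall>M.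
      (\<forall>n\<le>N. \<forall>x. cmod (nderiv n f x) \<le> M) \<longrightarrow> cmod (?L f) \<le> C * M"
    by blast
  then show "is_pdist ?L"
    using L test_functions_deriv unfolding is_pdist_def
    by (simp add: add mul Dadd Dmul)
qed

definition fourier_coeff :: "pdist \<Rightarrow> int \<Rightarrow> complex" where
  "fourier_coeff f k = pairing f (\<lambda>z. exp (- \<i> * of_int k * of_real z)) / (2 * pi)"

text \<open>\<open>represents f F\<close>: the distribution \<open>f\<close> is given by the integrable function \<open>F\<close>.\<close>

definition represents :: "pdist \<Rightarrow> (real \<Rightarrow> complex) \<Rightarrow> bool" where
  "represents f F \<longleftrightarrow> periodic F \<and> set_integrable lborel {-pi..pi} F \<and>
     (\<forall>g\<in>test_functions. pairing f g = (LINT x:{-pi..pi}|lborel. F x * g x))"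

definition square_integrable :: "(real \<Rightarrow> complex) \<Rightarrow> bool" where
  "square_integrable F \<longleftrightarrow> set_integrable lborel {-pi..pi} (\<lambda>x. (cmod (F x))\<^sup>2)"

definition L2_dist :: "pdist set" where
  "L2_dist = {f. \<exists>F. represents f F \<and> square_integrable F}"

definition L2_norm :: "pdist \<Rightarrow> real" where
  "L2_norm f = (THE r. \<exists>F. represents f F \<and> square_integrable F \<and>
     r = sqrt (LINT x:{-pi..pi}|lborel. (cmod (F x))\<^sup>2))"

text \<open>The square is the pointwise one and is meaningful on \<^const>\<open>L2_dist\<close> only. Elements of
  \<open>H\<^sup>s\<close>, \<open>s < 0\<close>, need not have one; for the solutions below this concerns at most the two
  endpoint times, a null set for the time integral.\<close>

definition dsquare :: "pdist \<Rightarrow> pdist" where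
  "dsquare f = (THE g. \<exists>F. represents f F \<and> square_integrable F \<and> represents g (\<lambda>x. (F x)\<^sup>2))"

definition u_ux :: "pdist \<Rightarrow> pdist" where
  "u_ux u = (1/2) *\<^sub>R dderiv (dsquare u)"


section \<open>Sobolev spaces and spaces of curves\<close>

definition Hs :: "real \<Rightarrow> pdist set" where
  "Hs s = {f. (\<lambda>k::int. ((1 + (of_int k)\<^sup>2) powr (s/2) * cmod (fourier_coeff f k))\<^sup>2) summable_on UNIV}"

definition Hs_norm :: "real \<Rightarrow> pdist \<Rightarrow> real" where
  "Hs_norm s f = sqrt (2 * pi) *
     sqrt (\<Sum>\<^sub>\<infinity>k::int. ((1 + (of_int k)\<^sup>2) powr (s/2) * cmod (fourier_coeff f k))\<^sup>2)"

definition continuous_Hs :: "real \<Rightarrow> real set \<Rightarrow> (real \<Rightarrow> pdist) \<Rightarrow> bool" where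
  "continuous_Hs s I u \<longleftrightarrow>
     (\<forall>t\<in>I. u t \<in> Hs s \<and> ((\<lambda>t'. Hs_norm s (u t' - u t)) \<longlongrightarrow> 0) (at t within I))"

text \<open>The topology of \<open>H\<^sup>\<infinity>\<close> is generated by all the norms \<open>H\<^sup>r\<close>.\<close>

definition continuous_Hinf :: "real set \<Rightarrow> (real \<Rightarrow> pdist) \<Rightarrow> bool" where
  "continuous_Hinf I u \<longleftrightarrow> (\<forall>r. continuous_Hs r I u)"

text \<open>A function on \<open>[0,T]\<close> is encoded as a function on the reals that vanishes outside
  \<open>[0,T]\<close>, so that equality of encodings is equality on \<open>[0,T]\<close>.\<close>

definition C_Hs :: "real \<Rightarrow> real \<Rightarrow> (real \<Rightarrow> pdist) set" where
  "C_Hs s T = {u. (\<forall>t. t \<notin> {0..T} \<longrightarrow> u t = 0) \<and> continuous_Hs s {0..T} u}"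

definition C_Hs_norm :: "real \<Rightarrow> real \<Rightarrow> (real \<Rightarrow> pdist) \<Rightarrow> real" where
  "C_Hs_norm s T u = (SUP t\<in>{0..T}. Hs_norm s (u t))"

definition X_space :: "real \<Rightarrow> real \<Rightarrow> (real \<Rightarrow> pdist) set" where
  "X_space s T = {u \<in> C_Hs s T. (\<forall>t\<in>{0<..T}. u t \<in> L2_dist) \<and>
     bdd_above ((\<lambda>t. Hs_norm s (u t) + t powr (\<bar>s\<bar>/2) * L2_norm (u t)) ` {0<..T})}"

definition X_norm :: "real \<Rightarrow> real \<Rightarrow> (real \<Rightarrow> pdist) \<Rightarrow> real" where
  "X_norm s T u = (SUP t\<in>{0<..T}. Hs_norm s (u t) + t powr (\<bar>s\<bar>/2) * L2_norm (u t))"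

definition frakX_space :: "real \<Rightarrow> real \<Rightarrow> (real \<Rightarrow> pdist) set" where
  "frakX_space s T = (if s < 0 then X_space s T else C_Hs s T)"

definition frakX_norm :: "real \<Rightarrow> real \<Rightarrow> (real \<Rightarrow> pdist) \<Rightarrow> real" where
  "frakX_norm s T = (if s < 0 then X_norm s T else C_Hs_norm s T)"

definition flow_space :: "real \<Rightarrow> real \<Rightarrow> (real \<Rightarrow> pdist) set" where
  "flow_space s T = C_Hs s T \<inter> {u. continuous_Hinf {0<..T} u} \<inter> frakX_space s T"

text \<open>Seminorms generating the topology of the intersection; \<open>C((0,T],H\<^sup>\<infinity>)\<close> carries uniform
  convergence on compact subsets of \<open>(0,T]\<close> in every \<open>H\<^sup>r\<close>.\<close>

definition flow_seminorms :: "real \<Rightarrow> real \<Rightarrow> ((real \<Rightarrow> pdist) \<Rightarrow> real) set" where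
  "flow_seminorms s T =
     {C_Hs_norm s T, frakX_norm s T} \<union>
     {p. \<exists>r. \<exists>a\<in>{0<..T}. p = (\<lambda>u. SUP t\<in>{a..T}. Hs_norm r (u t))}"


section \<open>Smooth maps\<close>

instantiation "fun" :: (type, real_vector) real_vector
begin

definition scaleR_fun :: "real \<Rightarrow> ('a \<Rightarrow> 'b) \<Rightarrow> 'a \<Rightarrow> 'b" where
  "scaleR_fun c f = (\<lambda>x. c *\<^sub>R f x)"

instance
  by standard (simp_all add: scaleR_fun_def fun_eq_iff algebra_simps)

end

definition linear_on_subspace :: "'a::real_vector set \<Rightarrow> ('a \<Rightarrow> 'b::real_vector) \<Rightarrow> bool" where
  "linear_on_subspace V G \<longleftrightarrow>
     (\<forall>h\<in>V. \<forall>k\<in>V. G (h + k) = G h + G k) \<and> (\<forall>c. \<forall>h\<in>V. G (c *\<^sub>R h) = c *\<^sub>R G h)"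

text \<open>\<open>C\<^sup>\<infinity>\<close> in the Frechet sense for a map from an open subset \<open>B\<close> of a normed space \<open>(V,N)\<close> into a
  locally convex space \<open>(W,P)\<close> with generating seminorms \<open>P\<close>. The list argument of \<open>D\<close> holds the
  directions: \<open>D x [h\<^sub>1,\<dots>,h\<^sub>n]\<close> is the \<open>n\<close>-th derivative at \<open>x\<close>, a bounded multilinear map, and
  \<open>D\<close> of order \<open>n + 1\<close> is the derivative of \<open>x \<mapsto> D x\<close> of order \<open>n\<close>, uniformly over bounded sets of
  directions.\<close>

definition smooth_map ::
  "'a::real_vector set \<Rightarrow> ('a \<Rightarrow> real) \<Rightarrow> 'b::real_vector set \<Rightarrow> ('b \<Rightarrow> real) set
     \<Rightarrow> 'a set \<Rightarrow> ('a \<Rightarrow> 'b) \<Rightarrow> bool" where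
  "smooth_map V N W P B F \<longleftrightarrow> (\<exists>D :: 'a \<Rightarrow> 'a list \<Rightarrow> 'b.
     (\<forall>x\<in>B. D x [] = F x) \<and>
     (\<forall>x\<in>B. \<forall>hs\<in>lists V. D x hs \<in> W) \<and>
     (\<forall>x\<in>B. \<forall>hs\<in>lists V. \<forall>ks\<in>lists V. linear_on_subspace V (\<lambda>h. D x (hs @ h # ks))) \<and>
     (\<forall>x\<in>B. \<forall>n. \<forall>p\<in>P. \<exists>C. \<forall>hs\<in>lists V. length hs = n \<longrightarrow>
        p (D x hs) \<le> C * prod_list (map N hs)) \<and>
     (\<forall>x\<in>B. \<forall>n. \<forall>p\<in>P. \<forall>\<epsilon>>0. \<exists>\<delta>>0. \<forall>h\<in>V. N h < \<delta> \<and> x + h \<in> B \<longrightarrow>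
        (\<forall>hs\<in>lists V. length hs = n \<longrightarrow>
           p (D (x + h) hs - D x hs - D x (h # hs)) \<le> \<epsilon> * N h * prod_list (map N hs))))"


section \<open>The integral equation\<close>

definition symbol_q :: "real \<Rightarrow> int \<Rightarrow> real" where
  "symbol_q \<beta> k = \<beta> * of_int k * \<bar>of_int k\<bar>"

definition symbol_p :: "real \<Rightarrow> int \<Rightarrow> real" where
  "symbol_p \<eta> k = \<eta> * ((of_int k)\<^sup>2 - \<bar>of_int k\<bar>)"

definition S_op :: "real \<Rightarrow> real \<Rightarrow> real \<Rightarrow> pdist \<Rightarrow> pdist" where
  "S_op \<beta> \<eta> t f = (THE g. \<forall>k. fourier_coeff g k =
     exp (\<i> * of_real (symbol_q \<beta> k * t) - of_real (symbol_p \<eta> k * t)) * fourier_coeff f k)"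

text \<open>Integral of a distribution-valued function over \<open>[a,b]\<close>, defined by duality.\<close>

definition has_pdist_integral :: "(real \<Rightarrow> pdist) \<Rightarrow> pdist \<Rightarrow> real \<Rightarrow> real \<Rightarrow> bool" where
  "has_pdist_integral G I a b \<longleftrightarrow> (\<forall>f\<in>test_functions.
     set_integrable lborel {a..b} (\<lambda>t. pairing (G t) f) \<and>
     pairing I f = (LINT t:{a..b}|lborel. pairing (G t) f))"

definition solves :: "real \<Rightarrow> real \<Rightarrow> real \<Rightarrow> pdist \<Rightarrow> (real \<Rightarrow> pdist) \<Rightarrow> bool" where
  "solves \<beta> \<eta> T \<phi> u \<longleftrightarrow> (\<forall>t\<in>{0..T}. \<exists>I.
     has_pdist_integral (\<lambda>t'. S_op \<beta> \<eta> (t - t') (u_ux (u t'))) I 0 t \<and> u t = S_op \<beta> \<eta> t \<phi> - I)"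

definition is_solution :: "real \<Rightarrow> real \<Rightarrow> real \<Rightarrow> real \<Rightarrow> pdist \<Rightarrow> (real \<Rightarrow> pdist) \<Rightarrow> bool" where
  "is_solution \<beta> \<eta> s T \<phi> u \<longleftrightarrow>
     u \<in> C_Hs s T \<and> continuous_Hinf {0<..<T} u \<and> solves \<beta> \<eta> T \<phi> u"

definition flow_map :: "real \<Rightarrow> real \<Rightarrow> real \<Rightarrow> real \<Rightarrow> pdist \<Rightarrow> real \<Rightarrow> pdist" where
  "flow_map \<beta> \<eta> s T \<phi> = (THE u. is_solution \<beta> \<eta> s T \<phi> u)"

definition Hs_ball :: "real \<Rightarrow> pdist \<Rightarrow> real \<Rightarrow> pdist set" where
  "Hs_ball s \<phi> \<rho> = {\<psi> \<in> Hs s. Hs_norm s (\<psi> - \<phi>) < \<rho>}"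

end

theory Submission
  imports Defs
begin

text \<open>On the Fourier side the equation is the fixed point equation \<open>u = L \<phi> + B(u,u)\<close> with \<open>L \<phi> = S(t) \<phi>\<close> and the
  bilinear Duhamel term \<open>B\<close>. It is solved in the space of curves for which \<open>t\<^sup>\<mu> \<parallel>e\<^sup>t\<^sup>|\<^sup>D\<^sup>| u(t)\<parallel>\<close> is bounded in \<open>H\<^sup>\<nu>\<close>,
  where \<open>\<mu> = |s|/2\<close>, \<open>\<nu> = 0\<close> for \<open>s < 0\<close> and \<open>\<mu> = 0\<close>, \<open>\<nu> = s\<close> for \<open>s \<ge> 0\<close>. The weight \<open>e\<^sup>t\<^sup>|\<^sup>k\<^sup>|\<close> is submultiplicative and
  absorbed by the dissipation, so it costs nothing in the bilinear estimate, and it makes solutions analytic for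
  \<open>t > 0\<close>. As \<open>B\<close> is bounded with norm \<open>O(T\<^sup>\<theta>)\<close>, the contraction principle applies for small \<open>T\<close>, and the fixed point
  depends smoothly on \<open>\<phi>\<close> because all derivatives solve linear equations with an invertible left-hand side.

  Uniqueness holds in a larger class: two solutions with bounded \<open>t\<^sup>\<mu> \<parallel>u(t)\<parallel>\<close> coincide, since a factor \<open>e\<^sup>-\<^sup>\<lambda>\<^sup>t\<close> makes
  the difference equation a contraction. An arbitrary solution is only bounded away from \<open>0\<close>; restarting it
  at \<open>t\<^sub>0 > 0\<close> identifies it with the constructed solution from \<open>u(t\<^sub>0)\<close>, whose bound does not depend on \<open>t\<^sub>0\<close>, and
  \<open>t\<^sub>0\<close> tends to \<open>0\<close>.\<close>

subsection \<open>Quadratic fixed point equations in Banach spaces\<close>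

text \<open>What limits s is square summability in k. Cauchy-Schwarz bounds the coefficients of a
  product by the l2 norms of its factors, but only uniformly in k, so the l2 norm in k has to be
  produced by the kernel |k| exp(-tau k^2), which has size tau^(-3/4) in l2. Two factors with
  singularity r^(-mu) cost 2 mu more, and the weight t^mu of the norm returns mu. This leaves the
  power t^(1/4 - mu), so mu < 1/4, that is s > -1/2; theta keeps half of this margin.

  Derivatives of the fixed point are indexed by finite sets I of positions of directions, so that
  the product rule is a sum over the subsets J of I. The terms J = {} and J = I contain the unknown
  and are absorbed into the left-hand side. The other terms contain only derivatives of lower order,
  which gives every induction below the same shape.

  A competing solution is smooth only for 0 < t < T, and its square need not exist at the two
  endpoints. For this reason all Duhamel integrals run over open intervals.\<close>

locale quadratic_fixpoint =
  fixes B :: "'z::banach \<Rightarrow> 'z \<Rightarrow> 'z" and L :: "'v::real_vector \<Rightarrow> 'z"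
    and V X :: "'v set" and N :: "'v \<Rightarrow> real" and K \<rho> c :: real
  assumes bilB: "bounded_bilinear B"
    and norm_B: "norm (B a b) \<le> K * norm a * norm b" and K_nonneg: "0 \<le> K"
    and lin_L: "linear_on_subspace V L"
    and norm_L: "h \<in> V \<Longrightarrow> norm (L h) \<le> c * N h" and c_nonneg: "0 \<le> c"
    and N_nonneg: "h \<in> V \<Longrightarrow> 0 \<le> N h"
    and X_V: "X \<subseteq> V" and norm_L_X: "x \<in> X \<Longrightarrow> norm (L x) \<le> \<rho>"
    and rho_pos: "0 < \<rho>" and small: "4 * K * \<rho> < 1"
begin

interpretation B: bounded_bilinear B by (rule bilB)

text \<open>On the ball of radius 2 rho the quadratic term is at most K (2 rho)^2 = (4 K rho) rho,
  and the difference of two values splits into two terms with Lipschitz constant 2 K rho each. So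
  \<open>4 * K * \<rho> < 1\<close> gives both the self-map and the contraction.\<close>

lemma ex_sol: assumes "norm l \<le> \<rho>" shows "\<exists>u. norm u \<le> 2 * \<rho> \<and> u = l + B u u"
proof -
  have "\<exists>!u\<in>cball 0 (2 * \<rho>). l + B u u = u"
  proof (rule Banach_fix)
    show "complete (cball 0 (2 * \<rho>) :: 'z set)" by (simp add: complete_eq_closed)
    show "cball 0 (2 * \<rho>) \<noteq> ({} :: 'z set)" using rho_pos by auto
    show "0 \<le> 4 * K * \<rho>" "4 * K * \<rho> < 1" using small K_nonneg rho_pos by auto
    show "(\<lambda>u. l + B u u) ` cball 0 (2 * \<rho>) \<subseteq> cball 0 (2 * \<rho>)"
    proof (clarsimp)
      fix u :: 'z assume u: "norm u \<le> 2 * \<rho>"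
      have "norm (B u u) \<le> K * (2 * \<rho>) * (2 * \<rho>)"
        by (rule order.trans[OF norm_B]) (use u K_nonneg rho_pos in \<open>intro mult_mono; simp\<close>)
      also have "\<dots> = (4 * K * \<rho>) * \<rho>" by simp
      also have "\<dots> \<le> 1 * \<rho>" using small rho_pos by (intro mult_right_mono) auto
      finally show "norm (l + B u u) \<le> 2 * \<rho>"
        using assms norm_triangle_ineq[of l "B u u"] by simp
    qed
    show "dist (l + B u u) (l + B v v) \<le> 4 * K * \<rho> * dist u v"
      if "u \<in> cball 0 (2 * \<rho>)" "v \<in> cball 0 (2 * \<rho>)" for u v
    proof -
      have uv: "norm u \<le> 2 * \<rho>" "norm v \<le> 2 * \<rho>" using that by auto
      have "norm (B u (u - v)) \<le> K * (2 * \<rho>) * norm (u - v)"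
        by (rule order.trans[OF norm_B]) (use uv K_nonneg rho_pos in \<open>intro mult_mono; simp\<close>)
      moreover have "norm (B (u - v) v) \<le> K * norm (u - v) * (2 * \<rho>)"
        by (rule order.trans[OF norm_B]) (use uv K_nonneg rho_pos in \<open>intro mult_mono; simp\<close>)
      moreover have "l + B u u - (l + B v v) = B u (u - v) + B (u - v) v"
        by (simp add: B.diff_left B.diff_right)
      ultimately show ?thesis
        using norm_triangle_ineq[of "B u (u - v)" "B (u - v) v"]
        by (simp add: dist_norm algebra_simps)
    qed
  qed
  then obtain u where "u \<in> cball 0 (2 * \<rho>)" "l + B u u = u" by blast
  then show ?thesis by (intro exI[of _ u]) auto
qed

definition sol :: "'v \<Rightarrow> 'z" where
  "sol x = (SOME u. norm u \<le> 2 * \<rho> \<and> u = L x + B u u)"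

lemma sol: assumes "x \<in> X" shows "norm (sol x) \<le> 2 * \<rho>" "sol x = L x + B (sol x) (sol x)"
  using someI_ex[OF ex_sol[OF norm_L_X[OF assms]]] unfolding sol_def[symmetric] by auto

section \<open>The linearised equation and the derivatives of the fixed point\<close>

abbreviation q :: real where "q \<equiv> 4 * K * \<rho>"

lemma q: "0 \<le> q" "q < 1" using small K_nonneg rho_pos by auto

text \<open>Each half of the linearised operator
  \<open>\<lambda>w. B (sol x) w + B w (sol x)\<close> takes one half of the contraction constant
  \<open>q\<close>, so the operator is a contraction on the whole space.\<close>

lemma norm_B_sol: assumes "x \<in> X"
  shows "norm (B (sol x) w) \<le> q / 2 * norm w" "norm (B w (sol x)) \<le> q / 2 * norm w"
proof -
  have "norm (B (sol x) w) \<le> K * (2 * \<rho>) * norm w"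
    by (rule order.trans[OF norm_B]) (use sol[OF assms] K_nonneg rho_pos in \<open>intro mult_mono; simp\<close>)
  then show "norm (B (sol x) w) \<le> q / 2 * norm w" by simp
  have "norm (B w (sol x)) \<le> K * norm w * (2 * \<rho>)"
    by (rule order.trans[OF norm_B]) (use sol[OF assms] K_nonneg rho_pos in \<open>intro mult_mono; simp\<close>)
  then show "norm (B w (sol x)) \<le> q / 2 * norm w" by (simp add: algebra_simps)
qed

lemma linearized_ex1: assumes x: "x \<in> X"
  shows "\<exists>!w. w = f + B (sol x) w + B w (sol x)"
proof -
  have "\<exists>!w\<in>UNIV. f + B (sol x) w + B w (sol x) = w"
  proof (rule Banach_fix[OF complete_UNIV UNIV_not_empty q])
    show "dist (f + B (sol x) v + B v (sol x)) (f + B (sol x) w + B w (sol x)) \<le> q * dist v w" for v w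
      using norm_triangle_ineq[of "B (sol x) (v - w)" "B (v - w) (sol x)"] norm_B_sol[OF x, of "v - w"]
      by (simp add: dist_norm B.diff_left B.diff_right algebra_simps)
  qed auto
  then show ?thesis by (simp add: eq_commute)
qed

text \<open>The inverse of \<open>\<lambda>w. w - B (sol x) w - B w (sol x)\<close>, the left-hand
  side that the equations for the derivatives of all positive orders share.\<close>

definition lin_sol :: "'v \<Rightarrow> 'z \<Rightarrow> 'z" where
  "lin_sol x f = (THE w. w = f + B (sol x) w + B w (sol x))"

lemma lin_sol: "x \<in> X \<Longrightarrow> lin_sol x f = f + B (sol x) (lin_sol x f) + B (lin_sol x f) (sol x)"
  unfolding lin_sol_def by (rule theI'[OF linearized_ex1])

text \<open>The derivatives of a linear map: its value at order 0, the map applied to the direction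
  at order 1, and 0 from order 2 on.\<close>

definition dir :: "('v \<Rightarrow> 'y::zero) \<Rightarrow> 'v \<Rightarrow> (nat \<Rightarrow> 'v) \<Rightarrow> nat set \<Rightarrow> 'y" where
  "dir f x e I = (if I = {} then f x else if card I = 1 then f (e (the_elem I)) else 0)"

text \<open>\<open>D x e I\<close> is the derivative of order \<open>card I\<close> of \<open>sol\<close> at \<open>x\<close> in the directions \<open>e i\<close>, \<open>i \<in> I\<close>;
  its equation is obtained by differentiating the fixed point equation by the product rule.\<close>

function D :: "'v \<Rightarrow> (nat \<Rightarrow> 'v) \<Rightarrow> nat set \<Rightarrow> 'z" where
  "D x e I = (if I = {} \<or> infinite I then sol x else lin_sol x
     (dir L x e I + (\<Sum>J\<in>Pow I - {I, {}}. B (D x e J) (D x e (I - J)))))"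
  by pat_completeness auto
termination
proof (relation "Wellfounded.measure (\<lambda>(x, e, I). card I)", goal_cases)
  case (2 x e I J) then show ?case by (auto intro!: psubset_card_mono)
next
  case (3 x e I J)
  then have "I - J \<subset> I" by auto
  with 3 show ?case by (auto intro!: psubset_card_mono)
qed auto

declare D.simps[simp del]

lemma D_empty [simp]: "D x e {} = sol x" by (simp add: D.simps)

lemma sum_Pow_left: "finite I \<Longrightarrow> (\<Sum>J\<in>Pow I. f J) = f I + (\<Sum>J\<in>Pow I - {I}. f J)"
  for f :: "nat set \<Rightarrow> 'y::comm_monoid_add"
  by (rule sum.remove) auto

lemma sum_Pow_right: "finite I \<Longrightarrow> (\<Sum>J\<in>Pow I. f J) = f {} + (\<Sum>J\<in>Pow I - {{}}. f J)"
  for f :: "nat set \<Rightarrow> 'y::comm_monoid_add"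
  by (rule sum.remove) auto

lemma sum_Pow_proper:
  fixes f :: "nat set \<Rightarrow> 'y::comm_monoid_add"
  assumes "finite I" "I \<noteq> {}"
  shows "(\<Sum>J\<in>Pow I. f J) = f I + f {} + (\<Sum>J\<in>Pow I - {I, {}}. f J)"
proof -
  have "(\<Sum>J\<in>Pow I - {I}. f J) = f {} + (\<Sum>J\<in>Pow I - {I} - {{}}. f J)"
    using assms by (intro sum.remove) auto
  moreover have "Pow I - {I} - {{}} = Pow I - {I, {}}" by auto
  ultimately show ?thesis using sum_Pow_left[OF assms(1), of f] by (simp add: add.assoc)
qed

text \<open>The sets J = {} and J = I are the terms that \<open>lin_sol\<close> had moved to the
  left-hand side. With them put back, the equation is the complete product rule and includes order
  0.\<close>

lemma D_eq: assumes "finite I" "x \<in> X"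
  shows "D x e I = dir L x e I + (\<Sum>J\<in>Pow I. B (D x e J) (D x e (I - J)))"
proof (cases "I = {}")
  case True then show ?thesis using sol(2)[OF assms(2)] by (simp add: dir_def)
next
  case False
  let ?f = "dir L x e I + (\<Sum>J\<in>Pow I - {I, {}}. B (D x e J) (D x e (I - J)))"
  have "D x e I = lin_sol x ?f" using False assms by (subst D.simps) auto
  then have "D x e I = ?f + B (sol x) (D x e I) + B (D x e I) (sol x)"
    using lin_sol[OF assms(2), of ?f] by simp
  then show ?thesis by (simp add: sum_Pow_proper[OF assms(1) False] algebra_simps)
qed

lemma dir_cong: assumes "\<And>i. i \<in> I \<Longrightarrow> e i = e' i" shows "dir f x e I = dir f x e' I"
proof (cases "card I = 1")
  case True
  then obtain i where "I = {i}" by (auto simp: card_1_singleton_iff)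
  then show ?thesis using assms by (simp add: dir_def)
qed (simp add: dir_def)

lemma D_cong: assumes "finite I" "\<And>i. i \<in> I \<Longrightarrow> e i = e' i" shows "D x e I = D x e' I"
  using assms
proof (induction I rule: finite_psubset_induct)
  case (psubset I)
  have "(\<Sum>J\<in>Pow I - {I, {}}. B (D x e J) (D x e (I - J))) =
      (\<Sum>J\<in>Pow I - {I, {}}. B (D x e' J) (D x e' (I - J)))"
  proof (rule sum.cong, simp)
    fix J assume J: "J \<in> Pow I - {I, {}}"
    have "D x e J = D x e' J" using J psubset.prems by (intro psubset.IH) auto
    moreover have "D x e (I - J) = D x e' (I - J)" using J psubset.prems by (intro psubset.IH) auto
    ultimately show "B (D x e J) (D x e (I - J)) = B (D x e' J) (D x e' (I - J))" by simp
  qed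
  moreover have "dir L x e I = dir L x e' I" by (rule dir_cong) (rule psubset.prems)
  ultimately show ?case by (simp only: D.simps[of x e I] D.simps[of x e' I])
qed

text \<open>The linear terms are absorbed because their joint norm is at most \<open>q\<close>. Two
  base points are allowed since the equation for a difference has the left factor at
  \<open>x + h\<close> and the right one at \<open>x\<close>.\<close>

lemma norm_absorb: assumes "x \<in> X" "y \<in> X" "norm (w - B (sol x) w - B w (sol y)) \<le> a"
  shows "norm w \<le> a / (1 - q)"
proof -
  have "norm w \<le> norm (w - B (sol x) w - B w (sol y)) + norm (B (sol x) w) + norm (B w (sol y))"
  proof -
    have "w = (w - B (sol x) w - B w (sol y)) + B (sol x) w + B w (sol y)" by simp
    then have "norm w \<le> norm ((w - B (sol x) w - B w (sol y)) + B (sol x) w) + norm (B w (sol y))"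
      by (metis norm_triangle_ineq)
    with norm_triangle_ineq[of "w - B (sol x) w - B w (sol y)" "B (sol x) w"] show ?thesis by linarith
  qed
  then have "norm w * (1 - q) \<le> a"
    using norm_B_sol(1)[OF assms(1), of w] norm_B_sol(2)[OF assms(2), of w] assms(3) 
    by (simp add: algebra_simps)
  then show ?thesis using q by (simp add: pos_le_divide_eq)
qed

lemma zero_absorb: assumes "x \<in> X" "w = B (sol x) w + B w (sol x)" shows "w = 0"
proof -
  have "w - B (sol x) w - B w (sol x) = 0" using assms(2) by (metis add_diff_cancel_left' diff_self diff_diff_eq)
  then show ?thesis using norm_absorb[OF assms(1) assms(1), of w 0] by simp
qed

lemma dir_linear:
  assumes G: "linear_on_subspace V G" and i: "i \<in> I" "\<And>j. j \<noteq> i \<Longrightarrow> e1 j = e3 j \<and> e2 j = e3 j"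
    and V: "e1 i \<in> V" "e2 i \<in> V"
  shows "e3 i = e1 i + e2 i \<Longrightarrow> dir G x e3 I = dir G x e1 I + dir G x e2 I"
    and "e3 i = a *\<^sub>R e1 i \<Longrightarrow> dir G x e3 I = a *\<^sub>R dir G x e1 I"
proof -
  have I: "I = {i}" if "card I = 1" using that i(1) by (auto simp: card_1_singleton_iff)
  have G': "G (e1 i + e2 i) = G (e1 i) + G (e2 i)" "G (a *\<^sub>R e1 i) = a *\<^sub>R G (e1 i)"
    using G V by (simp_all add: linear_on_subspace_def)
  show "dir G x e3 I = dir G x e1 I + dir G x e2 I" if "e3 i = e1 i + e2 i"
  proof (cases "card I = 1")
    case True then show ?thesis using I[OF True] that G' by (simp add: dir_def)
  qed (use i(1) in \<open>auto simp: dir_def\<close>)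
  show "dir G x e3 I = a *\<^sub>R dir G x e1 I" if "e3 i = a *\<^sub>R e1 i"
  proof (cases "card I = 1")
    case True then show ?thesis using I[OF True] that G' by (simp add: dir_def)
  qed (use i(1) in \<open>auto simp: dir_def\<close>)
qed

text \<open>The defect of additivity solves the homogeneous linearised equation, and by
  \<open>zero_absorb\<close> that equation has only the solution 0.\<close>

lemma D_add:
  assumes "finite I" "x \<in> X" "i \<in> I" "\<And>j. j \<noteq> i \<Longrightarrow> e1 j = e3 j \<and> e2 j = e3 j"
    "e1 i \<in> V" "e2 i \<in> V" "e3 i = e1 i + e2 i"
  shows "D x e3 I = D x e1 I + D x e2 I"
  using assms
proof (induction I rule: finite_psubset_induct)
  case (psubset I)
  let ?S = "\<lambda>e. \<Sum>J\<in>Pow I - {I, {}}. B (D x e J) (D x e (I - J))"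
  have fin: "finite J" if "J \<subseteq> I" for J using that psubset.hyps finite_subset by blast
  have S: "?S e3 = ?S e1 + ?S e2"
    unfolding sum.distrib[symmetric]
  proof (rule sum.cong, simp)
    fix J assume J: "J \<in> Pow I - {I, {}}"
    show "B (D x e3 J) (D x e3 (I - J)) = B (D x e1 J) (D x e1 (I - J)) + B (D x e2 J) (D x e2 (I - J))"
    \<comment> \<open>The modified index \<open>i\<close> lies in exactly one of \<open>J\<close>
      and \<open>I - J\<close>. That factor is additive by induction, and the other one does not see
      the change.\<close>
    proof (cases "i \<in> J")
      case True
      have 1: "D x e3 J = D x e1 J + D x e2 J" using J psubset.prems True by (intro psubset.IH) auto
      have 2: "D x e1 (I - J) = D x e3 (I - J)" "D x e2 (I - J) = D x e3 (I - J)"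
        using True psubset.prems fin[of "I - J"] by (metis D_cong Diff_iff Diff_subset)+
      show ?thesis by (simp only: 1 2 B.add_left)
    next
      case False
      have 1: "D x e3 (I - J) = D x e1 (I - J) + D x e2 (I - J)"
        using J psubset.prems False by (intro psubset.IH) auto
      have 2: "D x e1 J = D x e3 J" "D x e2 J = D x e3 J"
        using False psubset.prems fin[of J] J by (metis D_cong Diff_iff PowD)+
      show ?thesis by (simp only: 1 2 B.add_right)
    qed
  qed
  have ne: "I \<noteq> {}" using psubset.prems by auto
  have eq: "D x e I = dir L x e I + ?S e + B (sol x) (D x e I) + B (D x e I) (sol x)" for e
    using D_eq[OF psubset.hyps \<open>x \<in> X\<close>, of e] by (simp add: sum_Pow_proper[OF psubset.hyps ne] algebra_simps)
  have d: "dir L x e3 I = dir L x e1 I + dir L x e2 I"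
    using psubset.prems by (intro dir_linear[OF lin_L]) auto
  let ?w = "D x e3 I - D x e1 I - D x e2 I"
  have "?w = B (sol x) ?w + B ?w (sol x)"
    by (subst (1) eq[of e3], subst (1) eq[of e1], subst (1) eq[of e2])
      (simp add: d S B.diff_left B.diff_right B.add_left B.add_right algebra_simps)
  from zero_absorb[OF \<open>x \<in> X\<close> this] show ?case by (simp add: algebra_simps)
qed

lemma D_scale:
  assumes "finite I" "x \<in> X" "i \<in> I" "\<And>j. j \<noteq> i \<Longrightarrow> e1 j = e3 j"
    "e1 i \<in> V" "e3 i = a *\<^sub>R e1 i"
  shows "D x e3 I = a *\<^sub>R D x e1 I"
  using assms
proof (induction I rule: finite_psubset_induct)
  case (psubset I)
  let ?S = "\<lambda>e. \<Sum>J\<in>Pow I - {I, {}}. B (D x e J) (D x e (I - J))"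
  have fin: "finite J" if "J \<subseteq> I" for J using that psubset.hyps finite_subset by blast
  have S: "?S e3 = a *\<^sub>R ?S e1"
    unfolding scaleR_sum_right
  proof (rule sum.cong, simp)
    fix J assume J: "J \<in> Pow I - {I, {}}"
    show "B (D x e3 J) (D x e3 (I - J)) = a *\<^sub>R B (D x e1 J) (D x e1 (I - J))"
    proof (cases "i \<in> J")
      case True
      have 1: "D x e3 J = a *\<^sub>R D x e1 J" using J psubset.prems True by (intro psubset.IH) auto
      have 2: "D x e1 (I - J) = D x e3 (I - J)"
        using True psubset.prems fin[of "I - J"] by (metis D_cong Diff_iff Diff_subset)+
      show ?thesis by (simp only: 1 2 B.scaleR_left)
    next
      case False
      have 1: "D x e3 (I - J) = a *\<^sub>R D x e1 (I - J)"
        using J psubset.prems False by (intro psubset.IH) auto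
      have 2: "D x e1 J = D x e3 J"
        using False psubset.prems fin[of J] J by (metis D_cong Diff_iff PowD)+
      show ?thesis by (simp only: 1 2 B.scaleR_right)
    qed
  qed
  have ne: "I \<noteq> {}" using psubset.prems by auto
  have eq: "D x e I = dir L x e I + ?S e + B (sol x) (D x e I) + B (D x e I) (sol x)" for e
    using D_eq[OF psubset.hyps \<open>x \<in> X\<close>, of e] by (simp add: sum_Pow_proper[OF psubset.hyps ne] algebra_simps)
  have d: "dir L x e3 I = a *\<^sub>R dir L x e1 I"
    using psubset.prems by (intro dir_linear[OF lin_L, of i I e1 e3 e1]) auto
  let ?w = "D x e3 I - a *\<^sub>R D x e1 I"
  have "?w = B (sol x) ?w + B ?w (sol x)"
    by (subst (1) eq[of e3], subst (1) eq[of e1])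
      (simp add: d S B.diff_left B.diff_right B.scaleR_left B.scaleR_right algebra_simps)
  from zero_absorb[OF \<open>x \<in> X\<close> this] show ?case by simp
qed

section \<open>Uniform bounds for derivatives, differences and Taylor remainders\<close>

definition pN :: "(nat \<Rightarrow> 'v) \<Rightarrow> nat set \<Rightarrow> real" where "pN e I = (\<Prod>i\<in>I. N (e i))"

lemma pN_nonneg: "e ` I \<subseteq> V \<Longrightarrow> 0 \<le> pN e I"
  unfolding pN_def using N_nonneg by (intro prod_nonneg) auto

lemma pN_split: "finite I \<Longrightarrow> J \<subseteq> I \<Longrightarrow> pN e J * pN e (I - J) = pN e I"
  unfolding pN_def by (metis prod.subset_diff mult.commute)

lemma norm_dir_L: assumes "e ` I \<subseteq> V" "I \<noteq> {}" shows "norm (dir L x e I) \<le> c * pN e I"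
proof (cases "card I = 1")
  case True
  then obtain i where "I = {i}" by (auto simp: card_1_singleton_iff)
  then show ?thesis using assms norm_L by (auto simp: dir_def pN_def)
qed (use assms c_nonneg pN_nonneg in \<open>auto simp: dir_def\<close>)

text \<open>At most 2^n subsets occur, and in each term the product of the direction norms splits
  over \<open>J\<close> and \<open>I - J\<close>. The functional \<open>p\<close> is abstract so
  that the estimate serves both the Banach norm with \<open>B\<close> and, later, the output
  seminorms with \<open>Bo\<close>.\<close>

lemma sum_bound:
  fixes f g :: "nat set \<Rightarrow> 'z" and p :: "'y::real_vector \<Rightarrow> real"
  assumes p: "\<And>a b. p (a + b) \<le> p a + p b" "p 0 = 0" "\<And>a b. p (Bo a b) \<le> k * norm a * norm b" "0 \<le> k"
    and I: "finite I" "e ` I \<subseteq> V" "card I \<le> n" and \<P>: "\<P> \<subseteq> Pow I" and nn: "0 \<le> a1" "0 \<le> a2"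
    and f: "\<And>J. J \<in> \<P> \<Longrightarrow> norm (f J) \<le> a1 * pN e J"
    and g: "\<And>J. J \<in> \<P> \<Longrightarrow> norm (g (I - J)) \<le> a2 * pN e (I - J)"
  shows "p (\<Sum>J\<in>\<P>. Bo (f J) (g (I - J))) \<le> 2 ^ n * k * a1 * a2 * pN e I"
proof -
  have fin: "finite \<P>" using \<P> I(1) by (meson finite_Pow_iff finite_subset)
  have "p (\<Sum>J\<in>\<P>. Bo (f J) (g (I - J))) \<le> (\<Sum>J\<in>\<P>. p (Bo (f J) (g (I - J))))"
    using fin
  proof (induction \<P> rule: finite_induct)
    case (insert a F)
    then show ?case
      using p(1)[of "Bo (f a) (g (I - a))" "\<Sum>J\<in>F. Bo (f J) (g (I - J))"] by simp
  qed (use p in auto)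
  also have "\<dots> \<le> (\<Sum>J\<in>\<P>. k * a1 * a2 * pN e I)"
  proof (rule sum_mono)
    fix J assume J: "J \<in> \<P>"
    have JI: "J \<subseteq> I" using J \<P> by auto
    have "p (Bo (f J) (g (I - J))) \<le> k * norm (f J) * norm (g (I - J))" by (rule p)
    also have "\<dots> \<le> k * (a1 * pN e J) * (a2 * pN e (I - J))"
      using f[OF J] g[OF J] p(4) JI I(2) nn
      by (intro mult_mono mult_nonneg_nonneg pN_nonneg) (auto intro!: mult_nonneg_nonneg pN_nonneg)
    also have "\<dots> = k * a1 * a2 * pN e I" using pN_split[OF I(1) JI, of e] by (simp add: ac_simps)
    finally show "p (Bo (f J) (g (I - J))) \<le> k * a1 * a2 * pN e I" .
  qed
  also have "\<dots> = real (card \<P>) * (k * a1 * a2 * pN e I)" by simp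
  also have "\<dots> \<le> 2 ^ n * (k * a1 * a2 * pN e I)"
  proof (rule mult_right_mono)
    have "card \<P> \<le> card (Pow I)" using I(1) \<P> by (intro card_mono) auto
    also have "\<dots> \<le> 2 ^ n" using I by (simp add: card_Pow)
    finally show "real (card \<P>) \<le> 2 ^ n" by (metis of_nat_le_iff of_nat_numeral of_nat_power)
  qed (use p(4) nn pN_nonneg[OF I(2)] in auto)
  finally show ?thesis by (simp add: ac_simps)
qed

lemmas sum_bound_norm = sum_bound[where p = norm and Bo = B, OF norm_triangle_ineq norm_zero norm_B K_nonneg]

text \<open>The bound is uniform on \<open>X\<close> because \<open>sol\<close> is bounded by 2 rho
  there. In the induction step \<open>c\<close> comes from the linear part, the Leibniz sum runs
  over proper subsets only, and division by 1 - q pays for the absorption of the two extreme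
  terms.\<close>

lemma D_bound_ex: "\<exists>A\<ge>0. \<forall>x\<in>X. \<forall>e I. finite I \<and> card I \<le> n \<and> e ` I \<subseteq> V \<longrightarrow> norm (D x e I) \<le> A * pN e I"
proof (induction n)
  case 0
  show ?case
  proof (rule exI[of _ "2 * \<rho>"], intro conjI ballI allI impI)
    fix x and e :: "nat \<Rightarrow> 'v" and I assume "x \<in> X" "finite I \<and> card I \<le> 0 \<and> e ` I \<subseteq> V"
    then have "I = {}" using card_0_eq by blast
    moreover have "norm (sol x) \<le> 2 * \<rho>" by (rule sol(1)) fact
    ultimately show "norm (D x e I) \<le> 2 * \<rho> * pN e I" by (simp add: pN_def)
  qed (use rho_pos in simp)
next
  case (Suc n)
  from Suc obtain A where A0: "0 \<le> A"
    and A0': "\<forall>x\<in>X. \<forall>e I. finite I \<and> card I \<le> n \<and> e ` I \<subseteq> V \<longrightarrow> norm (D x e I) \<le> A * pN e I"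
    by (elim exE conjE)
  note A = A0 A0'[rule_format]
  let ?C = "(c + 2 ^ Suc n * K * A * A) / (1 - q)"
  have C: "0 \<le> ?C" using q c_nonneg K_nonneg A(1) by (intro divide_nonneg_nonneg) auto
  have "norm (D x e I) \<le> max A ?C * pN e I" if "x \<in> X" "finite I" "card I \<le> Suc n" "e ` I \<subseteq> V" for x e I
  proof (cases "card I \<le> n")
    case True
    then have "norm (D x e I) \<le> A * pN e I" using A(2) that by blast
    also have "\<dots> \<le> max A ?C * pN e I" using pN_nonneg that by (intro mult_right_mono) auto
    finally show ?thesis .
  next
    case False
    then have ne: "I \<noteq> {}" by auto
    let ?S = "\<Sum>J\<in>Pow I - {I, {}}. B (D x e J) (D x e (I - J))"
    have small: "card J \<le> n \<and> card (I - J) \<le> n" if "J \<in> Pow I - {I, {}}" for J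
    proof -
      have "J \<subset> I" "I - J \<subset> I" using that by auto
      from this[THEN psubset_card_mono[OF \<open>finite I\<close>]] show ?thesis using \<open>card I \<le> Suc n\<close> by auto
    qed
    have "norm ?S \<le> 2 ^ Suc n * K * A * A * pN e I"
    proof (rule sum_bound_norm)
      fix J assume J: "J \<in> Pow I - {I, {}}"
      then have "finite J" using \<open>finite I\<close> finite_subset by auto
      then show "norm (D x e J) \<le> A * pN e J"
        using A(2)[OF \<open>x \<in> X\<close>, of J e] small[OF J] J that(4) by auto
      show "norm (D x e (I - J)) \<le> A * pN e (I - J)"
        using A(2)[OF \<open>x \<in> X\<close>, of "I - J" e] small[OF J] that by auto
    qed (use that A in auto)
    moreover have W: "D x e I - B (sol x) (D x e I) - B (D x e I) (sol x) = dir L x e I + ?S"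
      using D_eq[OF \<open>finite I\<close> \<open>x \<in> X\<close>, of e]
      by (simp add: sum_Pow_proper[OF \<open>finite I\<close> ne] algebra_simps)
    ultimately have "norm (D x e I - B (sol x) (D x e I) - B (D x e I) (sol x)) \<le> (c + 2 ^ Suc n * K * A * A) * pN e I"
      unfolding W using norm_dir_L[OF that(4) ne, of x] norm_triangle_ineq[of "dir L x e I" ?S] by (simp add: algebra_simps)
    from norm_absorb[OF that(1) that(1) this] have "norm (D x e I) \<le> ?C * pN e I" by simp
    also have "\<dots> \<le> max A ?C * pN e I" using pN_nonneg that by (intro mult_right_mono) auto
    finally show ?thesis .
  qed
  then show ?case using A(1) by (intro exI[of _ "max A ?C"]) (auto simp: max_def)
qed


lemma D_bound:
  obtains A where "0 \<le> A"
    "\<And>x e I. x \<in> X \<Longrightarrow> finite I \<Longrightarrow> card I \<le> n \<Longrightarrow> e ` I \<subseteq> V \<Longrightarrow>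
       norm (D x e I) \<le> A * pN e I"
proof -
  obtain A where A: "0 \<le> A" "\<forall>x\<in>X. \<forall>e I. finite I \<and> card I \<le> n \<and> e ` I \<subseteq> V \<longrightarrow>
       norm (D x e I) \<le> A * pN e I"
    using D_bound_ex[of n] by (elim exE conjE)
  show thesis
    by (rule that[OF A(1)]) (use A(2) in simp)
qed

definition Delta :: "'v \<Rightarrow> 'v \<Rightarrow> (nat \<Rightarrow> 'v) \<Rightarrow> nat set \<Rightarrow> 'z" where
  "Delta x h e I = D (x + h) e I - D x e I"

text \<open>The identity ab - a'b' = a(b - b') + (a - a')b', applied to every term of the product
  rule. The equation stays linear in \<open>Delta\<close>, with the two base points mixed.\<close>

lemma Delta_eq: assumes "finite I" "x \<in> X" "x + h \<in> X" "h \<in> V"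
  shows "Delta x h e I = (if I = {} then L h else 0) +
    (\<Sum>J\<in>Pow I. B (D (x + h) e J) (Delta x h e (I - J)) + B (Delta x h e J) (D x e (I - J)))"
proof -
  have "L (x + h) = L x + L h" using lin_L assms X_V by (auto simp: linear_on_subspace_def)
  then have d: "dir L (x + h) e I - dir L x e I = (if I = {} then L h else 0)" by (simp add: dir_def)
  have "Delta x h e I = (dir L (x + h) e I - dir L x e I) +
     (\<Sum>J\<in>Pow I. B (D (x + h) e J) (D (x + h) e (I - J)) - B (D x e J) (D x e (I - J)))"
    unfolding Delta_def sum_subtractf D_eq[OF assms(1,2)] D_eq[OF assms(1,3)] by simp
  also have "(\<Sum>J\<in>Pow I. B (D (x + h) e J) (D (x + h) e (I - J)) - B (D x e J) (D x e (I - J))) =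
    (\<Sum>J\<in>Pow I. B (D (x + h) e J) (Delta x h e (I - J)) + B (Delta x h e J) (D x e (I - J)))"
    by (rule sum.cong) (simp_all add: Delta_def B.diff_left B.diff_right)
  finally show ?thesis unfolding d .
qed

lemma Delta_bound_ex: "\<exists>A\<ge>0. \<forall>x\<in>X. \<forall>h\<in>V. \<forall>e I. x + h \<in> X \<and> finite I \<and> card I \<le> n \<and> e ` I \<subseteq> V \<longrightarrow>
    norm (Delta x h e I) \<le> A * N h * pN e I"
proof (induction n)
  case 0
  have "norm (Delta x h e I) \<le> c / (1 - q) * N h * pN e I"
    if "x \<in> X" "h \<in> V" "x + h \<in> X" "finite I" "card I \<le> 0" for x h e I
  proof -
    have I: "I = {}" using that by simp
    have "Delta x h e I - B (sol (x + h)) (Delta x h e I) - B (Delta x h e I) (sol x) = L h"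
      using Delta_eq[OF that(4,1,3,2), of e] by (simp add: I diff_eq_eq ac_simps)
    then have "norm (Delta x h e I) \<le> c * N h / (1 - q)"
      using norm_L[OF that(2)] by (intro norm_absorb[OF that(3,1)]) simp
    then show ?thesis by (simp add: I pN_def)
  qed
  then show ?case using q c_nonneg by (intro exI[of _ "c / (1 - q)"]) auto
next
  case (Suc n)
  from Suc obtain A where A0: "0 \<le> A"
    and A0': "\<forall>x\<in>X. \<forall>h\<in>V. \<forall>e I. x + h \<in> X \<and> finite I \<and> card I \<le> n \<and> e ` I \<subseteq> V \<longrightarrow>
      norm (Delta x h e I) \<le> A * N h * pN e I"
    by (elim exE conjE)
  note A = A0 A0'[rule_format]
  \<comment> \<open>The factor \<open>D\<close> needs a bound of the full order
    \<open>Suc n\<close>, as its index set may be all of \<open>I\<close>. Only the factor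
    \<open>Delta\<close> sits on a proper subset.\<close>
  obtain A1 where A1: "A1 \<ge> 0"
    "\<And>x e I. x \<in> X \<Longrightarrow> finite I \<Longrightarrow> card I \<le> Suc n \<Longrightarrow> e ` I \<subseteq> V \<Longrightarrow> norm (D x e I) \<le> A1 * pN e I"
    using D_bound[of "Suc n"] that by metis
  let ?C = "(2 * 2 ^ Suc n * K * A * A1) / (1 - q)"
  have C: "0 \<le> ?C" using q K_nonneg A(1) A1(1) by (intro divide_nonneg_nonneg) auto
  have "norm (Delta x h e I) \<le> max A ?C * N h * pN e I"
    if that: "x \<in> X" "h \<in> V" "x + h \<in> X" "finite I" "card I \<le> Suc n" "e ` I \<subseteq> V" for x h e I
  proof (cases "card I \<le> n")
    case True
    then have "norm (Delta x h e I) \<le> A * N h * pN e I" using A(2) that by blast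
    also have "\<dots> \<le> max A ?C * N h * pN e I" using pN_nonneg N_nonneg that by (intro mult_right_mono) auto
    finally show ?thesis .
  next
    case False
    then have ne: "I \<noteq> {}" by auto
    let ?S1 = "\<Sum>J\<in>Pow I - {{}}. B (D (x + h) e J) (Delta x h e (I - J))"
    let ?S2 = "\<Sum>J\<in>Pow I - {I}. B (Delta x h e J) (D x e (I - J))"
    have fin: "finite J" if "J \<subseteq> I" for J using that \<open>finite I\<close> finite_subset by auto
    have card: "card J \<le> Suc n" if "J \<subseteq> I" for J using card_mono[OF \<open>finite I\<close> that] \<open>card I \<le> Suc n\<close> by linarith
    have small: "card J \<le> n" if "J \<subset> I" for J
      using that psubset_card_mono[OF \<open>finite I\<close> that] \<open>card I \<le> Suc n\<close> by auto
    have "norm ?S1 \<le> 2 ^ Suc n * K * A1 * (A * N h) * pN e I"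
    proof (rule sum_bound_norm)
      fix J assume J: "J \<in> Pow I - {{}}"
      show "norm (D (x + h) e J) \<le> A1 * pN e J"
        using J that by (intro A1(2)) (auto intro!: fin card)
      show "norm (Delta x h e (I - J)) \<le> A * N h * pN e (I - J)"
        using J that by (intro A(2)) (auto intro!: fin small)
    qed (use that A A1 N_nonneg in auto)
    moreover have "norm ?S2 \<le> 2 ^ Suc n * K * (A * N h) * A1 * pN e I"
    proof (rule sum_bound_norm)
      fix J assume J: "J \<in> Pow I - {I}"
      show "norm (D x e (I - J)) \<le> A1 * pN e (I - J)"
        using J that by (intro A1(2)) (auto intro!: fin card)
      show "norm (Delta x h e J) \<le> A * N h * pN e J"
        using J that by (intro A(2)) (auto intro!: fin small)
    qed (use that A A1 N_nonneg in auto)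
    moreover have W: "Delta x h e I - B (sol (x + h)) (Delta x h e I) - B (Delta x h e I) (sol x) = ?S1 + ?S2"
    proof -
      have s1: "(\<Sum>J\<in>Pow I. B (D (x + h) e J) (Delta x h e (I - J))) = B (sol (x + h)) (Delta x h e I) + ?S1"
        using sum_Pow_right[OF that(4), of "\<lambda>J. B (D (x + h) e J) (Delta x h e (I - J))"] by simp
      have s2: "(\<Sum>J\<in>Pow I. B (Delta x h e J) (D x e (I - J))) = B (Delta x h e I) (sol x) + ?S2"
        using sum_Pow_left[OF that(4), of "\<lambda>J. B (Delta x h e J) (D x e (I - J))"] by simp
      have "Delta x h e I = (B (sol (x + h)) (Delta x h e I) + ?S1) + (B (Delta x h e I) (sol x) + ?S2)"
        by (rule trans[OF Delta_eq[OF that(4,1,3,2), of e]]) (simp only: ne if_False add_0 sum.distrib s1 s2)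
      then have "Delta x h e I - (B (sol (x + h)) (Delta x h e I) + B (Delta x h e I) (sol x)) = ?S1 + ?S2"
        unfolding diff_eq_eq by (simp only: ac_simps)
      then show ?thesis by (simp only: diff_diff_eq)
    qed
    ultimately have "norm (Delta x h e I - B (sol (x + h)) (Delta x h e I) - B (Delta x h e I) (sol x))
        \<le> (2 * 2 ^ Suc n * K * A * A1) * N h * pN e I"
      unfolding W using norm_triangle_ineq[of ?S1 ?S2] by (simp add: algebra_simps)
    from norm_absorb[OF that(3,1) this] have "norm (Delta x h e I) \<le> ?C * N h * pN e I" by simp
    also have "\<dots> \<le> max A ?C * N h * pN e I" using pN_nonneg N_nonneg that by (intro mult_right_mono) auto
    finally show ?thesis .
  qed
  then show ?case using A(1) by (intro exI[of _ "max A ?C"]) (auto simp: max_def)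
qed

lemma Delta_bound:
  obtains A where "0 \<le> A"
    "\<And>x h e I. x \<in> X \<Longrightarrow> h \<in> V \<Longrightarrow> x + h \<in> X \<Longrightarrow> finite I \<Longrightarrow> card I \<le> n \<Longrightarrow> e ` I \<subseteq> V \<Longrightarrow>
       norm (Delta x h e I) \<le> A * N h * pN e I"
proof -
  obtain A where A: "0 \<le> A" "\<forall>x\<in>X. \<forall>h\<in>V. \<forall>e I. x + h \<in> X \<and> finite I \<and> card I \<le> n \<and> e ` I \<subseteq> V \<longrightarrow>
       norm (Delta x h e I) \<le> A * N h * pN e I"
    using Delta_bound_ex[of n] by (elim exE conjE)
  show thesis
    by (rule that[OF A(1)]) (use A(2) in simp)
qed

lemma sum_Pow_insert: fixes f :: "nat set \<Rightarrow> 'y::comm_monoid_add"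
  assumes "finite I" "i \<notin> I"
  shows "(\<Sum>J\<in>Pow (insert i I). f J) = (\<Sum>J\<in>Pow I. f J + f (insert i J))"
proof -
  have inj: "inj_on (insert i) (Pow I)" using assms by (auto simp: inj_on_def)
  have "(\<Sum>J\<in>Pow (insert i I). f J) = (\<Sum>J\<in>Pow I. f J) + (\<Sum>J\<in>insert i ` Pow I. f J)"
    unfolding Pow_insert using assms by (intro sum.union_disjoint) auto
  then show ?thesis by (simp add: sum.reindex[OF inj] sum.distrib)
qed

text \<open>The first order Taylor remainder of the derivative indexed by \<open>I\<close>. The
  increment \<open>h\<close> is stored as the direction at a fresh index \<open>i\<close>, so that
  the next derivative is again a value of \<open>D\<close>.\<close>

definition Rem :: "'v \<Rightarrow> 'v \<Rightarrow> (nat \<Rightarrow> 'v) \<Rightarrow> nat \<Rightarrow> nat set \<Rightarrow> 'z" where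
  "Rem x h e i I = D (x + h) e I - D x e I - D x e (insert i I)"

text \<open>This identity holds for every bilinear map, so it gives the remainder of the fixed point and of
  every quadratic function of it.\<close>

lemma remainder_identity:
  fixes Bo :: "'z \<Rightarrow> 'z \<Rightarrow> 'w::real_vector"
  assumes Bo: "\<And>a b c. Bo (a + b) c = Bo a c + Bo b c" "\<And>a b c. Bo a (b + c) = Bo a b + Bo a c"
    and "finite I" "i \<notin> I"
  shows "(\<Sum>J\<in>Pow I. Bo (D (x + h) e J) (D (x + h) e (I - J))) - (\<Sum>J\<in>Pow I. Bo (D x e J) (D x e (I - J)))
      - (\<Sum>J\<in>Pow (insert i I). Bo (D x e J) (D x e (insert i I - J))) =
    (\<Sum>J\<in>Pow I. Bo (Delta x h e J) (Delta x h e (I - J))) + (\<Sum>J\<in>Pow I. Bo (D x e J) (Rem x h e i (I - J))) +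
    (\<Sum>J\<in>Pow I. Bo (Rem x h e i J) (D x e (I - J)))"
  unfolding sum_Pow_insert[OF assms(3,4)] sum_subtractf[symmetric] sum.distrib[symmetric]
proof (rule sum.cong, simp)
  fix J assume "J \<in> Pow I"
  then have J: "insert i I - J = insert i (I - J)" "insert i I - insert i J = I - J" using assms by auto
  let ?d1 = "Delta x h e J" and ?d2 = "Delta x h e (I - J)"
  let ?r1 = "Rem x h e i J" and ?r2 = "Rem x h e i (I - J)"
  have *: "D x e (insert i J) + ?r1 = ?d1" "D x e (insert i (I - J)) + ?r2 = ?d2"
    "D (x + h) e J = D x e J + ?d1" "D (x + h) e (I - J) = D x e (I - J) + ?d2"
    by (simp_all add: Rem_def Delta_def)
  have "Bo (D (x + h) e J) (D (x + h) e (I - J)) = Bo (D x e J) (D x e (I - J)) + Bo (D x e J) ?d2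
      + Bo ?d1 (D x e (I - J)) + Bo ?d1 ?d2"
    by (simp only: *(3,4) Bo) (simp only: ac_simps)
  moreover have "Bo (D x e J) ?d2 = Bo (D x e J) (D x e (insert i (I - J))) + Bo (D x e J) ?r2"
    by (simp only: *(2)[symmetric] Bo)
  moreover have "Bo ?d1 (D x e (I - J)) = Bo (D x e (insert i J)) (D x e (I - J)) + Bo ?r1 (D x e (I - J))"
    by (simp only: *(1)[symmetric] Bo)
  ultimately show "Bo (D (x + h) e J) (D (x + h) e (I - J)) - Bo (D x e J) (D x e (I - J)) -
      (Bo (D x e J) (D x e (insert i I - J)) + Bo (D x e (insert i J)) (D x e (insert i I - insert i J))) =
      Bo (Delta x h e J) (Delta x h e (I - J)) + Bo (D x e J) (Rem x h e i (I - J)) + Bo (Rem x h e i J) (D x e (I - J))"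
    by (simp add: J)
qed

lemma remainder_dir:
  assumes G: "linear_on_subspace V G" and "finite I" "i \<notin> I" "x \<in> X" "h \<in> V" "e i = h"
  shows "dir G (x + h) e I - dir G x e I - dir G x e (insert i I) = 0"
proof (cases "I = {}")
  case True
  then show ?thesis using assms X_V by (auto simp: dir_def linear_on_subspace_def)
next
  case False
  then have "card (insert i I) \<noteq> 1" using assms by (simp add: card_0_eq)
  then show ?thesis using False by (simp add: dir_def)
qed

lemma Rem_eq:
  assumes "finite I" "i \<notin> I" "x \<in> X" "x + h \<in> X" "h \<in> V" "e i = h"
  shows "Rem x h e i I = (\<Sum>J\<in>Pow I. B (Delta x h e J) (Delta x h e (I - J))) +
    (\<Sum>J\<in>Pow I. B (D x e J) (Rem x h e i (I - J))) + (\<Sum>J\<in>Pow I. B (Rem x h e i J) (D x e (I - J)))"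
proof -
  have fin: "finite (insert i I)" using assms by simp
  have "Rem x h e i I = (dir L (x + h) e I - dir L x e I - dir L x e (insert i I)) +
      ((\<Sum>J\<in>Pow I. B (D (x + h) e J) (D (x + h) e (I - J))) - (\<Sum>J\<in>Pow I. B (D x e J) (D x e (I - J)))
      - (\<Sum>J\<in>Pow (insert i I). B (D x e J) (D x e (insert i I - J))))"
    unfolding Rem_def D_eq[OF assms(1,3)] D_eq[OF assms(1,4)] D_eq[OF fin assms(3)] by simp
  then show ?thesis
    by (simp add: remainder_dir[where e = e, OF lin_L assms(1-3,5,6)]
      remainder_identity[of B, OF B.add_left B.add_right assms(1,2)])
qed

text \<open>In the linear equation for \<open>Rem\<close> the only term without a remainder is the
  sum over products of two \<open>Delta\<close>, and this is of size (N h)^2. The other terms are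
  absorbed or lie on proper subsets.\<close>

lemma Rem_bound_ex: "\<exists>A\<ge>0. \<forall>x\<in>X. \<forall>h\<in>V. \<forall>e I i. x + h \<in> X \<and> finite I \<and> card I \<le> n \<and> e ` I \<subseteq> V
    \<and> i \<notin> I \<and> e i = h \<longrightarrow> norm (Rem x h e i I) \<le> A * (N h)\<^sup>2 * pN e I"
proof (induction n)
  case 0
  obtain A1 where A1: "A1 \<ge> 0"
    "\<And>x h e I. x \<in> X \<Longrightarrow> h \<in> V \<Longrightarrow> x + h \<in> X \<Longrightarrow> finite I \<Longrightarrow> card I \<le> 0 \<Longrightarrow> e ` I \<subseteq> V \<Longrightarrow>
       norm (Delta x h e I) \<le> A1 * N h * pN e I"
    using Delta_bound[of 0] that by metis
  have "norm (Rem x h e i I) \<le> (K * A1 * A1) / (1 - q) * (N h)\<^sup>2 * pN e I"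
    if that: "x \<in> X" "h \<in> V" "x + h \<in> X" "finite I" "card I \<le> 0" "i \<notin> I" "e i = h" for x h e I i
  proof -
    have I: "I = {}" using that by simp
    have 1: "norm (Delta x h e I) \<le> A1 * N h" using A1(2)[OF that(1-5)] by (simp add: I pN_def)
    have "norm (B (Delta x h e I) (Delta x h e I)) \<le> K * (A1 * N h) * (A1 * N h)"
      by (rule order.trans[OF norm_B]) (use 1 K_nonneg A1 N_nonneg that in \<open>intro mult_mono; simp\<close>)
    moreover have "Rem x h e i I - B (sol x) (Rem x h e i I) - B (Rem x h e i I) (sol x) =
        B (Delta x h e I) (Delta x h e I)"
      using Rem_eq[where e = e, OF that(4,6,1,3,2,7)] by (simp add: I diff_eq_eq ac_simps)
    ultimately have "norm (Rem x h e i I - B (sol x) (Rem x h e i I) - B (Rem x h e i I) (sol x)) \<le> (K * A1 * A1) * (N h)\<^sup>2"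
      by (simp add: power2_eq_square ac_simps)
    from norm_absorb[OF that(1) that(1) this] show ?thesis by (simp add: I pN_def)
  qed
  then show ?case using q K_nonneg A1 by (intro exI[of _ "(K * A1 * A1) / (1 - q)"]) auto
next
  case (Suc n)
  from Suc obtain A where A0: "0 \<le> A"
    and A0': "\<forall>x\<in>X. \<forall>h\<in>V. \<forall>e I i. x + h \<in> X \<and> finite I \<and> card I \<le> n \<and> e ` I \<subseteq> V \<and> i \<notin> I \<and> e i = h \<longrightarrow>
      norm (Rem x h e i I) \<le> A * (N h)\<^sup>2 * pN e I"
    by (elim exE conjE)
  note A = A0 A0'[rule_format]
  obtain A1 where A1: "A1 \<ge> 0"
    "\<And>x e I. x \<in> X \<Longrightarrow> finite I \<Longrightarrow> card I \<le> Suc n \<Longrightarrow> e ` I \<subseteq> V \<Longrightarrow> norm (D x e I) \<le> A1 * pN e I"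
    using D_bound[of "Suc n"] that by metis
  obtain A2 where A2: "A2 \<ge> 0"
    "\<And>x h e I. x \<in> X \<Longrightarrow> h \<in> V \<Longrightarrow> x + h \<in> X \<Longrightarrow> finite I \<Longrightarrow> card I \<le> Suc n \<Longrightarrow> e ` I \<subseteq> V \<Longrightarrow>
       norm (Delta x h e I) \<le> A2 * N h * pN e I"
    using Delta_bound[of "Suc n"] that by metis
  let ?C = "(2 * 2 ^ Suc n * K * A * A1 + 2 ^ Suc n * K * A2 * A2) / (1 - q)"
  have C: "0 \<le> ?C" using q K_nonneg A(1) A1(1) A2(1) by (intro divide_nonneg_nonneg) auto
  have "norm (Rem x h e i I) \<le> max A ?C * (N h)\<^sup>2 * pN e I"
    if that: "x \<in> X" "h \<in> V" "x + h \<in> X" "finite I" "card I \<le> Suc n" "e ` I \<subseteq> V" "i \<notin> I" "e i = h" for x h e I i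
  proof (cases "card I \<le> n")
    case True
    then have "norm (Rem x h e i I) \<le> A * (N h)\<^sup>2 * pN e I" using A(2) that by blast
    also have "\<dots> \<le> max A ?C * (N h)\<^sup>2 * pN e I" using pN_nonneg N_nonneg that by (intro mult_right_mono) auto
    finally show ?thesis .
  next
    case False
    then have ne: "I \<noteq> {}" by auto
    let ?S0 = "\<Sum>J\<in>Pow I. B (Delta x h e J) (Delta x h e (I - J))"
    let ?S1 = "\<Sum>J\<in>Pow I - {{}}. B (D x e J) (Rem x h e i (I - J))"
    let ?S2 = "\<Sum>J\<in>Pow I - {I}. B (Rem x h e i J) (D x e (I - J))"
    have fin: "finite J" if "J \<subseteq> I" for J using that \<open>finite I\<close> finite_subset by auto
    have card: "card J \<le> Suc n" if "J \<subseteq> I" for J using card_mono[OF \<open>finite I\<close> that] \<open>card I \<le> Suc n\<close> by linarith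
    have small: "card J \<le> n" if "J \<subset> I" for J
      using that psubset_card_mono[OF \<open>finite I\<close> that] \<open>card I \<le> Suc n\<close> by auto
    have "norm ?S0 \<le> 2 ^ Suc n * K * (A2 * N h) * (A2 * N h) * pN e I"
    proof (rule sum_bound_norm)
      fix J assume J: "J \<in> Pow I"
      show "norm (Delta x h e J) \<le> A2 * N h * pN e J"
        using J that by (intro A2(2)) (auto intro!: fin card)
      show "norm (Delta x h e (I - J)) \<le> A2 * N h * pN e (I - J)"
        using J that by (intro A2(2)) (auto intro!: fin card)
    qed (use that A2 N_nonneg in auto)
    moreover have "norm ?S1 \<le> 2 ^ Suc n * K * A1 * (A * (N h)\<^sup>2) * pN e I"
    proof (rule sum_bound_norm)
      fix J assume J: "J \<in> Pow I - {{}}"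
      show "norm (D x e J) \<le> A1 * pN e J"
        using J that by (intro A1(2)) (auto intro!: fin card)
      show "norm (Rem x h e i (I - J)) \<le> A * (N h)\<^sup>2 * pN e (I - J)"
        using J that by (intro A(2)) (auto intro!: fin small)
    qed (use that A A1 N_nonneg in auto)
    moreover have "norm ?S2 \<le> 2 ^ Suc n * K * (A * (N h)\<^sup>2) * A1 * pN e I"
    proof (rule sum_bound_norm)
      fix J assume J: "J \<in> Pow I - {I}"
      show "norm (D x e (I - J)) \<le> A1 * pN e (I - J)"
        using J that by (intro A1(2)) (auto intro!: fin card)
      show "norm (Rem x h e i J) \<le> A * (N h)\<^sup>2 * pN e J"
        using J that by (intro A(2)) (auto intro!: fin small)
    qed (use that A A1 N_nonneg in auto)
    moreover have W: "Rem x h e i I - B (sol x) (Rem x h e i I) - B (Rem x h e i I) (sol x) = ?S0 + ?S1 + ?S2"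
      using Rem_eq[where e = e, OF that(4,7,1,3,2,8)]
      by (simp add: sum_Pow_left[OF that(4), of "\<lambda>J. B (Rem x h e i J) (D x e (I - J))"]
        sum_Pow_right[OF that(4), of "\<lambda>J. B (D x e J) (Rem x h e i (I - J))"] algebra_simps)
    ultimately have "norm (Rem x h e i I - B (sol x) (Rem x h e i I) - B (Rem x h e i I) (sol x))
        \<le> (2 * 2 ^ Suc n * K * A * A1 + 2 ^ Suc n * K * A2 * A2) * (N h)\<^sup>2 * pN e I"
      unfolding W using norm_triangle_ineq[of ?S0 ?S1] norm_triangle_ineq[of "?S0 + ?S1" ?S2]
      by (simp add: algebra_simps power2_eq_square)
    from norm_absorb[OF that(1,1) this] have "norm (Rem x h e i I) \<le> ?C * (N h)\<^sup>2 * pN e I" by simp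
    also have "\<dots> \<le> max A ?C * (N h)\<^sup>2 * pN e I" using pN_nonneg N_nonneg that by (intro mult_right_mono) auto
    finally show ?thesis .
  qed
  then show ?case using A(1) by (intro exI[of _ "max A ?C"]) (auto simp: max_def)
qed

lemma Rem_bound:
  obtains A where "0 \<le> A"
    "\<And>x h e I i. x \<in> X \<Longrightarrow> h \<in> V \<Longrightarrow> x + h \<in> X \<Longrightarrow> finite I \<Longrightarrow> card I \<le> n \<Longrightarrow> e ` I \<subseteq> V \<Longrightarrow> i \<notin> I \<Longrightarrow> e i = h \<Longrightarrow>
       norm (Rem x h e i I) \<le> A * (N h)\<^sup>2 * pN e I"
proof -
  obtain A where A: "0 \<le> A" "\<forall>x\<in>X. \<forall>h\<in>V. \<forall>e I i. x + h \<in> X \<and> finite I \<and> card I \<le> n \<and> e ` I \<subseteq> V \<and> i \<notin> I \<and> e i = h \<longrightarrow>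
       norm (Rem x h e i I) \<le> A * (N h)\<^sup>2 * pN e I"
    using Rem_bound_ex[of n] by (elim exE conjE)
  show thesis
    by (rule that[OF A(1)]) (use A(2) in simp)
qed

end

text \<open>The Banach space of the fixed point does not control the solution up to \<open>t = 0\<close>. The solution is
  recovered as \<open>lo x + Bo (sol x) (sol x)\<close>, which is estimated in more seminorms.\<close>

locale quadratic_output = quadratic_fixpoint B L V X N K \<rho> c
  for B :: "'z::banach \<Rightarrow> 'z \<Rightarrow> 'z" and L :: "'v::real_vector \<Rightarrow> 'z" and V X N K \<rho> c +
  fixes Bo :: "'z \<Rightarrow> 'z \<Rightarrow> 'w::real_vector" and lo :: "'v \<Rightarrow> 'w" and P :: "('w \<Rightarrow> real) set" and k :: real
  assumes Bo_add: "Bo (a + b) d = Bo a d + Bo b d" "Bo d (a + b) = Bo d a + Bo d b"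
    and Bo_scale: "Bo (r *\<^sub>R a) b = r *\<^sub>R Bo a b" "Bo a (r *\<^sub>R b) = r *\<^sub>R Bo a b"
    and lin_lo: "linear_on_subspace V lo"
    and P_triangle: "p \<in> P \<Longrightarrow> p (v + w) \<le> p v + p w" and P_zero: "p \<in> P \<Longrightarrow> p 0 = 0"
    and k_nonneg: "0 \<le> k"
    and P_Bo: "p \<in> P \<Longrightarrow> p (Bo a b) \<le> k * norm a * norm b"
    and P_lo: "p \<in> P \<Longrightarrow> h \<in> V \<Longrightarrow> p (lo h) \<le> k * N h"
begin

text \<open>The derivative of order \<open>card I\<close> of
  \<open>\<lambda>x. lo x + Bo (sol x) (sol x)\<close>. It is explicit by the product rule, since
  the output is not itself an unknown.\<close>

definition Do :: "'v \<Rightarrow> (nat \<Rightarrow> 'v) \<Rightarrow> nat set \<Rightarrow> 'w" where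
  "Do x e I = dir lo x e I + (\<Sum>J\<in>Pow I. Bo (D x e J) (D x e (I - J)))"

lemma Do_empty: "Do x e {} = lo x + Bo (sol x) (sol x)"
  by (simp add: Do_def dir_def)

lemma Do_cong: assumes "finite I" "\<And>i. i \<in> I \<Longrightarrow> e i = e' i" shows "Do x e I = Do x e' I"
proof -
  have "(\<Sum>J\<in>Pow I. Bo (D x e J) (D x e (I - J))) = (\<Sum>J\<in>Pow I. Bo (D x e' J) (D x e' (I - J)))"
  proof (rule sum.cong, simp)
    fix J assume J: "J \<in> Pow I"
    have "D x e J = D x e' J" using J assms finite_subset[of J I] by (intro D_cong) auto
    moreover have "D x e (I - J) = D x e' (I - J)" using J assms by (intro D_cong) auto
    ultimately show "Bo (D x e J) (D x e (I - J)) = Bo (D x e' J) (D x e' (I - J))" by simp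
  qed
  moreover have "dir lo x e I = dir lo x e' I" by (rule dir_cong) (rule assms)
  ultimately show ?thesis unfolding Do_def by simp
qed

lemma Do_add:
  assumes "finite I" "x \<in> X" "i \<in> I" "\<And>j. j \<noteq> i \<Longrightarrow> e1 j = e3 j \<and> e2 j = e3 j"
    "e1 i \<in> V" "e2 i \<in> V" "e3 i = e1 i + e2 i"
  shows "Do x e3 I = Do x e1 I + Do x e2 I"
proof -
  have fin: "finite J" if "J \<subseteq> I" for J using that assms finite_subset by blast
  have "(\<Sum>J\<in>Pow I. Bo (D x e3 J) (D x e3 (I - J))) =
    (\<Sum>J\<in>Pow I. Bo (D x e1 J) (D x e1 (I - J))) + (\<Sum>J\<in>Pow I. Bo (D x e2 J) (D x e2 (I - J)))"
    unfolding sum.distrib[symmetric]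
  proof (rule sum.cong, simp)
    fix J assume J: "J \<in> Pow I"
    show "Bo (D x e3 J) (D x e3 (I - J)) = Bo (D x e1 J) (D x e1 (I - J)) + Bo (D x e2 J) (D x e2 (I - J))"
    proof (cases "i \<in> J")
      case True
      have 1: "D x e3 J = D x e1 J + D x e2 J" using J assms True fin by (intro D_add) auto
      have 2: "D x e1 (I - J) = D x e3 (I - J)" "D x e2 (I - J) = D x e3 (I - J)"
        using True assms fin[of "I - J"] by (metis D_cong Diff_iff Diff_subset)+
      show ?thesis by (simp only: 1 2 Bo_add)
    next
      case False
      have 1: "D x e3 (I - J) = D x e1 (I - J) + D x e2 (I - J)"
        using J assms False fin by (intro D_add) auto
      have 2: "D x e1 J = D x e3 J" "D x e2 J = D x e3 J"
        using False assms fin[of J] J by (metis D_cong PowD)+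
      show ?thesis by (simp only: 1 2 Bo_add)
    qed
  qed
  moreover have "dir lo x e3 I = dir lo x e1 I + dir lo x e2 I"
    using assms by (intro dir_linear[OF lin_lo]) auto
  ultimately show ?thesis unfolding Do_def by (simp add: ac_simps)
qed

lemma Do_scale:
  assumes "finite I" "x \<in> X" "i \<in> I" "\<And>j. j \<noteq> i \<Longrightarrow> e1 j = e3 j"
    "e1 i \<in> V" "e3 i = a *\<^sub>R e1 i"
  shows "Do x e3 I = a *\<^sub>R Do x e1 I"
proof -
  have fin: "finite J" if "J \<subseteq> I" for J using that assms finite_subset by blast
  have "(\<Sum>J\<in>Pow I. Bo (D x e3 J) (D x e3 (I - J))) = a *\<^sub>R (\<Sum>J\<in>Pow I. Bo (D x e1 J) (D x e1 (I - J)))"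
    unfolding scaleR_sum_right
  proof (rule sum.cong, simp)
    fix J assume J: "J \<in> Pow I"
    show "Bo (D x e3 J) (D x e3 (I - J)) = a *\<^sub>R Bo (D x e1 J) (D x e1 (I - J))"
    proof (cases "i \<in> J")
      case True
      have 1: "D x e3 J = a *\<^sub>R D x e1 J" using J assms True fin by (intro D_scale) auto
      have 2: "D x e1 (I - J) = D x e3 (I - J)"
        using True assms fin[of "I - J"] by (metis D_cong Diff_iff Diff_subset)+
      show ?thesis by (simp only: 1 2 Bo_scale)
    next
      case False
      have 1: "D x e3 (I - J) = a *\<^sub>R D x e1 (I - J)"
        using J assms False fin by (intro D_scale) auto
      have 2: "D x e1 J = D x e3 J"
        using False assms fin[of J] J by (metis D_cong PowD)+
      show ?thesis by (simp only: 1 2 Bo_scale)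
    qed
  qed
  moreover have "dir lo x e3 I = a *\<^sub>R dir lo x e1 I"
    using assms by (intro dir_linear[OF lin_lo, of i I e1 e3 e1]) auto
  ultimately show ?thesis unfolding Do_def by (simp add: scaleR_add_right)
qed

text \<open>One constant serves all of \<open>P\<close>. This uniformity later turns a family of
  seminorms, one for each time and each finite set of frequencies, into a bound for the norm of a
  curve.\<close>

lemma Do_bound: assumes "x \<in> X"
  shows "\<exists>A. \<forall>p\<in>P. \<forall>e I. finite I \<and> card I \<le> n \<and> e ` I \<subseteq> V \<longrightarrow> p (Do x e I) \<le> A * pN e I"
proof -
  obtain A1 where A1: "A1 \<ge> 0"
    "\<And>e I. finite I \<Longrightarrow> card I \<le> n \<Longrightarrow> e ` I \<subseteq> V \<Longrightarrow> norm (D x e I) \<le> A1 * pN e I"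
    using D_bound[of n] that assms by metis

  have "p (Do x e I) \<le> (k * N x + k + 2 ^ n * k * A1 * A1) * pN e I"
    if that: "p \<in> P" "finite I" "card I \<le> n" "e ` I \<subseteq> V" for p e I
  proof -
    have fin: "finite J" if "J \<subseteq> I" for J using that \<open>finite I\<close> finite_subset by auto
    have card: "card J \<le> n" if "J \<subseteq> I" for J using card_mono[OF \<open>finite I\<close> that] \<open>card I \<le> n\<close> by linarith
    have 1: "p (\<Sum>J\<in>Pow I. Bo (D x e J) (D x e (I - J))) \<le> 2 ^ n * k * A1 * A1 * pN e I"
    proof (rule sum_bound[where p = p and Bo = Bo and k = k, OF P_triangle[where p = p, OF that(1)] P_zero[where p = p, OF that(1)] P_Bo[where p = p, OF that(1)] k_nonneg])
      fix J assume J: "J \<in> Pow I"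
      show "norm (D x e J) \<le> A1 * pN e J" using J that by (intro A1(2)) (auto intro!: fin card)
      show "norm (D x e (I - J)) \<le> A1 * pN e (I - J)" using J that by (intro A1(2)) (auto intro!: fin card)
    qed (use that A1 in auto)
    have xV: "x \<in> V" using assms X_V by auto
    have nn: "0 \<le> k * N x" "0 \<le> pN e I" "0 \<le> k" using xV N_nonneg k_nonneg pN_nonneg that by auto
    \<comment> \<open>The part \<open>k * N x\<close> covers order 0 and the part \<open>k\<close>
      covers order 1.\<close>
    have 2: "p (dir lo x e I) \<le> (k * N x + k) * pN e I"
    proof (cases "I = {}")
      case True then show ?thesis using P_lo[OF that(1) xV] nn by (simp add: dir_def pN_def)
    next
      case False
      show ?thesis
      proof (cases "card I = 1")
        case True
        then obtain i where I: "I = {i}" by (auto simp: card_1_singleton_iff)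
        have "p (lo (e i)) \<le> k * N (e i)" using P_lo that I by auto
        moreover have "0 \<le> k * N x * N (e i)" using nn N_nonneg that I by auto
        ultimately show ?thesis using I by (simp add: dir_def pN_def algebra_simps)
      next
        case F: False
        have "0 \<le> (k * N x + k) * pN e I" using nn by simp
        then show ?thesis using F False P_zero[OF that(1)] by (simp add: dir_def)
      qed
    qed
    have "p (Do x e I) \<le> (k * N x + k) * pN e I + 2 ^ n * k * A1 * A1 * pN e I"
      using 1 2 P_triangle[OF that(1), of "dir lo x e I" "\<Sum>J\<in>Pow I. Bo (D x e J) (D x e (I - J))"]
      unfolding Do_def by linarith
    then show ?thesis by (simp only: distrib_right)
  qed
  then show ?thesis by blast
qed

lemma Do_remainder: assumes "x \<in> X"
  shows "\<exists>A\<ge>0. \<forall>p\<in>P. \<forall>h\<in>V. \<forall>e I i. x + h \<in> X \<and> finite I \<and> card I \<le> n \<and> e ` I \<subseteq> V \<and> i \<notin> I \<and> e i = h \<longrightarrow>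
     p (Do (x + h) e I - Do x e I - Do x e (insert i I)) \<le> A * (N h)\<^sup>2 * pN e I"
proof -
  obtain A1 where A1: "A1 \<ge> 0"
    "\<And>e I. finite I \<Longrightarrow> card I \<le> n \<Longrightarrow> e ` I \<subseteq> V \<Longrightarrow> norm (D x e I) \<le> A1 * pN e I"
    using D_bound[of n] that assms by metis

  obtain A2 where A2: "A2 \<ge> 0"
    "\<And>h e I. h \<in> V \<Longrightarrow> x + h \<in> X \<Longrightarrow> finite I \<Longrightarrow> card I \<le> n \<Longrightarrow> e ` I \<subseteq> V \<Longrightarrow>
       norm (Delta x h e I) \<le> A2 * N h * pN e I"
    using Delta_bound[of n] that assms by metis

  obtain A where A: "A \<ge> 0"
    "\<And>h e I i. h \<in> V \<Longrightarrow> x + h \<in> X \<Longrightarrow> finite I \<Longrightarrow> card I \<le> n \<Longrightarrow> e ` I \<subseteq> V \<Longrightarrow> i \<notin> I \<Longrightarrow> e i = h \<Longrightarrow>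
       norm (Rem x h e i I) \<le> A * (N h)\<^sup>2 * pN e I"
    using Rem_bound[of n] that assms by metis

  have "p (Do (x + h) e I - Do x e I - Do x e (insert i I)) \<le>
      (2 * 2 ^ n * k * A * A1 + 2 ^ n * k * A2 * A2) * (N h)\<^sup>2 * pN e I"
    if that: "p \<in> P" "h \<in> V" "x + h \<in> X" "finite I" "card I \<le> n" "e ` I \<subseteq> V" "i \<notin> I" "e i = h" for p h e I i
  proof -
    have fin: "finite J" if "J \<subseteq> I" for J using that \<open>finite I\<close> finite_subset by auto
    have card: "card J \<le> n" if "J \<subseteq> I" for J using card_mono[OF \<open>finite I\<close> that] \<open>card I \<le> n\<close> by linarith
    let ?S0 = "\<Sum>J\<in>Pow I. Bo (Delta x h e J) (Delta x h e (I - J))"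
    let ?S1 = "\<Sum>J\<in>Pow I. Bo (D x e J) (Rem x h e i (I - J))"
    let ?S2 = "\<Sum>J\<in>Pow I. Bo (Rem x h e i J) (D x e (I - J))"
    have "p ?S0 \<le> 2 ^ n * k * (A2 * N h) * (A2 * N h) * pN e I"
    proof (rule sum_bound[where p = p and Bo = Bo and k = k, OF P_triangle[where p = p, OF that(1)] P_zero[where p = p, OF that(1)] P_Bo[where p = p, OF that(1)] k_nonneg])
      fix J assume J: "J \<in> Pow I"
      show "norm (Delta x h e J) \<le> A2 * N h * pN e J"
        using J that by (intro A2(2)) (auto intro!: fin card)
      show "norm (Delta x h e (I - J)) \<le> A2 * N h * pN e (I - J)"
        using J that by (intro A2(2)) (auto intro!: fin card)
    qed (use that A2 N_nonneg in auto)
    moreover have "p ?S1 \<le> 2 ^ n * k * A1 * (A * (N h)\<^sup>2) * pN e I"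
    proof (rule sum_bound[where p = p and Bo = Bo and k = k, OF P_triangle[where p = p, OF that(1)] P_zero[where p = p, OF that(1)] P_Bo[where p = p, OF that(1)] k_nonneg])
      fix J assume J: "J \<in> Pow I"
      show "norm (D x e J) \<le> A1 * pN e J"
        using J that by (intro A1(2)) (auto intro!: fin card)
      show "norm (Rem x h e i (I - J)) \<le> A * (N h)\<^sup>2 * pN e (I - J)"
        using J that by (intro A(2)) (auto intro!: fin card)
    qed (use that A A1 N_nonneg in auto)
    moreover have "p ?S2 \<le> 2 ^ n * k * (A * (N h)\<^sup>2) * A1 * pN e I"
    proof (rule sum_bound[where p = p and Bo = Bo and k = k, OF P_triangle[where p = p, OF that(1)] P_zero[where p = p, OF that(1)] P_Bo[where p = p, OF that(1)] k_nonneg])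
      fix J assume J: "J \<in> Pow I"
      show "norm (D x e (I - J)) \<le> A1 * pN e (I - J)"
        using J that by (intro A1(2)) (auto intro!: fin card)
      show "norm (Rem x h e i J) \<le> A * (N h)\<^sup>2 * pN e J"
        using J that by (intro A(2)) (auto intro!: fin card)
    qed (use that A A1 N_nonneg in auto)
    moreover have "Do (x + h) e I - Do x e I - Do x e (insert i I) = ?S0 + ?S1 + ?S2"
    proof -
      have "Do (x + h) e I - Do x e I - Do x e (insert i I) =
        (dir lo (x + h) e I - dir lo x e I - dir lo x e (insert i I)) +
        ((\<Sum>J\<in>Pow I. Bo (D (x + h) e J) (D (x + h) e (I - J))) - (\<Sum>J\<in>Pow I. Bo (D x e J) (D x e (I - J)))
        - (\<Sum>J\<in>Pow (insert i I). Bo (D x e J) (D x e (insert i I - J))))"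
        unfolding Do_def by simp
      then show ?thesis
        by (simp add: remainder_dir[where e = e, OF lin_lo that(4,7) assms that(2,8)]
          remainder_identity[of Bo, OF Bo_add that(4,7)])
    qed
    ultimately show ?thesis
      using P_triangle[OF that(1), of ?S0 ?S1] P_triangle[OF that(1), of "?S0 + ?S1" ?S2]
      by (simp add: algebra_simps power2_eq_square)
  qed
  moreover have "0 \<le> 2 * 2 ^ n * k * A * A1 + 2 ^ n * k * A2 * A2" using k_nonneg A A1 A2 by auto
  ultimately show ?thesis by blast
qed

end

subsection \<open>Sums over the integers\<close>

abbreviation abs_sum :: "(int \<Rightarrow> 'a::real_normed_vector) \<Rightarrow> bool" where
  "abs_sum f \<equiv> (\<lambda>k. norm (f k)) summable_on UNIV"

lemma bracket_summable: assumes "b > 1"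
  shows "(\<lambda>k::int. (1 + \<bar>real_of_int k\<bar>) powr - b) summable_on UNIV"
proof -
  have "summable (\<lambda>n. of_nat (Suc n) powr - b :: real)"
    using assms by (subst summable_Suc_iff) (simp add: summable_real_powr_iff)
  then have n: "(\<lambda>n. (1 + real n) powr - b) summable_on UNIV"
    by (subst summable_on_UNIV_nonneg_real_iff) (simp_all add: ac_simps)
  have "(\<lambda>k::int. (1 + \<bar>real_of_int k\<bar>) powr - b) summable_on range int"
    by (subst summable_on_reindex) (use n in \<open>auto simp: inj_on_def o_def\<close>)
  moreover have "(\<lambda>k::int. (1 + \<bar>real_of_int k\<bar>) powr - b) summable_on range (\<lambda>n. - int n)"
    by (subst summable_on_reindex) (use n in \<open>auto simp: inj_on_def o_def\<close>)
  moreover have "UNIV = range int \<union> range (\<lambda>n. - int n)"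
    by (auto intro: int_cases2)
  ultimately show ?thesis by (metis summable_on_union)
qed

text \<open>The bijection \<open>int_decode\<close> turns absolutely convergent sums over the
  integers into ordinary series, which gives access to termwise integration, measurability of limits
  and Tannery's theorem.\<close>

lemma infsum_int_decode:
  fixes f :: "int \<Rightarrow> 'a::banach"
  assumes "abs_sum f"
  shows "summable (\<lambda>n. norm (f (int_decode n)))" "(\<Sum>\<^sub>\<infinity>k. f k) = (\<Sum>n. f (int_decode n))"
    "(\<lambda>n. f (int_decode n)) sums (\<Sum>\<^sub>\<infinity>k. f k)"
proof -
  have "(\<lambda>n. norm (f (int_decode n))) summable_on UNIV"
    using assms summable_on_reindex_bij_betw[OF bij_int_decode, of "\<lambda>k. norm (f k)"] by simp
  then show "summable (\<lambda>n. norm (f (int_decode n)))"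
    by (subst (asm) summable_on_UNIV_nonneg_real_iff) auto
  have "(\<lambda>n. f (int_decode n)) summable_on UNIV"
    using abs_summable_summable[OF assms] summable_on_reindex_bij_betw[OF bij_int_decode, of f] by simp
  from has_sum_infsum[OF this] have "(\<lambda>n. f (int_decode n)) sums (\<Sum>\<^sub>\<infinity>n. f (int_decode n))"
    by (rule has_sum_imp_sums)
  then show "(\<lambda>n. f (int_decode n)) sums (\<Sum>\<^sub>\<infinity>k. f k)"
    using infsum_reindex_bij_betw[OF bij_int_decode, of f] by simp
  then show "(\<Sum>\<^sub>\<infinity>k. f k) = (\<Sum>n. f (int_decode n))" by (simp add: sums_iff)
qed

lemma set_integral_infsum_int:
  fixes f :: "int \<Rightarrow> 'a \<Rightarrow> 'b::{banach, second_countable_topology}"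
  assumes f: "\<And>k. set_integrable M A (f k)"
    and norm: "(\<lambda>k. LINT x:A|M. norm (f k x)) summable_on UNIV"
    and pt: "\<And>x. x \<in> A \<Longrightarrow> abs_sum (\<lambda>k. f k x)"
  shows "set_integrable M A (\<lambda>x. \<Sum>\<^sub>\<infinity>k. f k x)"
    "(LINT x:A|M. (\<Sum>\<^sub>\<infinity>k. f k x)) = (\<Sum>\<^sub>\<infinity>k. LINT x:A|M. f k x)"
    "abs_sum (\<lambda>k. LINT x:A|M. f k x)"
proof -
  let ?F = "\<lambda>n x. indicator A x *\<^sub>R f (int_decode n) x"
  have i: "integrable M (?F n)" for n using f unfolding set_integrable_def by blast
  have pt': "abs_sum (\<lambda>k. indicator A x *\<^sub>R f k x)" for x
    using pt[of x] by (cases "x \<in> A") (auto simp: summable_on_0)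
  have nn: "0 \<le> (LINT x:A|M. norm (f k x))" for k
    unfolding set_lebesgue_integral_def by (intro integral_nonneg_AE) auto
  have norm': "abs_sum (\<lambda>k. LINT x:A|M. norm (f k x))"
    using norm nn by simp
  have s: "summable (\<lambda>n. \<integral>x. norm (?F n x) \<partial>M)"
    using infsum_int_decode(1)[OF norm'] nn by (simp add: set_lebesgue_integral_def)
  have ae: "AE x in M. summable (\<lambda>n. norm (?F n x))"
    using infsum_int_decode(1)[OF pt'] by (intro AE_I2) simp
  have eq: "indicator A x *\<^sub>R (\<Sum>\<^sub>\<infinity>k. f k x) = (\<Sum>n. ?F n x)" for x
  proof -
    have "(\<Sum>n. ?F n x) = (\<Sum>\<^sub>\<infinity>k. indicator A x *\<^sub>R f k x)"
      using infsum_int_decode(2)[OF pt'] by simp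
    then show ?thesis by (cases "x \<in> A") auto
  qed
  show "set_integrable M A (\<lambda>x. \<Sum>\<^sub>\<infinity>k. f k x)"
    unfolding set_integrable_def eq by (rule integrable_suminf[OF i ae s])
  have "norm (LINT x:A|M. f k x) \<le> (LINT x:A|M. norm (f k x))" for k
    by (rule set_integral_norm_bound[OF f])
  then show a: "abs_sum (\<lambda>k. LINT x:A|M. f k x)"
    by (intro summable_on_comparison_test[OF norm]) auto
  have "(LINT x:A|M. (\<Sum>\<^sub>\<infinity>k. f k x)) = (\<Sum>n. \<integral>x. ?F n x \<partial>M)"
    unfolding set_lebesgue_integral_def eq by (rule integral_suminf[OF i ae s])
  also have "\<dots> = (\<Sum>\<^sub>\<infinity>k. LINT x:A|M. f k x)"
    using infsum_int_decode(2)[OF a] by (simp add: set_lebesgue_integral_def)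
  finally show "(LINT x:A|M. (\<Sum>\<^sub>\<infinity>k. f k x)) = (\<Sum>\<^sub>\<infinity>k. LINT x:A|M. f k x)" .
qed

subsection \<open>Trigonometric integrals\<close>

definition ee :: "int \<Rightarrow> real \<Rightarrow> complex" where
  "ee k x = exp (\<i> * of_int k * of_real x)"

abbreviation LI :: "(real \<Rightarrow> complex) \<Rightarrow> complex" where
  "LI f \<equiv> (LINT x:{-pi..pi}|lborel. f x)"

lemma ee_0 [simp]: "ee 0 x = 1" by (simp add: ee_def)

lemma ee_mult: "ee k x * ee l x = ee (k + l) x"
  by (simp add: ee_def exp_add[symmetric] algebra_simps)

lemma norm_ee [simp]: "cmod (ee k x) = 1"
proof -
  have "\<i> * of_int k * of_real x = \<i> * complex_of_real (of_int k * x)" by simp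
  then show ?thesis unfolding ee_def by (metis norm_exp_i_times)
qed

lemma cnj_ee: "cnj (ee k x) = ee (- k) x"
  by (simp add: ee_def exp_cnj)

lemma ee_periodic: "ee k (x + 2 * pi) = ee k x"
proof -
  have "ee k (x + 2 * pi) = ee k x * exp (2 * of_int k * of_real pi * \<i>)"
    by (simp add: ee_def exp_add[symmetric] algebra_simps)
  also have "exp (2 * of_int k * of_real pi * \<i>) = (1::complex)"
    using exp_integer_2pi[of "of_int k"] by simp
  finally show ?thesis by simp
qed

lemma continuous_ee [continuous_intros]: "continuous_on S (ee k)"
  unfolding ee_def by (intro continuous_intros)

lemma ee_deriv: "(ee k has_vector_derivative \<i> * of_int k * ee k x) (at x within S)"
proof -
  have "((\<lambda>z. exp (\<i> * of_int k * z)) has_field_derivative \<i> * of_int k * exp (\<i> * of_int k * of_real x))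
      (at (of_real x))"
    by (auto intro!: derivative_eq_intros)
  from has_vector_derivative_real_field[OF this]
  have "((\<lambda>x. exp (\<i> * of_int k * of_real x)) has_vector_derivative
      \<i> * of_int k * exp (\<i> * of_int k * of_real x)) (at x within S)" by this
  then show ?thesis unfolding ee_def[abs_def] by this
qed

lemma continuous_set_integrable:
  fixes g :: "real \<Rightarrow> complex"
  assumes "continuous_on UNIV g" shows "set_integrable lborel {-pi..pi} g"
  using borel_integrable_atLeastAtMost'[of "-pi" pi g] assms continuous_on_subset by blast

lemma set_integrable_mult_continuous:
  fixes h g :: "real \<Rightarrow> complex"
  assumes h: "set_integrable lborel {-pi..pi} h" and g: "continuous_on UNIV g"
  shows "set_integrable lborel {-pi..pi} (\<lambda>x. h x * g x)"
proof -
  have "compact (g ` {-pi..pi})" by (intro compact_continuous_image continuous_on_subset[OF g]) auto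
  then have "bounded (g ` {-pi..pi})" by (rule compact_imp_bounded)
  then obtain C where "\<forall>y\<in>g ` {-pi..pi}. cmod y \<le> C" unfolding bounded_iff by (elim exE)
  then have C: "cmod (g x) \<le> C" if "x \<in> {-pi..pi}" for x using that by simp
  have gm: "g \<in> borel_measurable lborel" using borel_measurable_continuous_onI[OF g] by simp
  have hm: "(\<lambda>x. indicator {-pi..pi} x *\<^sub>R h x) \<in> borel_measurable lborel"
    using h unfolding set_integrable_def by (rule borel_measurable_integrable)
  show ?thesis unfolding set_integrable_def
  proof (rule Bochner_Integration.integrable_bound)
    show "integrable lborel (\<lambda>x. of_real C * (indicator {-pi..pi} x *\<^sub>R h x))"
      using h unfolding set_integrable_def by (rule integrable_mult_right)
    have "(\<lambda>x. (indicator {-pi..pi} x *\<^sub>R h x) * g x) \<in> borel_measurable lborel"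
      using gm hm by (rule borel_measurable_times[rotated])
    then show "(\<lambda>x. indicator {-pi..pi} x *\<^sub>R (h x * g x)) \<in> borel_measurable lborel" by simp
    show "AE x in lborel. cmod (indicator {-pi..pi} x *\<^sub>R (h x * g x)) \<le>
        cmod (of_real C * (indicator {-pi..pi} x *\<^sub>R h x))"
    proof (rule AE_I2)
      fix x
      show "cmod (indicator {-pi..pi} x *\<^sub>R (h x * g x)) \<le> cmod (of_real C * (indicator {-pi..pi} x *\<^sub>R h x))"
      proof (cases "x \<in> {-pi..pi}")
        case True
        have "cmod (g x) * cmod (h x) \<le> \<bar>C\<bar> * cmod (h x)" using C[OF True] by (intro mult_right_mono) auto
        then show ?thesis using True by (simp add: norm_mult ac_simps)
      qed simp
    qed
  qed
qed

lemma LI_deriv_periodic: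
  assumes "\<And>x. (F has_vector_derivative f x) (at x)" "continuous_on UNIV f" "F pi = F (- pi)"
  shows "LI f = 0"
proof -
  have "(\<integral>x. indicator {-pi..pi} x *\<^sub>R f x \<partial>lborel) = F pi - F (- pi)"
    by (rule integral_FTC_Icc) (use assms in \<open>auto intro: has_vector_derivative_at_within continuous_on_subset\<close>)
  then show ?thesis using assms by (simp add: set_lebesgue_integral_def)
qed

lemma ee_pi: "ee k pi = ee k (- pi)"
  using ee_periodic[of k "- pi"] by simp

lemma LI_ee: "LI (ee k) = (if k = 0 then 2 * pi else 0)"
proof (cases "k = 0")
  case True
  have "ee 0 = (\<lambda>x. 1)" by (auto simp: fun_eq_iff)
  then show ?thesis using True by (simp add: set_lebesgue_integral_def scaleR_conv_of_real)
next
  case False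
  have "LI (\<lambda>x. \<i> * of_int k * ee k x) = 0"
    by (rule LI_deriv_periodic[of "ee k"]) (auto intro!: ee_deriv continuous_intros simp: ee_pi)
  then show ?thesis using False by simp
qed

subsection \<open>Uniqueness of Fourier coefficients\<close>

text \<open>An integrable function orthogonal to all exponentials is orthogonal to all continuous functions
  of \<open>cos (x - m)\<close>, hence to indicators of arcs.\<close>

context
  fixes h :: "real \<Rightarrow> complex"
  assumes h: "set_integrable lborel {-pi..pi} h" and orth: "\<And>k. LI (\<lambda>x. h x * ee k x) = 0"
begin

text \<open>Multiplication by cos (x - m) turns \<open>ee k\<close> into a combination of
  \<open>ee (k + 1)\<close> and \<open>ee (k - 1)\<close>, so the induction has to keep
  \<open>k\<close> arbitrary.\<close>

lemma orth_cos_power: "LI (\<lambda>x. h x * (of_real (cos (x - m)) ^ j * ee k x)) = 0"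
proof (induction j arbitrary: k)
  case 0 then show ?case using orth by simp
next
  case (Suc j)
  have c: "complex_of_real (cos (x - m)) * ee k x =
      exp (- \<i> * m) / 2 * ee (k + 1) x + exp (\<i> * m) / 2 * ee (k - 1) x" for x
  proof -
    have "complex_of_real (cos (x - m)) = (exp (- \<i> * m) * ee 1 x + exp (\<i> * m) * ee (- 1) x) / 2"
      by (simp add: cos_exp_eq ee_def cos_of_real[symmetric] exp_add[symmetric] algebra_simps del: cos_of_real)
    then have "complex_of_real (cos (x - m)) * ee k x =
      (exp (- \<i> * m) * (ee 1 x * ee k x) + exp (\<i> * m) * (ee (- 1) x * ee k x)) / 2"
      by (simp only: times_divide_eq_left distrib_right mult.assoc)
    then show ?thesis unfolding ee_mult by (simp add: add_divide_distrib ac_simps)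
  qed
  have i: "set_integrable lborel {-pi..pi} (\<lambda>x. h x * (of_real (cos (x - m)) ^ j * ee k x))" for k
    by (intro set_integrable_mult_continuous[OF h] continuous_intros)
  have "h x * (of_real (cos (x - m)) ^ Suc j * ee k x) =
      (exp (- \<i> * m) / 2) * (h x * (of_real (cos (x - m)) ^ j * ee (k + 1) x)) +
      (exp (\<i> * m) / 2) * (h x * (of_real (cos (x - m)) ^ j * ee (k - 1) x))" for x
  proof -
    have "h x * (of_real (cos (x - m)) ^ Suc j * ee k x) =
        (h x * of_real (cos (x - m)) ^ j) * (of_real (cos (x - m)) * ee k x)"
      by (simp only: power_Suc ac_simps)
    then show ?thesis unfolding c by (simp only: distrib_left ac_simps)
  qed
  then show ?case using i Suc.IH by (simp del: power_Suc)
qed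

lemma orth_cos_poly: "LI (\<lambda>x. h x * of_real (\<Sum>i\<le>n. a i * cos (x - m) ^ i)) = 0"
proof (induction n)
  case 0 then show ?case using orth_cos_power[of m 0 0] by simp
next
  case (Suc n)
  have 1: "set_integrable lborel {-pi..pi} (\<lambda>x. h x * of_real (\<Sum>i\<le>n. a i * cos (x - m) ^ i))"
    by (intro set_integrable_mult_continuous[OF h] continuous_intros)
  have 2: "set_integrable lborel {-pi..pi} (\<lambda>x. h x * (of_real (cos (x - m)) ^ Suc n * ee 0 x))"
    by (intro set_integrable_mult_continuous[OF h] continuous_intros)
  have "h x * of_real (\<Sum>i\<le>Suc n. a i * cos (x - m) ^ i) =
     h x * of_real (\<Sum>i\<le>n. a i * cos (x - m) ^ i) + of_real (a (Suc n)) * (h x * (of_real (cos (x - m)) ^ Suc n * ee 0 x))" for x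
    by (simp add: algebra_simps)
  then show ?case using 1 2 Suc.IH orth_cos_power[of m "Suc n" 0] by (simp del: power_Suc)
qed

text \<open>Polynomial approximation on [-1, 1] in the variable y = cos (x - m); the error is at
  most \<open>e\<close> times the L1 norm of \<open>h\<close>.\<close>

lemma orth_cos_continuous:
  assumes f: "continuous_on UNIV (f :: real \<Rightarrow> real)"
  shows "LI (\<lambda>x. h x * of_real (f (cos (x - m)))) = 0"
proof -
  define H where "H = (LINT x:{-pi..pi}|lborel. cmod (h x))"
  have H: "0 \<le> H" unfolding H_def set_lebesgue_integral_def by (intro integral_nonneg_AE) auto
  have "cmod (LI (\<lambda>x. h x * of_real (f (cos (x - m))))) \<le> e * H" if e: "e > 0" for e
  proof -
    obtain p where p: "real_polynomial_function p" "\<And>y. y \<in> {-1..1} \<Longrightarrow> \<bar>f y - p y\<bar> < e"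
      using Stone_Weierstrass_real_polynomial_function[of "{-1..1}" f e] f e continuous_on_subset by blast
    obtain a n where pa: "p = (\<lambda>y. \<Sum>i\<le>n. a i * y ^ i)" using p(1) unfolding real_polynomial_function_iff_sum by blast
    have cont_f: "continuous_on UNIV (\<lambda>x. complex_of_real (f (cos (x - m))))"
      by (intro continuous_intros continuous_on_compose2[OF f]) auto
    have 1: "set_integrable lborel {-pi..pi} (\<lambda>x. h x * of_real (f (cos (x - m))))"
      by (intro set_integrable_mult_continuous[OF h] cont_f)
    have 2: "set_integrable lborel {-pi..pi} (\<lambda>x. h x * of_real (p (cos (x - m))))"
      unfolding pa by (intro set_integrable_mult_continuous[OF h] continuous_intros)
    have 3: "set_integrable lborel {-pi..pi} (\<lambda>x. h x * of_real (f (cos (x - m)) - p (cos (x - m))))"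
      using set_integral_diff(1)[OF 1 2] by (simp add: right_diff_distrib)
    have "LI (\<lambda>x. h x * of_real (f (cos (x - m)))) = LI (\<lambda>x. h x * of_real (f (cos (x - m)) - p (cos (x - m))))"
      using set_integral_diff(2)[OF 1 2] orth_cos_poly[where m = m and n = n and a = a] 
      by (simp add: right_diff_distrib pa)
    also have "cmod \<dots> \<le> (LINT x:{-pi..pi}|lborel. cmod (h x * of_real (f (cos (x - m)) - p (cos (x - m)))))"
      by (rule set_integral_norm_bound[OF 3])
    also have "\<dots> \<le> (LINT x:{-pi..pi}|lborel. e * cmod (h x))"
    proof (rule set_integral_mono)
      show "set_integrable lborel {-pi..pi} (\<lambda>x. cmod (h x * of_real (f (cos (x - m)) - p (cos (x - m)))))"
        using set_integrable_norm[OF 3] by simp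
      show "set_integrable lborel {-pi..pi} (\<lambda>x. e * cmod (h x))"
        using set_integrable_norm[OF h] by simp
      fix x
      have "cmod (h x) * \<bar>f (cos (x - m)) - p (cos (x - m))\<bar> \<le> cmod (h x) * e"
        using p(2)[of "cos (x - m)"] by (intro mult_left_mono) auto
      then show "cmod (h x * of_real (f (cos (x - m)) - p (cos (x - m)))) \<le> e * cmod (h x)"
        by (simp only: norm_mult norm_of_real mult.commute)
    qed
    also have "\<dots> = e * H" by (simp add: H_def)
    finally show ?thesis .
  qed
  then have *: "cmod (LI (\<lambda>x. h x * of_real (f (cos (x - m))))) \<le> e * H" if "e > 0" for e using that by blast
  have "cmod (LI (\<lambda>x. h x * of_real (f (cos (x - m))))) \<le> e" if e: "e > 0" for e
  proof -
    have "e / (H + 1) * H \<le> e" using H e by (simp add: field_simps)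
    moreover have "e / (H + 1) > 0" using H e by (intro divide_pos_pos) auto
    ultimately show ?thesis using *[of "e / (H + 1)"] by (blast intro: order.trans)
  qed
  then have "cmod (LI (\<lambda>x. h x * of_real (f (cos (x - m))))) \<le> 0"
    by (rule dense_ge)
  then show ?thesis by simp
qed


text \<open>The ramps \<open>f n\<close> are continuous, have values in [0, 1] and tend pointwise to
  the indicator of y > c, so dominated convergence applies with majorant |h|.\<close>

lemma orth_cos_indicator: "LI (\<lambda>x. h x * indicator {x. cos (x - m) > c} x) = 0"
proof -
  define f where "f n y = min 1 (max 0 (real n * (y - c)))" for n y
  have cont: "continuous_on UNIV (f n)" for n unfolding f_def by (intro continuous_intros)
  have lim: "(\<lambda>n. f n y) \<longlonglongrightarrow> (if y > c then 1 else 0)" for y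
  proof (cases "y > c")
    case True
    obtain N where N: "1 < real N * (y - c)" using ex_less_of_nat_mult[of "y - c" 1] True by auto
    have "f n y = 1" if "n \<ge> N" for n
    proof -
      have "real N * (y - c) \<le> real n * (y - c)" using that True by (intro mult_right_mono) auto
      then show ?thesis using N by (simp add: f_def)
    qed
    then have "eventually (\<lambda>n. f n y = 1) sequentially" unfolding eventually_sequentially by blast
    then show ?thesis using True by (simp add: tendsto_eventually)
  next
    case False
    then have "f n y = 0" for n unfolding f_def by (simp add: mult_nonneg_nonpos)
    then show ?thesis using False by simp
  qed
  let ?g = "\<lambda>n x. indicator {-pi..pi} x *\<^sub>R (h x * of_real (f n (cos (x - m))))"
  have hm: "(\<lambda>x. indicator {-pi..pi} x *\<^sub>R h x) \<in> borel_measurable lborel"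
    using h unfolding set_integrable_def by (rule borel_measurable_integrable)
  have "(\<lambda>n. \<integral>x. ?g n x \<partial>lborel) \<longlonglongrightarrow>
      (\<integral>x. indicator {-pi..pi} x *\<^sub>R (h x * indicator {x. cos (x - m) > c} x) \<partial>lborel)"
  proof (rule integral_dominated_convergence)
    show "integrable lborel (\<lambda>x. cmod (indicator {-pi..pi} x *\<^sub>R h x))"
      using h unfolding set_integrable_def by (rule integrable_norm)
    have cm: "(\<lambda>x. complex_of_real (f n (cos (x - m)))) \<in> borel_measurable lborel" for n
    proof -
      have "continuous_on UNIV (\<lambda>x. complex_of_real (f n (cos (x - m))))"
        by (intro continuous_intros continuous_on_compose2[OF cont]) auto
      from borel_measurable_continuous_onI[OF this] show ?thesis by simp
    qed
    have "(\<lambda>x. (indicator {-pi..pi} x *\<^sub>R h x) * of_real (f n (cos (x - m)))) \<in> borel_measurable lborel" for n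
      using hm cm by (rule borel_measurable_times)
    then show "?g n \<in> borel_measurable lborel" for n by simp
    have "{x. cos (x - m) > c} \<in> sets lborel" by measurable
    then have im: "(\<lambda>x. indicator {x. cos (x - m) > c} x :: complex) \<in> borel_measurable lborel"
      by (intro borel_measurable_indicator)
    have "(\<lambda>x. (indicator {-pi..pi} x *\<^sub>R h x) * indicator {x. cos (x - m) > c} x) \<in> borel_measurable lborel"
      using hm im by (rule borel_measurable_times)
    then show "(\<lambda>x. indicator {-pi..pi} x *\<^sub>R (h x * indicator {x. cos (x - m) > c} x)) \<in> borel_measurable lborel"
      by simp
    show "AE x in lborel. (\<lambda>n. ?g n x) \<longlonglongrightarrow> indicator {-pi..pi} x *\<^sub>R (h x * indicator {x. cos (x - m) > c} x)"
    proof (rule AE_I2)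
      fix x
      have "(\<lambda>n. complex_of_real (f n (cos (x - m)))) \<longlonglongrightarrow> of_real (if cos (x - m) > c then 1 else 0)"
        by (intro tendsto_of_real lim)
      also have "of_real (if cos (x - m) > c then 1 else 0) = (indicator {x. cos (x - m) > c} x :: complex)"
        by (simp add: indicator_def)
      finally show "(\<lambda>n. ?g n x) \<longlonglongrightarrow> indicator {-pi..pi} x *\<^sub>R (h x * indicator {x. cos (x - m) > c} x)"
        by (intro tendsto_scaleR tendsto_mult tendsto_const)
    qed
    show "AE x in lborel. norm (?g n x) \<le> cmod (indicator {-pi..pi} x *\<^sub>R h x)" for n
    proof (rule AE_I2)
      fix x
      have "\<bar>f n (cos (x - m))\<bar> \<le> 1" unfolding f_def by auto
      then have "cmod (h x) * \<bar>f n (cos (x - m))\<bar> \<le> cmod (h x) * 1" by (intro mult_left_mono) auto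
      then show "norm (?g n x) \<le> cmod (indicator {-pi..pi} x *\<^sub>R h x)"
        by (cases "x \<in> {-pi..pi}") (simp_all add: norm_mult)
    qed
  qed
  moreover have "(\<integral>x. ?g n x \<partial>lborel) = 0" for n
    using orth_cos_continuous[OF cont] unfolding set_lebesgue_integral_def by blast
  ultimately show ?thesis unfolding set_lebesgue_integral_def
    by (simp add: LIMSEQ_const_iff)
qed

lemma orth_interval: assumes "- pi \<le> a" "a < b" "b \<le> pi"
  shows "(LINT x:{a<..<b}|lborel. h x) = 0"
proof -
  define m d where "m = (a + b) / 2" and "d = (b - a) / 2"
  have d: "0 < d" "d \<le> pi" using assms by (auto simp: d_def)
  have md: "\<bar>m\<bar> + d \<le> pi" using assms by (auto simp: d_def m_def abs_if field_simps)
  have "indicator {-pi..pi} x *\<^sub>R (h x * indicator {x. cos (x - m) > cos d} x) = indicator {a<..<b} x *\<^sub>R h x" for x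
  proof (cases "x \<in> {-pi..pi}")
    case True
    have "cos (x - m) > cos d \<longleftrightarrow> \<bar>x - m\<bar> < d"
    proof (cases "\<bar>x - m\<bar> \<le> pi")
      case le: True
      have "cos \<bar>x - m\<bar> > cos d \<longleftrightarrow> \<bar>x - m\<bar> < d"
        using le d by (intro cos_mono_less_eq) auto
      then show ?thesis by (simp add: cos_abs_real)
    next
      case gt: False
      \<comment> \<open>The arc around \<open>m\<close> could wrap around the circle.
        \<open>md\<close> prevents this: the distance from \<open>x\<close> to \<open>m\<close> on
        the circle stays at least \<open>d\<close>.\<close>
      have 1: "2 * pi - \<bar>x - m\<bar> \<ge> d" "2 * pi - \<bar>x - m\<bar> \<le> pi" using True md gt by (auto simp: abs_if split: if_splits)
      have "cos \<bar>x - m\<bar> = cos (2 * pi - \<bar>x - m\<bar>)" by (simp add: cos_diff)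
      also have "\<dots> \<le> cos d" using 1 d by (subst cos_mono_le_eq) auto
      finally have "\<not> cos (x - m) > cos d" by (simp add: cos_abs_real)
      moreover have "\<not> \<bar>x - m\<bar> < d" using gt d by auto
      ultimately show ?thesis by blast
    qed
    moreover have "\<bar>x - m\<bar> < d \<longleftrightarrow> x \<in> {a<..<b}" by (auto simp: m_def d_def abs_if field_simps)
    ultimately show ?thesis using True by (auto simp: indicator_def)
  next
    case False
    then have "x \<notin> {a<..<b}" using assms by auto
    then show ?thesis using False by simp
  qed
  then show ?thesis using orth_cos_indicator[of "cos d" m] unfolding set_lebesgue_integral_def by simp
qed

text \<open>The half-lines are an intersection-stable generator of the Borel sets, so the vanishing
  of the integrals over them extends to all Borel sets. An integrable function with this property is
  zero almost everywhere.\<close>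

lemma orth_AE_zero: "AE x in lborel. x \<in> {-pi..pi} \<longrightarrow> h x = 0"
proof -
  define H where "H x = indicator {-pi..pi} x *\<^sub>R h x" for x
  have H: "integrable lborel H" using h unfolding set_integrable_def H_def by simp
  have HA: "set_integrable lborel A H" if "A \<in> sets borel" for A
    unfolding set_integrable_def using H that by (intro integrable_mult_indicator) auto
  have Ioi: "(LINT x:{a<..}|lborel. H x) = 0" for a
  proof -
    define a' where "a' = max a (- pi)"
    show ?thesis
    proof (cases "a' < pi")
      case True
      have "AE x in lborel. indicator {a<..} x *\<^sub>R H x = indicator {a'<..<pi} x *\<^sub>R h x"
        using AE_lborel_singleton[of pi] AE_lborel_singleton[of "-pi"]
        by eventually_elim (auto simp: H_def indicator_def a'_def)
      moreover have "(\<lambda>x. indicator {a<..} x *\<^sub>R H x) \<in> borel_measurable lborel"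
        using HA[of "{a<..}"] unfolding set_integrable_def by (intro borel_measurable_integrable) simp
      moreover have "(\<lambda>x. indicator {a'<..<pi} x *\<^sub>R h x) \<in> borel_measurable lborel"
      proof -
        have "set_integrable lborel {a'<..<pi} h"
          by (rule set_integrable_subset[OF h]) (auto simp: a'_def)
        then show ?thesis unfolding set_integrable_def by (rule borel_measurable_integrable)
      qed
      ultimately have "(LINT x:{a<..}|lborel. H x) = (LINT x:{a'<..<pi}|lborel. h x)"
        unfolding set_lebesgue_integral_def by (intro integral_cong_AE)
      then show ?thesis using orth_interval[of a' pi] True by (simp add: a'_def)
    next
      case False
      have *: "indicator {a<..} x *\<^sub>R H x = 0" if "x \<noteq> pi" for x
        using False that pi_gt_zero by (auto simp: H_def indicator_def a'_def max_def split: if_splits)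
      have "AE x in lborel. indicator {a<..} x *\<^sub>R H x = 0"
        by (rule AE_mp[OF AE_lborel_singleton[of pi]], rule AE_I2, rule impI, rule *)
      then show ?thesis unfolding set_lebesgue_integral_def by (rule integral_eq_zero_AE)
    qed
  qed
  have all: "(\<integral>x. H x \<partial>lborel) = 0"
  proof -
    have "(\<lambda>x. indicator {-pi - 1<..} x *\<^sub>R H x) = H" by (auto simp: H_def indicator_def fun_eq_iff)
    then show ?thesis using Ioi[of "- pi - 1"] unfolding set_lebesgue_integral_def by simp
  qed
  have zero: "(LINT x:A|lborel. H x) = 0" if "A \<in> sets borel" for A
  proof -
    have bor: "sigma_sets UNIV (range (\<lambda>a::real. {a<..})) = sets borel"
      by (simp add: borel_Ioi)
    have "Int_stable (range (\<lambda>a::real. {a<..}))"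
    proof (rule Int_stableI)
      fix A B assume "A \<in> range (\<lambda>a::real. {a<..})" "B \<in> range (\<lambda>a::real. {a<..})"
      then obtain a b where "A = {a<..}" "B = {b<..}" by (elim rangeE)
      then have "A \<inter> B = {max a b<..}" by auto
      then show "A \<inter> B \<in> range (\<lambda>a::real. {a<..})" by simp
    qed
    moreover have "range (\<lambda>a::real. {a<..}) \<subseteq> Pow UNIV" by simp
    moreover have "A \<in> sigma_sets UNIV (range (\<lambda>a::real. {a<..}))"
      using that bor by simp
    ultimately show ?thesis
    proof (induction rule: sigma_sets_induct_disjoint)
      case (basic A) then show ?case using Ioi by auto
    next
      case empty then show ?case by (simp add: set_lebesgue_integral_def)
    next
      case (compl A)
      have "A \<in> sets borel" using compl bor by simp
      have "indicator (UNIV - A) x *\<^sub>R H x = H x - indicator A x *\<^sub>R H x" for x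
        by (auto simp: indicator_def)
      then have "(LINT x:UNIV - A|lborel. H x) = (\<integral>x. H x \<partial>lborel) - (LINT x:A|lborel. H x)"
        using H HA[OF \<open>A \<in> sets borel\<close>] unfolding set_lebesgue_integral_def set_integrable_def by simp
      then show ?case using all compl by simp
    next
      case (union A)
      have "(LINT x:(\<Union>i. A i)|lborel. H x) = (\<Sum>i. (LINT x:(A i)|lborel. H x))"
        using union bor HA[of "\<Union>i. A i"]
        by (intro lebesgue_integral_countable_add) (auto simp: disjoint_family_on_def)
      then show ?case using union by simp
    qed
  qed
  have "AE x in lborel. H x = 0"
    by (rule sigma_finite_measure.density_zero[OF lborel.sigma_finite_measure_axioms H]) (use zero in auto)
  then show ?thesis by eventually_elim (auto simp: H_def)
qed

end

lemma AE_eq_of_LI: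
  assumes F: "set_integrable lborel {-pi..pi} F" and G: "set_integrable lborel {-pi..pi} G"
    and eq: "\<And>k. LI (\<lambda>x. F x * ee k x) = LI (\<lambda>x. G x * ee k x)"
  shows "AE x in lborel. x \<in> {-pi..pi} \<longrightarrow> F x = G x"
proof -
  have "AE x in lborel. x \<in> {-pi..pi} \<longrightarrow> F x - G x = 0"
  proof (rule orth_AE_zero)
    show "set_integrable lborel {-pi..pi} (\<lambda>x. F x - G x)" using F G by (rule set_integral_diff)
    have "LI (\<lambda>x. F x * ee k x - G x * ee k x) = 0" for k
      using set_integral_diff(2)[OF set_integrable_mult_continuous[OF F continuous_ee, of k]
          set_integrable_mult_continuous[OF G continuous_ee, of k]] eq[of k] by simp
    then show "LI (\<lambda>x. (F x - G x) * ee k x) = 0" for k by (simp add: left_diff_distrib)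
  qed
  then show ?thesis by simp
qed

section \<open>Absolutely convergent trigonometric series\<close>

definition trig :: "(int \<Rightarrow> complex) \<Rightarrow> real \<Rightarrow> complex" where
  "trig c x = (\<Sum>\<^sub>\<infinity>k. c k * ee k x)"

lemma periodic_of_int: assumes "periodic f" shows "f (x + 2 * pi * of_int n) = f x"
proof (induction n rule: int_induct[where k = 0])
  case base then show ?case by simp
next
  case (step1 i)
  have "f (x + 2 * pi * of_int (i + 1)) = f (x + 2 * pi * of_int i + 2 * pi)" by (simp add: algebra_simps)
  then show ?case using assms step1 by (simp add: periodic_def)
next
  case (step2 i)
  have "f (x + 2 * pi * of_int i) = f (x + 2 * pi * of_int (i - 1) + 2 * pi)" by (simp add: algebra_simps)
  then show ?case using assms step2 by (simp add: periodic_def)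
qed

lemma periodic_reduce: assumes "periodic f" obtains y where "y \<in> {-pi..pi}" "f x = f y"
proof
  define n where "n = \<lfloor>(x + pi) / (2 * pi)\<rfloor>"
  let ?y = "x + 2 * pi * of_int (- n)"
  have "of_int n \<le> (x + pi) / (2 * pi)" "(x + pi) / (2 * pi) < of_int n + 1" unfolding n_def by linarith+
  then show "?y \<in> {-pi..pi}" by (auto simp: field_simps)
  show "f x = f ?y" using periodic_of_int[OF assms, of x "- n"] by simp
qed

lemma trig_periodic: "periodic (trig c)"
  by (simp add: periodic_def trig_def ee_periodic)

lemma abs_sum_ee: "abs_sum c \<Longrightarrow> abs_sum (\<lambda>k. c k * ee k x)"
  by (simp add: norm_mult)

lemma continuous_trig: assumes "abs_sum c" shows "continuous_on UNIV (trig c)"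
proof -
  have "uniform_limit UNIV (\<lambda>X x. \<Sum>k\<in>X. c k * ee k x) (\<lambda>x. \<Sum>\<^sub>\<infinity>k. c k * ee k x) (finite_subsets_at_top UNIV)"
    by (rule Weierstrass_m_test_general[OF _ assms]) (simp add: norm_mult)
  then have "continuous_on UNIV (\<lambda>x. \<Sum>\<^sub>\<infinity>k. c k * ee k x)"
    by (rule uniform_limit_theorem[rotated]) (auto intro!: always_eventually continuous_intros)
  then show ?thesis by (simp add: trig_def[abs_def])
qed

lemma LI_trig_mult: assumes c: "abs_sum c" and g: "continuous_on UNIV g"
  shows "LI (\<lambda>x. trig c x * g x) = (\<Sum>\<^sub>\<infinity>k. c k * LI (\<lambda>x. ee k x * g x))"
proof -
  let ?f = "\<lambda>k x. c k * ee k x * g x"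
  define G where "G = (LINT x:{-pi..pi}|lborel. cmod (g x))"
  have eq: "trig c x * g x = (\<Sum>\<^sub>\<infinity>k. ?f k x)" for x
    unfolding trig_def using abs_summable_summable[OF abs_sum_ee[OF c]] by (simp add: infsum_cmult_left)
  have n: "(LINT x:{-pi..pi}|lborel. cmod (?f k x)) = cmod (c k) * G" for k
    by (simp add: norm_mult G_def mult.assoc)
  have "LI (\<lambda>x. \<Sum>\<^sub>\<infinity>k. ?f k x) = (\<Sum>\<^sub>\<infinity>k. LI (?f k))"
  proof (rule set_integral_infsum_int)
    show "set_integrable lborel {-pi..pi} (?f k)" for k
      by (intro continuous_set_integrable continuous_intros g)
    show "(\<lambda>k. LINT x:{-pi..pi}|lborel. cmod (?f k x)) summable_on UNIV"
      unfolding n by (intro summable_on_cmult_left c)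
    show "abs_sum (\<lambda>k. ?f k x)" for x
      using summable_on_cmult_left[OF c, of "cmod (g x)"] by (simp add: norm_mult)
  qed
  then show ?thesis unfolding eq by (simp add: mult.assoc)
qed

lemma LI_trig_ee:
  fixes c :: "int \<Rightarrow> complex"
  assumes c: "abs_sum c" shows "LI (\<lambda>x. trig c x * ee (- l) x) = 2 * of_real pi * c l"
proof -
  have "LI (\<lambda>x. trig c x * ee (- l) x) = (\<Sum>\<^sub>\<infinity>k. c k * LI (\<lambda>x. ee k x * ee (- l) x))"
    by (rule LI_trig_mult[OF c]) (rule continuous_ee)
  also have "(\<lambda>k. c k * LI (\<lambda>x. ee k x * ee (- l) x)) = (\<lambda>k. if k = l then 2 * pi * c l else 0)"
    by (auto simp: ee_mult fun_eq_iff LI_ee[unfolded ee_def[abs_def]] LI_ee simp flip: ee_def)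
  also have "(\<Sum>\<^sub>\<infinity>k. if k = l then 2 * pi * c l else 0) = (\<Sum>\<^sub>\<infinity>k\<in>{l}. 2 * pi * c l)"
    by (rule infsum_cong_neutral) auto
  finally show ?thesis by simp
qed

text \<open>The set of disagreement inside the open interval is open and null, hence empty; the
  endpoints follow by continuity.\<close>

lemma continuous_AE_eq:
  fixes F G :: "real \<Rightarrow> complex"
  assumes F: "continuous_on UNIV F" and G: "continuous_on UNIV G"
    and ae: "AE x in lborel. x \<in> {-pi..pi} \<longrightarrow> F x = G x" and x: "x \<in> {-pi..pi}"
  shows "F x = G x"
proof -
  let ?S = "{-pi<..<pi} \<inter> {x. F x \<noteq> G x}"
  have op: "open ?S"
    using open_Collect_neq[OF F G] by (intro open_Int) auto
  have "AE x in lborel. x \<notin> ?S" using ae by eventually_elim auto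
  then have "?S \<in> null_sets lborel" using op by (simp add: AE_iff_null_sets)
  then have "negligible ?S" unfolding negligible_iff_null_sets by (rule null_sets_completionI)
  then have "?S = {}" using open_not_negligible[OF op] by blast
  then have eq: "F x - G x = 0" if "x \<in> {-pi<..<pi}" for x using that by auto
  have "F x - G x = 0"
  proof (rule continuous_constant_on_closure[where S = "{-pi<..<pi}"])
    show "continuous_on (closure {-pi<..<pi}) (\<lambda>x. F x - G x)"
      by (intro continuous_intros continuous_on_subset[OF F] continuous_on_subset[OF G]) auto
    show "x \<in> closure {-pi<..<pi}" using x by simp
  qed (rule eq)
  then show ?thesis by simp
qed

subsection \<open>Test functions\<close>

lemma nderiv_Suc: "nderiv (Suc n) f = (\<lambda>x. vector_derivative (nderiv n f) (at x))"
  by (simp add: nderiv_def)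

lemma nderiv_0 [simp]: "nderiv 0 f = f" by (simp add: nderiv_def)

lemma nderiv_test: "f \<in> test_functions \<Longrightarrow> nderiv n f \<in> test_functions"
  by (induction n) (simp_all add: nderiv_Suc test_functions_deriv)

lemma test_has_derivative:
  "f \<in> test_functions \<Longrightarrow> (f has_vector_derivative nderiv 1 f x) (at x)"
  using test_function_differentiable[of f x] by (simp add: vector_derivative_works nderiv_def)

lemma test_continuous: "f \<in> test_functions \<Longrightarrow> continuous_on UNIV f"
  by (simp add: continuous_at_imp_continuous_on differentiable_imp_continuous_within test_function_differentiable)

lemma test_periodic: "f \<in> test_functions \<Longrightarrow> periodic f"
  by (simp add: test_functions_def)

text \<open>Iterated derivatives are found by exhibiting the whole tower \<open>g\<close> at once;
  each level is then a statement about a single derivative.\<close>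

lemma nderiv_unique:
  assumes "\<And>n x. (g n has_vector_derivative g (Suc n) x) (at x)"
  shows "nderiv n (g 0) = g n"
proof (induction n)
  case (Suc n)
  show ?case unfolding nderiv_Suc Suc.IH by (rule ext, rule vector_derivative_at, rule assms)
qed simp

lemma test_intro:
  assumes "\<And>n x. (g n has_vector_derivative g (Suc n) x) (at x)" "periodic (g 0)"
  shows "g 0 \<in> test_functions"
  unfolding test_functions_def using assms(2) nderiv_unique[where g = g, OF assms(1)] assms(1)
  by (auto intro: differentiableI_vector)

lemma test_lincomb:
  assumes "f \<in> test_functions" "g \<in> test_functions"
  shows "(\<lambda>x. a * f x + b * g x) \<in> test_functions"
proof -
  let ?g = "\<lambda>n x. a * nderiv n f x + b * nderiv n g x"
  have "?g 0 \<in> test_functions"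
  proof (rule test_intro)
    have "(nderiv n f has_vector_derivative nderiv (Suc n) f x) (at x)" "(nderiv n g has_vector_derivative nderiv (Suc n) g x) (at x)" for n x
      using test_has_derivative[OF nderiv_test] assms by (simp_all add: nderiv_Suc)
    then show "(?g n has_vector_derivative ?g (Suc n) x) (at x)" for n x
      by (intro has_vector_derivative_add has_vector_derivative_mult_right)
    show "periodic (?g 0)" using assms by (simp add: test_functions_def periodic_def)
  qed
  then show ?thesis by simp
qed

lemma ee_nderiv: "nderiv n (ee k) = (\<lambda>x. (\<i> * of_int k) ^ n * ee k x)"
  and ee_test: "ee k \<in> test_functions"
proof -
  let ?g = "\<lambda>n x. (\<i> * of_int k) ^ n * ee k x"
  have d: "(?g n has_vector_derivative ?g (Suc n) x) (at x)" for n x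
    using has_vector_derivative_mult_right[OF ee_deriv[of k x UNIV], of "(\<i> * of_int k) ^ n"] by (simp add: ac_simps)
  have 0: "?g 0 = ee k" by simp
  show "nderiv n (ee k) = (\<lambda>x. (\<i> * of_int k) ^ n * ee k x)"
    using nderiv_unique[of ?g n, OF d] unfolding 0 .
  show "ee k \<in> test_functions"
    using test_intro[of ?g, OF d] unfolding 0 by (simp add: periodic_def ee_periodic)
qed

lemma test_bounded: assumes "f \<in> test_functions" obtains M where "0 \<le> M" "\<And>x. cmod (f x) \<le> M"
proof -
  have "compact (f ` {-pi..pi})"
    using test_continuous[OF assms] by (intro compact_continuous_image) (auto intro: continuous_on_subset)
  then have "bounded (f ` {-pi..pi})" by (rule compact_imp_bounded)
  then obtain M where "\<forall>y\<in>f ` {-pi..pi}. cmod y \<le> M" unfolding bounded_iff by (elim exE)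
  then have M: "cmod (f y) \<le> M" if "y \<in> {-pi..pi}" for y using that by simp
  have "cmod (f x) \<le> M" for x
    using periodic_reduce[OF test_periodic[OF assms], of x] M by metis
  moreover have "0 \<le> M" using order.trans[OF norm_ge_zero M[of 0]] by simp
  ultimately show thesis using that by blast
qed

section \<open>Fourier coefficients of test functions\<close>

definition tc :: "(real \<Rightarrow> complex) \<Rightarrow> int \<Rightarrow> complex" where
  "tc g k = LI (\<lambda>x. g x * ee (- k) x) / (2 * pi)"

lemma norm_tc: assumes "continuous_on UNIV g" "\<And>x. cmod (g x) \<le> M" shows "cmod (tc g k) \<le> M"
proof -
  have i: "set_integrable lborel {-pi..pi} (\<lambda>x. g x * ee (- k) x)"
    by (intro continuous_set_integrable continuous_intros assms)
  have "cmod (LI (\<lambda>x. g x * ee (- k) x)) \<le> (LINT x:{-pi..pi}|lborel. cmod (g x * ee (- k) x))"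
    by (rule set_integral_norm_bound[OF i])
  also have "\<dots> \<le> (LINT x:{-pi..pi}|lborel. M)"
  proof (rule set_integral_mono)
    show "set_integrable lborel {-pi..pi} (\<lambda>x. cmod (g x * ee (- k) x))" by (rule set_integrable_norm[OF i])
    show "set_integrable lborel {-pi..pi} (\<lambda>x. M)" by (simp add: set_integrable_def)
  qed (simp add: norm_mult assms)
  also have "\<dots> = 2 * pi * M" by (simp add: set_lebesgue_integral_def)
  finally show ?thesis by (simp add: tc_def norm_divide field_simps)
qed

lemma tc_deriv: assumes g: "g \<in> test_functions" shows "tc (nderiv 1 g) k = \<i> * of_int k * tc g k"
proof -
  have c: "continuous_on UNIV g" "continuous_on UNIV (nderiv 1 g)"
    using test_continuous g nderiv_test by blast+
  have "LI (\<lambda>x. g x * (\<i> * of_int (- k) * ee (- k) x) + nderiv 1 g x * ee (- k) x) = 0"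
  proof (rule LI_deriv_periodic)
    show "((\<lambda>x. g x * ee (- k) x) has_vector_derivative
        g x * (\<i> * of_int (- k) * ee (- k) x) + nderiv 1 g x * ee (- k) x) (at x)" for x
      by (intro has_vector_derivative_mult test_has_derivative g ee_deriv)
    show "continuous_on UNIV (\<lambda>x. g x * (\<i> * of_int (- k) * ee (- k) x) + nderiv 1 g x * ee (- k) x)"
      by (intro continuous_intros c)
    have "g (- pi + 2 * pi) = g (- pi)" using test_periodic[OF g] unfolding periodic_def by blast
    then show "g pi * ee (- k) pi = g (- pi) * ee (- k) (- pi)" by (simp add: ee_pi[of "- k"])
  qed
  moreover have "LI (\<lambda>x. (- \<i> * of_int k) * (g x * ee (- k) x) + nderiv 1 g x * ee (- k) x) =
      LI (\<lambda>x. (- \<i> * of_int k) * (g x * ee (- k) x)) + LI (\<lambda>x. nderiv 1 g x * ee (- k) x)"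
    by (intro set_integral_add(2) set_integrable_mult_right continuous_set_integrable continuous_intros c)
  moreover have "LI (\<lambda>x. (- \<i> * of_int k) * (g x * ee (- k) x)) = (- \<i> * of_int k) * LI (\<lambda>x. g x * ee (- k) x)"
    by (rule set_integral_mult_right)
  moreover have "g x * (\<i> * of_int (- k) * ee (- k) x) = (- \<i> * of_int k) * (g x * ee (- k) x)" for x by simp
  ultimately have "LI (\<lambda>x. nderiv 1 g x * ee (- k) x) = \<i> * of_int k * LI (\<lambda>x. g x * ee (- k) x)"
    by (simp only: add_eq_0_iff2) (simp add: add_eq_0_iff)
  then show ?thesis by (simp add: tc_def)
qed

lemma tc_nderiv: assumes "g \<in> test_functions" shows "tc (nderiv n g) k = (\<i> * of_int k) ^ n * tc g k"
proof (induction n)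
  case (Suc n)
  have "nderiv (Suc n) g = nderiv 1 (nderiv n g)" by (simp add: nderiv_Suc)
  then show ?case using Suc tc_deriv[OF nderiv_test[OF assms]] by simp
qed simp

lemma tc_decay:
  assumes g: "g \<in> test_functions" and M: "\<And>n x. n \<le> m \<Longrightarrow> cmod (nderiv n g x) \<le> M"
  shows "(1 + \<bar>real_of_int k\<bar>) ^ m * cmod (tc g k) \<le> 2 ^ (m + 1) * M"
proof -
  have "\<bar>real_of_int k\<bar> ^ n * cmod (tc g k) \<le> M" if "n \<le> m" for n
    using norm_tc[OF test_continuous[OF nderiv_test[OF g]], of n M k] M[OF that] tc_nderiv[OF g, of n k]
    by (simp add: norm_mult norm_power)
  from this[of 0] this[of m] have 1: "cmod (tc g k) \<le> M" "\<bar>real_of_int k\<bar> ^ m * cmod (tc g k) \<le> M" by auto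
  have "(1 + \<bar>real_of_int k\<bar>) ^ m \<le> 2 ^ m * (1 + \<bar>real_of_int k\<bar> ^ m)"
  proof (cases "\<bar>real_of_int k\<bar> \<le> 1")
    case True
    then have "(1 + \<bar>real_of_int k\<bar>) ^ m \<le> 2 ^ m" by (intro power_mono) auto
    also have "\<dots> \<le> 2 ^ m * (1 + \<bar>real_of_int k\<bar> ^ m)" by simp
    finally show ?thesis .
  next
    case False
    then have "(1 + \<bar>real_of_int k\<bar>) ^ m \<le> (2 * \<bar>real_of_int k\<bar>) ^ m" by (intro power_mono) auto
    also have "\<dots> \<le> 2 ^ m * (1 + \<bar>real_of_int k\<bar> ^ m)" by (simp add: power_mult_distrib)
    finally show ?thesis .
  qed
  then have "(1 + \<bar>real_of_int k\<bar>) ^ m * cmod (tc g k) \<le> 2 ^ m * (1 + \<bar>real_of_int k\<bar> ^ m) * cmod (tc g k)"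
    by (rule mult_right_mono) simp
  also have "\<dots> = 2 ^ m * (cmod (tc g k) + \<bar>real_of_int k\<bar> ^ m * cmod (tc g k))" by (simp add: algebra_simps)
  also have "\<dots> \<le> 2 ^ m * (M + M)" using 1 by (intro mult_left_mono add_mono) auto
  finally show ?thesis by simp
qed

text \<open>Two additional derivatives buy the summable factor (1 + |k|)^(-2). The constant is
  explicit and linear in \<open>M\<close>, because the continuity of a functional built from
  coefficients is read off from it.\<close>

lemma tc_summable_bound:
  assumes g: "g \<in> test_functions" and M: "\<And>n x. n \<le> m + 2 \<Longrightarrow> cmod (nderiv n g x) \<le> M"
  shows "(1 + \<bar>real_of_int k\<bar>) ^ m * cmod (tc g k) \<le> 2 ^ (m + 3) * M * (1 + \<bar>real_of_int k\<bar>) powr - 2"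
proof -
  have p: "(1 + \<bar>real_of_int k\<bar>) powr - 2 = 1 / (1 + \<bar>real_of_int k\<bar>)\<^sup>2"
    by (simp add: powr_minus_divide)
  have "(1 + \<bar>real_of_int k\<bar>) ^ (m + 2) * cmod (tc g k) \<le> 2 ^ (m + 2 + 1) * M"
    using M by (intro tc_decay[OF g]) auto
  then have "(1 + \<bar>real_of_int k\<bar>) ^ (m + 2) * cmod (tc g k) * (1 / (1 + \<bar>real_of_int k\<bar>)\<^sup>2) \<le>
      2 ^ (m + 2 + 1) * M * (1 / (1 + \<bar>real_of_int k\<bar>)\<^sup>2)"
    by (rule mult_right_mono) simp
  moreover have "(1 + \<bar>real_of_int k\<bar>) ^ (m + 2) * cmod (tc g k) * (1 / (1 + \<bar>real_of_int k\<bar>)\<^sup>2) =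
      (1 + \<bar>real_of_int k\<bar>) ^ m * cmod (tc g k)"
    by (simp add: power_add power2_eq_square)
  ultimately show ?thesis unfolding p by (simp add: numeral_3_eq_3)
qed

lemma test_nderiv_bounded:
  assumes "g \<in> test_functions" obtains M where "0 \<le> M" "\<And>n x. n \<le> m \<Longrightarrow> cmod (nderiv n g x) \<le> M"
proof -
  have "\<exists>M\<ge>0. \<forall>x. cmod (nderiv n g x) \<le> M" for n using test_bounded[OF nderiv_test[OF assms, of n]] by metis
  then obtain f where f: "\<And>n. 0 \<le> f n" "\<And>n x. cmod (nderiv n g x) \<le> f n" by metis
  have "cmod (nderiv n g x) \<le> (\<Sum>i\<le>m. f i)" if "n \<le> m" for n x
    using f(2)[of n x] member_le_sum[of n "{..m}" f] that f(1) by (auto intro: order.trans)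
  moreover have "0 \<le> (\<Sum>i\<le>m. f i)" by (intro sum_nonneg f)
  ultimately show thesis by (rule that[rotated])
qed

lemma tc_abs_sum: assumes "g \<in> test_functions"
  shows "(\<lambda>k. (1 + \<bar>real_of_int k\<bar>) ^ m * cmod (tc g k)) summable_on UNIV"
proof -
  obtain M where M: "\<And>n x. n \<le> m + 2 \<Longrightarrow> cmod (nderiv n g x) \<le> M"
    using test_nderiv_bounded[OF assms, of "m + 2"] by metis
  have s: "(\<lambda>k::int. 2 ^ (m + 3) * M * (1 + \<bar>real_of_int k\<bar>) powr - 2) summable_on UNIV"
    by (intro summable_on_cmult_right bracket_summable) simp
  show ?thesis
    by (rule summable_on_comparison_test[OF s]) (rule tc_summable_bound[OF assms M], simp_all)
qed

lemma tc_abs_sum': "g \<in> test_functions \<Longrightarrow> abs_sum (tc g)"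
  using tc_abs_sum[of g 0] by simp

text \<open>The series of \<open>tc g\<close> is continuous and has the same Fourier coefficients as
  \<open>g\<close>. The two functions agree almost everywhere, then everywhere by continuity and
  periodicity.\<close>

lemma fourier_inversion: assumes g: "g \<in> test_functions" shows "trig (tc g) = g"
proof
  fix x
  have c: "continuous_on UNIV (trig (tc g))" by (rule continuous_trig[OF tc_abs_sum'[OF g]])
  have "AE x in lborel. x \<in> {-pi..pi} \<longrightarrow> trig (tc g) x = g x"
  proof (rule AE_eq_of_LI)
    show "LI (\<lambda>x. trig (tc g) x * ee k x) = LI (\<lambda>x. g x * ee k x)" for k
    proof -
      have "LI (\<lambda>x. trig (tc g) x * ee k x) = 2 * of_real pi * tc g (- k)"
        using LI_trig_ee[OF tc_abs_sum'[OF g], of "- k"] by simp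
      then show ?thesis unfolding tc_def[of g "- k"] by simp
    qed
  qed (use c test_continuous[OF g] in \<open>auto intro: continuous_set_integrable\<close>)
  then have eq: "trig (tc g) y = g y" if "y \<in> {-pi..pi}" for y
    using continuous_AE_eq[OF c test_continuous[OF g]] that by blast
  have "periodic (\<lambda>x. trig (tc g) x - g x)"
    using trig_periodic[of "tc g"] test_periodic[OF g] by (simp add: periodic_def)
  from periodic_reduce[OF this, of x] obtain y where "y \<in> {-pi..pi}" "trig (tc g) x - g x = trig (tc g) y - g y" by metis
  then show "trig (tc g) x = g x" using eq[of y] by simp
qed

lemma nderiv_trig: assumes "g \<in> test_functions"
  shows "nderiv n g x = (\<Sum>\<^sub>\<infinity>k. (\<i> * of_int k) ^ n * tc g k * ee k x)"
  using fourier_inversion[OF nderiv_test[OF assms, of n]] tc_nderiv[OF assms, of n] 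
  by (simp add: trig_def fun_eq_iff)

lemma tc_ee: "tc (ee l) k = (if k = l then 1 else 0)"
  using LI_ee[of "l - k"] by (simp add: tc_def ee_mult eq_commute[of l k])

subsection \<open>Distributions and their Fourier coefficients\<close>

definition poly_growth :: "(int \<Rightarrow> complex) \<Rightarrow> bool" where
  "poly_growth c \<longleftrightarrow> (\<exists>C N. \<forall>k. cmod (c k) \<le> C * (1 + \<bar>real_of_int k\<bar>) ^ N)"

lemma fourier_coeff_ee: "fourier_coeff f k = pairing f (ee (- k)) / (2 * pi)"
proof -
  have "(\<lambda>z. exp (- \<i> * of_int k * of_real z)) = ee (- k)" by (simp add: ee_def fun_eq_iff)
  then show ?thesis unfolding fourier_coeff_def by (rule arg_cong)
qed

lemma pairing_ee: "pairing f (ee k) = 2 * pi * fourier_coeff f (- k)"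
  by (simp add: fourier_coeff_ee)

lemma pairing_lincomb:
  "f \<in> test_functions \<Longrightarrow> g \<in> test_functions \<Longrightarrow> pairing L (\<lambda>x. a * f x + b * g x) = a * pairing L f + b * pairing L g"
proof -
  assume fg: "f \<in> test_functions" "g \<in> test_functions"
  have L: "is_pdist (pairing L)" using pairing by simp
  have "(\<lambda>x. a * f x) \<in> test_functions" "(\<lambda>x. b * g x) \<in> test_functions"
    using test_lincomb[OF fg, of a 0] test_lincomb[OF fg, of 0 b] by simp_all
  then show ?thesis using L fg unfolding is_pdist_def by metis
qed

lemma pairing_bound: "\<exists>C N. 0 \<le> C \<and> (\<forall>f\<in>test_functions. \<forall>M.
    (\<forall>n\<le>N. \<forall>x. cmod (nderiv n f x) \<le> M) \<longrightarrow> cmod (pairing L f) \<le> C * M)"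
proof -
  have L: "is_pdist (pairing L)" using pairing by simp
  then obtain C N where C: "\<forall>f\<in>test_functions. \<forall>M.
        (\<forall>n\<le>N. \<forall>x. cmod (nderiv n f x) \<le> M) \<longrightarrow> cmod (pairing L f) \<le> C * M"
    unfolding is_pdist_def by (elim conjE exE)
  show ?thesis
  proof (intro exI conjI ballI allI impI)
    fix f M assume f: "f \<in> test_functions" "\<forall>n\<le>N. \<forall>x. cmod (nderiv n f x) \<le> M"
    have "cmod (nderiv 0 f 0) \<le> M" using f(2) by blast
    then have M: "0 \<le> M" by (rule order.trans[OF norm_ge_zero])
    have "cmod (pairing L f) \<le> C * M" using C f by simp
    also have "\<dots> \<le> \<bar>C\<bar> * M" using M by (intro mult_right_mono) auto
    finally show "cmod (pairing L f) \<le> \<bar>C\<bar> * M" .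
  qed simp
qed

lemma tc_lincomb:
  assumes "continuous_on UNIV f" "continuous_on UNIV g"
  shows "tc (\<lambda>x. a * f x + b * g x) k = a * tc f k + b * tc g k"
proof -
  have "LI (\<lambda>x. a * (f x * ee (- k) x) + b * (g x * ee (- k) x)) =
      a * LI (\<lambda>x. f x * ee (- k) x) + b * LI (\<lambda>x. g x * ee (- k) x)"
    by (subst set_integral_add(2))
      (auto intro!: set_integrable_mult_right continuous_set_integrable continuous_intros assms)
  moreover have "(a * f x + b * g x) * ee (- k) x = a * (f x * ee (- k) x) + b * (g x * ee (- k) x)" for x
    by (simp add: algebra_simps)
  ultimately show ?thesis by (simp add: tc_def add_divide_distrib)
qed

lemma partial_sum_test:
  assumes "finite F"
  shows "(\<lambda>x. \<Sum>k\<in>F. c k * ee k x) \<in> test_functions"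
    "tc (\<lambda>x. \<Sum>k\<in>F. c k * ee k x) l = (if l \<in> F then c l else 0)"
    "pairing L (\<lambda>x. \<Sum>k\<in>F. c k * ee k x) = (\<Sum>k\<in>F. c k * pairing L (ee k))"
proof -
  let ?g = "\<lambda>F x. \<Sum>k\<in>F. c k * ee k x"
  have z: "(\<lambda>x. 0) \<in> test_functions" using test_lincomb[OF ee_test ee_test, of 0 0 0 0] by simp
  have z2: "pairing L (\<lambda>x. 0) = 0" using pairing_lincomb[OF ee_test ee_test, of L 0 0 0 0] by simp
  have "?g F \<in> test_functions \<and> tc (?g F) l = (if l \<in> F then c l else 0) \<and>
      pairing L (?g F) = (\<Sum>k\<in>F. c k * pairing L (ee k))"
    using assms
  proof (induction F)
    case empty then show ?case using z z2 by (simp add: tc_def)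
  next
    case (insert a F)
    then have IH: "?g F \<in> test_functions" by blast
    have "?g (insert a F) = (\<lambda>x. c a * ee a x + 1 * ?g F x)" using insert by (simp add: fun_eq_iff)
    then show ?case
      using insert test_lincomb[OF ee_test[of a] IH, of "c a" 1] pairing_lincomb[OF ee_test[of a] IH, of L "c a" 1]
        tc_lincomb[OF continuous_ee[of UNIV a] test_continuous[OF IH], of "c a" 1 l]
      by (auto simp: tc_ee)
  qed
  then show "?g F \<in> test_functions" "tc (?g F) l = (if l \<in> F then c l else 0)"
    "pairing L (?g F) = (\<Sum>k\<in>F. c k * pairing L (ee k))" by blast+
qed

text \<open>A distribution can be applied termwise because the Fourier series of a test function converges in every
  \<open>C\<^sup>N\<close>-norm.\<close>

lemma pairing_has_sum: assumes g: "g \<in> test_functions"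
  shows "((\<lambda>k. tc g k * pairing L (ee k)) has_sum pairing L g) UNIV"
proof -
  obtain C N where C0: "0 \<le> C" and C1: "\<forall>f\<in>test_functions. \<forall>M.
      (\<forall>n\<le>N. \<forall>x. cmod (nderiv n f x) \<le> M) \<longrightarrow> cmod (pairing L f) \<le> C * M"
    using pairing_bound[of L] by (elim exE conjE)
  note C = C0 C1[rule_format]
  let ?w = "\<lambda>k::int. (1 + \<bar>real_of_int k\<bar>) ^ N * cmod (tc g k)"
  have w: "?w summable_on UNIV" by (rule tc_abs_sum[OF g])
  have est: "cmod (pairing L g - (\<Sum>k\<in>F. tc g k * pairing L (ee k))) \<le> C * (infsum ?w UNIV - sum ?w F)"
    if F: "finite F" for F
  proof -
    let ?p = "\<lambda>x. \<Sum>k\<in>F. tc g k * ee k x"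
    note p = partial_sum_test(1)[OF F, of "tc g"] partial_sum_test(2)[OF F, of "tc g"]
      partial_sum_test(3)[OF F, of L "tc g"]
    define f where "f = (\<lambda>x. 1 * g x + (-1) * ?p x)"
    have f: "f \<in> test_functions" unfolding f_def by (rule test_lincomb[OF g p(1)])
    have tcf: "tc f k = (if k \<in> F then 0 else tc g k)" for k
      unfolding f_def tc_lincomb[OF test_continuous[OF g] test_continuous[OF p(1)]] p(2) by simp
    have w': "?w summable_on (- F)" by (rule summable_on_subset[OF w]) simp
    have tail: "infsum ?w (- F) = infsum ?w UNIV - sum ?w F"
      using infsum_Un_disjoint[of ?w F "- F"] F w' by simp
    have "cmod (pairing L f) \<le> C * infsum ?w (- F)"
    proof (rule C(2)[OF f])
      fix n x assume n: "n \<le> N"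
      have s: "abs_sum (\<lambda>k. (\<i> * of_int k) ^ n * tc f k * ee k x)"
        using tc_abs_sum[OF f, of n] by (rule summable_on_comparison_test)
          (auto simp: norm_mult norm_power intro!: mult_right_mono power_mono)
      have "cmod (nderiv n f x) \<le> (\<Sum>\<^sub>\<infinity>k. cmod ((\<i> * of_int k) ^ n * tc f k * ee k x))"
        unfolding nderiv_trig[OF f] by (rule norm_infsum_bound[OF s])
      also have "\<dots> = (\<Sum>\<^sub>\<infinity>k\<in>- F. cmod ((\<i> * of_int k) ^ n * tc f k * ee k x))"
        by (rule infsum_cong_neutral) (auto simp: tcf)
      also have "\<dots> \<le> infsum ?w (- F)"
      proof (rule infsum_mono[OF summable_on_subset[OF s] w'])
        fix k assume "k \<in> - F"
        have "\<bar>real_of_int k\<bar> ^ n \<le> (1 + \<bar>real_of_int k\<bar>) ^ n" by (intro power_mono) auto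
        also have "\<dots> \<le> (1 + \<bar>real_of_int k\<bar>) ^ N" by (intro power_increasing n) auto
        finally show "cmod ((\<i> * of_int k) ^ n * tc f k * ee k x) \<le> ?w k"
          by (auto simp: norm_mult norm_power tcf intro!: mult_right_mono)
      qed auto
      finally show "cmod (nderiv n f x) \<le> infsum ?w (- F)" .
    qed
    moreover have "pairing L f = pairing L g - (\<Sum>k\<in>F. tc g k * pairing L (ee k))"
      unfolding f_def pairing_lincomb[OF g p(1)] p(3) by simp
    ultimately show ?thesis unfolding tail by simp
  qed
  have "((\<lambda>F. C * (infsum ?w UNIV - sum ?w F)) \<longlongrightarrow> C * (infsum ?w UNIV - infsum ?w UNIV)) (finite_subsets_at_top UNIV)"
    using infsum_tendsto[OF w] by (intro tendsto_intros)
  then have lim: "((\<lambda>F. C * (infsum ?w UNIV - sum ?w F)) \<longlongrightarrow> 0) (finite_subsets_at_top UNIV)" by simp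
  have "((\<lambda>F. pairing L g - (\<Sum>k\<in>F. tc g k * pairing L (ee k))) \<longlongrightarrow> 0) (finite_subsets_at_top UNIV)"
    by (rule Lim_null_comparison[OF _ lim], rule eventually_finite_subsets_at_top_weakI, rule est)
  then have "((\<lambda>F. pairing L g - (pairing L g - (\<Sum>k\<in>F. tc g k * pairing L (ee k)))) \<longlongrightarrow> pairing L g - 0) (finite_subsets_at_top UNIV)"
    by (intro tendsto_intros)
  then show ?thesis by (simp add: has_sum_def)
qed

lemma poly_growth_fourier: "poly_growth (fourier_coeff L)"
proof -
  obtain C N where C0: "0 \<le> C" and C1: "\<forall>f\<in>test_functions. \<forall>M.
      (\<forall>n\<le>N. \<forall>x. cmod (nderiv n f x) \<le> M) \<longrightarrow> cmod (pairing L f) \<le> C * M"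
    using pairing_bound[of L] by (elim exE conjE)
  note C = C0 C1[rule_format]
  have "cmod (fourier_coeff L k) \<le> C / (2 * pi) * (1 + \<bar>real_of_int k\<bar>) ^ N" for k
  proof -
    have "cmod (pairing L (ee (- k))) \<le> C * (1 + \<bar>real_of_int k\<bar>) ^ N"
    proof (rule C(2)[OF ee_test])
      fix n x assume n: "n \<le> N"
      have "\<bar>real_of_int k\<bar> ^ n \<le> (1 + \<bar>real_of_int k\<bar>) ^ n" by (intro power_mono) auto
      also have "\<dots> \<le> (1 + \<bar>real_of_int k\<bar>) ^ N" by (intro power_increasing n) auto
      finally show "cmod (nderiv n (ee (- k)) x) \<le> (1 + \<bar>real_of_int k\<bar>) ^ N"
        by (simp add: ee_nderiv norm_mult norm_power)
    qed
    then show ?thesis by (simp add: fourier_coeff_ee norm_divide field_simps)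
  qed
  then show ?thesis unfolding poly_growth_def by blast
qed

lemma abs_sum_tc_poly_growth: assumes g: "g \<in> test_functions" and c: "poly_growth c"
  shows "abs_sum (\<lambda>k. tc g k * c (- k))"
proof -
  obtain C N where C: "\<And>k. cmod (c k) \<le> C * (1 + \<bar>real_of_int k\<bar>) ^ N"
    using c unfolding poly_growth_def by blast
  show ?thesis
  proof (rule summable_on_comparison_test)
    show "(\<lambda>k. C * ((1 + \<bar>real_of_int k\<bar>) ^ N * cmod (tc g k))) summable_on UNIV"
      by (intro summable_on_cmult_right tc_abs_sum g)
    fix k :: int
    have "cmod (tc g k) * cmod (c (- k)) \<le> cmod (tc g k) * (C * (1 + \<bar>real_of_int k\<bar>) ^ N)"
      using C[of "- k"] by (intro mult_left_mono) auto
    then show "cmod (tc g k * c (- k)) \<le> C * ((1 + \<bar>real_of_int k\<bar>) ^ N * cmod (tc g k))"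
      by (simp add: norm_mult ac_simps)
  qed simp
qed

lemma pairing_fourier: assumes g: "g \<in> test_functions"
  shows "pairing L g = 2 * of_real pi * (\<Sum>\<^sub>\<infinity>k. tc g k * fourier_coeff L (- k))"
proof -
  have "pairing L g = (\<Sum>\<^sub>\<infinity>k. tc g k * pairing L (ee k))"
    using pairing_has_sum[OF g, of L] by (simp add: infsumI)
  also have "\<dots> = (\<Sum>\<^sub>\<infinity>k. 2 * of_real pi * (tc g k * fourier_coeff L (- k)))"
    by (simp add: pairing_ee ac_simps)
  also have "\<dots> = 2 * of_real pi * (\<Sum>\<^sub>\<infinity>k. tc g k * fourier_coeff L (- k))"
    by (rule infsum_cmult_right')
  finally show ?thesis .
qed

text \<open>The coefficients determine the pairing with every test function, and off the test
  functions every distribution has the default value 0, so the functionals are equal as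
  functions.\<close>

lemma pdist_eqI: assumes "\<And>k. fourier_coeff K k = fourier_coeff L k" shows "K = L"
proof -
  have "pairing K g = pairing L g" for g
  proof (cases "g \<in> test_functions")
    case True then show ?thesis by (simp add: pairing_fourier assms)
  next
    case False
    have "is_pdist (pairing K)" "is_pdist (pairing L)" using pairing by simp_all
    then show ?thesis using False unfolding is_pdist_def by simp
  qed
  then show ?thesis by (simp add: pairing_inject[symmetric] fun_eq_iff)
qed

lemma fourier_coeff_zero [simp]: "fourier_coeff 0 k = 0"
  by (simp add: fourier_coeff_def zero_pdist.rep_eq)

lemma fourier_coeff_add: "fourier_coeff (f + g) k = fourier_coeff f k + fourier_coeff g k"
  by (simp add: fourier_coeff_def plus_pdist.rep_eq add_divide_distrib)

lemma fourier_coeff_diff: "fourier_coeff (f - g) k = fourier_coeff f k - fourier_coeff g k"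
  by (simp add: fourier_coeff_def minus_pdist.rep_eq diff_divide_distrib)

lemma fourier_coeff_scaleR: "fourier_coeff (a *\<^sub>R f) k = of_real a * fourier_coeff f k"
  by (simp add: fourier_coeff_def scaleR_pdist.rep_eq)

lemma fourier_coeff_dderiv: "fourier_coeff (dderiv f) k = \<i> * of_int k * fourier_coeff f k"
proof -
  have 1: "(\<lambda>x. vector_derivative (ee (- k)) (at x)) = (\<lambda>x. (- \<i> * of_int k) * ee (- k) x + 0 * ee (- k) x)"
    using vector_derivative_at[OF ee_deriv[of "- k"]] by (simp add: fun_eq_iff)
  have "pairing (dderiv f) (ee (- k)) = - pairing f (\<lambda>x. vector_derivative (ee (- k)) (at x))"
    by (simp add: dderiv.rep_eq ee_test)
  also have "\<dots> = - (- \<i> * of_int k * pairing f (ee (- k)))"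
    unfolding 1 by (subst pairing_lincomb) (simp_all add: ee_test)
  finally show ?thesis by (simp add: fourier_coeff_ee)
qed

text \<open>The inverse of \<open>fourier_coeff\<close> on sequences of polynomial growth. The
  functional is the Parseval pairing, whence the reflection \<open>- k\<close>.\<close>

definition of_coeffs :: "(int \<Rightarrow> complex) \<Rightarrow> pdist" where
  "of_coeffs c = Abs_pdist (\<lambda>g. if g \<in> test_functions then 2 * of_real pi * (\<Sum>\<^sub>\<infinity>k. tc g k * c (- k)) else 0)"

lemma fourier_of_coeffs: assumes c: "poly_growth c" shows "fourier_coeff (of_coeffs c) k = c k"
proof -
  let ?L = "\<lambda>g. if g \<in> test_functions then 2 * of_real pi * (\<Sum>\<^sub>\<infinity>k. tc g k * c (- k)) else 0"
  obtain C N where C: "\<And>k. cmod (c k) \<le> C * (1 + \<bar>real_of_int k\<bar>) ^ N"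
    using c unfolding poly_growth_def by blast
  have C0: "0 \<le> C" using order.trans[OF norm_ge_zero C[of 0]] by simp
  note s = abs_sum_tc_poly_growth[OF _ c]
  have lin: "?L (\<lambda>x. a * f x + b * g x) = a * ?L f + b * ?L g"
    if "f \<in> test_functions" "g \<in> test_functions" for f g a b
  proof -
    have "(\<lambda>k. tc (\<lambda>x. a * f x + b * g x) k * c (- k)) = (\<lambda>k. a * (tc f k * c (- k)) + b * (tc g k * c (- k)))"
      using tc_lincomb[OF that[THEN test_continuous], of a b] by (simp add: fun_eq_iff algebra_simps)
    moreover have "(\<Sum>\<^sub>\<infinity>k. a * (tc f k * c (- k)) + b * (tc g k * c (- k))) =
        a * (\<Sum>\<^sub>\<infinity>k. tc f k * c (- k)) + b * (\<Sum>\<^sub>\<infinity>k. tc g k * c (- k))"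
      using abs_summable_summable[OF s[OF that(1)]] abs_summable_summable[OF s[OF that(2)]]
      by (simp add: infsum_add summable_on_cmult_right infsum_cmult_right')
    ultimately show ?thesis using that test_lincomb[OF that] by (simp add: algebra_simps)
  qed
  have bound: "cmod (?L f) \<le> (2 * pi * C * 2 ^ (N + 3) * (\<Sum>\<^sub>\<infinity>k::int. (1 + \<bar>real_of_int k\<bar>) powr - 2)) * M"
    if f: "f \<in> test_functions" and M: "\<And>n x. n \<le> N + 2 \<Longrightarrow> cmod (nderiv n f x) \<le> M" for f M
  proof -
    let ?b = "\<lambda>k::int. (1 + \<bar>real_of_int k\<bar>) powr - 2"
    have sb: "?b summable_on UNIV" by (rule bracket_summable) simp
    have "cmod (\<Sum>\<^sub>\<infinity>k. tc f k * c (- k)) \<le> (\<Sum>\<^sub>\<infinity>k. cmod (tc f k * c (- k)))"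
      by (rule norm_infsum_bound[OF s[OF f]])
    also have "\<dots> \<le> (\<Sum>\<^sub>\<infinity>k. (C * 2 ^ (N + 3) * M) * ?b k)"
    proof (rule infsum_mono[OF s[OF f] summable_on_cmult_right[OF sb]])
      fix k :: int
      have "cmod (tc f k * c (- k)) \<le> cmod (tc f k) * (C * (1 + \<bar>real_of_int k\<bar>) ^ N)"
        unfolding norm_mult using C[of "- k"] by (intro mult_left_mono) auto
      also have "\<dots> = C * ((1 + \<bar>real_of_int k\<bar>) ^ N * cmod (tc f k))" by simp
      also have "\<dots> \<le> C * (2 ^ (N + 3) * M * ?b k)"
        using tc_summable_bound[OF f M] C0 by (intro mult_left_mono) auto
      finally show "cmod (tc f k * c (- k)) \<le> (C * 2 ^ (N + 3) * M) * ?b k" by simp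
    qed
    also have "\<dots> = (C * 2 ^ (N + 3) * M) * infsum ?b UNIV" by (rule infsum_cmult_right')
    finally have "2 * pi * cmod (\<Sum>\<^sub>\<infinity>k. tc f k * c (- k)) \<le> 2 * pi * ((C * 2 ^ (N + 3) * M) * infsum ?b UNIV)"
      by (intro mult_left_mono) auto
    then show ?thesis using f by (simp add: norm_mult ac_simps)
  qed
  have "is_pdist ?L"
    unfolding is_pdist_def
  proof (intro conjI ballI allI impI)
    show "?L (\<lambda>x. f x + g x) = ?L f + ?L g" if "f \<in> test_functions" "g \<in> test_functions" for f g
      using lin[OF that, of 1 1] unfolding mult_1 .
    show "?L (\<lambda>x. a * f x) = a * ?L f" if "f \<in> test_functions" for f a
      using lin[OF that that, of a 0] unfolding mult_zero_left add_0_right .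
    \<comment> \<open>The order \<open>N + 2\<close> of the functional consists of the growth
      \<open>N\<close> of the sequence and of two derivatives that make the sum over k
      converge.\<close>
    show "\<exists>C N. \<forall>f\<in>test_functions. \<forall>M. (\<forall>n\<le>N. \<forall>x. cmod (nderiv n f x) \<le> M) \<longrightarrow> cmod (?L f) \<le> C * M"
      by (intro exI[of _ "2 * pi * C * 2 ^ (N + 3) * (\<Sum>\<^sub>\<infinity>k::int. (1 + \<bar>real_of_int k\<bar>) powr - 2)"]
          exI[of _ "N + 2"] ballI allI impI bound) auto
  qed simp
  then have "pairing (of_coeffs c) = ?L" unfolding of_coeffs_def by (simp add: Abs_pdist_inverse)
  then have "fourier_coeff (of_coeffs c) k = (\<Sum>\<^sub>\<infinity>l. tc (ee (- k)) l * c (- l))"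
    by (simp add: fourier_coeff_ee ee_test)
  also have "\<dots> = (\<Sum>\<^sub>\<infinity>l\<in>{- k}. c k)" by (rule infsum_cong_neutral) (auto simp: tc_ee)
  finally show ?thesis by simp
qed

lemma poly_growth_mult_bounded:
  assumes "poly_growth c" "\<And>k. cmod (m k) \<le> B" shows "poly_growth (\<lambda>k. m k * c k)"
proof -
  obtain C N where C: "\<And>k. cmod (c k) \<le> C * (1 + \<bar>real_of_int k\<bar>) ^ N"
    using assms unfolding poly_growth_def by blast
  have "cmod (m k * c k) \<le> (B * C) * (1 + \<bar>real_of_int k\<bar>) ^ N" for k
  proof -
    have "cmod (m k) * cmod (c k) \<le> B * (C * (1 + \<bar>real_of_int k\<bar>) ^ N)"
      using C[of k] assms(2)[of k] by (intro mult_mono) (auto intro: order.trans[OF norm_ge_zero])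
    then show ?thesis by (simp add: norm_mult)
  qed
  then show ?thesis unfolding poly_growth_def by blast
qed

subsection \<open>Representing functions, squares and integrals\<close>

lemma represents_coeff: assumes "represents f F" shows "LI (\<lambda>x. F x * ee k x) = 2 * pi * fourier_coeff f (- k)"
proof -
  have "pairing f (ee k) = LI (\<lambda>x. F x * ee k x)" using assms ee_test[of k] unfolding represents_def by blast
  then show ?thesis by (simp add: pairing_ee)
qed

lemma represents_AE: assumes "represents f F" "represents f G"
  shows "AE x in lborel. x \<in> {-pi..pi} \<longrightarrow> F x = G x"
  by (rule AE_eq_of_LI) (use assms represents_coeff in \<open>auto simp: represents_def\<close>)

lemma represents_trig: assumes c: "abs_sum (fourier_coeff f)"
  shows "represents f (trig (fourier_coeff f))"
  unfolding represents_def
proof (intro conjI ballI)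
  show "periodic (trig (fourier_coeff f))" by (rule trig_periodic)
  show "set_integrable lborel {-pi..pi} (trig (fourier_coeff f))"
    by (intro continuous_set_integrable continuous_trig c)
  fix g assume g: "g \<in> test_functions"
  have bij: "bij (uminus :: int \<Rightarrow> int)" by (rule bij_uminus)
  have tg: "LI (\<lambda>x. ee k x * g x) = 2 * of_real pi * tc g (- k)" for k by (simp add: tc_def mult.commute)
  have "LI (\<lambda>x. trig (fourier_coeff f) x * g x) = (\<Sum>\<^sub>\<infinity>k. fourier_coeff f k * LI (\<lambda>x. ee k x * g x))"
    by (rule LI_trig_mult[OF c test_continuous[OF g]])
  also have "\<dots> = (\<Sum>\<^sub>\<infinity>k. 2 * of_real pi * (tc g (- k) * fourier_coeff f k))" unfolding tg by (simp add: ac_simps)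
  also have "\<dots> = 2 * of_real pi * (\<Sum>\<^sub>\<infinity>k. tc g (- k) * fourier_coeff f k)" by (rule infsum_cmult_right')
  also have "(\<Sum>\<^sub>\<infinity>k. tc g (- k) * fourier_coeff f k) = (\<Sum>\<^sub>\<infinity>k. tc g k * fourier_coeff f (- k))"
    using infsum_reindex_bij_betw[OF bij, of "\<lambda>k. tc g k * fourier_coeff f (- k)"] by simp
  finally show "pairing f g = LI (\<lambda>x. trig (fourier_coeff f) x * g x)" unfolding pairing_fourier[OF g] by simp
qed

text \<open>This supplies the distribution of the squared function in \<open>dsquare\<close>; the L1
  norm of \<open>F\<close> bounds the functional by the sup norm, hence order 0.\<close>

lemma represents_continuous: assumes F: "continuous_on UNIV F" "periodic F" shows "\<exists>g. represents g F"
proof -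
  let ?L = "\<lambda>g. if g \<in> test_functions then LI (\<lambda>x. F x * g x) else 0"
  define C where "C = (LINT x:{-pi..pi}|lborel. cmod (F x))"
  have lin: "?L (\<lambda>x. a * f x + b * g x) = a * ?L f + b * ?L g"
    if "f \<in> test_functions" "g \<in> test_functions" for f g a b
  proof -
    note cf = test_continuous[OF that(1)] test_continuous[OF that(2)]
    have "LI (\<lambda>x. a * (F x * f x) + b * (F x * g x)) = a * LI (\<lambda>x. F x * f x) + b * LI (\<lambda>x. F x * g x)"
      by (subst set_integral_add(2))
        (auto intro!: set_integrable_mult_right continuous_set_integrable continuous_on_mult F cf)
    then show ?thesis using that test_lincomb[OF that] by (simp add: algebra_simps)
  qed
  have bound: "cmod (?L f) \<le> C * M" if f: "f \<in> test_functions" and M: "\<And>x. cmod (f x) \<le> M" for f M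
  proof -
    have i: "set_integrable lborel {-pi..pi} (\<lambda>x. F x * f x)" "set_integrable lborel {-pi..pi} F"
      by (intro continuous_set_integrable continuous_on_mult F test_continuous[OF f])+
    have "cmod (LI (\<lambda>x. F x * f x)) \<le> (LINT x:{-pi..pi}|lborel. cmod (F x * f x))"
      by (rule set_integral_norm_bound[OF i(1)])
    also have "\<dots> \<le> (LINT x:{-pi..pi}|lborel. cmod (F x) * M)"
      by (intro set_integral_mono set_integrable_norm i set_integrable_mult_left)
        (simp_all add: norm_mult mult_left_mono M)
    also have "\<dots> = C * M" by (simp add: C_def)
    finally show ?thesis using f by simp
  qed
  have "is_pdist ?L"
    unfolding is_pdist_def
  proof (intro conjI ballI allI impI)
    show "?L (\<lambda>x. f x + g x) = ?L f + ?L g" if "f \<in> test_functions" "g \<in> test_functions" for f g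
      using lin[OF that, of 1 1] unfolding mult_1 .
    show "?L (\<lambda>x. a * f x) = a * ?L f" if "f \<in> test_functions" for f a
      using lin[OF that that, of a 0] unfolding mult_zero_left add_0_right .
    show "\<exists>C N. \<forall>f\<in>test_functions. \<forall>M. (\<forall>n\<le>N. \<forall>x. cmod (nderiv n f x) \<le> M) \<longrightarrow> cmod (?L f) \<le> C * M"
    proof (intro exI[of _ C] exI[of _ "0::nat"] ballI allI impI)
      fix f M assume f: "f \<in> test_functions" "\<forall>n\<le>0. \<forall>x. cmod (nderiv n f x) \<le> M"
      show "cmod (?L f) \<le> C * M" using f(2) by (intro bound f(1)) (metis le_refl nderiv_0)
    qed
  qed simp
  then have "pairing (Abs_pdist ?L) = ?L" by (simp add: Abs_pdist_inverse)
  then have "represents (Abs_pdist ?L) F"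
    unfolding represents_def using F continuous_set_integrable by simp
  then show ?thesis by blast
qed

lemma abs_sum_square: assumes c: "abs_sum c" shows "(\<lambda>k. (cmod (c k))\<^sup>2) summable_on UNIV"
proof (rule summable_on_comparison_test[OF summable_on_cmult_right[OF c]])
  fix k
  have "sum (\<lambda>k. cmod (c k)) {k} \<le> (\<Sum>\<^sub>\<infinity>k. cmod (c k))"
    by (rule finite_sum_le_infsum[OF c]) auto
  then show "(cmod (c k))\<^sup>2 \<le> (\<Sum>\<^sub>\<infinity>k. cmod (c k)) * cmod (c k)"
    unfolding power2_eq_square by (intro mult_right_mono) auto
qed auto

text \<open>Parseval's identity: the series of one factor is integrated termwise against the
  conjugate of the other.\<close>

lemma norm_sq_trig: assumes c: "abs_sum c"
  shows "(LINT x:{-pi..pi}|lborel. (cmod (trig c x))\<^sup>2) = 2 * pi * (\<Sum>\<^sub>\<infinity>k. (cmod (c k))\<^sup>2)"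
proof -
  have cc: "continuous_on UNIV (trig c)" by (rule continuous_trig[OF c])
  have tg: "LI (\<lambda>x. ee k x * cnj (trig c x)) = 2 * of_real pi * cnj (c k)" for k
  proof -
    have "LI (\<lambda>x. ee k x * cnj (trig c x)) = LI (\<lambda>x. cnj (trig c x * ee (- k) x))"
      by (simp add: cnj_ee mult.commute)
    also have "\<dots> = cnj (LI (\<lambda>x. trig c x * ee (- k) x))"
      unfolding set_lebesgue_integral_def by (simp flip: Bochner_Integration.integral_cnj add: scaleR_conv_of_real)
    finally show ?thesis by (simp add: LI_trig_ee[OF c])
  qed
  have "LI (\<lambda>x. trig c x * cnj (trig c x)) = (\<Sum>\<^sub>\<infinity>k. c k * LI (\<lambda>x. ee k x * cnj (trig c x)))"
    by (rule LI_trig_mult[OF c]) (intro continuous_intros cc)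
  also have "\<dots> = (\<Sum>\<^sub>\<infinity>k. 2 * of_real pi * of_real ((cmod (c k))\<^sup>2))"
    unfolding tg complex_norm_square by (simp only: ac_simps)
  also have "\<dots> = 2 * of_real pi * (\<Sum>\<^sub>\<infinity>k. complex_of_real ((cmod (c k))\<^sup>2))" by (rule infsum_cmult_right')
  also have "\<dots> = of_real (2 * pi * (\<Sum>\<^sub>\<infinity>k. (cmod (c k))\<^sup>2))" 
    using has_sum_of_real[OF has_sum_infsum[OF abs_sum_square[OF c]], where 'a = complex]
    by (simp only: infsumI of_real_mult of_real_numeral)
  finally have "LI (\<lambda>x. of_real ((cmod (trig c x))\<^sup>2)) = complex_of_real (2 * pi * (\<Sum>\<^sub>\<infinity>k. (cmod (c k))\<^sup>2))"
    unfolding complex_norm_square .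
  then show ?thesis unfolding set_integral_complex_of_real of_real_eq_iff .
qed

lemma square_integrable_continuous: assumes "continuous_on UNIV F" shows "square_integrable F"
proof -
  have "continuous_on {-pi..pi} F" by (rule continuous_on_subset[OF assms]) simp
  then have "continuous_on {-pi..pi} (\<lambda>x. (cmod (F x))\<^sup>2)" by (intro continuous_intros)
  then show ?thesis unfolding square_integrable_def by (rule borel_integrable_atLeastAtMost')
qed

lemma square_integrable_sq_AE:
  assumes "represents f F" "represents f G" "square_integrable F" "square_integrable G"
  shows "(LINT x:{-pi..pi}|lborel. (cmod (F x))\<^sup>2) = (LINT x:{-pi..pi}|lborel. (cmod (G x))\<^sup>2)"
  unfolding set_lebesgue_integral_def
proof (rule integral_cong_AE)
  show "(\<lambda>x. indicator {-pi..pi} x *\<^sub>R (cmod (F x))\<^sup>2) \<in> borel_measurable lborel"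
    "(\<lambda>x. indicator {-pi..pi} x *\<^sub>R (cmod (G x))\<^sup>2) \<in> borel_measurable lborel"
    using assms(3,4) unfolding square_integrable_def set_integrable_def by (auto intro: borel_measurable_integrable)
  show "AE x in lborel. indicator {-pi..pi} x *\<^sub>R (cmod (F x))\<^sup>2 = indicator {-pi..pi} x *\<^sub>R (cmod (G x))\<^sup>2"
    using represents_AE[OF assms(1,2)] by eventually_elim (auto simp: indicator_def)
qed

lemma L2_abs_sum: assumes c: "abs_sum (fourier_coeff f)"
  shows "f \<in> L2_dist" "L2_norm f = Hs_norm 0 f"
proof -
  let ?F = "trig (fourier_coeff f)"
  have F: "represents f ?F" "square_integrable ?F"
    using represents_trig[OF c] square_integrable_continuous[OF continuous_trig[OF c]] by auto
  then show "f \<in> L2_dist" unfolding L2_dist_def by blast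
  have "L2_norm f = sqrt (LINT x:{-pi..pi}|lborel. (cmod (?F x))\<^sup>2)"
    unfolding L2_norm_def
  proof (rule the_equality)
    show "\<exists>F. represents f F \<and> square_integrable F \<and> sqrt (LINT x:{-pi..pi}|lborel. (cmod (?F x))\<^sup>2) =
        sqrt (LINT x:{-pi..pi}|lborel. (cmod (F x))\<^sup>2)" using F by blast
    fix r assume "\<exists>F. represents f F \<and> square_integrable F \<and> r = sqrt (LINT x:{-pi..pi}|lborel. (cmod (F x))\<^sup>2)"
    then show "r = sqrt (LINT x:{-pi..pi}|lborel. (cmod (?F x))\<^sup>2)"
      using square_integrable_sq_AE F by metis
  qed
  also have "\<dots> = sqrt (2 * pi) * sqrt (\<Sum>\<^sub>\<infinity>k. (cmod (fourier_coeff f k))\<^sup>2)"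
    unfolding norm_sq_trig[OF c] by (rule real_sqrt_mult)
  also have "\<dots> = Hs_norm 0 f"
  proof -
    have "(1 + (real_of_int k)\<^sup>2) powr (0/2) = 1" for k
      using zero_le_power2[of "real_of_int k"] by (simp add: add_nonneg_eq_0_iff)
    then show ?thesis by (simp add: Hs_norm_def)
  qed
  finally show "L2_norm f = Hs_norm 0 f" .
qed

section \<open>The nonlinearity, the semigroup and time integrals on the Fourier side\<close>

definition conv :: "(int \<Rightarrow> complex) \<Rightarrow> (int \<Rightarrow> complex) \<Rightarrow> int \<Rightarrow> complex" where
  "conv c d k = (\<Sum>\<^sub>\<infinity>j. c j * d (k - j))"

text \<open>With summable coefficients there is a continuous representative, whose square is again
  represented by a distribution. Any other representative agrees with it almost everywhere, so the
  definite description in \<open>dsquare\<close> is met. The coefficients follow by integrating one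
  factor termwise.\<close>

lemma fourier_coeff_dsquare: assumes c: "abs_sum (fourier_coeff f)"
  shows "fourier_coeff (dsquare f) k = conv (fourier_coeff f) (fourier_coeff f) k"
proof -
  let ?F = "trig (fourier_coeff f)"
  have cF: "continuous_on UNIV ?F" by (rule continuous_trig[OF c])
  have F: "represents f ?F" "square_integrable ?F"
    using represents_trig[OF c] square_integrable_continuous[OF cF] by auto
  have "\<exists>g. represents g (\<lambda>x. (?F x)\<^sup>2)"
    using trig_periodic[of "fourier_coeff f"]
    by (intro represents_continuous continuous_intros cF) (simp add: periodic_def)
  then obtain g where g: "represents g (\<lambda>x. (?F x)\<^sup>2)" by blast
  have "dsquare f = g"
    unfolding dsquare_def
  proof (rule the_equality)
    show "\<exists>F. represents f F \<and> square_integrable F \<and> represents g (\<lambda>x. (F x)\<^sup>2)" using F g by blast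
    fix g' assume "\<exists>F. represents f F \<and> square_integrable F \<and> represents g' (\<lambda>x. (F x)\<^sup>2)"
    then obtain G where G: "represents f G" "represents g' (\<lambda>x. (G x)\<^sup>2)" by blast
    have "LI (\<lambda>x. (G x)\<^sup>2 * ee l x) = LI (\<lambda>x. (?F x)\<^sup>2 * ee l x)" for l
      unfolding set_lebesgue_integral_def
    proof (rule integral_cong_AE)
      have "set_integrable lborel {-pi..pi} (\<lambda>x. (G x)\<^sup>2 * ee l x)" "set_integrable lborel {-pi..pi} (\<lambda>x. (?F x)\<^sup>2 * ee l x)"
        using G(2) g unfolding represents_def by (intro set_integrable_mult_continuous continuous_ee; blast)+
      then show "(\<lambda>x. indicator {-pi..pi} x *\<^sub>R ((G x)\<^sup>2 * ee l x)) \<in> borel_measurable lborel"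
        "(\<lambda>x. indicator {-pi..pi} x *\<^sub>R ((?F x)\<^sup>2 * ee l x)) \<in> borel_measurable lborel"
        unfolding set_integrable_def by (auto intro: borel_measurable_integrable)
      show "AE x in lborel. indicator {-pi..pi} x *\<^sub>R ((G x)\<^sup>2 * ee l x) = indicator {-pi..pi} x *\<^sub>R ((?F x)\<^sup>2 * ee l x)"
        using represents_AE[OF G(1) F(1)] by eventually_elim (auto simp: indicator_def)
    qed
    then have "fourier_coeff g' (- l) = fourier_coeff g (- l)" for l
      using represents_coeff[OF G(2), of l] represents_coeff[OF g, of l] by simp
    from this[of "- l" for l] show "g' = g" by (intro pdist_eqI) simp
  qed
  have "2 * of_real pi * fourier_coeff g k = LI (\<lambda>x. ?F x * (?F x * ee (- k) x))"
    using represents_coeff[OF g, of "- k"] by (simp add: power2_eq_square mult.assoc)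
  also have "\<dots> = (\<Sum>\<^sub>\<infinity>j. fourier_coeff f j * LI (\<lambda>x. ee j x * (?F x * ee (- k) x)))"
    by (rule LI_trig_mult[OF c]) (intro continuous_intros cF)
  also have "\<dots> = (\<Sum>\<^sub>\<infinity>j. 2 * of_real pi * (fourier_coeff f j * fourier_coeff f (k - j)))"
  proof (rule infsum_cong)
    fix j
    have "LI (\<lambda>x. ee j x * (?F x * ee (- k) x)) = LI (\<lambda>x. ?F x * ee (- (k - j)) x)"
    proof -
      have "ee j x * (?F x * ee (- k) x) = ?F x * (ee j x * ee (- k) x)" for x by simp
      then have "ee j x * (?F x * ee (- k) x) = ?F x * ee (- (k - j)) x" for x unfolding ee_mult by simp
      then show ?thesis by (simp only:)
    qed
    then show "fourier_coeff f j * LI (\<lambda>x. ee j x * (?F x * ee (- k) x)) =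
        2 * of_real pi * (fourier_coeff f j * fourier_coeff f (k - j))"
      unfolding LI_trig_ee[OF c] by simp
  qed
  also have "\<dots> = 2 * of_real pi * conv (fourier_coeff f) (fourier_coeff f) k"
    unfolding conv_def by (rule infsum_cmult_right')
  finally show ?thesis using \<open>dsquare f = g\<close> by simp
qed

lemma fourier_coeff_u_ux: assumes c: "abs_sum (fourier_coeff f)"
  shows "fourier_coeff (u_ux f) k = (\<i> * of_int k / 2) * conv (fourier_coeff f) (fourier_coeff f) k"
  by (simp add: u_ux_def fourier_coeff_scaleR fourier_coeff_dderiv fourier_coeff_dsquare[OF c])

definition alpha :: "real \<Rightarrow> real \<Rightarrow> int \<Rightarrow> complex" where
  "alpha \<beta> \<eta> k = \<i> * of_real (symbol_q \<beta> k) - of_real (symbol_p \<eta> k)"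

text \<open>A property of integer frequencies: for real k with 0 < |k| < 1 the symbol is negative,
  while |k| <= k^2 holds on the integers. It makes the semigroup a contraction on each
  coefficient.\<close>

lemma symbol_p_nonneg: assumes "\<eta> > 0" shows "0 \<le> symbol_p \<eta> k"
proof -
  have "\<bar>k\<bar> * 1 \<le> \<bar>k\<bar> * \<bar>k\<bar>" if "k \<noteq> 0" using that by (intro mult_left_mono) auto
  then have "\<bar>k\<bar> \<le> k\<^sup>2" by (cases "k = 0") (simp_all add: power2_eq_square)
  then have "real_of_int \<bar>k\<bar> \<le> real_of_int (k\<^sup>2)" by (simp only: of_int_le_iff)
  then show ?thesis using assms by (simp add: symbol_p_def)
qed

lemma fourier_coeff_S_op: assumes "\<eta> > 0" "0 \<le> t"
  shows "fourier_coeff (S_op \<beta> \<eta> t f) k = exp (alpha \<beta> \<eta> k * of_real t) * fourier_coeff f k"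
proof -
  let ?m = "\<lambda>k. exp (\<i> * of_real (symbol_q \<beta> k * t) - of_real (symbol_p \<eta> k * t))"
  have "cmod (?m k) \<le> 1" for k
    using symbol_p_nonneg[OF assms(1), of k] assms(2) by simp
  then have g: "poly_growth (\<lambda>k. ?m k * fourier_coeff f k)"
    by (intro poly_growth_mult_bounded poly_growth_fourier)
  have "S_op \<beta> \<eta> t f = of_coeffs (\<lambda>k. ?m k * fourier_coeff f k)"
    unfolding S_op_def
  proof (rule the_equality)
    show "\<forall>k. fourier_coeff (of_coeffs (\<lambda>k. ?m k * fourier_coeff f k)) k = ?m k * fourier_coeff f k"
      by (rule allI) (rule fourier_of_coeffs[OF g])
    show "h = of_coeffs (\<lambda>k. ?m k * fourier_coeff f k)" if "\<forall>k. fourier_coeff h k = ?m k * fourier_coeff f k" for h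
      by (rule pdist_eqI) (simp only: fourier_of_coeffs[OF g] that)
  qed
  moreover have "?m k = exp (alpha \<beta> \<eta> k * of_real t)" by (simp add: alpha_def algebra_simps)
  ultimately show ?thesis by (simp only: fourier_of_coeffs[OF g])
qed

lemma has_pdist_integral_coeff:
  assumes "has_pdist_integral G I a b"
  shows "set_integrable lborel {a..b} (\<lambda>t. fourier_coeff (G t) k)"
    "fourier_coeff I k = (LINT t:{a..b}|lborel. fourier_coeff (G t) k)"
  using assms ee_test[of "- k"] unfolding has_pdist_integral_def fourier_coeff_ee
  by (simp_all add: set_integral_divide_zero)

text \<open>The polynomial bound on the time integrals of the coefficients, together with the rapid
  decay of \<open>tc g\<close>, permits exchanging the Fourier sum and the time integral.\<close>

lemma has_pdist_integralI:
  assumes i: "\<And>k. set_integrable lborel {a..b} (\<lambda>t. fourier_coeff (G t) k)"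
    and I: "\<And>k. fourier_coeff I k = (LINT t:{a..b}|lborel. fourier_coeff (G t) k)"
    and bound: "\<And>k. (LINT t:{a..b}|lborel. cmod (fourier_coeff (G t) k)) \<le> C * (1 + \<bar>real_of_int k\<bar>) ^ N"
  shows "has_pdist_integral G I a b"
  unfolding has_pdist_integral_def
proof (intro ballI)
  fix g assume g: "g \<in> test_functions"
  let ?f = "\<lambda>k t. tc g k * fourier_coeff (G t) (- k)"
  have nn: "0 \<le> (LINT t:{a..b}|lborel. cmod (fourier_coeff (G t) k))" for k
    unfolding set_lebesgue_integral_def by (intro integral_nonneg_AE) auto
  have a1: "(\<lambda>k. LINT t:{a..b}|lborel. cmod (?f k t)) summable_on UNIV"
  proof (rule summable_on_comparison_test)
    show "(\<lambda>k. C * ((1 + \<bar>real_of_int k\<bar>) ^ N * cmod (tc g k))) summable_on UNIV"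
      by (intro summable_on_cmult_right tc_abs_sum g)
    fix k :: int
    have "(LINT t:{a..b}|lborel. cmod (?f k t)) = cmod (tc g k) * (LINT t:{a..b}|lborel. cmod (fourier_coeff (G t) (- k)))"
      by (simp add: norm_mult)
    also have "\<dots> \<le> cmod (tc g k) * (C * (1 + \<bar>real_of_int k\<bar>) ^ N)"
      using bound[of "- k"] by (intro mult_left_mono) auto
    finally show "(LINT t:{a..b}|lborel. cmod (?f k t)) \<le> C * ((1 + \<bar>real_of_int k\<bar>) ^ N * cmod (tc g k))"
      by (simp add: ac_simps)
    show "0 \<le> (LINT t:{a..b}|lborel. cmod (?f k t))"
      using nn[of "- k"] by (simp add: norm_mult)
  qed
  have a2: "set_integrable lborel {a..b} (?f k)" for k by (intro set_integrable_mult_right i)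
  have a3: "abs_sum (\<lambda>k. ?f k t)" for t by (rule abs_sum_tc_poly_growth[OF g poly_growth_fourier])
  note s = set_integral_infsum_int[where f = ?f, OF a2 a1 a3]
  have p: "pairing (G t) g = 2 * of_real pi * (\<Sum>\<^sub>\<infinity>k. ?f k t)" for t by (rule pairing_fourier[OF g])
  have "pairing I g = 2 * of_real pi * (\<Sum>\<^sub>\<infinity>k. LINT t:{a..b}|lborel. ?f k t)"
    unfolding pairing_fourier[OF g] I by simp
  also have "\<dots> = (LINT t:{a..b}|lborel. pairing (G t) g)" unfolding p using s(2) by simp
  finally show "set_integrable lborel {a..b} (\<lambda>t. pairing (G t) g) \<and>
      pairing I g = (LINT t:{a..b}|lborel. pairing (G t) g)"
    unfolding p using s(1) by simp
qed

subsection \<open>Square-summable families\<close>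

text \<open>For a nonnegative family this says that its l2 norm is at most \<open>M\<close>. Finite
  partial sums express summability and the bound together, and they pass to pointwise limits without
  further argument.\<close>

definition l2b :: "(int \<Rightarrow> real) \<Rightarrow> real \<Rightarrow> bool" where
  "l2b f M \<longleftrightarrow> (\<forall>F. finite F \<longrightarrow> L2_set f F \<le> M)"

lemma l2bD: "l2b f M \<Longrightarrow> finite F \<Longrightarrow> L2_set f F \<le> M"
  by (simp add: l2b_def)

lemma l2b_nonneg: "l2b f M \<Longrightarrow> 0 \<le> M"
  using l2bD[of f M "{}"] by simp

lemma l2b_mono: assumes "l2b g M" "\<And>k. 0 \<le> f k" "\<And>k. f k \<le> g k" shows "l2b f M"
  unfolding l2b_def
proof (intro allI impI)
  fix F :: "int set" assume "finite F"
  have "L2_set f F \<le> L2_set g F" using assms by (intro L2_set_mono) auto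
  also have "\<dots> \<le> M" using assms(1) \<open>finite F\<close> by (rule l2bD)
  finally show "L2_set f F \<le> M" .
qed

lemma l2b_cmult: assumes "l2b f M" "0 \<le> a" shows "l2b (\<lambda>k. a * f k) (a * M)"
  unfolding l2b_def L2_set_right_distrib[OF assms(2), symmetric]
  using assms by (intro allI impI mult_left_mono l2bD) auto

lemma l2b_le: "l2b f M \<Longrightarrow> M \<le> M' \<Longrightarrow> l2b f M'"
  unfolding l2b_def by (meson order.trans)

lemma l2b_add: assumes "l2b f M" "l2b g M'" shows "l2b (\<lambda>k. f k + g k) (M + M')"
  unfolding l2b_def
proof (intro allI impI)
  fix F :: "int set" assume F: "finite F"
  show "L2_set (\<lambda>k. f k + g k) F \<le> M + M'"
    using L2_set_triangle_ineq[of f g F] l2bD[OF assms(1) F] l2bD[OF assms(2) F] by linarith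
qed

lemma l2b_term: assumes "l2b f M" shows "f k \<le> M"
  using member_le_L2_set[of "{k}" k f] l2bD[OF assms, of "{k}"] by simp

lemma sum_sq_le_of_l2b: assumes "l2b f M" "finite F" shows "(\<Sum>k\<in>F. (f k)\<^sup>2) \<le> M\<^sup>2"
proof -
  have "(L2_set f F)\<^sup>2 \<le> M\<^sup>2" using l2bD[OF assms] by (intro power_mono) auto
  then show ?thesis by (simp add: L2_set_def sum_nonneg)
qed

lemma l2b_summable: assumes "l2b f M"
  shows "(\<lambda>k. (f k)\<^sup>2) summable_on UNIV" "sqrt (\<Sum>\<^sub>\<infinity>k. (f k)\<^sup>2) \<le> M"
proof -
  show s: "(\<lambda>k. (f k)\<^sup>2) summable_on UNIV"
  proof (rule nonneg_bdd_above_summable_on)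
    show "bdd_above (sum (\<lambda>k. (f k)\<^sup>2) ` {F. F \<subseteq> UNIV \<and> finite F})"
      using sum_sq_le_of_l2b[OF assms] by (intro bdd_aboveI2[where M = "M\<^sup>2"]) auto
  qed simp
  have "(\<Sum>\<^sub>\<infinity>k. (f k)\<^sup>2) \<le> M\<^sup>2"
    by (rule infsum_le_finite_sums[OF s]) (rule sum_sq_le_of_l2b[OF assms])
  then have "sqrt (\<Sum>\<^sub>\<infinity>k. (f k)\<^sup>2) \<le> sqrt (M\<^sup>2)" by (rule real_sqrt_le_mono)
  then show "sqrt (\<Sum>\<^sub>\<infinity>k. (f k)\<^sup>2) \<le> M" using l2b_nonneg[OF assms] by simp
qed

lemma l2b_of_summable: assumes "(\<lambda>k. (f k)\<^sup>2) summable_on UNIV"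
  shows "l2b f (sqrt (\<Sum>\<^sub>\<infinity>k. (f k)\<^sup>2))"
  unfolding l2b_def L2_set_def
  by (intro allI impI real_sqrt_le_mono finite_sum_le_infsum assms) auto

text \<open>The weight is distributed over the two factors by submultiplicativity, and
  Cauchy-Schwarz is applied to the sum over j. The result is a bound for each k, not an l2 bound in
  k.\<close>

lemma l2b_convolution:
  assumes W: "\<And>j. W j > 0" "\<And>j. W k \<le> P * W j * W (k - j)" and P: "0 \<le> P"
    and x: "l2b (\<lambda>j. W j * cmod (x j)) M1" and y: "l2b (\<lambda>j. W j * cmod (y j)) M2"
  shows "abs_sum (\<lambda>j. x j * y (k - j))" "W k * cmod (conv x y k) \<le> P * M1 * M2"
proof -
  have fin: "(\<Sum>j\<in>F. cmod (x j * y (k - j))) \<le> P * M1 * M2 / W k" if F: "finite F" for F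
  proof -
    have "W k * (\<Sum>j\<in>F. cmod (x j * y (k - j))) = (\<Sum>j\<in>F. W k * (cmod (x j) * cmod (y (k - j))))"
      by (simp add: sum_distrib_left norm_mult)
    also have "\<dots> \<le> (\<Sum>j\<in>F. P * W j * W (k - j) * (cmod (x j) * cmod (y (k - j))))"
      by (intro sum_mono mult_right_mono W) auto
    also have "\<dots> = P * (\<Sum>j\<in>F. \<bar>W j * cmod (x j)\<bar> * \<bar>W (k - j) * cmod (y (k - j))\<bar>)"
      using W(1) by (simp add: sum_distrib_left abs_mult ac_simps less_imp_le)
    also have "\<dots> \<le> P * (L2_set (\<lambda>j. W j * cmod (x j)) F * L2_set (\<lambda>j. W (k - j) * cmod (y (k - j))) F)"
      by (intro mult_left_mono L2_set_mult_ineq P)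
    also have "L2_set (\<lambda>j. W (k - j) * cmod (y (k - j))) F = L2_set (\<lambda>j. W j * cmod (y j)) ((\<lambda>j. k - j) ` F)"
      unfolding L2_set_def by (subst sum.reindex) (auto simp: inj_on_def)
    also have "P * (L2_set (\<lambda>j. W j * cmod (x j)) F * L2_set (\<lambda>j. W j * cmod (y j)) ((\<lambda>j. k - j) ` F)) \<le> P * (M1 * M2)"
      using F by (intro mult_left_mono mult_mono l2bD[OF x] l2bD[OF y] P l2b_nonneg[OF x]) auto
    finally show ?thesis using W(1)[of k] by (simp add: field_simps)
  qed
  show s: "abs_sum (\<lambda>j. x j * y (k - j))"
    by (rule nonneg_bdd_above_summable_on) (auto intro!: bdd_aboveI2 fin)
  have "cmod (conv x y k) \<le> (\<Sum>\<^sub>\<infinity>j. cmod (x j * y (k - j)))"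
    unfolding conv_def by (rule norm_infsum_bound[OF s])
  also have "\<dots> \<le> P * M1 * M2 / W k" by (rule infsum_le_finite_sums[OF s]) (rule fin)
  finally show "W k * cmod (conv x y k) \<le> P * M1 * M2" using W(1)[of k] by (simp add: field_simps)
qed

lemma conv_add_left:
  "abs_sum (\<lambda>j. x j * y (k - j)) \<Longrightarrow> abs_sum (\<lambda>j. x' j * y (k - j)) \<Longrightarrow>
   conv (\<lambda>j. x j + x' j) y k = conv x y k + conv x' y k"
  unfolding conv_def by (simp add: distrib_right infsum_add abs_summable_summable)

lemma conv_add_right:
  "abs_sum (\<lambda>j. x j * y (k - j)) \<Longrightarrow> abs_sum (\<lambda>j. x j * y' (k - j)) \<Longrightarrow>
   conv x (\<lambda>j. y j + y' j) k = conv x y k + conv x y' k"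
  unfolding conv_def by (simp add: distrib_left infsum_add abs_summable_summable)

lemma conv_scale: "conv (\<lambda>j. a * x j) (\<lambda>j. b * y j) k = a * b * conv x y k"
proof -
  have "(\<lambda>j. a * x j * (b * y (k - j))) = (\<lambda>j. (a * b) * (x j * y (k - j)))" by (simp add: fun_eq_iff ac_simps)
  then show ?thesis unfolding conv_def by (simp only: infsum_cmult_right')
qed

lemma conv_measurable:
  assumes "\<And>j. (\<lambda>t. c t j) \<in> borel_measurable borel" "\<And>j. (\<lambda>t. d t j) \<in> borel_measurable borel"
    and s: "\<And>t. abs_sum (\<lambda>j. c t j * d t (k - j))"
  shows "(\<lambda>t::real. conv (c t) (d t) k) \<in> borel_measurable borel"
proof -
  have "(\<lambda>t. conv (c t) (d t) k) = (\<lambda>t. \<Sum>n. c t (int_decode n) * d t (k - int_decode n))"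
    unfolding conv_def using infsum_int_decode(2)[OF s] by blast
  then show ?thesis using assms(1,2) by simp
qed

subsection \<open>Weights\<close>

definition J :: "int \<Rightarrow> real" where "J k = 1 + (of_int k)\<^sup>2"

lemma J_ge_1: "1 \<le> J k" and J_pos: "0 < J k"
  by (simp_all add: J_def add_pos_nonneg)

lemma J_Peetre: "J k \<le> 2 * J j * J (k - j)"
proof -
  have "J (a + b) \<le> 2 * J a * J b" for a b
  proof -
    have "2 * J a * J b - J (a + b) = 1 + (real_of_int a - of_int b)\<^sup>2 + 2 * (of_int a * of_int b)\<^sup>2"
      by (simp add: J_def power2_eq_square algebra_simps)
    then show ?thesis by (smt (verit) zero_le_power2)
  qed
  from this[of j "k - j"] show ?thesis by simp
qed

text \<open>The rate \<open>\<sigma> = 1\<close> belongs to the construction and to analyticity.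
  Uniqueness uses \<open>\<sigma> = 0\<close>, since an arbitrary solution is not known to carry an
  exponential weight.\<close>

definition wgt :: "real \<Rightarrow> real \<Rightarrow> real \<Rightarrow> int \<Rightarrow> real" where
  "wgt \<nu> \<sigma> t k = J k powr (\<nu> / 2) * exp (\<sigma> * t * \<bar>of_int k\<bar>)"

lemma wgt_pos: "0 < wgt \<nu> \<sigma> t k"
  using J_pos[of k] by (simp add: wgt_def)

lemma wgt_ge_1: assumes "0 \<le> \<nu>" "0 \<le> \<sigma>" "0 \<le> t" shows "1 \<le> wgt \<nu> \<sigma> t k"
proof -
  have "1 \<le> J k powr (\<nu> / 2)" using J_ge_1[of k] assms by (intro ge_one_powr_ge_zero) auto
  moreover have "1 \<le> exp (\<sigma> * t * \<bar>of_int k\<bar>)" using assms by simp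
  ultimately show ?thesis unfolding wgt_def using mult_mono[of 1 _ 1] by fastforce
qed

lemma wgt_submult: assumes "0 \<le> \<nu>" "0 \<le> \<sigma>" "0 \<le> t"
  shows "wgt \<nu> \<sigma> t k \<le> 2 powr (\<nu> / 2) * wgt \<nu> \<sigma> t j * wgt \<nu> \<sigma> t (k - j)"
proof -
  have "J k powr (\<nu> / 2) \<le> (2 * J j * J (k - j)) powr (\<nu> / 2)"
    using J_Peetre[of k j] J_pos[of k] assms by (intro powr_mono2) auto
  also have "\<dots> = 2 powr (\<nu> / 2) * J j powr (\<nu> / 2) * J (k - j) powr (\<nu> / 2)"
    using J_pos[of j] J_pos[of "k - j"] by (simp add: powr_mult)
  finally have 1: "J k powr (\<nu> / 2) \<le> 2 powr (\<nu> / 2) * J j powr (\<nu> / 2) * J (k - j) powr (\<nu> / 2)" .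
  have "\<sigma> * t * \<bar>real_of_int k\<bar> \<le> \<sigma> * t * (\<bar>of_int j\<bar> + \<bar>of_int (k - j)\<bar>)"
    using assms by (intro mult_left_mono) auto
  then have "exp (\<sigma> * t * \<bar>real_of_int k\<bar>) \<le> exp (\<sigma> * t * \<bar>of_int j\<bar>) * exp (\<sigma> * t * \<bar>of_int (k - j)\<bar>)"
    by (simp add: exp_add[symmetric] distrib_left)
  from mult_mono[OF 1 this] show ?thesis by (simp add: wgt_def ac_simps)
qed

text \<open>The growth of the weight between the times r and t is charged to the kernel, which
  absorbs it by its Gaussian decay.\<close>

lemma wgt_shift: "wgt \<nu> \<sigma> t k = wgt \<nu> \<sigma> r k * exp (\<sigma> * (t - r) * \<bar>of_int k\<bar>)"
  by (simp add: wgt_def exp_add[symmetric] algebra_simps)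

text \<open>Scaling by t reduces the integral to the Beta integral on the unit interval; both
  endpoint singularities are integrable as a, b < 1.\<close>

lemma beta_integral:
  fixes t a b :: real
  assumes "0 < t" "a < 1" "b < 1"
  shows "set_integrable lborel {0<..<t} (\<lambda>x. (t - x) powr - a * x powr - b)"
    "(LINT x:{0<..<t}|lborel. (t - x) powr - a * x powr - b) = Beta (1 - b) (1 - a) * t powr (1 - a - b)"
proof -
  define f where "f x = indicator {0<..<t} x * ((t - x) powr - a * x powr - b)" for x
  define g where "g x = indicator {0<..<1} x * (x powr - b * (1 - x) powr - a)" for x :: real
  have fg: "f (0 + t * x) = t powr (- a - b) * g x" for x
  proof (cases "x \<in> {0<..<1}")
    case True
    then have "t * x \<in> {0<..<t}" using assms(1) by simp
    moreover have "t - t * x = t * (1 - x)" by (simp add: algebra_simps)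
    ultimately show ?thesis using True assms(1)
      by (simp add: f_def g_def powr_mult powr_add[symmetric] ac_simps flip: powr_minus)
  next
    case False
    then have "t * x \<notin> {0<..<t}" using assms(1) by (auto simp: zero_less_mult_iff)
    then show ?thesis using False by (simp add: f_def g_def)
  qed
  let ?h = "\<lambda>x. x powr - b * (1 - x) powr - a"
  have nn: "0 \<le> ?h x" for x by simp
  have hi: "(?h has_integral Beta (1 - b) (1 - a)) {0<..<1}"
    using has_integral_Beta_real[of "1 - b" "1 - a"] assms by (simp add: has_integral_Icc_iff_Ioo)
  have ai: "?h absolutely_integrable_on {0<..<1}"
    by (rule nonnegative_absolutely_integrable_1) (use hi in \<open>auto simp: integrable_on_def\<close>)
  have gm: "g \<in> borel_measurable borel" unfolding g_def by measurable
  have gi: "integrable lborel g" "integral\<^sup>L lborel g = Beta (1 - b) (1 - a)"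
  proof -
    have "integrable lebesgue g" using ai unfolding set_integrable_def g_def by simp
    then show i: "integrable lborel g" using gm by (subst (asm) integrable_completion) auto
    then have "(g has_integral integral\<^sup>L lborel g) UNIV" by (rule has_integral_integral_lborel)
    moreover have "(g has_integral Beta (1 - b) (1 - a)) UNIV"
    proof -
      have "g = (\<lambda>x. if x \<in> {0<..<1} then ?h x else 0)" by (simp add: g_def fun_eq_iff indicator_def)
      then show ?thesis using hi by (simp only: has_integral_restrict_UNIV)
    qed
    ultimately show "integral\<^sup>L lborel g = Beta (1 - b) (1 - a)" by (rule has_integral_unique)
  qed
  have "integrable lborel (\<lambda>x. f (0 + t * x))" unfolding fg using gi(1) by simp
  then have fi: "integrable lborel f" using lborel_integrable_real_affine_iff[of t f 0] assms(1) by simp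
  then show "set_integrable lborel {0<..<t} (\<lambda>x. (t - x) powr - a * x powr - b)"
    by (simp add: set_integrable_def f_def[abs_def])
  have "integral\<^sup>L lborel f = t * integral\<^sup>L lborel (\<lambda>x. f (0 + t * x))"
    using lborel_integral_real_affine[of t f 0] assms(1) by simp
  also have "\<dots> = t * (t powr (- a - b) * Beta (1 - b) (1 - a))" unfolding fg using gi(2) by simp
  also have "\<dots> = Beta (1 - b) (1 - a) * t powr (1 - a - b)"
  proof -
    have "t powr (1 - a - b) = t powr (1 + (- a - b))" by (simp add: algebra_simps)
    then show ?thesis using assms(1) by (simp add: powr_add)
  qed
  finally show "(LINT x:{0<..<t}|lborel. (t - x) powr - a * x powr - b) = Beta (1 - b) (1 - a) * t powr (1 - a - b)"
    by (simp add: set_lebesgue_integral_def f_def[abs_def])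
qed

subsection \<open>The Duhamel integral\<close>

text \<open>The factor in front combines the minus sign of the integral equation with the multiplier
  of half the derivative, coming from u u_x = (u^2)_x / 2.\<close>

definition duhamel :: "(int \<Rightarrow> complex) \<Rightarrow> (real \<Rightarrow> int \<Rightarrow> complex) \<Rightarrow> (real \<Rightarrow> int \<Rightarrow> complex) \<Rightarrow> real \<Rightarrow> int \<Rightarrow> complex" where
  "duhamel al c d t k = - (\<i> * of_int k / 2) *
     (LINT r:{0<..<t}|lborel. exp (al k * of_real (t - r)) * conv (c r) (d r) k)"

text \<open>The class in which the bilinear estimate is iterated: \<open>t\<^sup>\<mu> e\<^sup>-\<^sup>\<lambda>\<^sup>t \<parallel>c t\<parallel>\<close> is bounded on \<open>(0,T)\<close>, in the
  norm with weight \<open>wgt \<nu> \<sigma> t\<close>.\<close>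

definition adm :: "real \<Rightarrow> real \<Rightarrow> real \<Rightarrow> real \<Rightarrow> real \<Rightarrow> (real \<Rightarrow> int \<Rightarrow> complex) \<Rightarrow> real \<Rightarrow> bool" where
  "adm \<mu> \<nu> \<sigma> l T c M \<longleftrightarrow> (\<forall>k. (\<lambda>t. indicator {0<..<T} t *\<^sub>R c t k) \<in> borel_measurable borel) \<and>
     (\<forall>t\<in>{0<..<T}. l2b (\<lambda>k. t powr \<mu> * exp (- l * t) * wgt \<nu> \<sigma> t k * cmod (c t k)) M)"

lemma adm_l2b: assumes "adm \<mu> \<nu> \<sigma> l T c M" "t \<in> {0<..<T}"
  shows "l2b (\<lambda>k. wgt \<nu> \<sigma> t k * cmod (c t k)) (t powr - \<mu> * exp (l * t) * M)"
proof -
  have "l2b (\<lambda>k. (t powr - \<mu> * exp (l * t)) * (t powr \<mu> * exp (- l * t) * wgt \<nu> \<sigma> t k * cmod (c t k)))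
      (t powr - \<mu> * exp (l * t) * M)"
    using assms unfolding adm_def by (intro l2b_cmult) auto
  moreover have "(t powr - \<mu> * exp (l * t)) * (t powr \<mu> * exp (- l * t) * x) = x" for x
  proof -
    have "t powr - \<mu> * t powr \<mu> = 1" using assms(2) by (simp flip: powr_add)
    moreover have "exp (l * t) * exp (- l * t) = 1" by (simp flip: exp_add)
    ultimately show ?thesis by (metis (no_types, opaque_lifting) mult.assoc mult.commute mult_1)
  qed
  ultimately show ?thesis by (simp only: mult.assoc)
qed

context
  fixes al :: "int \<Rightarrow> complex" and \<mu> \<nu> \<sigma> :: real
  assumes al: "\<And>k. Re (al k) \<le> 0" and mu: "0 \<le> \<mu>" "\<mu> < 1/4" and nu: "0 \<le> \<nu>" and sg: "0 \<le> \<sigma>"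
begin

text \<open>The singularities of the two factors multiply to r^(-2 mu). Only the second factor
  carries the rate \<open>l\<close>: in the uniqueness argument it is the difference of two
  solutions, multiplied by one of the solutions.\<close>

lemma adm_conv:
  assumes c: "adm \<mu> \<nu> \<sigma> 0 T c M1" and d: "adm \<mu> \<nu> \<sigma> l T d M2" and r: "r \<in> {0<..<T}"
  shows "abs_sum (\<lambda>j. c r j * d r (k - j))"
    "wgt \<nu> \<sigma> r k * cmod (conv (c r) (d r) k) \<le> 2 powr (\<nu> / 2) * M1 * M2 * exp (l * r) * r powr - (2 * \<mu>)"
proof -
  have r0: "0 \<le> r" "0 < r" using r by auto
  note l = l2b_convolution[where k = k, OF wgt_pos wgt_submult[OF nu sg r0(1)] _ adm_l2b[OF c r] adm_l2b[OF d r]]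
  show "abs_sum (\<lambda>j. c r j * d r (k - j))" by (rule l(1)) simp
  have "wgt \<nu> \<sigma> r k * cmod (conv (c r) (d r) k) \<le>
      2 powr (\<nu> / 2) * (r powr - \<mu> * exp (0 * r) * M1) * (r powr - \<mu> * exp (l * r) * M2)"
    by (rule l(2)) simp
  also have "\<dots> = 2 powr (\<nu> / 2) * M1 * M2 * exp (l * r) * (r powr - \<mu> * r powr - \<mu>)" by simp
  also have "r powr - \<mu> * r powr - \<mu> = r powr - (2 * \<mu>)" by (simp flip: powr_add)
  finally show "wgt \<nu> \<sigma> r k * cmod (conv (c r) (d r) k) \<le> 2 powr (\<nu> / 2) * M1 * M2 * exp (l * r) * r powr - (2 * \<mu>)" .
qed

lemma duhamel_integrable:
  assumes c: "adm \<mu> \<nu> \<sigma> 0 T c M1" and d: "adm \<mu> \<nu> \<sigma> l T d M2" and l: "0 \<le> l" and t: "0 \<le> t" "t \<le> T"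
  shows "set_integrable lborel {0<..<t} (\<lambda>r. exp (al k * of_real (t - r)) * conv (c r) (d r) k)"
proof (cases "t = 0")
  case False
  then have t0: "0 < t" using t by simp
  let ?f = "\<lambda>r. exp (al k * of_real (t - r)) * conv (c r) (d r) k"
  \<comment> \<open>Membership in \<open>adm\<close> gives measurability only after cutting off to
    (0, T), and only there are the convolutions known to converge. The cut-off curves have the same
    convolution on (0, t).\<close>
  let ?ct = "\<lambda>r j. indicator {0<..<T} r *\<^sub>R c r j" and ?dt = "\<lambda>r j. indicator {0<..<T} r *\<^sub>R d r j"
  have as: "abs_sum (\<lambda>j. ?ct r j * ?dt r (k - j))" for r
  proof (cases "r \<in> {0<..<T}")
    case True then show ?thesis using adm_conv(1)[OF c d True] by simp
  qed simp
  have m: "(\<lambda>r. conv (?ct r) (?dt r) k) \<in> borel_measurable borel"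
    by (rule conv_measurable) (use c d as in \<open>auto simp: adm_def\<close>)
  have eq: "indicator {0<..<t} r *\<^sub>R ?f r = indicator {0<..<t} r *\<^sub>R (exp (al k * of_real (t - r)) * conv (?ct r) (?dt r) k)" for r
    using t by (cases "r \<in> {0<..<t}") auto
  define C where "C = 2 powr (\<nu> / 2) * M1 * M2 * exp (l * T)"
  have M: "0 \<le> M1" "0 \<le> M2"
  proof -
    have "t / 2 \<in> {0<..<T}" using t t0 by auto
    then show "0 \<le> M1" "0 \<le> M2" using c d l2b_nonneg unfolding adm_def by blast+
  qed
  show ?thesis unfolding set_integrable_def
  proof (rule Bochner_Integration.integrable_bound)
    have "set_integrable lborel {0<..<t} (\<lambda>x. C * ((t - x) powr - 0 * x powr - (2 * \<mu>)))"
      using beta_integral(1)[of t 0 "2 * \<mu>"] t0 mu by simp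
    then show "integrable lborel (\<lambda>x. indicator {0<..<t} x *\<^sub>R (C * ((t - x) powr - 0 * x powr - (2 * \<mu>))))"
      unfolding set_integrable_def .
    show "(\<lambda>r. indicator {0<..<t} r *\<^sub>R ?f r) \<in> borel_measurable lborel"
      unfolding eq using m by measurable
    show "AE r in lborel. cmod (indicator {0<..<t} r *\<^sub>R ?f r) \<le>
        norm (indicator {0<..<t} r *\<^sub>R (C * ((t - r) powr - 0 * r powr - (2 * \<mu>))))"
    proof (rule AE_I2)
      fix r
      show "cmod (indicator {0<..<t} r *\<^sub>R ?f r) \<le>
        norm (indicator {0<..<t} r *\<^sub>R (C * ((t - r) powr - 0 * r powr - (2 * \<mu>))))"
      proof (cases "r \<in> {0<..<t}")
        case True
        then have r: "r \<in> {0<..<T}" "0 \<le> r" "r \<le> T" using t by auto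
        have e: "cmod (exp (al k * of_real (t - r))) \<le> 1"
          using al[of k] True by (simp add: mult_nonpos_nonneg)
        have "cmod (conv (c r) (d r) k) \<le> wgt \<nu> \<sigma> r k * cmod (conv (c r) (d r) k)"
          using mult_right_mono[OF wgt_ge_1[OF nu sg r(2), of k], of "cmod (conv (c r) (d r) k)"] by simp
        also have "\<dots> \<le> 2 powr (\<nu> / 2) * M1 * M2 * exp (l * r) * r powr - (2 * \<mu>)"
          by (rule adm_conv(2)[OF c d r(1)])
        also have "\<dots> \<le> C * r powr - (2 * \<mu>)"
          unfolding C_def using r l M by (intro mult_right_mono mult_left_mono) (auto intro: mult_left_mono)
        finally have "cmod (exp (al k * of_real (t - r))) * cmod (conv (c r) (d r) k) \<le> 1 * (C * r powr - (2 * \<mu>))"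
          using e by (intro mult_mono) auto
        moreover have "0 \<le> C" unfolding C_def using M by simp
        ultimately show ?thesis using True by (simp add: norm_mult)
      qed simp
    qed
  qed
qed (simp add: set_integrable_def)

text \<open>The common source of all bilinear estimates, with the kernel left abstract.
  \<open>V\<close> is an additional weight at the frequency k, \<open>a\<close> the singularity
  allowed in time, and \<open>g\<close> the factor whose l2 norm in k is taken later;
  \<open>l\<close> is 0 except in the uniqueness argument.\<close>

lemma duhamel_bound:
  assumes c: "adm \<mu> \<nu> \<sigma> 0 T c M1" and d: "adm \<mu> \<nu> \<sigma> l T d M2" and l: "0 \<le> l"
    and t: "0 < t" "t \<le> T" and T: "T \<le> 1" and a: "a < 1" and K: "0 \<le> K" and V: "0 \<le> V" and M: "0 \<le> M1" "0 \<le> M2"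
    and ker: "\<And>\<tau>. 0 < \<tau> \<Longrightarrow> \<tau> \<le> 1 \<Longrightarrow>
      V * \<bar>of_int k\<bar> * exp (Re (al k) * \<tau>) * exp (\<sigma> * \<tau> * \<bar>of_int k\<bar>) * exp (- l * \<tau>) \<le> K * \<tau> powr - a * g"
  shows "V * exp (- l * t) * wgt \<nu> \<sigma> t k * cmod (duhamel al c d t k) \<le>
     K * 2 powr (\<nu> / 2) * Beta (1 - 2 * \<mu>) (1 - a) * g * M1 * M2 * t powr (1 - a - 2 * \<mu>)"
proof -
  let ?f = "\<lambda>r. exp (al k * of_real (t - r)) * conv (c r) (d r) k"
  define A where "A = V * exp (- l * t) * wgt \<nu> \<sigma> t k * (\<bar>of_int k\<bar> / 2)"
  have A: "0 \<le> A" unfolding A_def using V wgt_pos[of \<nu> \<sigma> t k] by simp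
  define C where "C = K * g * (2 powr (\<nu> / 2) * M1 * M2)"
  \<comment> \<open>The sign is read off from \<open>ker\<close> at time 1.\<close>
  have g: "0 \<le> K * g"
  proof -
    have "0 \<le> V * \<bar>of_int k\<bar> * exp (Re (al k) * 1) * exp (\<sigma> * 1 * \<bar>of_int k\<bar>) * exp (- l * 1)" using V by simp
    also have "\<dots> \<le> K * 1 powr - a * g" by (rule ker) auto
    finally show ?thesis by simp
  qed
  have i: "set_integrable lborel {0<..<t} ?f" using duhamel_integrable[OF c d l] t by simp
  have pt: "A * cmod (?f r) \<le> C * ((t - r) powr - a * r powr - (2 * \<mu>))" if r: "r \<in> {0<..<t}" for r
  proof -
    have rT: "r \<in> {0<..<T}" using r t by auto
    have n: "cmod (exp (al k * of_real (t - r))) = exp (Re (al k) * (t - r))" by simp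
    define X where "X = V * \<bar>of_int k\<bar> * exp (Re (al k) * (t - r)) * exp (\<sigma> * (t - r) * \<bar>of_int k\<bar>) * exp (- l * (t - r))"
    define Y where "Y = wgt \<nu> \<sigma> r k * cmod (conv (c r) (d r) k)"
    have X: "0 \<le> X" "X \<le> K * (t - r) powr - a * g"
      unfolding X_def using V ker[of "t - r"] r t T by auto
    have Y: "0 \<le> Y" "Y \<le> 2 powr (\<nu> / 2) * M1 * M2 * exp (l * r) * r powr - (2 * \<mu>)"
      unfolding Y_def using adm_conv(2)[OF c d rT] wgt_pos[of \<nu> \<sigma> r k] by auto
    \<comment> \<open>The damping is split as well: the part over t - r goes to the kernel and the
      part over r cancels the growth of the second factor.\<close>
    have ee: "exp (- l * t) = exp (- l * (t - r)) * exp (- l * r)" by (simp flip: exp_add add: algebra_simps)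
    have "A * cmod (?f r) = X / 2 * (exp (- l * r) * Y)"
      unfolding A_def X_def Y_def norm_mult n wgt_shift[of \<nu> \<sigma> t k r] ee by simp
    also have "\<dots> \<le> X * (exp (- l * r) * Y)"
      using X Y by (intro mult_right_mono) auto
    also have "\<dots> \<le> (K * (t - r) powr - a * g) * (exp (- l * r) * (2 powr (\<nu> / 2) * M1 * M2 * exp (l * r) * r powr - (2 * \<mu>)))"
      using X Y by (intro mult_mono mult_left_mono) (auto intro: order.trans[OF X])
    also have "\<dots> = C * ((t - r) powr - a * r powr - (2 * \<mu>)) * (exp (- l * r) * exp (l * r))" by (simp add: C_def)
    also have "exp (- l * r) * exp (l * r) = 1" by (simp flip: exp_add)
    finally show ?thesis by simp
  qed
  have bi: "set_integrable lborel {0<..<t} (\<lambda>r. (t - r) powr - a * r powr - (2 * \<mu>))"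
    using beta_integral(1)[of t a "2 * \<mu>"] t a mu by simp
  have "V * exp (- l * t) * wgt \<nu> \<sigma> t k * cmod (duhamel al c d t k) = A * cmod (LINT r:{0<..<t}|lborel. ?f r)"
    by (simp add: duhamel_def A_def norm_mult)
  also have "\<dots> \<le> A * (LINT r:{0<..<t}|lborel. cmod (?f r))"
    by (intro mult_left_mono set_integral_norm_bound i A)
  also have "\<dots> = (LINT r:{0<..<t}|lborel. A * cmod (?f r))" by simp
  also have "\<dots> \<le> (LINT r:{0<..<t}|lborel. C * ((t - r) powr - a * r powr - (2 * \<mu>)))"
    by (intro set_integral_mono set_integrable_mult_right set_integrable_norm i bi pt)
  also have "\<dots> = C * (Beta (1 - 2 * \<mu>) (1 - a) * t powr (1 - a - 2 * \<mu>))"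
    using beta_integral(2)[of t a "2 * \<mu>"] t a mu by simp
  finally show ?thesis by (simp add: C_def ac_simps)
qed

text \<open>The factor exp (al k t) is taken out of the integral. The remaining integrand does not
  depend on t, so the claim reduces to the continuity of an indefinite integral; for fixed k the
  factor exp (- al k r) is bounded on [0, T].\<close>

lemma duhamel_continuous:
  assumes c: "adm \<mu> \<nu> \<sigma> 0 T c M1" and d: "adm \<mu> \<nu> \<sigma> l T d M2" and l: "0 \<le> l" and T: "0 < T"
  shows "continuous_on {0..T} (\<lambda>t. duhamel al c d t k)"
proof -
  let ?h = "\<lambda>r. exp (- al k * of_real r) * conv (c r) (d r) k"
  have h: "set_integrable lborel {0<..<t} ?h" if "0 \<le> t" "t \<le> T" for t
  proof -
    have 1: "set_integrable lborel {0<..<t} (\<lambda>r. exp (- al k * of_real t) * (exp (al k * of_real (t - r)) * conv (c r) (d r) k))"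
      by (intro set_integrable_mult_right duhamel_integrable[OF c d l] that)
    have 2: "exp (- al k * of_real t) * (exp (al k * of_real (t - r)) * x) = exp (- al k * of_real r) * x" for r x
      by (simp add: algebra_simps exp_add[symmetric] flip: mult.assoc)
    show ?thesis using 1 unfolding 2 .
  qed
  have eq: "duhamel al c d t k = - (\<i> * of_int k / 2) * (exp (al k * of_real t) * integral {0..t} ?h)" if t: "t \<in> {0..T}" for t
  proof -
    have "(LINT r:{0<..<t}|lborel. exp (al k * of_real (t - r)) * conv (c r) (d r) k) =
        (LINT r:{0<..<t}|lborel. exp (al k * of_real t) * ?h r)"
    proof -
      have "exp (al k * of_real (t - r)) * x = exp (al k * of_real t) * (exp (- al k * of_real r) * x)" for r x
        by (simp add: algebra_simps exp_add[symmetric] flip: mult.assoc)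
      then show ?thesis by (simp only:)
    qed
    also have "\<dots> = exp (al k * of_real t) * (LINT r:{0<..<t}|lborel. ?h r)" by (rule set_integral_mult_right)
    also have "(LINT r:{0<..<t}|lborel. ?h r) = integral {0<..<t} ?h"
      using t by (intro set_borel_integral_eq_integral(2) h) auto
    also have "\<dots> = integral {0..t} ?h" by (rule integral_open_interval_real[symmetric])
    finally show ?thesis by (simp add: duhamel_def)
  qed
  have "?h integrable_on {0<..<T}" using T by (intro set_borel_integral_eq_integral(1) h) auto
  then have "?h integrable_on {0..T}" by (simp add: integrable_on_open_interval_real)
  then have "continuous_on {0..T} (\<lambda>t. integral {0..t} ?h)" by (rule indefinite_integral_continuous_1)
  then have "continuous_on {0..T} (\<lambda>t. - (\<i> * of_int k / 2) * (exp (al k * of_real t) * integral {0..t} ?h))"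
    by (intro continuous_intros)
  then show ?thesis by (rule continuous_on_eq) (rule eq[symmetric])
qed

lemma duhamel_add_left:
  assumes c: "adm \<mu> \<nu> \<sigma> 0 T c M1" "adm \<mu> \<nu> \<sigma> 0 T c' M1'" and d: "adm \<mu> \<nu> \<sigma> l T d M2" and l: "0 \<le> l"
    and t: "0 \<le> t" "t \<le> T"
  shows "duhamel al (\<lambda>t k. c t k + c' t k) d t k = duhamel al c d t k + duhamel al c' d t k"
proof -
  have "(LINT r:{0<..<t}|lborel. exp (al k * of_real (t - r)) * conv (\<lambda>j. c r j + c' r j) (d r) k) =
     (LINT r:{0<..<t}|lborel. exp (al k * of_real (t - r)) * conv (c r) (d r) k +
        exp (al k * of_real (t - r)) * conv (c' r) (d r) k)"
    using t adm_conv(1)[OF c(1) d] adm_conv(1)[OF c(2) d]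
    by (intro set_lebesgue_integral_cong) (auto simp: conv_add_left distrib_left)
  also have "\<dots> = (LINT r:{0<..<t}|lborel. exp (al k * of_real (t - r)) * conv (c r) (d r) k) +
      (LINT r:{0<..<t}|lborel. exp (al k * of_real (t - r)) * conv (c' r) (d r) k)"
    by (intro set_integral_add(2) duhamel_integrable[OF c(1) d l t] duhamel_integrable[OF c(2) d l t])
  finally show ?thesis by (simp add: duhamel_def distrib_left)
qed

lemma duhamel_add_right:
  assumes c: "adm \<mu> \<nu> \<sigma> 0 T c M1" and d: "adm \<mu> \<nu> \<sigma> l T d M2" "adm \<mu> \<nu> \<sigma> l T d' M2'" and l: "0 \<le> l"
    and t: "0 \<le> t" "t \<le> T"
  shows "duhamel al c (\<lambda>t k. d t k + d' t k) t k = duhamel al c d t k + duhamel al c d' t k"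
proof -
  have "(LINT r:{0<..<t}|lborel. exp (al k * of_real (t - r)) * conv (c r) (\<lambda>j. d r j + d' r j) k) =
     (LINT r:{0<..<t}|lborel. exp (al k * of_real (t - r)) * conv (c r) (d r) k +
        exp (al k * of_real (t - r)) * conv (c r) (d' r) k)"
    using t adm_conv(1)[OF c d(1)] adm_conv(1)[OF c d(2)]
    by (intro set_lebesgue_integral_cong) (auto simp: conv_add_right distrib_left)
  also have "\<dots> = (LINT r:{0<..<t}|lborel. exp (al k * of_real (t - r)) * conv (c r) (d r) k) +
      (LINT r:{0<..<t}|lborel. exp (al k * of_real (t - r)) * conv (c r) (d' r) k)"
    by (intro set_integral_add(2) duhamel_integrable[OF c d(1) l t] duhamel_integrable[OF c d(2) l t])
  finally show ?thesis by (simp add: duhamel_def distrib_left)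
qed

end

lemma duhamel_scale: "duhamel al (\<lambda>t k. a * c t k) (\<lambda>t k. b * d t k) t k = a * b * duhamel al c d t k"
proof -
  have "(LINT r:{0<..<t}|lborel. exp (al k * of_real (t - r)) * conv (\<lambda>j. a * c r j) (\<lambda>j. b * d r j) k) =
    (LINT r:{0<..<t}|lborel. (a * b) * (exp (al k * of_real (t - r)) * conv (c r) (d r) k))"
    unfolding conv_scale by (simp only: ac_simps)
  then show ?thesis by (simp add: duhamel_def)
qed

lemma duhamel_cong: assumes "\<And>r j. r \<in> {0<..<t} \<Longrightarrow> c r j = c' r j \<and> d r j = d' r j"
  shows "duhamel al c d t k = duhamel al c' d' t k"
proof -
  have "(LINT r:{0<..<t}|lborel. exp (al k * of_real (t - r)) * conv (c r) (d r) k) =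
    (LINT r:{0<..<t}|lborel. exp (al k * of_real (t - r)) * conv (c' r) (d' r) k)"
    using assms by (intro set_lebesgue_integral_cong) (auto simp: conv_def)
  then show ?thesis by (simp add: duhamel_def)
qed

subsection \<open>A Banach space of curves\<close>

text \<open>Bounded curves in l2 with measurable coefficients. The norm takes the supremum over
  every t and not an essential supremum, so no quotient has to be formed; the time weights enter
  through \<open>enc\<close> and \<open>dec\<close>.\<close>

typedef l2curve = "{z :: real \<Rightarrow> int \<Rightarrow> complex. (\<forall>k. (\<lambda>t. z t k) \<in> borel_measurable borel) \<and>
    (\<exists>M. \<forall>t. l2b (\<lambda>k. cmod (z t k)) M)}"
  morphisms curve Abs_l2curve
  by (rule exI[of _ "\<lambda>t k. 0"]) (auto simp: l2b_def L2_set_def)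

setup_lifting type_definition_l2curve

lemma curve_measurable: "(\<lambda>t. curve z t k) \<in> borel_measurable borel"
  using curve[of z] by simp

lemma l2b_triangle: assumes "l2b (\<lambda>k. cmod (x k)) M" "l2b (\<lambda>k. cmod (y k)) M'"
  shows "l2b (\<lambda>k. cmod (x k + y k)) (M + M')"
  by (rule l2b_mono[OF l2b_add[OF assms]]) (auto intro: norm_triangle_ineq)

lemma l2b_scale: assumes "l2b (\<lambda>k. cmod (x k)) M" shows "l2b (\<lambda>k. cmod (a * x k)) (cmod a * M)"
  using l2b_cmult[OF assms, of "cmod a"] by (simp add: norm_mult)

instantiation l2curve :: real_vector
begin

lift_definition zero_l2curve :: l2curve is "\<lambda>t k. 0" by (auto simp: l2b_def L2_set_def)

lift_definition plus_l2curve :: "l2curve \<Rightarrow> l2curve \<Rightarrow> l2curve" is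
  "\<lambda>(x :: real \<Rightarrow> int \<Rightarrow> complex) y t k. x t k + y t k"
proof (rule conjI, goal_cases)
  case (1 x y) then show ?case by (elim conjE, intro allI borel_measurable_add) (rule spec, assumption)+
next
  case (2 x y)
  then obtain M M' where "\<And>t. l2b (\<lambda>k. cmod (x t k)) M" "\<And>t. l2b (\<lambda>k. cmod (y t k)) M'" by blast
  then show ?case using l2b_triangle by blast
qed

lift_definition scaleR_l2curve :: "real \<Rightarrow> l2curve \<Rightarrow> l2curve" is "\<lambda>a x t k. of_real a * x t k"
proof (rule conjI, goal_cases)
  case (1 a x)
  then show ?case by (elim conjE, intro allI borel_measurable_times borel_measurable_const) (rule spec, assumption)
next
  case (2 a x)
  then obtain M where "\<And>t. l2b (\<lambda>k. cmod (x t k)) M" by blast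
  then show ?case using l2b_scale by blast
qed

definition uminus_l2curve :: "l2curve \<Rightarrow> l2curve" where "uminus_l2curve x = (-1) *\<^sub>R x"

definition minus_l2curve :: "l2curve \<Rightarrow> l2curve \<Rightarrow> l2curve" where "minus_l2curve x y = x + - y"

instance
proof
  fix a b c :: l2curve and r q :: real
  show "a + b + c = a + (b + c)" by transfer (simp add: add.assoc)
  show "a + b = b + a" by transfer (simp add: add.commute)
  show "0 + a = a" by transfer simp
  show "- a + a = 0" unfolding uminus_l2curve_def by transfer simp
  show "a - b = a + - b" by (simp add: minus_l2curve_def)
  show "r *\<^sub>R (a + b) = r *\<^sub>R a + r *\<^sub>R b" by transfer (simp add: distrib_left)
  show "(r + q) *\<^sub>R a = r *\<^sub>R a + q *\<^sub>R a" by transfer (simp add: distrib_right)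
  show "r *\<^sub>R q *\<^sub>R a = (r * q) *\<^sub>R a" by transfer (simp add: mult.assoc)
  show "1 *\<^sub>R a = a" by transfer simp
qed

end

lemma curve_add: "curve (x + y) t k = curve x t k + curve y t k" by (simp add: plus_l2curve.rep_eq)
lemma curve_scaleR: "curve (a *\<^sub>R x) t k = of_real a * curve x t k" by (simp add: scaleR_l2curve.rep_eq)
lemma curve_zero: "curve 0 t k = 0" by (simp add: zero_l2curve.rep_eq)
lemma curve_diff: "curve (x - y) t k = curve x t k - curve y t k"
  unfolding minus_l2curve_def uminus_l2curve_def curve_add curve_scaleR by simp

instantiation l2curve :: real_normed_vector
begin

definition norm_l2curve :: "l2curve \<Rightarrow> real" where
  "norm_l2curve z = (SUP (t, F)\<in>UNIV \<times> {F. finite F}. L2_set (\<lambda>k. cmod (curve z t k)) F)"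

definition dist_l2curve :: "l2curve \<Rightarrow> l2curve \<Rightarrow> real" where "dist_l2curve x y = norm (x - y)"
definition sgn_l2curve :: "l2curve \<Rightarrow> l2curve" where "sgn_l2curve x = inverse (norm x) *\<^sub>R x"
definition uniformity_l2curve :: "(l2curve \<times> l2curve) filter" where
  "uniformity_l2curve = (INF e\<in>{0 <..}. principal {(x, y). dist x y < e})"
definition open_l2curve :: "l2curve set \<Rightarrow> bool" where
  "open_l2curve U \<longleftrightarrow> (\<forall>x\<in>U. eventually (\<lambda>(x', y). x' = x \<longrightarrow> y \<in> U) uniformity)"

lemma l2b_curve_aux: "l2b (\<lambda>k. cmod (curve z t k)) (norm z)"
  unfolding l2b_def
proof (intro allI impI)
  fix F :: "int set" assume F: "finite F"
  obtain M where M: "\<And>t. l2b (\<lambda>k. cmod (curve z t k)) M" using curve[of z] by auto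
  show "L2_set (\<lambda>k. cmod (curve z t k)) F \<le> norm z"
    unfolding norm_l2curve_def
    by (rule cSUP_upper2[where x = "(t, F)"]) (use F l2bD[OF M] in \<open>auto intro!: bdd_aboveI2\<close>)
qed

lemma norm_l2curve_le_aux: assumes "\<And>t. l2b (\<lambda>k. cmod (curve z t k)) M" shows "norm z \<le> M"
  unfolding norm_l2curve_def by (rule cSUP_least) (use l2bD[OF assms] in auto)

instance
proof
  fix x y :: l2curve and a :: real and U :: "l2curve set"
  show "dist x y = norm (x - y)" by (simp add: dist_l2curve_def)
  show "sgn x = inverse (norm x) *\<^sub>R x" by (simp add: sgn_l2curve_def)
  show "uniformity = (INF e\<in>{0 <..}. principal {(x :: l2curve, y). dist x y < e})"
    by (simp add: uniformity_l2curve_def)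
  show "open U = (\<forall>x\<in>U. eventually (\<lambda>(x', y). x' = x \<longrightarrow> y \<in> U) uniformity)"
    by (simp add: open_l2curve_def)
  show "norm (x + y) \<le> norm x + norm y"
    by (rule norm_l2curve_le_aux) (simp add: curve_add l2b_triangle l2b_curve_aux)
  have le: "norm (a *\<^sub>R x) \<le> \<bar>a\<bar> * norm x" for a and x :: l2curve
    using l2b_scale[OF l2b_curve_aux[of x], of "of_real a"] by (intro norm_l2curve_le_aux) (simp add: curve_scaleR)
  show "norm (a *\<^sub>R x) = \<bar>a\<bar> * norm x"
  proof (cases "a = 0")
    case True
    have "0 \<le> norm (a *\<^sub>R x)" by (rule l2b_nonneg[OF l2b_curve_aux])
    then show ?thesis using le[of a x] True by simp
  next
    case False
    have "\<bar>a\<bar> * norm x = \<bar>a\<bar> * norm (inverse a *\<^sub>R (a *\<^sub>R x))" using False by simp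
    also have "\<dots> \<le> \<bar>a\<bar> * (\<bar>inverse a\<bar> * norm (a *\<^sub>R x))" by (intro mult_left_mono le) auto
    also have "\<dots> = norm (a *\<^sub>R x)" using False by (simp add: abs_mult[symmetric] flip: mult.assoc)
    finally show ?thesis using le[of a x] by simp
  qed
  show "norm x = 0 \<longleftrightarrow> x = 0"
  proof
    assume 0: "norm x = 0"
    have "curve x t k = 0" for t k using l2b_term[OF l2b_curve_aux[of x t], of k] 0 by simp
    then show "x = 0" by (simp add: curve_inject[symmetric] fun_eq_iff curve_zero)
  next
    assume "x = 0"
    then have "norm x \<le> 0" by (intro norm_l2curve_le_aux) (simp add: curve_zero l2b_def L2_set_def)
    then show "norm x = 0" using l2b_nonneg[OF l2b_curve_aux[of x]] by simp
  qed
qed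

end

lemmas l2b_curve = l2b_curve_aux and norm_l2curve_le = norm_l2curve_le_aux

lemma norm_curve_le: "cmod (curve z t k) \<le> norm z"
  by (rule l2b_term[OF l2b_curve])

text \<open>A form of Fatou's lemma: each finite partial norm passes to the coefficientwise limit.
  Completeness of \<open>l2curve\<close> rests on it.\<close>

lemma l2b_limit:
  assumes "\<And>k. (\<lambda>n. x n k) \<longlonglongrightarrow> y k" "\<And>n. n \<ge> N \<Longrightarrow> l2b (\<lambda>k. cmod (x n k)) M"
  shows "l2b (\<lambda>k. cmod (y k)) M"
  unfolding l2b_def
proof (intro allI impI)
  fix F :: "int set" assume F: "finite F"
  have "(\<lambda>n. L2_set (\<lambda>k. cmod (x n k)) F) \<longlonglongrightarrow> L2_set (\<lambda>k. cmod (y k)) F"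
    unfolding L2_set_def by (intro tendsto_intros assms)
  then show "L2_set (\<lambda>k. cmod (y k)) F \<le> M"
    by (rule LIMSEQ_le_const2) (use l2bD[OF assms(2) F] in blast)
qed

instance l2curve :: banach
proof
  fix X :: "nat \<Rightarrow> l2curve" assume X: "Cauchy X"
  have "Cauchy (\<lambda>n. curve (X n) t k)" for t k
  proof (rule CauchyI)
    fix e :: real assume "0 < e"
    then obtain N where N: "\<And>m n. m \<ge> N \<Longrightarrow> n \<ge> N \<Longrightarrow> norm (X m - X n) < e" using CauchyD[OF X] by metis
    have "cmod (curve (X m) t k - curve (X n) t k) < e" if "m \<ge> N" "n \<ge> N" for m n
      using norm_curve_le[of "X m - X n" t k] N[OF that] by (simp add: curve_diff)
    then show "\<exists>N. \<forall>m\<ge>N. \<forall>n\<ge>N. cmod (curve (X m) t k - curve (X n) t k) < e" by blast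
  qed
  then have "\<exists>l. (\<lambda>n. curve (X n) t k) \<longlonglongrightarrow> l" for t k
    using Cauchy_convergent_iff convergent_def by blast
  then obtain z where z: "\<And>t k. (\<lambda>n. curve (X n) t k) \<longlonglongrightarrow> z t k" by metis
  obtain B where B: "\<And>n. norm (X n) \<le> B"
    using cauchy_imp_bounded[OF X] unfolding bounded_iff by auto
  have zm: "(\<lambda>t. z t k) \<in> borel_measurable borel" for k
    by (rule borel_measurable_LIMSEQ_metric[OF curve_measurable z])
  have zb: "l2b (\<lambda>k. cmod (z t k)) B" for t
    by (rule l2b_limit[OF z, of 0]) (rule l2b_le[OF l2b_curve B])
  have cz: "curve (Abs_l2curve z) = z"
    by (rule Abs_l2curve_inverse) (use zm zb in blast)
  have "X \<longlonglongrightarrow> Abs_l2curve z"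
  proof (rule LIMSEQ_I)
    fix e :: real assume e: "0 < e"
    then have "0 < e / 2" by simp
    then obtain N where N: "\<And>m n. m \<ge> N \<Longrightarrow> n \<ge> N \<Longrightarrow> norm (X m - X n) < e / 2" using CauchyD[OF X] by metis
    have "norm (X n - Abs_l2curve z) < e" if n: "n \<ge> N" for n
    proof -
      have "norm (X n - Abs_l2curve z) \<le> e / 2"
      proof (rule norm_l2curve_le)
        fix t
        have lim: "(\<lambda>m. curve (X n - X m) t k) \<longlonglongrightarrow> curve (X n - Abs_l2curve z) t k" for k
          unfolding curve_diff cz by (intro tendsto_intros z)
        show "l2b (\<lambda>k. cmod (curve (X n - Abs_l2curve z) t k)) (e / 2)"
          by (rule l2b_limit[OF lim, of N]) (rule l2b_le[OF l2b_curve less_imp_le[OF N[OF n]]])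
      qed
      then show ?thesis using e by simp
    qed
    then show "\<exists>N. \<forall>n\<ge>N. norm (X n - Abs_l2curve z) < e" by blast
  qed
  then show "convergent X" by (rule convergentI)
qed

subsection \<open>Kernel estimates\<close>

text \<open>The maximum is attained at x = p / c, which explains the constant; the factor exp (- p)
  of the sharp bound is dropped.\<close>

lemma powr_exp_bound:
  fixes p c x :: real
  assumes "0 < p" "0 < c" "0 < x" shows "x powr p * exp (- c * x) \<le> (p / c) powr p"
proof -
  have "ln (c * x / p) \<le> c * x / p - 1"
  proof -
    have "0 < c * x / p" using assms by (intro divide_pos_pos mult_pos_pos)
    then show ?thesis using exp_ge_add_one_self[of "ln (c * x / p)"] by simp
  qed
  moreover have "ln x = ln (p / c) + ln (c * x / p)" using assms by (simp add: ln_mult ln_div)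
  ultimately have "ln x \<le> ln (p / c) + c * x / p" by simp
  then have "p * ln x \<le> p * (ln (p / c) + c * x / p)" using assms by (intro mult_left_mono) auto
  also have "\<dots> = p * ln (p / c) + c * x" using assms by (simp add: distrib_left)
  finally have "exp (p * ln x + - c * x) \<le> exp (p * ln (p / c))" by simp
  then show ?thesis using assms unfolding exp_add by (simp add: powr_def)
qed

lemma conv_commute: "conv x y k = conv y x k"
proof -
  have bij: "bij (\<lambda>j. k - j :: int)" by (rule bij_betw_byWitness[where f' = "\<lambda>j. k - j"]) auto
  show ?thesis unfolding conv_def
    using infsum_reindex_bij_betw[OF bij, of "\<lambda>j. x j * y (k - j)"] by (simp add: mult.commute)
qed

lemma duhamel_commute: "duhamel al c d = duhamel al d c"
  by (simp add: duhamel_def fun_eq_iff conv_commute[of "c _"])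

locale bo_burgers =
  fixes \<beta> \<eta> s :: real
  assumes eta: "0 < \<eta>" and s: "- 1 / 2 < s"
begin

definition \<nu> :: real where "\<nu> = max s 0"
definition \<mu> :: real where "\<mu> = max (- s) 0 / 2"
text \<open>\<open>\<bar>k\<bar> e\<^sup>-\<^sup>c\<^sup>t\<^sup>k\<^sup>2 \<le> C t\<^sup>-\<^sup>a\<^sup>0 \<bar>k\<bar>\<^sup>1\<^sup>-\<^sup>2\<^sup>a\<^sup>0\<close>, where \<open>a0 > 3/4\<close> makes the last factor square summable and
  \<open>a0 + \<mu> < 1\<close> leaves the power \<open>t\<^sup>\<theta>\<close>, \<open>\<theta> = 1 - a0 - \<mu>\<close>, after integration in time.\<close>

definition a0 :: real where "a0 = 7/8 - \<mu> / 2"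
definition \<theta> :: real where "\<theta> = 1/8 - \<mu> / 2"
definition al :: "int \<Rightarrow> complex" where "al = alpha \<beta> \<eta>"
definition gk :: "int \<Rightarrow> real" where "gk k = (if k = 0 then 0 else \<bar>of_int k\<bar> powr (1 - 2 * a0))"
definition C1 :: real where "C1 = exp ((\<eta> + 1)\<^sup>2 / (2 * \<eta>))"

lemma nu: "0 \<le> \<nu>" and mu: "0 \<le> \<mu>" "\<mu> < 1/4" and theta: "0 < \<theta>" and nu_mu: "\<nu> / 2 = s / 2 + \<mu>"
  using s by (auto simp: \<nu>_def \<mu>_def \<theta>_def max_def)

lemma al_Re: "Re (al k) = - symbol_p \<eta> k" "Re (al k) \<le> 0"
  using symbol_p_nonneg[OF eta, of k] by (simp_all add: al_def alpha_def)

lemma C1_ge_1: "1 \<le> C1" using eta by (simp add: C1_def)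

text \<open>The linear terms eta |k| of the symbol and sigma |k| of the weight are absorbed into
  half of eta k^2. The square (eta |k| - (eta + 1))^2 yields the maximum (eta + 1)^2 / (2 eta) of
  what is left over, and \<open>C1\<close> is its exponential.\<close>

lemma semigroup_bound: assumes "0 \<le> \<tau>" "\<tau> \<le> 1" "0 \<le> \<sigma>" "\<sigma> \<le> 1"
  shows "exp (Re (al k) * \<tau>) * exp (\<sigma> * \<tau> * \<bar>of_int k\<bar>) \<le> C1 * exp (- (\<eta> / 2) * (\<tau> * (of_int k)\<^sup>2))"
proof -
  let ?x = "\<bar>real_of_int k\<bar>"
  have "0 \<le> (\<eta> * ?x - (\<eta> + 1))\<^sup>2" by simp
  then have "2 * \<eta> * ((\<eta> + 1) * ?x) \<le> 2 * \<eta> * ((\<eta> / 2) * ?x\<^sup>2) + (\<eta> + 1)\<^sup>2"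
    by (simp add: power2_eq_square algebra_simps)
  then have q: "(\<eta> + 1) * ?x \<le> (\<eta> / 2) * ?x\<^sup>2 + (\<eta> + 1)\<^sup>2 / (2 * \<eta>)"
    using eta by (simp add: field_simps)
  have "\<sigma> * ?x \<le> 1 * ?x" using assms by (intro mult_right_mono) auto
  then have "- \<eta> * (?x\<^sup>2 - ?x) + \<sigma> * ?x \<le> - (\<eta> / 2) * ?x\<^sup>2 + (\<eta> + 1)\<^sup>2 / (2 * \<eta>)"
    using q by (simp add: algebra_simps)
  then have "\<tau> * (- \<eta> * (?x\<^sup>2 - ?x) + \<sigma> * ?x) \<le> \<tau> * (- (\<eta> / 2) * ?x\<^sup>2 + (\<eta> + 1)\<^sup>2 / (2 * \<eta>))"
    using assms by (intro mult_left_mono) auto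
  also have "\<dots> \<le> - (\<eta> / 2) * (\<tau> * ?x\<^sup>2) + (\<eta> + 1)\<^sup>2 / (2 * \<eta>)"
  proof -
    have "\<tau> * ((\<eta> + 1)\<^sup>2 / (2 * \<eta>)) \<le> 1 * ((\<eta> + 1)\<^sup>2 / (2 * \<eta>))"
      using assms eta by (intro mult_right_mono) auto
    then show ?thesis by (simp add: algebra_simps)
  qed
  finally have "Re (al k) * \<tau> + \<sigma> * \<tau> * ?x \<le> (\<eta> + 1)\<^sup>2 / (2 * \<eta>) + - (\<eta> / 2) * (\<tau> * (of_int k)\<^sup>2)"
    by (simp add: al_Re symbol_p_def algebra_simps)
  then show ?thesis unfolding C1_def by (simp flip: exp_add)
qed

text \<open>Bounding the Gaussian by a multiple of (tau k^2)^(-p) trades decay in k for a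
  singularity in tau. The exponent \<open>p\<close> is a parameter because both \<open>a0\<close>
  and \<open>a0 - \<mu>\<close> are used.\<close>

lemma kernel_power: assumes p: "0 < p" and t: "0 < \<tau>" "\<tau> \<le> 1" "0 \<le> \<sigma>" "\<sigma> \<le> 1"
  shows "\<bar>of_int k\<bar> * exp (Re (al k) * \<tau>) * exp (\<sigma> * \<tau> * \<bar>of_int k\<bar>) \<le>
    C1 * (p / (\<eta> / 2)) powr p * \<tau> powr - p * (if k = 0 then 0 else \<bar>of_int k\<bar> powr (1 - 2 * p))"
proof (cases "k = 0")
  case False
  let ?x = "\<bar>real_of_int k\<bar>"
  have x: "0 < ?x" using False by simp
  have e: "exp (- (\<eta> / 2) * (\<tau> * ?x\<^sup>2)) \<le> (p / (\<eta> / 2)) powr p * (\<tau> powr - p * ?x powr (- 2 * p))"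
  proof -
    have "(\<tau> * ?x\<^sup>2) powr p * exp (- (\<eta> / 2) * (\<tau> * ?x\<^sup>2)) \<le> (p / (\<eta> / 2)) powr p"
      using p eta t x by (intro powr_exp_bound) auto
    moreover have "(\<tau> * ?x\<^sup>2) powr p = \<tau> powr p * ?x powr (2 * p)"
      using t x powr_powr[of ?x 2 p] by (simp add: powr_mult)
    ultimately show ?thesis using t x by (simp add: powr_minus field_simps)
  qed
  have "?x * exp (Re (al k) * \<tau>) * exp (\<sigma> * \<tau> * ?x) \<le> ?x * (C1 * exp (- (\<eta> / 2) * (\<tau> * ?x\<^sup>2)))"
    using semigroup_bound[of \<tau> \<sigma> k] t by (simp add: mult.assoc mult_left_mono)
  also have "\<dots> \<le> ?x * (C1 * ((p / (\<eta> / 2)) powr p * (\<tau> powr - p * ?x powr (- 2 * p))))"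
    using e C1_ge_1 by (intro mult_left_mono) auto
  also have "\<dots> = C1 * (p / (\<eta> / 2)) powr p * \<tau> powr - p * (?x powr 1 * ?x powr (- 2 * p))" by simp
  also have "?x powr 1 * ?x powr (- 2 * p) = ?x powr (1 - 2 * p)"
    using powr_add[of ?x 1 "- 2 * p"] by (simp only: mult_minus_left diff_conv_add_uminus)
  finally show ?thesis using False by simp
qed simp

lemma gk_nonneg: "0 \<le> gk k" by (simp add: gk_def)

lemma gk_l2b: "\<exists>G\<ge>0. l2b gk G"
proof -
  have "(\<lambda>k::int. 2 powr (3/2 - 2 * \<mu>) * (1 + \<bar>real_of_int k\<bar>) powr - (3/2 - 2 * \<mu>)) summable_on UNIV"
    using mu by (intro summable_on_cmult_right bracket_summable) simp
  then have "(\<lambda>k. (gk k)\<^sup>2) summable_on UNIV"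
  proof (rule summable_on_comparison_test)
    fix k :: int
    show "(gk k)\<^sup>2 \<le> 2 powr (3/2 - 2 * \<mu>) * (1 + \<bar>real_of_int k\<bar>) powr - (3/2 - 2 * \<mu>)"
    proof (cases "k = 0")
      case False
      let ?x = "\<bar>real_of_int k\<bar>"
      have x: "1 \<le> ?x" using False by (simp flip: of_int_abs)
      have "(gk k)\<^sup>2 = ?x powr (2 * (1 - 2 * a0))"
        using False x by (simp add: gk_def power2_eq_square flip: powr_add)
      \<comment> \<open>The exponent 3/2 - 2 mu exceeds 1 exactly when mu < 1/4. This is where s >
        -1/2 yields square summability.\<close>
      also have "2 * (1 - 2 * a0) = - (3/2 - 2 * \<mu>)" by (simp add: a0_def)
      also have "?x powr - (3/2 - 2 * \<mu>) \<le> ((1 + ?x) / 2) powr - (3/2 - 2 * \<mu>)"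
        using x mu by (intro powr_mono2') auto
      also have "\<dots> = 2 powr (3/2 - 2 * \<mu>) * (1 + ?x) powr - (3/2 - 2 * \<mu>)"
      proof -
        define b where "b = 3/2 - 2 * \<mu>"
        show ?thesis using x unfolding b_def[symmetric] by (simp add: powr_divide powr_minus field_simps)
      qed
      finally show ?thesis .
    qed (simp add: gk_def)
  qed simp
  from l2b_of_summable[OF this] show ?thesis using l2b_nonneg by blast
qed

lemmas duhamel_bound' = duhamel_bound[OF al_Re(2) mu nu]

lemma adm_nonneg: assumes "adm \<mu> \<nu> \<sigma> l T c M" "0 < T" shows "0 \<le> M"
proof -
  have "T / 2 \<in> {0<..<T}" using assms(2) by auto
  then show ?thesis using assms(1) l2b_nonneg unfolding adm_def by blast
qed

text \<open>The first estimate closes the fixed point argument, the second controls the curve in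
  \<open>H\<^sup>s\<close> down to t = 0. In the second one J^(-mu) replaces t^mu and contributes
  |k|^(-2 mu), so the kernel may be taken with the weaker singularity a0 - mu; both leave the same
  power t^theta.\<close>

lemma duhamel_bounds:
  "\<exists>C\<ge>0. \<forall>\<sigma> T c d M1 M2 t k. 0 \<le> \<sigma> \<and> \<sigma> \<le> 1 \<and> 0 < t \<and> t \<le> T \<and> T \<le> 1 \<and>
     adm \<mu> \<nu> \<sigma> 0 T c M1 \<and> adm \<mu> \<nu> \<sigma> 0 T d M2 \<longrightarrow>
     t powr \<mu> * wgt \<nu> \<sigma> t k * cmod (duhamel al c d t k) \<le> C * gk k * M1 * M2 * t powr \<theta> \<and>
     J k powr - \<mu> * wgt \<nu> \<sigma> t k * cmod (duhamel al c d t k) \<le> C * gk k * M1 * M2 * t powr \<theta>"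
proof -
  define K1 K2 where "K1 = C1 * (a0 / (\<eta> / 2)) powr a0" and "K2 = C1 * ((a0 - \<mu>) / (\<eta> / 2)) powr (a0 - \<mu>)"
  define B1 B2 where "B1 = K1 * 2 powr (\<nu> / 2) * Beta (1 - 2 * \<mu>) (1 - a0)"
    and "B2 = K2 * 2 powr (\<nu> / 2) * Beta (1 - 2 * \<mu>) (1 - (a0 - \<mu>))"
  have a0: "0 < a0" "a0 < 1" "0 < a0 - \<mu>" "a0 - \<mu> < 1" using mu by (auto simp: a0_def)
  have K: "0 \<le> K1" "0 \<le> K2" using C1_ge_1 by (auto simp: K1_def K2_def)
  have "t powr \<mu> * wgt \<nu> \<sigma> t k * cmod (duhamel al c d t k) \<le> max (max B1 B2) 0 * gk k * M1 * M2 * t powr \<theta> \<and>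
     J k powr - \<mu> * wgt \<nu> \<sigma> t k * cmod (duhamel al c d t k) \<le> max (max B1 B2) 0 * gk k * M1 * M2 * t powr \<theta>"
    if h: "0 \<le> \<sigma>" "\<sigma> \<le> 1" "0 < t" "t \<le> T" "T \<le> 1" and c: "adm \<mu> \<nu> \<sigma> 0 T c M1" and d: "adm \<mu> \<nu> \<sigma> 0 T d M2"
    for \<sigma> T c d M1 M2 t k
  proof -
    have M: "0 \<le> M1" "0 \<le> M2" using adm_nonneg[OF c] adm_nonneg[OF d] h by auto
    have fin: "B * gk k * M1 * M2 * t powr \<theta> \<le> max (max B1 B2) 0 * gk k * M1 * M2 * t powr \<theta>"
      if "B \<le> max B1 B2" for B
      using that M gk_nonneg[of k] by (intro mult_right_mono) auto
    have "1 * exp (- 0 * t) * wgt \<nu> \<sigma> t k * cmod (duhamel al c d t k) \<le>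
        K1 * 2 powr (\<nu> / 2) * Beta (1 - 2 * \<mu>) (1 - a0) * gk k * M1 * M2 * t powr (1 - a0 - 2 * \<mu>)"
    proof (rule duhamel_bound'[OF h(1) c d])
      fix \<tau> :: real assume t: "0 < \<tau>" "\<tau> \<le> 1"
      show "1 * \<bar>of_int k\<bar> * exp (Re (al k) * \<tau>) * exp (\<sigma> * \<tau> * \<bar>of_int k\<bar>) * exp (- 0 * \<tau>) \<le> K1 * \<tau> powr - a0 * gk k"
        using kernel_power[OF a0(1) t h(1,2), of k] by (simp add: K1_def gk_def)
    qed (use h M a0 K in auto)
    then have "t powr \<mu> * (wgt \<nu> \<sigma> t k * cmod (duhamel al c d t k)) \<le> t powr \<mu> * (B1 * gk k * M1 * M2 * t powr (1 - a0 - 2 * \<mu>))"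
      by (intro mult_left_mono) (simp_all add: B1_def)
    also have "\<dots> = B1 * gk k * M1 * M2 * (t powr \<mu> * t powr (1 - a0 - 2 * \<mu>))" by simp
    also have "t powr \<mu> * t powr (1 - a0 - 2 * \<mu>) = t powr \<theta>" by (simp add: \<theta>_def a0_def flip: powr_add)
    also have "B1 * gk k * M1 * M2 * t powr \<theta> \<le> max (max B1 B2) 0 * gk k * M1 * M2 * t powr \<theta>" by (rule fin) simp
    finally have 1: "t powr \<mu> * wgt \<nu> \<sigma> t k * cmod (duhamel al c d t k) \<le> max (max B1 B2) 0 * gk k * M1 * M2 * t powr \<theta>"
      by (simp add: mult.assoc)
    have "J k powr - \<mu> * exp (- 0 * t) * wgt \<nu> \<sigma> t k * cmod (duhamel al c d t k) \<le>
        K2 * 2 powr (\<nu> / 2) * Beta (1 - 2 * \<mu>) (1 - (a0 - \<mu>)) * gk k * M1 * M2 * t powr (1 - (a0 - \<mu>) - 2 * \<mu>)"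
    proof (rule duhamel_bound'[OF h(1) c d])
      fix \<tau> :: real assume t: "0 < \<tau>" "\<tau> \<le> 1"
      have "J k powr - \<mu> * (if k = 0 then 0 else \<bar>real_of_int k\<bar> powr (1 - 2 * (a0 - \<mu>))) \<le> gk k"
      proof (cases "k = 0")
        case False
        let ?x = "\<bar>real_of_int k\<bar>"
        have x: "0 < ?x" using False by simp
        have "J k powr - \<mu> \<le> (?x\<^sup>2) powr - \<mu>"
          using x mu by (intro powr_mono2') (auto simp: J_def)
        also have "(?x\<^sup>2) powr - \<mu> = ?x powr (- 2 * \<mu>)" using x powr_powr[of ?x 2 "- \<mu>"] by simp
        finally have "J k powr - \<mu> * ?x powr (1 - 2 * (a0 - \<mu>)) \<le> ?x powr (- 2 * \<mu>) * ?x powr (1 - 2 * (a0 - \<mu>))"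
          by (intro mult_right_mono) auto
        also have "\<dots> = ?x powr (1 - 2 * a0)" by (simp flip: powr_add)
        finally show ?thesis using False by (simp add: gk_def)
      qed (simp add: gk_def)
      then have g: "(C1 * ((a0 - \<mu>) / (\<eta> / 2)) powr (a0 - \<mu>) * \<tau> powr - (a0 - \<mu>)) *
          (J k powr - \<mu> * (if k = 0 then 0 else \<bar>real_of_int k\<bar> powr (1 - 2 * (a0 - \<mu>)))) \<le> K2 * \<tau> powr - (a0 - \<mu>) * gk k"
        unfolding K2_def using C1_ge_1 by (intro mult_left_mono) auto
      have "J k powr - \<mu> * (\<bar>of_int k\<bar> * exp (Re (al k) * \<tau>) * exp (\<sigma> * \<tau> * \<bar>of_int k\<bar>)) \<le>
        J k powr - \<mu> * (C1 * ((a0 - \<mu>) / (\<eta> / 2)) powr (a0 - \<mu>) * \<tau> powr - (a0 - \<mu>) * (if k = 0 then 0 else \<bar>of_int k\<bar> powr (1 - 2 * (a0 - \<mu>))))"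
        by (intro mult_left_mono kernel_power[OF a0(3) t h(1,2)]) simp
      also note g[unfolded mult.left_commute[of _ "J k powr - \<mu>"]]
      finally show "J k powr - \<mu> * \<bar>of_int k\<bar> * exp (Re (al k) * \<tau>) * exp (\<sigma> * \<tau> * \<bar>of_int k\<bar>) * exp (- 0 * \<tau>) \<le> K2 * \<tau> powr - (a0 - \<mu>) * gk k"
        by (simp add: mult.assoc)
    qed (use h M a0 K in auto)
    also have "1 - (a0 - \<mu>) - 2 * \<mu> = \<theta>" by (simp add: \<theta>_def a0_def)
    also have "K2 * 2 powr (\<nu> / 2) * Beta (1 - 2 * \<mu>) (1 - (a0 - \<mu>)) * gk k * M1 * M2 * t powr \<theta> \<le>
        max (max B1 B2) 0 * gk k * M1 * M2 * t powr \<theta>"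
      unfolding B2_def[symmetric] by (rule fin) simp
    finally show ?thesis using 1 by simp
  qed
  then show ?thesis by (intro exI[of _ "max (max B1 B2) 0"]) auto
qed

text \<open>The exponential weight makes the constant in the bilinear estimate arbitrarily small.\<close>

lemma duhamel_small:
  "\<exists>C\<ge>0. \<forall>l T c d M1 M2 t k. 0 < l \<and> 0 < t \<and> t \<le> T \<and> T \<le> 1 \<and>
     adm \<mu> \<nu> 0 0 T c M1 \<and> adm \<mu> \<nu> 0 l T d M2 \<longrightarrow>
     t powr \<mu> * exp (- l * t) * wgt \<nu> 0 t k * cmod (duhamel al c d t k) \<le> C * l powr - (\<theta> / 2) * gk k * M1 * M2"
proof -
  \<comment> \<open>Half of theta pays for the decay in \<open>l\<close>; the other half leaves a
    nonnegative power of t, which is at most 1.\<close>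
  define \<delta> where "\<delta> = \<theta> / 2"
  define K where "K = C1 * (a0 / (\<eta> / 2)) powr a0 * \<delta> powr \<delta>"
  define B where "B = K * 2 powr (\<nu> / 2) * Beta (1 - 2 * \<mu>) (1 - (a0 + \<delta>))"
  have dl: "0 < \<delta>" using theta by (simp add: \<delta>_def)
  have a0: "0 < a0" "a0 + \<delta> < 1" unfolding a0_def \<delta>_def \<theta>_def using mu by (simp_all add: field_simps)
  have K: "0 \<le> K" using C1_ge_1 by (auto simp: K_def)
  have "t powr \<mu> * exp (- l * t) * wgt \<nu> 0 t k * cmod (duhamel al c d t k) \<le> max B 0 * l powr - \<delta> * gk k * M1 * M2"
    if h: "0 < l" "0 < t" "t \<le> T" "T \<le> 1" and c: "adm \<mu> \<nu> 0 0 T c M1" and d: "adm \<mu> \<nu> 0 l T d M2"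
    for l T c d M1 M2 t k
  proof -
    have M: "0 \<le> M1" "0 \<le> M2" using adm_nonneg[OF c] adm_nonneg[OF d] h by auto
    have "1 * exp (- l * t) * wgt \<nu> 0 t k * cmod (duhamel al c d t k) \<le>
        (K * l powr - \<delta>) * 2 powr (\<nu> / 2) * Beta (1 - 2 * \<mu>) (1 - (a0 + \<delta>)) * gk k * M1 * M2 * t powr (1 - (a0 + \<delta>) - 2 * \<mu>)"
    proof (rule duhamel_bound'[OF order.refl c d])
      fix \<tau> :: real assume t: "0 < \<tau>" "\<tau> \<le> 1"
      have "(l * \<tau>) powr \<delta> * exp (- 1 * (l * \<tau>)) \<le> (\<delta> / 1) powr \<delta>"
        using dl h t by (intro powr_exp_bound) auto
      moreover have "(l * \<tau>) powr \<delta> = l powr \<delta> * \<tau> powr \<delta>" using h t by (simp add: powr_mult)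
      ultimately have e: "exp (- l * \<tau>) \<le> \<delta> powr \<delta> * l powr - \<delta> * \<tau> powr - \<delta>"
        using h t by (simp add: powr_minus field_simps)
      have k: "\<bar>of_int k\<bar> * exp (Re (al k) * \<tau>) * exp (0 * \<tau> * \<bar>of_int k\<bar>) \<le> C1 * (a0 / (\<eta> / 2)) powr a0 * \<tau> powr - a0 * gk k"
        using kernel_power[OF a0(1) t, of 0 k] by (simp add: gk_def)
      have "(\<bar>of_int k\<bar> * exp (Re (al k) * \<tau>) * exp (0 * \<tau> * \<bar>of_int k\<bar>)) * exp (- l * \<tau>) \<le>
          (C1 * (a0 / (\<eta> / 2)) powr a0 * \<tau> powr - a0 * gk k) * (\<delta> powr \<delta> * l powr - \<delta> * \<tau> powr - \<delta>)"
        by (rule mult_mono[OF k e]) (use C1_ge_1 gk_nonneg[of k] in auto)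
      also have "\<dots> = K * l powr - \<delta> * (\<tau> powr - a0 * \<tau> powr - \<delta>) * gk k" by (simp add: K_def)
      also have "\<tau> powr - a0 * \<tau> powr - \<delta> = \<tau> powr - (a0 + \<delta>)" by (simp flip: powr_add)
      finally show "1 * \<bar>of_int k\<bar> * exp (Re (al k) * \<tau>) * exp (0 * \<tau> * \<bar>of_int k\<bar>) * exp (- l * \<tau>) \<le>
          (K * l powr - \<delta>) * \<tau> powr - (a0 + \<delta>) * gk k" by simp
    qed (use h M a0 K in auto)
    then have "t powr \<mu> * (exp (- l * t) * wgt \<nu> 0 t k * cmod (duhamel al c d t k)) \<le>
        t powr \<mu> * (B * l powr - \<delta> * gk k * M1 * M2 * t powr (1 - (a0 + \<delta>) - 2 * \<mu>))"
      by (intro mult_left_mono) (simp_all add: B_def ac_simps)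
    also have "\<dots> = B * (l powr - \<delta> * gk k * M1 * M2 * (t powr \<mu> * t powr (1 - (a0 + \<delta>) - 2 * \<mu>)))" by simp
    also have "\<dots> \<le> max B 0 * (l powr - \<delta> * gk k * M1 * M2 * 1)"
    proof (intro mult_mono mult_left_mono)
      have "t powr \<mu> * t powr (1 - (a0 + \<delta>) - 2 * \<mu>) = t powr (\<theta> - \<delta>)"
        by (simp add: \<theta>_def a0_def algebra_simps flip: powr_add)
      also have "\<dots> \<le> 1" using h theta by (intro powr_le1) (auto simp: \<delta>_def)
      finally show "t powr \<mu> * t powr (1 - (a0 + \<delta>) - 2 * \<mu>) \<le> 1" .
    qed (use M gk_nonneg[of k] in auto)
    finally show ?thesis by (simp add: ac_simps)
  qed
  then show ?thesis unfolding \<delta>_def by (intro exI[of _ "max B 0"]) auto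
qed

text \<open>The smoothing norm asks for J^mu more than \<open>H\<^sup>s\<close> provides, by nu / 2
  = s / 2 + mu. For t <= 1 one has t^mu J^mu <= 1 + t k^2, and the Gaussian pays for this
  factor.\<close>

lemma linear_bounds:
  "\<exists>C\<ge>0. \<forall>\<sigma> t k. 0 \<le> \<sigma> \<and> \<sigma> \<le> 1 \<and> 0 \<le> t \<and> t \<le> 1 \<longrightarrow>
     t powr \<mu> * wgt \<nu> \<sigma> t k * cmod (exp (al k * of_real t)) \<le> C * J k powr (s / 2) \<and>
     J k powr - \<mu> * wgt \<nu> \<sigma> t k * cmod (exp (al k * of_real t)) \<le> C * J k powr (s / 2)"
proof -
  define C where "C = C1 * (1 + 2 / \<eta>)"
  have C: "C1 \<le> C" "0 \<le> C" using C1_ge_1 eta mult_left_mono[of 1 "1 + 2 / \<eta>" C1] by (auto simp: C_def)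
  have "t powr \<mu> * wgt \<nu> \<sigma> t k * cmod (exp (al k * of_real t)) \<le> C * J k powr (s / 2) \<and>
     J k powr - \<mu> * wgt \<nu> \<sigma> t k * cmod (exp (al k * of_real t)) \<le> C * J k powr (s / 2)"
    if h: "0 \<le> \<sigma>" "\<sigma> \<le> 1" "0 \<le> t" "t \<le> 1" for \<sigma> t k
  proof -
    let ?e = "exp (- (\<eta> / 2) * (t * (real_of_int k)\<^sup>2))"
    have w: "wgt \<nu> \<sigma> t k * cmod (exp (al k * of_real t)) =
        J k powr (s / 2) * J k powr \<mu> * (exp (Re (al k) * t) * exp (\<sigma> * t * \<bar>of_int k\<bar>))"
      unfolding wgt_def nu_mu by (simp add: powr_add)
    have le: "wgt \<nu> \<sigma> t k * cmod (exp (al k * of_real t)) \<le> J k powr (s / 2) * J k powr \<mu> * (C1 * ?e)"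
      unfolding w using h by (intro mult_left_mono semigroup_bound) auto
    have Jm: "J k powr - \<mu> * J k powr \<mu> = 1" using J_pos[of k] by (simp flip: powr_add)
    have "J k powr - \<mu> * (wgt \<nu> \<sigma> t k * cmod (exp (al k * of_real t))) \<le> J k powr - \<mu> * (J k powr (s / 2) * J k powr \<mu> * (C1 * ?e))"
      by (intro mult_left_mono le) simp
    also have "\<dots> = (J k powr - \<mu> * J k powr \<mu>) * (J k powr (s / 2) * (C1 * ?e))" by simp
    also have "\<dots> \<le> J k powr (s / 2) * (C * 1)"
    proof -
      have "?e \<le> 1" using eta h by simp
      then have "C1 * ?e \<le> C * 1" using C by (intro mult_mono) auto
      then show ?thesis unfolding Jm by (simp add: mult_left_mono)
    qed
    finally have 2: "J k powr - \<mu> * wgt \<nu> \<sigma> t k * cmod (exp (al k * of_real t)) \<le> C * J k powr (s / 2)"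
      by (simp add: ac_simps)
    define x where "x = t * (real_of_int k)\<^sup>2"
    have x: "0 \<le> x" using h by (simp add: x_def)
    have "t powr \<mu> * J k powr \<mu> = (t * J k) powr \<mu>" using h J_pos[of k] by (simp add: powr_mult)
    also have "\<dots> \<le> (1 + x) powr \<mu>" using h mu J_pos[of k] by (intro powr_mono2) (auto simp: x_def J_def algebra_simps)
    also have "\<dots> \<le> (1 + x) powr 1" using x mu by (intro powr_mono) auto
    finally have tJ: "t powr \<mu> * J k powr \<mu> \<le> 1 + x" using x by simp
    \<comment> \<open>The origin of the factor 1 + 2 / eta in \<open>C\<close>: it bounds (1 + x)
      exp (- (eta / 2) x) for x >= 0.\<close>
    have "1 + x \<le> (1 + 2 / \<eta>) * exp ((\<eta> / 2) * x)"
    proof -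
      have "1 + (\<eta> / 2) * x \<le> exp ((\<eta> / 2) * x)" by (rule exp_ge_add_one_self)
      then have "(1 + 2 / \<eta>) * (1 + (\<eta> / 2) * x) \<le> (1 + 2 / \<eta>) * exp ((\<eta> / 2) * x)"
        using eta by (intro mult_left_mono) auto
      moreover have "1 + x \<le> (1 + 2 / \<eta>) * (1 + (\<eta> / 2) * x)" using eta x by (simp add: field_simps)
      ultimately show ?thesis by simp
    qed
    then have "(1 + x) * ?e \<le> (1 + 2 / \<eta>) * exp ((\<eta> / 2) * x) * ?e" by (intro mult_right_mono) auto
    also have "\<dots> = 1 + 2 / \<eta>" unfolding x_def[symmetric] by (simp add: mult.assoc flip: exp_add)
    finally have xe: "(1 + x) * ?e \<le> 1 + 2 / \<eta>" .
    have "t powr \<mu> * (wgt \<nu> \<sigma> t k * cmod (exp (al k * of_real t))) \<le> t powr \<mu> * (J k powr (s / 2) * J k powr \<mu> * (C1 * ?e))"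
      by (intro mult_left_mono le) simp
    also have "\<dots> = J k powr (s / 2) * C1 * ((t powr \<mu> * J k powr \<mu>) * ?e)" by simp
    also have "\<dots> \<le> J k powr (s / 2) * C1 * ((1 + x) * ?e)"
      using tJ C1_ge_1 by (intro mult_left_mono mult_right_mono) auto
    also have "\<dots> \<le> J k powr (s / 2) * C1 * (1 + 2 / \<eta>)"
      using xe C1_ge_1 by (intro mult_left_mono) auto
    finally show ?thesis using 2 by (simp add: C_def ac_simps)
  qed
  then show ?thesis using C by (intro exI[of _ C]) auto
qed

end

subsection \<open>Sobolev norms\<close>

lemma Hs_iff: "f \<in> Hs r \<longleftrightarrow> (\<lambda>k. (J k powr (r/2) * cmod (fourier_coeff f k))\<^sup>2) summable_on UNIV"
  by (simp add: Hs_def J_def)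

lemma Hs_norm_eq: "Hs_norm r f = sqrt (2 * pi) * sqrt (\<Sum>\<^sub>\<infinity>k. (J k powr (r/2) * cmod (fourier_coeff f k))\<^sup>2)"
  by (simp add: Hs_norm_def J_def)

lemma Hs_norm_nonneg: "0 \<le> Hs_norm r f"
  unfolding Hs_norm_eq by (intro mult_nonneg_nonneg real_sqrt_ge_zero infsum_nonneg) auto

lemma Hs_l2b: "f \<in> Hs r \<Longrightarrow> l2b (\<lambda>k. J k powr (r/2) * cmod (fourier_coeff f k)) (Hs_norm r f / sqrt (2 * pi))"
  using l2b_of_summable[of "\<lambda>k. J k powr (r/2) * cmod (fourier_coeff f k)"] by (simp add: Hs_iff Hs_norm_eq)

lemma sqrt_2pi: "1 \<le> sqrt (2 * pi)"
  using pi_gt3 by (intro real_le_rsqrt) simp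

lemma Hs_l2b': assumes "f \<in> Hs r" shows "l2b (\<lambda>k. J k powr (r/2) * cmod (fourier_coeff f k)) (Hs_norm r f)"
proof (rule l2b_le[OF Hs_l2b[OF assms]])
  have "Hs_norm r f * 1 \<le> Hs_norm r f * sqrt (2 * pi)" by (intro mult_left_mono sqrt_2pi Hs_norm_nonneg)
  then show "Hs_norm r f / sqrt (2 * pi) \<le> Hs_norm r f" by (simp add: field_simps)
qed

lemma HsI: assumes "l2b (\<lambda>k. J k powr (r/2) * cmod (fourier_coeff f k)) M"
  shows "f \<in> Hs r" "Hs_norm r f \<le> sqrt (2 * pi) * M"
  using l2b_summable[OF assms] by (simp_all add: Hs_iff Hs_norm_eq mult_left_mono)

lemma Hs_diff: assumes "f \<in> Hs r" "g \<in> Hs r"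
  shows "f - g \<in> Hs r" "Hs_norm r (f - g) \<le> Hs_norm r f + Hs_norm r g"
proof -
  have l: "l2b (\<lambda>k. J k powr (r/2) * cmod (fourier_coeff (f - g) k)) (Hs_norm r f / sqrt (2 * pi) + Hs_norm r g / sqrt (2 * pi))"
  proof (rule l2b_mono[OF l2b_add[OF Hs_l2b[OF assms(1)] Hs_l2b[OF assms(2)]]])
    fix k
    have "J k powr (r/2) * cmod (fourier_coeff (f - g) k) \<le>
        J k powr (r/2) * (cmod (fourier_coeff f k) + cmod (fourier_coeff g k))"
      unfolding fourier_coeff_diff by (intro mult_left_mono norm_triangle_ineq4) simp
    then show "J k powr (r/2) * cmod (fourier_coeff (f - g) k) \<le>
        J k powr (r/2) * cmod (fourier_coeff f k) + J k powr (r/2) * cmod (fourier_coeff g k)"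
      by (simp only: distrib_left)
  qed simp
  show "f - g \<in> Hs r" by (rule HsI(1)[OF l])
  have "Hs_norm r (f - g) \<le> sqrt (2 * pi) * (Hs_norm r f / sqrt (2 * pi) + Hs_norm r g / sqrt (2 * pi))"
    by (rule HsI(2)[OF l])
  also have "\<dots> = Hs_norm r f + Hs_norm r g" by (simp add: distrib_left)
  finally show "Hs_norm r (f - g) \<le> Hs_norm r f + Hs_norm r g" .
qed

lemma Hs_norm_minus: "Hs_norm r (f - g) = Hs_norm r (g - f)"
  by (simp add: Hs_norm_eq fourier_coeff_diff norm_minus_commute)

lemma Hs_norm_triangle: assumes "f \<in> Hs r" "g \<in> Hs r"
  shows "\<bar>Hs_norm r f - Hs_norm r g\<bar> \<le> Hs_norm r (f - g)"
proof -
  have *: "Hs_norm r f \<le> Hs_norm r g + Hs_norm r (f - g)" if "f \<in> Hs r" "g \<in> Hs r" for f g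
  proof -
    have z: "0 \<in> Hs r" by (simp add: Hs_iff)
    have "0 - (f - g) \<in> Hs r" "Hs_norm r (0 - (f - g)) = Hs_norm r (f - g)"
      using Hs_diff(1)[OF z Hs_diff(1)[OF that]] by (simp_all add: Hs_norm_eq fourier_coeff_diff norm_minus_commute)
    moreover have "f = g - (0 - (f - g))" by simp
    ultimately show ?thesis using Hs_diff(2)[OF that(2), of "0 - (f - g)"] by simp
  qed
  show ?thesis using *[OF assms] *[OF assms(2,1)] Hs_norm_minus[of r f g] by simp
qed

text \<open>Dominated convergence in l2, obtained from Tannery's theorem for the series enumerated
  by \<open>int_decode\<close>.\<close>

lemma l2b_lim_zero:
  assumes lim: "\<And>k. ((\<lambda>t. c t k) \<longlongrightarrow> c0 k) F" and g: "l2b g G"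
    and le: "eventually (\<lambda>t. \<forall>k. w k * cmod (c t k - c0 k) \<le> g k) F" and w: "\<And>k. 0 \<le> w k"
  shows "((\<lambda>t. \<Sum>\<^sub>\<infinity>k. (w k * cmod (c t k - c0 k))\<^sup>2) \<longlongrightarrow> (0::real)) F"
proof (cases "F = bot")
  case False
  let ?a = "\<lambda>n t. (w (int_decode n) * cmod (c t (int_decode n) - c0 (int_decode n)))\<^sup>2"
  have gs: "summable (\<lambda>n. (g (int_decode n))\<^sup>2)"
    using infsum_int_decode(1)[of "\<lambda>k. (g k)\<^sup>2"] l2b_summable(1)[OF g] by simp
  have "((\<lambda>t. suminf (\<lambda>n. ?a n t)) \<longlongrightarrow> suminf (\<lambda>n. 0 :: real)) F"
  proof (rule tannerys_theorem[THEN conjunct2, THEN conjunct2])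
    show "((\<lambda>t. ?a n t) \<longlongrightarrow> 0) F" for n
    proof -
      have "((\<lambda>t. ?a n t) \<longlongrightarrow> (w (int_decode n) * cmod (c0 (int_decode n) - c0 (int_decode n)))\<^sup>2) F"
        by (intro tendsto_intros lim)
      then show ?thesis by simp
    qed
    have "eventually (\<lambda>x. case x of (n, t) \<Rightarrow> \<forall>k. w k * cmod (c t k - c0 k) \<le> g k) (sequentially \<times>\<^sub>F F)"
      using eventually_prodI[of "\<lambda>n. True" sequentially, OF _ le] by (simp add: case_prod_unfold)
    then show "eventually (\<lambda>(n, t). norm (?a n t) \<le> (g (int_decode n))\<^sup>2) (sequentially \<times>\<^sub>F F)"
    proof eventually_elim
      case (elim x)
      then show ?case using w by (auto simp: case_prod_unfold intro!: power_mono)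
    qed
  qed (use gs False in auto)
  moreover have "eventually (\<lambda>t. suminf (\<lambda>n. ?a n t) = (\<Sum>\<^sub>\<infinity>k. (w k * cmod (c t k - c0 k))\<^sup>2)) F"
    using le
  proof eventually_elim
    case (elim t)
    have "l2b (\<lambda>k. w k * cmod (c t k - c0 k)) G" by (rule l2b_mono[OF g]) (use w elim in auto)
    from l2b_summable(1)[OF this] show ?case
      using infsum_int_decode(2)[of "\<lambda>k. (w k * cmod (c t k - c0 k))\<^sup>2"] by simp
  qed
  ultimately show ?thesis by (simp cong: filterlim_cong add: tendsto_cong)
qed simp

text \<open>Continuity in Sobolev norm is reduced to continuity of each coefficient together with
  one square summable majorant near \<open>t0\<close>.\<close>

lemma Hs_tendsto:
  assumes u: "\<And>t k. t \<in> I \<Longrightarrow> fourier_coeff (u t) k = c t k" and t0: "t0 \<in> I"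
    and lim: "\<And>k. ((\<lambda>t. c t k) \<longlongrightarrow> c t0 k) (at t0 within I)" and g: "l2b g G"
    and le: "eventually (\<lambda>t. \<forall>k. J k powr (r/2) * cmod (c t k) \<le> g k) (at t0 within I)"
    and le0: "\<And>k. J k powr (r/2) * cmod (c t0 k) \<le> g k"
  shows "((\<lambda>t. Hs_norm r (u t - u t0)) \<longlongrightarrow> 0) (at t0 within I)"
proof -
  have g2: "l2b (\<lambda>k. 2 * g k) (2 * G)" using l2b_cmult[OF g, of 2] by simp
  have "eventually (\<lambda>t. \<forall>k. J k powr (r/2) * cmod (c t k - c t0 k) \<le> 2 * g k) (at t0 within I)"
    using le
  proof eventually_elim
    case (elim t)
    show ?case
    proof
      fix k
      have "J k powr (r/2) * cmod (c t k - c t0 k) \<le> J k powr (r/2) * (cmod (c t k) + cmod (c t0 k))"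
        by (intro mult_left_mono norm_triangle_ineq4) simp
      then show "J k powr (r/2) * cmod (c t k - c t0 k) \<le> 2 * g k"
        using elim le0[of k] by (simp add: distrib_left) (smt (verit))
    qed
  qed
  from l2b_lim_zero[OF lim g2 this]
  have "((\<lambda>t. \<Sum>\<^sub>\<infinity>k. (J k powr (r/2) * cmod (c t k - c t0 k))\<^sup>2) \<longlongrightarrow> 0) (at t0 within I)" by simp
  then have "((\<lambda>t. sqrt (2 * pi) * sqrt (\<Sum>\<^sub>\<infinity>k. (J k powr (r/2) * cmod (c t k - c t0 k))\<^sup>2)) \<longlongrightarrow> sqrt (2 * pi) * sqrt 0) (at t0 within I)"
    by (intro tendsto_intros)
  moreover have "eventually (\<lambda>t. sqrt (2 * pi) * sqrt (\<Sum>\<^sub>\<infinity>k. (J k powr (r/2) * cmod (c t k - c t0 k))\<^sup>2) = Hs_norm r (u t - u t0)) (at t0 within I)"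
    unfolding eventually_at_topological using u t0 by (intro exI[of _ UNIV]) (simp add: Hs_norm_eq fourier_coeff_diff)
  ultimately show ?thesis by (simp add: tendsto_cong)
qed

lemma continuous_Hs_coeff: assumes "continuous_Hs r I u" shows "continuous_on I (\<lambda>t. fourier_coeff (u t) k)"
  unfolding continuous_on_def
proof
  fix t assume t: "t \<in> I"
  have ev: "eventually (\<lambda>t'. cmod (fourier_coeff (u t') k - fourier_coeff (u t) k) \<le> Hs_norm r (u t' - u t) * J k powr (- r / 2)) (at t within I)"
    unfolding eventually_at_topological
  proof (intro exI[of _ UNIV] conjI ballI impI)
    fix t' assume "t' \<in> I"
    then have "u t' - u t \<in> Hs r" using assms t unfolding continuous_Hs_def by (blast intro: Hs_diff)
    from l2b_term[OF Hs_l2b'[OF this], of k]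
    show "cmod (fourier_coeff (u t') k - fourier_coeff (u t) k) \<le> Hs_norm r (u t' - u t) * J k powr (- r / 2)"
      using J_pos[of k] by (simp add: fourier_coeff_diff powr_minus field_simps)
  qed auto
  have "((\<lambda>t'. Hs_norm r (u t' - u t) * J k powr (- r / 2)) \<longlongrightarrow> 0 * J k powr (- r / 2)) (at t within I)"
    using assms t unfolding continuous_Hs_def by (intro tendsto_intros) blast
  then have "((\<lambda>t'. fourier_coeff (u t') k - fourier_coeff (u t) k) \<longlongrightarrow> 0) (at t within I)"
    by (intro Lim_null_comparison[OF ev]) simp
  then show "((\<lambda>t. fourier_coeff (u t) k) \<longlongrightarrow> fourier_coeff (u t) k) (at t within I)"
    by (simp add: LIM_zero_iff)
qed

lemma continuous_Hs_norm: assumes "continuous_Hs r I u" shows "continuous_on I (\<lambda>t. Hs_norm r (u t))"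
  unfolding continuous_on_def
proof
  fix t assume t: "t \<in> I"
  have ev: "eventually (\<lambda>t'. norm (Hs_norm r (u t') - Hs_norm r (u t)) \<le> Hs_norm r (u t' - u t)) (at t within I)"
    unfolding eventually_at_topological
    using assms t unfolding continuous_Hs_def by (intro exI[of _ UNIV]) (auto intro: Hs_norm_triangle)
  have "((\<lambda>t'. Hs_norm r (u t') - Hs_norm r (u t)) \<longlongrightarrow> 0) (at t within I)"
    by (rule Lim_null_comparison[OF ev]) (use assms t in \<open>auto simp: continuous_Hs_def\<close>)
  then show "((\<lambda>t. Hs_norm r (u t)) \<longlongrightarrow> Hs_norm r (u t)) (at t within I)" by (simp add: LIM_zero_iff)
qed

lemma continuous_Hs_subset: assumes "continuous_Hs r I u" "I' \<subseteq> I" shows "continuous_Hs r I' u"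
  using assms unfolding continuous_Hs_def by (meson subsetD tendsto_within_subset)

lemma continuous_Hs_bounded: assumes "continuous_Hs r I u" "{a..b} \<subseteq> I"
  shows "\<exists>M. \<forall>t\<in>{a..b}. Hs_norm r (u t) \<le> M"
proof -
  have "compact ((\<lambda>t. Hs_norm r (u t)) ` {a..b})"
    using continuous_Hs_norm[OF continuous_Hs_subset[OF assms]] by (rule compact_continuous_image) simp
  then have "bounded ((\<lambda>t. Hs_norm r (u t)) ` {a..b})" by (rule compact_imp_bounded)
  then obtain M where "\<forall>y\<in>(\<lambda>t. Hs_norm r (u t)) ` {a..b}. norm y \<le> M" unfolding bounded_iff by (elim exE)
  then show ?thesis by (intro exI[of _ M]) auto
qed

lemma exp_beats_J: assumes "0 < a"
  shows "\<exists>C\<ge>0. \<forall>k. J k powr r \<le> C * exp (a * \<bar>of_int k\<bar>)"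
proof (cases "r \<le> 0")
  case True
  have "J k powr r \<le> 1 * exp (a * \<bar>of_int k\<bar>)" for k
  proof -
    have "J k powr r \<le> J k powr 0" using J_ge_1[of k] True by (intro powr_mono) auto
    also have "\<dots> \<le> 1 * exp (a * \<bar>of_int k\<bar>)" using J_pos[of k] assms by simp
    finally show ?thesis .
  qed
  then show ?thesis by (intro exI[of _ 1]) auto
next
  case False
  define C where "C = (2 * r / a) powr (2 * r) * exp a"
  have "J k powr r \<le> C * exp (a * \<bar>of_int k\<bar>)" for k
  proof -
    let ?x = "1 + \<bar>real_of_int k\<bar>"
    have "?x powr (2 * r) * exp (- a * ?x) \<le> (2 * r / a) powr (2 * r)"
      using False assms by (intro powr_exp_bound) auto
    then have "?x powr (2 * r) * exp (- a * ?x) * exp (a * ?x) \<le> (2 * r / a) powr (2 * r) * exp (a * ?x)"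
      by (rule mult_right_mono) simp
    moreover have "exp (- a * ?x) * exp (a * ?x) = 1" by (simp flip: exp_add)
    ultimately have 1: "?x powr (2 * r) \<le> (2 * r / a) powr (2 * r) * exp (a * ?x)"
      by (simp only: mult.assoc mult_1_right)
    have "J k \<le> ?x\<^sup>2" by (simp add: J_def power2_eq_square algebra_simps)
    then have "J k powr r \<le> (?x\<^sup>2) powr r" using False J_pos[of k] by (intro powr_mono2) auto
    also have "(?x\<^sup>2) powr r = ?x powr (2 * r)" using powr_powr[of ?x 2 r] by simp
    also note 1
    also have "exp (a * ?x) = exp a * exp (a * \<bar>of_int k\<bar>)" by (simp add: distrib_left exp_add)
    finally show ?thesis by (simp add: C_def)
  qed
  moreover have "0 \<le> C" by (simp add: C_def)
  ultimately show ?thesis by blast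
qed

text \<open>The bound on single terms suffices: J k |c k| <= M already means decay of order
  k^(-2).\<close>

lemma l2b_abs_sum: assumes "l2b (\<lambda>k. J k powr (2/2) * cmod (c k)) M" shows "abs_sum c"
proof (rule summable_on_comparison_test)
  show "(\<lambda>k::int. 2 * M * (1 + \<bar>real_of_int k\<bar>) powr - 2) summable_on UNIV"
    by (intro summable_on_cmult_right bracket_summable) simp
  fix k :: int
  have "(1 + \<bar>real_of_int k\<bar>)\<^sup>2 \<le> 2 * J k"
    using zero_le_power2[of "1 - \<bar>real_of_int k\<bar>"] by (simp add: J_def power2_eq_square algebra_simps)
  moreover have "J k * cmod (c k) \<le> M" using l2b_term[OF assms, of k] J_pos[of k] by simp
  ultimately have "(1 + \<bar>real_of_int k\<bar>)\<^sup>2 * cmod (c k) \<le> 2 * M"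
    using mult_right_mono[of "(1 + \<bar>real_of_int k\<bar>)\<^sup>2" "2 * J k" "cmod (c k)"] by simp
  then show "cmod (c k) \<le> 2 * M * (1 + \<bar>real_of_int k\<bar>) powr - 2"
    by (simp add: powr_minus_divide field_simps)
qed simp

lemma Hs_abs_sum: "f \<in> Hs 2 \<Longrightarrow> abs_sum (fourier_coeff f)"
  by (rule l2b_abs_sum[OF Hs_l2b'])

subsection \<open>Uniqueness for bounded weighted norms\<close>

context bo_burgers
begin

definition lin :: "pdist \<Rightarrow> real \<Rightarrow> int \<Rightarrow> complex" where
  "lin \<phi> t k = exp (al k * of_real t) * fourier_coeff \<phi> k"

lemma adm_decrease: assumes "adm \<mu> \<nu> \<sigma> 0 T c M" "0 \<le> l" shows "adm \<mu> \<nu> \<sigma> l T c M"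
  unfolding adm_def
proof (intro conjI allI ballI)
  show "(\<lambda>t. indicator {0<..<T} t *\<^sub>R c t k) \<in> borel_measurable borel" for k using assms unfolding adm_def by blast
  fix t assume t: "t \<in> {0<..<T}"
  then have "l2b (\<lambda>k. t powr \<mu> * exp (- 0 * t) * wgt \<nu> \<sigma> t k * cmod (c t k)) M" using assms unfolding adm_def by blast
  then show "l2b (\<lambda>k. t powr \<mu> * exp (- l * t) * wgt \<nu> \<sigma> t k * cmod (c t k)) M"
  proof (rule l2b_mono)
    fix k
    have w: "0 \<le> t powr \<mu> * (wgt \<nu> \<sigma> t k * cmod (c t k))" using wgt_pos[of \<nu> \<sigma> t k] by simp
    then show "0 \<le> t powr \<mu> * exp (- l * t) * wgt \<nu> \<sigma> t k * cmod (c t k)" using wgt_pos[of \<nu> \<sigma> t k] by simp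
    have "exp (- l * t) \<le> 1" using t assms by simp
    from mult_right_mono[OF this w]
    show "t powr \<mu> * exp (- l * t) * wgt \<nu> \<sigma> t k * cmod (c t k) \<le> t powr \<mu> * exp (- 0 * t) * wgt \<nu> \<sigma> t k * cmod (c t k)"
      by (simp add: ac_simps)
  qed
qed

lemma adm_diff: assumes "adm \<mu> \<nu> \<sigma> l T c M" "adm \<mu> \<nu> \<sigma> l T d M'"
  shows "adm \<mu> \<nu> \<sigma> l T (\<lambda>t k. c t k - d t k) (M + M')"
  unfolding adm_def
proof (intro conjI allI ballI)
  show "(\<lambda>t. indicator {0<..<T} t *\<^sub>R (c t k - d t k)) \<in> borel_measurable borel" for k
    using assms unfolding adm_def scaleR_diff_right by (intro borel_measurable_diff) auto
  fix t assume t: "t \<in> {0<..<T}"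
  let ?w = "\<lambda>k. t powr \<mu> * exp (- l * t) * wgt \<nu> \<sigma> t k"
  have l: "l2b (\<lambda>k. ?w k * cmod (c t k) + ?w k * cmod (d t k)) (M + M')"
    using assms t unfolding adm_def by (intro l2b_add) auto
  show "l2b (\<lambda>k. ?w k * cmod (c t k - d t k)) (M + M')"
  proof (rule l2b_mono[OF l])
    show "0 \<le> ?w k * cmod (c t k - d t k)" for k using wgt_pos[of \<nu> \<sigma> t k] by simp
    show "?w k * cmod (c t k - d t k) \<le> ?w k * cmod (c t k) + ?w k * cmod (d t k)" for k
      unfolding distrib_left[symmetric] using wgt_pos[of \<nu> \<sigma> t k] by (intro mult_left_mono norm_triangle_ineq4) simp
  qed
qed

lemma duhamel_minus_right: "duhamel al c (\<lambda>t k. - d t k) t k = - duhamel al c d t k"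
  using duhamel_scale[of al 1 c "-1" d t k] by simp

lemma adm_minus: "adm \<mu> \<nu> \<sigma> l T d M \<Longrightarrow> adm \<mu> \<nu> \<sigma> l T (\<lambda>t k. - d t k) M"
  unfolding adm_def by (auto dest!: borel_measurable_uminus)

lemma duhamel_diff_right:
  assumes "adm \<mu> \<nu> 0 0 T c M1" "adm \<mu> \<nu> 0 0 T d M2" "adm \<mu> \<nu> 0 0 T d' M3" "0 \<le> t" "t \<le> T"
  shows "duhamel al c (\<lambda>t k. d t k - d' t k) t k = duhamel al c d t k - duhamel al c d' t k"
  using duhamel_add_right[of al \<mu> \<nu> 0, OF al_Re(2) mu nu order.refl assms(1,2) adm_minus[OF assms(3)] order.refl assms(4,5)]
  by (simp add: duhamel_minus_right)

text \<open>For a large rate \<open>l\<close> the equation of the difference halves every bound on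
  it. Starting from the bound \<open>M1 + M2\<close>, n rounds give
  \<open>(M1 + M2) / 2 ^ n\<close>. The linear part \<open>f\<close> is arbitrary, as it
  cancels.\<close>

lemma uniqueness_adm:
  assumes T: "0 < T" "T \<le> 1"
    and c: "adm \<mu> \<nu> 0 0 T c M1" and d: "adm \<mu> \<nu> 0 0 T d M2"
    and ceq: "\<And>t k. t \<in> {0<..<T} \<Longrightarrow> c t k = f t k + duhamel al c c t k"
    and deq: "\<And>t k. t \<in> {0<..<T} \<Longrightarrow> d t k = f t k + duhamel al d d t k"
    and t: "t \<in> {0<..<T}"
  shows "c t k = d t k"
proof -
  obtain C where C0: "0 \<le> C" and C1: "\<forall>l T c d M1 M2 t k. 0 < l \<and> 0 < t \<and> t \<le> T \<and> T \<le> 1 \<and>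
     adm \<mu> \<nu> 0 0 T c M1 \<and> adm \<mu> \<nu> 0 l T d M2 \<longrightarrow>
     t powr \<mu> * exp (- l * t) * wgt \<nu> 0 t k * cmod (duhamel al c d t k) \<le> C * l powr - (\<theta> / 2) * gk k * M1 * M2"
    using duhamel_small by (elim exE conjE)
  obtain G where G: "0 \<le> G" "l2b gk G" using gk_l2b by blast
  have M: "0 \<le> M1" "0 \<le> M2" using adm_nonneg c d T by auto
  define A where "A = C * G * (M1 + M2)"
  have A: "0 \<le> A" using C0 G M by (simp add: A_def)
  \<comment> \<open>The rate is chosen so that l^(-theta / 2) = 1 / (2 A + 1); the contraction
    factor A / (2 A + 1) is then below 1/2.\<close>
  define l where "l = (2 * A + 1) powr (2 / \<theta>)"
  have l: "0 < l" using A by (simp add: l_def)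
  have lp: "l powr - (\<theta> / 2) = 1 / (2 * A + 1)"
    using A theta by (simp add: l_def powr_powr powr_minus_divide)
  let ?e = "\<lambda>t k. c t k - d t k"
  have e0: "adm \<mu> \<nu> 0 0 T ?e (M1 + M2)" by (rule adm_diff[OF c d])
  have half: "adm \<mu> \<nu> 0 l T ?e (M / 2)" if e: "adm \<mu> \<nu> 0 l T ?e M" for M
    unfolding adm_def
  proof (intro conjI allI ballI)
    show "(\<lambda>t. indicator {0<..<T} t *\<^sub>R ?e t k) \<in> borel_measurable borel" for k using e unfolding adm_def by blast
    have M0: "0 \<le> M" using adm_nonneg[OF e T(1)] .
    fix t assume t: "t \<in> {0<..<T}"
    let ?w = "\<lambda>k. t powr \<mu> * exp (- l * t) * wgt \<nu> 0 t k"
    \<comment> \<open>By the symmetry of the bilinear term, B(c,c) - B(d,d) = B(c, c - d) + B(d, c -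
      d). The difference always stands in the second slot, the one that carries the rate
      \<open>l\<close>.\<close>
    have eq: "?e t k = duhamel al c ?e t k + duhamel al d ?e t k" for k
    proof -
      have "duhamel al c ?e t k = duhamel al c c t k - duhamel al c d t k" "duhamel al d ?e t k = duhamel al d c t k - duhamel al d d t k"
        using t by (auto intro: duhamel_diff_right[OF c c d] duhamel_diff_right[OF d c d])
      moreover have "duhamel al d c = duhamel al c d" by (rule duhamel_commute)
      ultimately show ?thesis using ceq[OF t] deq[OF t] by simp
    qed
    have b: "?w k * cmod (duhamel al c ?e t k) \<le> C * l powr - (\<theta> / 2) * gk k * M1 * M"
      "?w k * cmod (duhamel al d ?e t k) \<le> C * l powr - (\<theta> / 2) * gk k * M2 * M" for k
      by (rule C1[rule_format, where T = T], use l t T c d e in simp)+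
    have "l2b (\<lambda>k. (C * l powr - (\<theta> / 2) * (M1 + M2) * M) * gk k) ((C * l powr - (\<theta> / 2) * (M1 + M2) * M) * G)"
      by (rule l2b_cmult[OF G(2)]) (use C0 M M0 in simp)
    then have "l2b (\<lambda>k. ?w k * cmod (?e t k)) ((C * l powr - (\<theta> / 2) * (M1 + M2) * M) * G)"
    proof (rule l2b_mono)
      fix k
      show "0 \<le> ?w k * cmod (?e t k)" using wgt_pos[of \<nu> 0 t k] by simp
      have "?w k * cmod (?e t k) \<le> ?w k * (cmod (duhamel al c ?e t k) + cmod (duhamel al d ?e t k))"
        unfolding eq[of k] using wgt_pos[of \<nu> 0 t k] by (intro mult_left_mono norm_triangle_ineq) simp
      also have "\<dots> = ?w k * cmod (duhamel al c ?e t k) + ?w k * cmod (duhamel al d ?e t k)" by (rule distrib_left)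
      also have "\<dots> \<le> C * l powr - (\<theta> / 2) * gk k * M1 * M + C * l powr - (\<theta> / 2) * gk k * M2 * M"
        by (rule add_mono[OF b])
      finally show "?w k * cmod (?e t k) \<le> (C * l powr - (\<theta> / 2) * (M1 + M2) * M) * gk k" by (simp add: algebra_simps)
    qed
    moreover have "(C * l powr - (\<theta> / 2) * (M1 + M2) * M) * G \<le> M / 2"
    proof -
      have "(C * l powr - (\<theta> / 2) * (M1 + M2) * M) * G = A / (2 * A + 1) * M" unfolding lp A_def by simp
      also have "\<dots> \<le> 1 / 2 * M" using A M0 by (intro mult_right_mono) (auto simp: field_simps)
      finally show ?thesis by simp
    qed
    ultimately show "l2b (\<lambda>k. ?w k * cmod (?e t k)) (M / 2)" by (rule l2b_le)
  qed
  have iter: "adm \<mu> \<nu> 0 l T ?e ((M1 + M2) / 2 ^ n)" for n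
  proof (induction n)
    case 0 then show ?case using adm_decrease[OF e0, of l] l by simp
  next
    case (Suc n) then show ?case using half[OF Suc] by (simp add: ac_simps)
  qed
  have "t powr \<mu> * exp (- l * t) * wgt \<nu> 0 t k * cmod (?e t k) \<le> (M1 + M2) / 2 ^ n" for n
  proof -
    have "l2b (\<lambda>k. t powr \<mu> * exp (- l * t) * wgt \<nu> 0 t k * cmod (?e t k)) ((M1 + M2) / 2 ^ n)"
      using iter[of n] t unfolding adm_def by (elim conjE) (rule bspec)
    then show ?thesis by (rule l2b_term)
  qed
  moreover have "(\<lambda>n. (M1 + M2) / 2 ^ n) \<longlonglongrightarrow> 0"
  proof -
    have "(\<lambda>n. (M1 + M2) * (1 / 2) ^ n) \<longlonglongrightarrow> (M1 + M2) * 0" by (intro tendsto_intros LIMSEQ_power_zero) simp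
    then show ?thesis by (simp add: power_divide)
  qed
  ultimately have "t powr \<mu> * exp (- l * t) * wgt \<nu> 0 t k * cmod (?e t k) \<le> 0"
    by (intro LIMSEQ_le_const) auto
  moreover have "0 < t powr \<mu> * exp (- l * t) * wgt \<nu> 0 t k" using t wgt_pos[of \<nu> 0 t k] by simp
  ultimately show ?thesis by (metis (no_types, lifting) mult_le_cancel_left_pos mult_zero_right norm_le_zero_iff right_minus_eq)
qed

end

subsection \<open>The fixed point problem on the Fourier side\<close>

lemma l2curve_eqI: "(\<And>t k. curve x t k = curve y t k) \<Longrightarrow> x = y"
  by (simp add: curve_inject[symmetric] fun_eq_iff)

lemma l2b_inverse_J: "\<exists>G. l2b (\<lambda>k. 1 / J k) G"
proof -
  have "(\<lambda>k::int. 4 * (1 + \<bar>real_of_int k\<bar>) powr - 2) summable_on UNIV"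
    by (intro summable_on_cmult_right bracket_summable) simp
  then have "(\<lambda>k. (1 / J k)\<^sup>2) summable_on UNIV"
  proof (rule summable_on_comparison_test)
    fix k :: int
    have "(1 + \<bar>real_of_int k\<bar>)\<^sup>2 \<le> 2 * J k"
      using zero_le_power2[of "1 - \<bar>real_of_int k\<bar>"] by (simp add: J_def power2_eq_square algebra_simps)
    then have "1 / J k \<le> 2 * (1 + \<bar>real_of_int k\<bar>) powr - 2"
      using J_pos[of k] by (simp add: powr_minus_divide field_simps)
    moreover have "(1 / J k)\<^sup>2 \<le> 1 / J k" using J_ge_1[of k] by (simp add: power2_eq_square field_simps)
    ultimately show "(1 / J k)\<^sup>2 \<le> 4 * (1 + \<bar>real_of_int k\<bar>) powr - 2" by (smt (verit) powr_ge_zero)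
  qed simp
  from l2b_of_summable[OF this] show ?thesis by blast
qed

context bo_burgers
begin

text \<open>The weights of the smoothing norm, which is infinite at \<open>t = 0\<close> for \<open>s < 0\<close>, and of the analytic
  \<open>H\<^sup>s\<close>-norm.\<close>

definition om :: "real \<Rightarrow> int \<Rightarrow> real" where "om t k = t powr \<mu> * wgt \<nu> 1 t k"
definition sm :: "real \<Rightarrow> int \<Rightarrow> real" where "sm t k = J k powr - \<mu> * wgt \<nu> 1 t k"

lemma sm_eq: "sm t k = J k powr (s / 2) * exp (t * \<bar>of_int k\<bar>)"
proof -
  have "- \<mu> + \<nu> / 2 = s / 2" using nu_mu by linarith
  then have "J k powr - \<mu> * J k powr (\<nu> / 2) = J k powr (s / 2)" by (simp only: powr_add[symmetric])
  then show ?thesis by (simp add: sm_def wgt_def flip: mult.assoc)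
qed

lemma om_pos: "0 < t \<Longrightarrow> 0 < om t k" and om_nonneg: "0 \<le> om t k" and sm_pos: "0 < sm t k"
  using wgt_pos[of \<nu> 1 t k] J_pos[of k] by (simp_all add: om_def sm_def)

lemma ex_CB: "\<exists>C\<ge>0. \<forall>T c d M1 M2 t. 0 < t \<and> t \<le> T \<and> T \<le> 1 \<and>
     adm \<mu> \<nu> 1 0 T c M1 \<and> adm \<mu> \<nu> 1 0 T d M2 \<longrightarrow>
     l2b (\<lambda>k. om t k * cmod (duhamel al c d t k)) (C * M1 * M2 * t powr \<theta>) \<and>
     l2b (\<lambda>k. sm t k * cmod (duhamel al c d t k)) (C * M1 * M2 * t powr \<theta>)"
proof -
  obtain C where C0: "0 \<le> C" and C1: "\<forall>\<sigma> T c d M1 M2 t k. 0 \<le> \<sigma> \<and> \<sigma> \<le> 1 \<and> 0 < t \<and> t \<le> T \<and> T \<le> 1 \<and>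
     adm \<mu> \<nu> \<sigma> 0 T c M1 \<and> adm \<mu> \<nu> \<sigma> 0 T d M2 \<longrightarrow>
     t powr \<mu> * wgt \<nu> \<sigma> t k * cmod (duhamel al c d t k) \<le> C * gk k * M1 * M2 * t powr \<theta> \<and>
     J k powr - \<mu> * wgt \<nu> \<sigma> t k * cmod (duhamel al c d t k) \<le> C * gk k * M1 * M2 * t powr \<theta>"
    using duhamel_bounds by (elim exE conjE)
  obtain G where G: "0 \<le> G" "l2b gk G" using gk_l2b by blast
  have "l2b (\<lambda>k. om t k * cmod (duhamel al c d t k)) (C * G * M1 * M2 * t powr \<theta>) \<and>
     l2b (\<lambda>k. sm t k * cmod (duhamel al c d t k)) (C * G * M1 * M2 * t powr \<theta>)"
    if h: "0 < t" "t \<le> T" "T \<le> 1" and c: "adm \<mu> \<nu> 1 0 T c M1" and d: "adm \<mu> \<nu> 1 0 T d M2" for T c d M1 M2 t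
  proof -
    have M: "0 \<le> M1" "0 \<le> M2" using adm_nonneg[OF c] adm_nonneg[OF d] h by auto
    have "l2b (\<lambda>k. (C * M1 * M2 * t powr \<theta>) * gk k) ((C * M1 * M2 * t powr \<theta>) * G)"
      by (rule l2b_cmult[OF G(2)]) (use C0 M in simp)
    then have g: "l2b (\<lambda>k. C * gk k * M1 * M2 * t powr \<theta>) (C * G * M1 * M2 * t powr \<theta>)" by (simp add: ac_simps)
    have 1: "om t k * cmod (duhamel al c d t k) \<le> C * gk k * M1 * M2 * t powr \<theta>"
      "sm t k * cmod (duhamel al c d t k) \<le> C * gk k * M1 * M2 * t powr \<theta>" for k
      using C1[rule_format, of 1 t T c M1 d M2 k] h c d unfolding om_def sm_def by auto
    show ?thesis
      by (intro conjI; rule l2b_mono[OF g]) (use 1 om_nonneg sm_pos in \<open>auto simp: less_imp_le\<close>)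
  qed
  moreover have "0 \<le> C * G" using C0 G by simp
  ultimately show ?thesis by blast
qed

text \<open>The constant gets a name because the locale \<open>bo_time\<close> states its smallness
  condition with it; the same holds for \<open>CL\<close>.\<close>

definition CB :: real where "CB = (SOME C. 0 \<le> C \<and> (\<forall>T c d M1 M2 t. 0 < t \<and> t \<le> T \<and> T \<le> 1 \<and>
     adm \<mu> \<nu> 1 0 T c M1 \<and> adm \<mu> \<nu> 1 0 T d M2 \<longrightarrow>
     l2b (\<lambda>k. om t k * cmod (duhamel al c d t k)) (C * M1 * M2 * t powr \<theta>) \<and>
     l2b (\<lambda>k. sm t k * cmod (duhamel al c d t k)) (C * M1 * M2 * t powr \<theta>)))"

lemma CB: "0 \<le> CB"
  "0 < t \<Longrightarrow> t \<le> T \<Longrightarrow> T \<le> 1 \<Longrightarrow> adm \<mu> \<nu> 1 0 T c M1 \<Longrightarrow> adm \<mu> \<nu> 1 0 T d M2 \<Longrightarrow>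
    l2b (\<lambda>k. om t k * cmod (duhamel al c d t k)) (CB * M1 * M2 * t powr \<theta>)"
  "0 < t \<Longrightarrow> t \<le> T \<Longrightarrow> T \<le> 1 \<Longrightarrow> adm \<mu> \<nu> 1 0 T c M1 \<Longrightarrow> adm \<mu> \<nu> 1 0 T d M2 \<Longrightarrow>
    l2b (\<lambda>k. sm t k * cmod (duhamel al c d t k)) (CB * M1 * M2 * t powr \<theta>)"
  using someI_ex[OF ex_CB] unfolding CB_def[symmetric] by auto

lemma ex_CL: "\<exists>C\<ge>0. \<forall>t \<phi>. 0 \<le> t \<and> t \<le> 1 \<and> \<phi> \<in> Hs s \<longrightarrow>
    l2b (\<lambda>k. om t k * cmod (lin \<phi> t k)) (C * Hs_norm s \<phi>) \<and> l2b (\<lambda>k. sm t k * cmod (lin \<phi> t k)) (C * Hs_norm s \<phi>)"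
proof -
  obtain C where C0: "0 \<le> C" and C1: "\<forall>\<sigma> t k. 0 \<le> \<sigma> \<and> \<sigma> \<le> 1 \<and> 0 \<le> t \<and> t \<le> 1 \<longrightarrow>
     t powr \<mu> * wgt \<nu> \<sigma> t k * cmod (exp (al k * of_real t)) \<le> C * J k powr (s / 2) \<and>
     J k powr - \<mu> * wgt \<nu> \<sigma> t k * cmod (exp (al k * of_real t)) \<le> C * J k powr (s / 2)"
    using linear_bounds by (elim exE conjE)
  have "l2b (\<lambda>k. om t k * cmod (lin \<phi> t k)) (C * Hs_norm s \<phi>) \<and> l2b (\<lambda>k. sm t k * cmod (lin \<phi> t k)) (C * Hs_norm s \<phi>)"
    if h: "0 \<le> t" "t \<le> 1" and p: "\<phi> \<in> Hs s" for t \<phi>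
  proof -
    have g: "l2b (\<lambda>k. C * (J k powr (s/2) * cmod (fourier_coeff \<phi> k))) (C * Hs_norm s \<phi>)"
      by (rule l2b_cmult[OF Hs_l2b'[OF p] C0])
    have "om t k * cmod (exp (al k * of_real t)) \<le> C * J k powr (s / 2)"
      "sm t k * cmod (exp (al k * of_real t)) \<le> C * J k powr (s / 2)" for k
      using C1[rule_format, of 1 t k] h unfolding om_def sm_def by auto
    from this[THEN mult_right_mono, of "cmod (fourier_coeff \<phi> _)"]
    have 1: "om t k * cmod (lin \<phi> t k) \<le> C * (J k powr (s/2) * cmod (fourier_coeff \<phi> k))"
      "sm t k * cmod (lin \<phi> t k) \<le> C * (J k powr (s/2) * cmod (fourier_coeff \<phi> k))" for k
      unfolding lin_def norm_mult by (simp_all add: mult.assoc)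
    show ?thesis
      by (intro conjI; rule l2b_mono[OF g]) (use 1 om_nonneg sm_pos in \<open>auto simp: less_imp_le\<close>)
  qed
  then show ?thesis using C0 by blast
qed

definition CL :: real where "CL = (SOME C. 0 \<le> C \<and> (\<forall>t \<phi>. 0 \<le> t \<and> t \<le> 1 \<and> \<phi> \<in> Hs s \<longrightarrow>
    l2b (\<lambda>k. om t k * cmod (lin \<phi> t k)) (C * Hs_norm s \<phi>) \<and> l2b (\<lambda>k. sm t k * cmod (lin \<phi> t k)) (C * Hs_norm s \<phi>)))"

lemma CL: "0 \<le> CL"
  "0 \<le> t \<Longrightarrow> t \<le> 1 \<Longrightarrow> \<phi> \<in> Hs s \<Longrightarrow> l2b (\<lambda>k. om t k * cmod (lin \<phi> t k)) (CL * Hs_norm s \<phi>)"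
  "0 \<le> t \<Longrightarrow> t \<le> 1 \<Longrightarrow> \<phi> \<in> Hs s \<Longrightarrow> l2b (\<lambda>k. sm t k * cmod (lin \<phi> t k)) (CL * Hs_norm s \<phi>)"
  using someI_ex[OF ex_CL] unfolding CL_def[symmetric] by auto

lemma lin_continuous: "continuous_on S (\<lambda>t. lin \<phi> t k)"
  unfolding lin_def by (intro continuous_intros)

end

text \<open>\<open>R\<close> bounds the data in \<open>H\<^sup>s\<close>. \<open>T_small\<close> is
  the smallness condition of the abstract fixed point with K = CB T^theta and rho = CL R + 1, where
  the summand 1 keeps rho positive for all values of \<open>CL\<close> and \<open>R\<close>.\<close>

locale bo_time = bo_burgers \<beta> \<eta> s for \<beta> \<eta> s :: real +
  fixes T R :: real
  assumes T: "0 < T" "T \<le> 1" and R: "0 \<le> R" and T_small: "4 * (CB * T powr \<theta>) * (CL * R + 1) < 1"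
begin

text \<open>Dividing by the weight \<open>om\<close> identifies \<open>l2curve\<close>, as far as
  times in (0, T] are concerned, with the space of the overview: the norm of the code is the
  weighted supremum of the decoded curve.\<close>

definition dec :: "l2curve \<Rightarrow> real \<Rightarrow> int \<Rightarrow> complex" where
  "dec z t k = (if 0 < t \<and> t \<le> T then curve z t k / of_real (om t k) else 0)"

definition enc :: "(real \<Rightarrow> int \<Rightarrow> complex) \<Rightarrow> l2curve" where
  "enc c = Abs_l2curve (\<lambda>t k. if 0 < t \<and> t \<le> T then of_real (om t k) * c t k else 0)"

lemma enc:
  assumes cont: "\<And>k. continuous_on {0..T} (\<lambda>t. c t k)"
    and b: "\<And>t. 0 < t \<Longrightarrow> t \<le> T \<Longrightarrow> l2b (\<lambda>k. om t k * cmod (c t k)) M" and M: "0 \<le> M"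
  shows "curve (enc c) t k = (if 0 < t \<and> t \<le> T then of_real (om t k) * c t k else 0)" "norm (enc c) \<le> M"
    "0 < t \<Longrightarrow> t \<le> T \<Longrightarrow> dec (enc c) t k = c t k"
proof -
  let ?z = "\<lambda>t k. if 0 < t \<and> t \<le> T then of_real (om t k) * c t k else 0"
  have m: "(\<lambda>t. ?z t k) \<in> borel_measurable borel" for k
  proof -
    have "continuous_on {0<..T} (\<lambda>t. of_real (om t k) * c t k)"
      unfolding om_def wgt_def by (intro continuous_intros continuous_on_subset[OF cont]) auto
    then have "(\<lambda>t. indicator {0<..T} t *\<^sub>R (of_real (om t k) * c t k)) \<in> borel_measurable borel"
      by (intro borel_measurable_continuous_on_indicator) auto
    moreover have "(\<lambda>t. indicator {0<..T} t *\<^sub>R (of_real (om t k) * c t k)) = (\<lambda>t. ?z t k)"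
      by (auto simp: fun_eq_iff indicator_def)
    ultimately show ?thesis by (simp only:)
  qed
  have l: "l2b (\<lambda>k. cmod (?z t k)) M" for t
  proof (cases "0 < t \<and> t \<le> T")
    case True
    then show ?thesis using b[of t] om_nonneg[of t] by (simp add: norm_mult)
  qed (use M in \<open>auto simp: l2b_def L2_set_def\<close>)
  have e: "curve (enc c) = ?z" unfolding enc_def
    by (rule Abs_l2curve_inverse) (use m l in blast)
  show "curve (enc c) t k = (if 0 < t \<and> t \<le> T then of_real (om t k) * c t k else 0)" by (simp add: e)
  show "norm (enc c) \<le> M" by (rule norm_l2curve_le) (simp only: e l)
  show "0 < t \<Longrightarrow> t \<le> T \<Longrightarrow> dec (enc c) t k = c t k" using om_pos[of t k] by (simp add: dec_def e)
qed

lemma dec_add: "dec (x + y) = (\<lambda>t k. dec x t k + dec y t k)"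
  by (intro ext) (simp add: dec_def curve_add add_divide_distrib)

lemma dec_scaleR: "dec (a *\<^sub>R x) = (\<lambda>t k. of_real a * dec x t k)"
  by (intro ext) (simp add: dec_def curve_scaleR)

lemma om_dec: "0 < t \<Longrightarrow> t \<le> T \<Longrightarrow> om t k * cmod (dec z t k) = cmod (curve z t k)"
  using om_pos[of t k] by (simp add: dec_def norm_divide)

lemma adm_dec: "adm \<mu> \<nu> 1 0 T (dec z) (norm z)"
  unfolding adm_def
proof (intro conjI allI ballI)
  fix k
  have "(\<lambda>t. indicator {0<..<T} t *\<^sub>R dec z t k) = (\<lambda>t. indicator {0<..<T} t *\<^sub>R (curve z t k / of_real (om t k)))"
    by (auto simp: fun_eq_iff dec_def indicator_def)
  moreover have "(\<lambda>t. indicator {0<..<T} t *\<^sub>R (curve z t k / of_real (om t k))) \<in> borel_measurable borel"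
    using curve_measurable[of z k] unfolding om_def wgt_def by measurable
  ultimately show "(\<lambda>t. indicator {0<..<T} t *\<^sub>R dec z t k) \<in> borel_measurable borel" by (simp only:)
next
  fix t assume t: "t \<in> {0<..<T}"
  have "(\<lambda>k. t powr \<mu> * exp (- 0 * t) * wgt \<nu> 1 t k * cmod (dec z t k)) = (\<lambda>k. cmod (curve z t k))"
    using om_dec[of t _ z] t unfolding om_def by (simp add: fun_eq_iff)
  then show "l2b (\<lambda>k. t powr \<mu> * exp (- 0 * t) * wgt \<nu> 1 t k * cmod (dec z t k)) (norm z)"
    using l2b_curve[of z t] by (simp only:)
qed

lemma duhamel_dec_continuous: "continuous_on {0..T} (\<lambda>t. duhamel al (dec z) (dec z') t k)"
  by (rule duhamel_continuous[OF al_Re(2) mu nu _ adm_dec adm_dec _ T(1)]) auto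

definition LZ :: "pdist \<Rightarrow> l2curve" where "LZ \<phi> = enc (lin \<phi>)"
definition BZ :: "l2curve \<Rightarrow> l2curve \<Rightarrow> l2curve" where "BZ z z' = enc (duhamel al (dec z) (dec z'))"
text \<open>In contrast to \<open>LZ\<close>, the time 0 is kept: the weight \<open>om\<close> is 0
  there, so an encoded curve carries no information about its value at 0.\<close>

definition lo :: "pdist \<Rightarrow> real \<Rightarrow> int \<Rightarrow> complex" where
  "lo \<phi> = (\<lambda>t k. if 0 \<le> t \<and> t \<le> T then lin \<phi> t k else 0)"
definition Bo :: "l2curve \<Rightarrow> l2curve \<Rightarrow> real \<Rightarrow> int \<Rightarrow> complex" where
  "Bo z z' = (\<lambda>t k. if 0 \<le> t \<and> t \<le> T then duhamel al (dec z) (dec z') t k else 0)"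

lemma LZ: assumes "\<phi> \<in> Hs s"
  shows "curve (LZ \<phi>) t k = (if 0 < t \<and> t \<le> T then of_real (om t k) * lin \<phi> t k else 0)"
    "norm (LZ \<phi>) \<le> CL * Hs_norm s \<phi>" "0 < t \<Longrightarrow> t \<le> T \<Longrightarrow> dec (LZ \<phi>) t k = lin \<phi> t k"
proof -
  have nn: "0 \<le> CL * Hs_norm s \<phi>" using CL(1) Hs_norm_nonneg by simp
  have b: "l2b (\<lambda>k. om t k * cmod (lin \<phi> t k)) (CL * Hs_norm s \<phi>)" if "0 < t" "t \<le> T" for t
    using that T by (intro CL(2) assms) auto
  note e = enc[where c = "lin \<phi>", OF lin_continuous b nn]
  show "curve (LZ \<phi>) t k = (if 0 < t \<and> t \<le> T then of_real (om t k) * lin \<phi> t k else 0)"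
    "norm (LZ \<phi>) \<le> CL * Hs_norm s \<phi>" "0 < t \<Longrightarrow> t \<le> T \<Longrightarrow> dec (LZ \<phi>) t k = lin \<phi> t k"
    unfolding LZ_def using e by blast+
qed

lemma BZ_bound: assumes "0 < t" "t \<le> T"
  shows "l2b (\<lambda>k. om t k * cmod (duhamel al (dec z) (dec z') t k)) (CB * T powr \<theta> * norm z * norm z')"
    "l2b (\<lambda>k. sm t k * cmod (duhamel al (dec z) (dec z') t k)) (CB * norm z * norm z' * t powr \<theta>)"
proof -
  have "CB * norm z * norm z' * t powr \<theta> \<le> CB * norm z * norm z' * T powr \<theta>"
    using CB(1) assms theta by (intro mult_left_mono powr_mono2) auto
  then have le: "CB * norm z * norm z' * t powr \<theta> \<le> CB * T powr \<theta> * norm z * norm z'" by (simp add: ac_simps)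
  show "l2b (\<lambda>k. om t k * cmod (duhamel al (dec z) (dec z') t k)) (CB * T powr \<theta> * norm z * norm z')"
    by (rule l2b_le[OF CB(2)[OF assms T(2) adm_dec adm_dec] le])
  show "l2b (\<lambda>k. sm t k * cmod (duhamel al (dec z) (dec z') t k)) (CB * norm z * norm z' * t powr \<theta>)"
    by (rule CB(3)[OF assms T(2) adm_dec adm_dec])
qed

lemma BZ:
  "curve (BZ z z') t k = (if 0 < t \<and> t \<le> T then of_real (om t k) * duhamel al (dec z) (dec z') t k else 0)"
  "norm (BZ z z') \<le> CB * T powr \<theta> * norm z * norm z'"
  "0 < t \<Longrightarrow> t \<le> T \<Longrightarrow> dec (BZ z z') t k = duhamel al (dec z) (dec z') t k"
proof -
  have nn: "0 \<le> CB * T powr \<theta> * norm z * norm z'" using CB(1) by simp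
  note e = enc[where c = "duhamel al (dec z) (dec z')", OF duhamel_dec_continuous BZ_bound(1) nn]
  show "curve (BZ z z') t k = (if 0 < t \<and> t \<le> T then of_real (om t k) * duhamel al (dec z) (dec z') t k else 0)"
    "norm (BZ z z') \<le> CB * T powr \<theta> * norm z * norm z'"
    "0 < t \<Longrightarrow> t \<le> T \<Longrightarrow> dec (BZ z z') t k = duhamel al (dec z) (dec z') t k"
    unfolding BZ_def using e by blast+
qed

lemma duhamel_dec_add:
  assumes "0 \<le> t" "t \<le> T"
  shows "duhamel al (dec (x + y)) (dec z) t k = duhamel al (dec x) (dec z) t k + duhamel al (dec y) (dec z) t k"
    "duhamel al (dec z) (dec (x + y)) t k = duhamel al (dec z) (dec x) t k + duhamel al (dec z) (dec y) t k"
  unfolding dec_add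
  using duhamel_add_left[of al \<mu> \<nu> 1, OF al_Re(2) mu nu _ adm_dec adm_dec adm_dec _ assms]
    duhamel_add_right[of al \<mu> \<nu> 1, OF al_Re(2) mu nu _ adm_dec adm_dec adm_dec _ assms] by auto

lemma duhamel_dec_scale:
  "duhamel al (dec (a *\<^sub>R x)) (dec z) t k = of_real a * duhamel al (dec x) (dec z) t k"
  "duhamel al (dec z) (dec (a *\<^sub>R x)) t k = of_real a * duhamel al (dec z) (dec x) t k"
  unfolding dec_scaleR using duhamel_scale[of al "of_real a" "dec x" 1 "dec z" t k] duhamel_scale[of al 1 "dec z" "of_real a" "dec x" t k]
  by simp_all

lemma bilinear_BZ: "bounded_bilinear BZ"
proof
  show "BZ (a + a') b = BZ a b + BZ a' b" for a a' b
    by (rule l2curve_eqI) (simp add: BZ curve_add duhamel_dec_add distrib_left)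
  show "BZ a (b + b') = BZ a b + BZ a b'" for a b b'
    by (rule l2curve_eqI) (simp add: BZ curve_add duhamel_dec_add distrib_left)
  show "BZ (r *\<^sub>R a) b = r *\<^sub>R BZ a b" for r a b
    by (rule l2curve_eqI) (simp add: BZ curve_scaleR duhamel_dec_scale)
  show "BZ a (r *\<^sub>R b) = r *\<^sub>R BZ a b" for r a b
    by (rule l2curve_eqI) (simp add: BZ curve_scaleR duhamel_dec_scale)
  show "\<exists>K. \<forall>a b. norm (BZ a b) \<le> norm a * norm b * K"
    using BZ(2) by (intro exI[of _ "CB * T powr \<theta>"]) (simp add: ac_simps)
qed

lemma Hs_add: "f \<in> Hs r \<Longrightarrow> g \<in> Hs r \<Longrightarrow> f + g \<in> Hs r"
proof -
  assume f: "f \<in> Hs r" and g: "g \<in> Hs r"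
  have "0 \<in> Hs r" by (simp add: Hs_iff)
  then have "0 - g \<in> Hs r" using g by (rule Hs_diff)
  from Hs_diff(1)[OF f this] show ?thesis by simp
qed

lemma Hs_scaleR: assumes "f \<in> Hs r" shows "a *\<^sub>R f \<in> Hs r"
proof (rule HsI(1))
  show "l2b (\<lambda>k. J k powr (r/2) * cmod (fourier_coeff (a *\<^sub>R f) k)) (\<bar>a\<bar> * Hs_norm r f)"
    using l2b_cmult[OF Hs_l2b'[OF assms], of "\<bar>a\<bar>"] by (simp add: fourier_coeff_scaleR norm_mult ac_simps)
qed

lemma lin_add: "lin (f + g) t k = lin f t k + lin g t k"
  and lin_scaleR: "lin (a *\<^sub>R f) t k = of_real a * lin f t k"
  by (simp_all add: lin_def fourier_coeff_add fourier_coeff_scaleR distrib_left)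

lemma linear_LZ: "linear_on_subspace (Hs s) LZ"
  unfolding linear_on_subspace_def
  by (intro conjI ballI allI l2curve_eqI)
    (simp_all add: LZ Hs_add Hs_scaleR curve_add curve_scaleR lin_add lin_scaleR distrib_left)

lemma linear_lo: "linear_on_subspace (Hs s) lo"
  unfolding linear_on_subspace_def
  by (intro conjI ballI allI ext) (simp_all add: lo_def lin_add lin_scaleR scaleR_fun_def scaleR_conv_of_real)

text \<open>Finite partial norms at single times are finite on every curve, also on those of
  infinite weighted norm, and are therefore seminorms on the whole function space. A common bound
  over \<open>P\<close> is the weighted norm bound, see \<open>bnd_iff\<close>.\<close>

definition P :: "((real \<Rightarrow> int \<Rightarrow> complex) \<Rightarrow> real) set" where
  "P = {p. \<exists>t\<in>{0..T}. \<exists>F. finite F \<and> p = (\<lambda>c. L2_set (\<lambda>k. sm t k * cmod (c t k)) F)} \<union>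
       {p. \<exists>t\<in>{0<..T}. \<exists>F. finite F \<and> p = (\<lambda>c. L2_set (\<lambda>k. om t k * cmod (c t k)) F)}"

definition bnd :: "(real \<Rightarrow> int \<Rightarrow> complex) \<Rightarrow> real \<Rightarrow> bool" where
  "bnd c M \<longleftrightarrow> (\<forall>t\<in>{0..T}. l2b (\<lambda>k. sm t k * cmod (c t k)) M) \<and> (\<forall>t\<in>{0<..T}. l2b (\<lambda>k. om t k * cmod (c t k)) M)"

lemma bnd_iff: "bnd c M \<longleftrightarrow> (\<forall>p\<in>P. p c \<le> M)"
proof
  assume b: "bnd c M"
  show "\<forall>p\<in>P. p c \<le> M"
  proof
    fix p assume "p \<in> P"
    then show "p c \<le> M" unfolding P_def
      by (elim UnE CollectE bexE exE conjE) (use b in \<open>simp_all add: bnd_def l2b_def\<close>)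
  qed
next
  assume b: "\<forall>p\<in>P. p c \<le> M"
  have 1: "(\<lambda>c. L2_set (\<lambda>k. sm t k * cmod (c t k)) F) \<in> P" if "t \<in> {0..T}" "finite F" for t F
    using that unfolding P_def by blast
  have 2: "(\<lambda>c. L2_set (\<lambda>k. om t k * cmod (c t k)) F) \<in> P" if "t \<in> {0<..T}" "finite F" for t F
    using that unfolding P_def by blast
  show "bnd c M" unfolding bnd_def l2b_def
  proof (intro conjI ballI allI impI)
    show "L2_set (\<lambda>k. sm t k * cmod (c t k)) F \<le> M" if "t \<in> {0..T}" "finite F" for t F
      using bspec[OF b 1[OF that]] .
    show "L2_set (\<lambda>k. om t k * cmod (c t k)) F \<le> M" if "t \<in> {0<..T}" "finite F" for t F
      using bspec[OF b 2[OF that]] .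
  qed
qed

lemma bndD: "bnd c M \<Longrightarrow> 0 \<le> t \<Longrightarrow> t \<le> T \<Longrightarrow> l2b (\<lambda>k. sm t k * cmod (c t k)) M"
  "bnd c M \<Longrightarrow> 0 < t \<Longrightarrow> t \<le> T \<Longrightarrow> l2b (\<lambda>k. om t k * cmod (c t k)) M"
  by (auto simp: bnd_def)

lemma duhamel_0 [simp]: "duhamel al c d 0 k = 0"
  by (simp add: duhamel_def set_lebesgue_integral_def)

lemma bnd_lo: assumes "\<phi> \<in> Hs s" shows "bnd (lo \<phi>) (CL * Hs_norm s \<phi>)"
  using CL(2,3)[OF _ _ assms] T by (auto simp: bnd_def lo_def)

lemma bnd_Bo: "bnd (Bo z z') (CB * norm z * norm z')"
  unfolding bnd_def
proof (intro conjI ballI)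
  have T1: "t powr \<theta> \<le> 1" if "0 < t" "t \<le> T" for t using that T theta by (intro powr_le1) auto
  fix t assume t: "t \<in> {0..T}"
  show "l2b (\<lambda>k. sm t k * cmod (Bo z z' t k)) (CB * norm z * norm z')"
  proof (cases "t = 0")
    case True
    then show ?thesis using CB(1) T by (simp add: Bo_def l2b_def L2_set_def)
  next
    case False
    have "CB * norm z * norm z' * t powr \<theta> \<le> CB * norm z * norm z'"
      using mult_left_mono[OF T1[of t], of "CB * norm z * norm z'"] CB(1) t False by simp
    from l2b_le[OF BZ_bound(2) this] show ?thesis using t False by (simp add: Bo_def)
  qed
next
  fix t assume t: "t \<in> {0<..T}"
  have "T powr \<theta> \<le> 1" using T theta by (intro powr_le1) auto
  then have "CB * T powr \<theta> * norm z * norm z' \<le> CB * norm z * norm z'"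
    using mult_left_mono[of "T powr \<theta>" 1 "CB * norm z * norm z'"] CB(1) by (simp add: ac_simps)
  from l2b_le[OF BZ_bound(1) this, of t] show "l2b (\<lambda>k. om t k * cmod (Bo z z' t k)) (CB * norm z * norm z')"
    using t by (simp add: Bo_def)
qed

lemma P_triangle: assumes "p \<in> P" shows "p (c + d) \<le> p c + p d"
proof -
  have *: "L2_set (\<lambda>k. w k * cmod (c t k + d t k)) F \<le> L2_set (\<lambda>k. w k * cmod (c t k)) F + L2_set (\<lambda>k. w k * cmod (d t k)) F"
    if w: "\<And>k. 0 \<le> w k" for w :: "int \<Rightarrow> real" and t F
  proof -
    have "L2_set (\<lambda>k. w k * cmod (c t k + d t k)) F \<le> L2_set (\<lambda>k. w k * cmod (c t k) + w k * cmod (d t k)) F"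
      unfolding distrib_left[symmetric] using w by (intro L2_set_mono mult_left_mono norm_triangle_ineq) auto
    also have "\<dots> \<le> L2_set (\<lambda>k. w k * cmod (c t k)) F + L2_set (\<lambda>k. w k * cmod (d t k)) F" by (rule L2_set_triangle_ineq)
    finally show ?thesis .
  qed
  show ?thesis using assms *[of "sm _"] *[of "om _"] sm_pos om_nonneg unfolding P_def by (auto simp: less_imp_le)
qed

lemma P_zero: "p \<in> P \<Longrightarrow> p 0 = 0"
  unfolding P_def by (auto simp: L2_set_def)

definition X :: "pdist set" where "X = {\<phi> \<in> Hs s. Hs_norm s \<phi> < R}"

sublocale qo: quadratic_output BZ LZ "Hs s" X "Hs_norm s" "CB * T powr \<theta>" "CL * R + 1" CL Bo lo P "CL + CB"
proof
  show "\<exists>K. \<forall>a b. norm (BZ a b) \<le> norm a * norm b * K" using bilinear_BZ unfolding bounded_bilinear_def by blast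
  show "norm (BZ a b) \<le> CB * T powr \<theta> * norm a * norm b" for a b by (rule BZ)
  show "0 \<le> CB * T powr \<theta>" using CB(1) by simp
  show "linear_on_subspace (Hs s) LZ" by (rule linear_LZ)
  show "norm (LZ h) \<le> CL * Hs_norm s h" if "h \<in> Hs s" for h by (rule LZ[OF that])
  show "0 \<le> CL" by (rule CL)
  show "0 \<le> Hs_norm s h" for h by (rule Hs_norm_nonneg)
  show "X \<subseteq> Hs s" by (auto simp: X_def)
  show "norm (LZ x) \<le> CL * R + 1" if "x \<in> X" for x
    using LZ(2)[of x] that mult_left_mono[of "Hs_norm s x" R CL] CL(1) by (simp add: X_def)
  show "0 < CL * R + 1" using CL(1) R by (simp add: add_nonneg_pos)
  show "4 * (CB * T powr \<theta>) * (CL * R + 1) < 1" by (rule T_small)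
  show "Bo (a + b) d = Bo a d + Bo b d" "Bo d (a + b) = Bo d a + Bo d b" for a b d
    by (intro ext, simp add: Bo_def duhamel_dec_add)+
  show "Bo (r *\<^sub>R a) b = r *\<^sub>R Bo a b" "Bo a (r *\<^sub>R b) = r *\<^sub>R Bo a b" for r a b
    by (intro ext, simp add: Bo_def duhamel_dec_scale scaleR_fun_def scaleR_conv_of_real)+
  show "linear_on_subspace (Hs s) lo" by (rule linear_lo)
  show "p (v + w) \<le> p v + p w" if "p \<in> P" for p v w by (rule P_triangle[OF that])
  show "p 0 = 0" if "p \<in> P" for p by (rule P_zero[OF that])
  show "0 \<le> CL + CB" using CL CB by simp
  show "p (Bo a b) \<le> (CL + CB) * norm a * norm b" if "p \<in> P" for p a b
  proof -
    have "p (Bo a b) \<le> CB * norm a * norm b" using bnd_Bo[of a b] that unfolding bnd_iff by blast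
    also have "\<dots> \<le> (CL + CB) * norm a * norm b" using CL(1) by (intro mult_right_mono) auto
    finally show ?thesis .
  qed
  show "p (lo h) \<le> (CL + CB) * Hs_norm s h" if "p \<in> P" "h \<in> Hs s" for p h
  proof -
    have "p (lo h) \<le> CL * Hs_norm s h" using bnd_lo[of h] that unfolding bnd_iff by blast
    also have "\<dots> \<le> (CL + CB) * Hs_norm s h" using CB(1) Hs_norm_nonneg by (intro mult_right_mono) auto
    finally show ?thesis .
  qed
qed (use bilinear_BZ in \<open>auto simp: bounded_bilinear_def\<close>)

end

subsection \<open>Regularity of the curves of distributions\<close>

text \<open>The distributional integral is taken over the closed interval, but nothing is known
  about the integrand at the endpoints. Changing single values affects neither integrability nor the
  integral.\<close>

lemma set_integral_Icc_Ioo: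
  fixes f :: "real \<Rightarrow> complex"
  assumes f: "set_integrable lborel {a<..<b} f"
  shows "set_integrable lborel {a..b} f" "(LINT x:{a..b}|lborel. f x) = (LINT x:{a<..<b}|lborel. f x)"
proof -
  let ?c = "\<lambda>x. indicator {a..b} x *\<^sub>R f x"
  \<comment> \<open>Removing \<open>a\<close> from \<open>{b}\<close> covers the degenerate interval
    a = b, which occurs at time 0.\<close>
  have e: "?c x = indicator {a<..<b} x *\<^sub>R f x + (indicator {a} x *\<^sub>R ?c a + indicator ({b} - {a}) x *\<^sub>R ?c b)" for x
    by (auto simp: indicator_def)
  have pt: "integrable lborel (\<lambda>x. indicator A x *\<^sub>R z)" if "A = {y} \<or> A = {}" for A and y :: real and z :: complex
    using that by (intro integrable_scaleR_left integrable_real_indicator) auto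
  define r where "r x = indicator {a<..<b} x *\<^sub>R f x + (indicator {a} x *\<^sub>R ?c a + indicator ({b} - {a}) x *\<^sub>R ?c b)" for x
  have "integrable lborel r" unfolding r_def
    by (intro Bochner_Integration.integrable_add pt f[unfolded set_integrable_def]) auto
  moreover have "r = ?c" unfolding r_def by (rule ext) (rule e[symmetric])
  ultimately show i: "set_integrable lborel {a..b} f" unfolding set_integrable_def by (simp only:)
  show "(LINT x:{a..b}|lborel. f x) = (LINT x:{a<..<b}|lborel. f x)"
    unfolding set_lebesgue_integral_def
  proof (rule integral_cong_AE)
    show "?c \<in> borel_measurable lborel" "(\<lambda>x. indicator {a<..<b} x *\<^sub>R f x) \<in> borel_measurable lborel"
      using i f unfolding set_integrable_def by (auto intro: borel_measurable_integrable)
    show "AE x in lborel. ?c x = indicator {a<..<b} x *\<^sub>R f x"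
      using AE_lborel_singleton[of a] AE_lborel_singleton[of b] by eventually_elim (auto simp: indicator_def)
  qed
qed

lemma set_integral_shift:
  fixes f :: "real \<Rightarrow> complex"
  shows "(LINT x:{a<..<a + b}|lborel. f x) = (LINT x:{0<..<b}|lborel. f (a + x))"
proof -
  have "indicator {a<..<a + b} (a + 1 * x) *\<^sub>R f (a + 1 * x) = indicator {0<..<b} x *\<^sub>R f (a + x)" for x
    by (auto simp: indicator_def)
  then show ?thesis
    unfolding set_lebesgue_integral_def
    using lborel_integral_real_affine[of 1 "\<lambda>x. indicator {a<..<a + b} x *\<^sub>R f x" a]
    by (simp only: abs_one scaleR_one zero_neq_one[symmetric] not_False_eq_True simp_thms)
qed

lemma set_integral_split:
  fixes f :: "real \<Rightarrow> complex"
  assumes f: "set_integrable lborel {0<..<a + b} f" and "0 \<le> a" "0 \<le> b"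
  shows "(LINT x:{0<..<a + b}|lborel. f x) = (LINT x:{0<..<a}|lborel. f x) + (LINT x:{a<..<a + b}|lborel. f x)"
proof -
  have s: "set_integrable lborel {0<..<a} f" "set_integrable lborel {a<..<a + b} f"
    by (rule set_integrable_subset[OF f]; use assms in auto)+
  have "(LINT x:{0<..<a + b}|lborel. f x) = (\<integral>x. indicator {0<..<a} x *\<^sub>R f x + indicator {a<..<a + b} x *\<^sub>R f x \<partial>lborel)"
    unfolding set_lebesgue_integral_def
  proof (rule integral_cong_AE)
    show "(\<lambda>x. indicator {0<..<a + b} x *\<^sub>R f x) \<in> borel_measurable lborel"
      "(\<lambda>x. indicator {0<..<a} x *\<^sub>R f x + indicator {a<..<a + b} x *\<^sub>R f x) \<in> borel_measurable lborel"
      using f s unfolding set_integrable_def by (auto intro!: borel_measurable_integrable Bochner_Integration.integrable_add)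
    show "AE x in lborel. indicator {0<..<a + b} x *\<^sub>R f x = indicator {0<..<a} x *\<^sub>R f x + indicator {a<..<a + b} x *\<^sub>R f x"
      using AE_lborel_singleton[of a] by eventually_elim (use assms in \<open>auto simp: indicator_def\<close>)
  qed
  also have "\<dots> = (LINT x:{0<..<a}|lborel. f x) + (LINT x:{a<..<a + b}|lborel. f x)"
    using s unfolding set_integrable_def set_lebesgue_integral_def by (rule Bochner_Integration.integral_add)
  finally show ?thesis .
qed

lemma Hs_norm_add: assumes "f \<in> Hs r" "g \<in> Hs r" shows "Hs_norm r (f + g) \<le> Hs_norm r f + Hs_norm r g"
proof -
  have z: "0 \<in> Hs r" by (simp add: Hs_iff)
  have "Hs_norm r (0 - g) = Hs_norm r g" unfolding Hs_norm_eq fourier_coeff_diff by simp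
  then show ?thesis using Hs_diff(2)[OF assms(1) Hs_diff(1)[OF z assms(2)]] by simp
qed

lemma poly_growth_J: assumes "\<And>k. cmod (c k) \<le> M * J k" shows "poly_growth c"
  unfolding poly_growth_def
proof (intro exI allI)
  fix k
  have "0 \<le> M" using order.trans[OF norm_ge_zero assms[of 0]] by (simp add: J_def)
  moreover have "J k \<le> (1 + \<bar>real_of_int k\<bar>)\<^sup>2" by (simp add: J_def power2_eq_square algebra_simps)
  ultimately have "M * J k \<le> M * (1 + \<bar>real_of_int k\<bar>)\<^sup>2" by (intro mult_left_mono)
  with assms[of k] show "cmod (c k) \<le> M * (1 + \<bar>real_of_int k\<bar>) ^ 2" by simp
qed

context bo_time
begin

section \<open>From coefficient curves to curves of distributions\<close>

definition tocurve :: "(real \<Rightarrow> int \<Rightarrow> complex) \<Rightarrow> real \<Rightarrow> pdist" where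
  "tocurve c t = (if t \<in> {0..T} then of_coeffs (c t) else 0)"

lemma tocurve_outside: "t \<notin> {0..T} \<Longrightarrow> tocurve c t = 0"
  unfolding tocurve_def by (rule if_not_P)

lemma scaleR_fun_app: "(a *\<^sub>R f) x = a *\<^sub>R f x"
  by (simp add: scaleR_fun_def)

lemma bnd_sm: assumes "bnd c M" "t \<in> {0..T}" shows "l2b (\<lambda>k. J k powr (s/2) * cmod (c t k)) M"
proof -
  have "l2b (\<lambda>k. sm t k * cmod (c t k)) M" using assms by (intro bndD) auto
  then show ?thesis
  proof (rule l2b_mono)
    fix k
    have "1 \<le> exp (t * \<bar>of_int k\<bar>)" using assms by simp
    from mult_left_mono[OF this, of "J k powr (s/2) * cmod (c t k)"]
    show "J k powr (s/2) * cmod (c t k) \<le> sm t k * cmod (c t k)" by (simp add: sm_eq ac_simps)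
  qed simp
qed

lemma bnd_nonneg: "bnd c M \<Longrightarrow> 0 \<le> M"
  using bndD(1)[of c M 0] T l2b_nonneg by auto

lemma bnd_poly: assumes "bnd c M" "t \<in> {0..T}" shows "poly_growth (c t)"
proof (rule poly_growth_J)
  fix k
  have 1: "J k powr (s/2) * cmod (c t k) \<le> M" by (rule l2b_term[OF bnd_sm[OF assms]])
  have "cmod (c t k) = J k powr (- s/2) * (J k powr (s/2) * cmod (c t k))"
    using J_pos[of k] by (simp add: mult.assoc[symmetric] flip: powr_add)
  also have "\<dots> \<le> J k powr 1 * M"
    using 1 J_ge_1[of k] s by (intro mult_mono powr_mono) auto
  finally show "cmod (c t k) \<le> M * J k" using J_pos[of k] by (simp add: mult.commute)
qed

lemma fc_tocurve: "bnd c M \<Longrightarrow> t \<in> {0..T} \<Longrightarrow> fourier_coeff (tocurve c t) k = c t k"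
  using fourier_of_coeffs[OF bnd_poly] by (simp add: tocurve_def)

text \<open>For t >= a the factor exp (a |k|) dominates every power of J, so a single bound controls
  all Sobolev norms. The constant does not depend on the curve, as the seminorm estimates for the
  flow require.\<close>

lemma bnd_exp: assumes a: "0 < a"
  shows "\<exists>C\<ge>0. \<forall>c M t. bnd c M \<and> a \<le> t \<and> t \<le> T \<longrightarrow> l2b (\<lambda>k. J k powr (r/2) * cmod (c t k)) (C * M)"
proof -
  obtain C where C: "0 \<le> C" "\<forall>k. J k powr (r/2 - s/2) \<le> C * exp (a * \<bar>of_int k\<bar>)"
    using exp_beats_J[OF a, of "r/2 - s/2"] by blast
  have "l2b (\<lambda>k. J k powr (r/2) * cmod (c t k)) (C * M)" if b: "bnd c M" and t: "a \<le> t" "t \<le> T" for c M t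
  proof -
    have "l2b (\<lambda>k. C * (sm t k * cmod (c t k))) (C * M)"
      using b t a by (intro l2b_cmult bndD C) auto
    then show ?thesis
    proof (rule l2b_mono)
      fix k
      have "J k powr (r/2) = J k powr (s/2) * J k powr (r/2 - s/2)" using J_pos[of k] by (simp flip: powr_add)
      also have "\<dots> \<le> J k powr (s/2) * (C * exp (a * \<bar>of_int k\<bar>))" using C by (intro mult_left_mono) auto
      also have "\<dots> \<le> J k powr (s/2) * (C * exp (t * \<bar>of_int k\<bar>))"
        using C t by (intro mult_left_mono) (auto intro: mult_right_mono)
      finally have "J k powr (r/2) \<le> C * sm t k" by (simp add: sm_eq ac_simps)
      from mult_right_mono[OF this, of "cmod (c t k)"]
      show "J k powr (r/2) * cmod (c t k) \<le> C * (sm t k * cmod (c t k))" by (simp add: ac_simps)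
    qed simp
  qed
  then show ?thesis using C(1) by blast
qed

lemma bnd_abs_sum: assumes "bnd c M" "0 < t" "t \<le> T" shows "abs_sum (c t)"
proof -
  obtain C where "\<forall>c M t'. bnd c M \<and> t \<le> t' \<and> t' \<le> T \<longrightarrow> l2b (\<lambda>k. J k powr (2/2) * cmod (c t' k)) (C * M)"
    using bnd_exp[OF assms(2), of 2] by (elim exE conjE)
  then have "l2b (\<lambda>k. J k powr (2/2) * cmod (c t k)) (C * M)" using assms by blast
  then show ?thesis by (rule l2b_abs_sum)
qed

lemma bnd_add: assumes "bnd c M" "bnd d M'" shows "bnd (c + d) (M + M')"
  unfolding bnd_iff
proof
  fix p assume p: "p \<in> P"
  then have "p c \<le> M" "p d \<le> M'" using assms unfolding bnd_iff by blast+
  then show "p (c + d) \<le> M + M'" using P_triangle[OF p, of c d] by linarith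
qed

lemma tocurve_add: assumes "bnd c M" "bnd d M'" shows "tocurve (c + d) = tocurve c + tocurve d"
proof
  fix t
  show "tocurve (c + d) t = (tocurve c + tocurve d) t"
  proof (cases "t \<in> {0..T}")
    case True
    show ?thesis
      by (rule pdist_eqI) (simp add: fc_tocurve[OF bnd_add[OF assms] True] fourier_coeff_add
        fc_tocurve[OF assms(1) True] fc_tocurve[OF assms(2) True])
  qed (simp add: tocurve_outside del: atLeastAtMost_iff)
qed

lemma bnd_scale: assumes "bnd c M" shows "bnd (a *\<^sub>R c) (\<bar>a\<bar> * M)"
proof -
  have e: "w * cmod ((a *\<^sub>R c) t k) = \<bar>a\<bar> * (w * cmod (c t k))" for w t k
    by (simp add: scaleR_fun_app)
  show ?thesis using assms unfolding bnd_def e by (intro conjI ballI l2b_cmult abs_ge_zero) auto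
qed

lemma tocurve_scale: assumes "bnd c M" shows "tocurve (a *\<^sub>R c) = a *\<^sub>R tocurve c"
proof
  fix t
  show "tocurve (a *\<^sub>R c) t = (a *\<^sub>R tocurve c) t"
  proof (cases "t \<in> {0..T}")
    case True
    show ?thesis
      by (rule pdist_eqI) (simp only: fc_tocurve[OF bnd_scale[OF assms] True] scaleR_fun_app fourier_coeff_scaleR
        fc_tocurve[OF assms(1) True] scaleR_conv_of_real)
  qed (simp add: tocurve_outside scaleR_fun_app del: atLeastAtMost_iff)
qed

lemma bnd_zero: "bnd 0 0" unfolding bnd_iff using P_zero by (metis order_refl)

text \<open>Continuity in \<open>H\<^sup>s\<close> at time 0 is a separate requirement, since the
  exponential weight is 1 there and supplies no majorant. At positive times it follows from the
  other two requirements by \<open>good_continuous\<close>.\<close>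

definition good :: "(real \<Rightarrow> int \<Rightarrow> complex) \<Rightarrow> bool" where
  "good c \<longleftrightarrow> (\<forall>k. continuous_on {0..T} (\<lambda>t. c t k)) \<and> (\<exists>M. bnd c M) \<and>
     ((\<lambda>t. Hs_norm s (tocurve c t - tocurve c 0)) \<longlongrightarrow> 0) (at 0 within {0..T})"

lemma tocurve_Hs: "bnd c M \<Longrightarrow> t \<in> {0..T} \<Longrightarrow> tocurve c t \<in> Hs s"
  "bnd c M \<Longrightarrow> t \<in> {0..T} \<Longrightarrow> Hs_norm s (tocurve c t) \<le> sqrt (2 * pi) * M"
  using HsI[of s "tocurve c t" M] bnd_sm[of c M t] by (simp_all add: fc_tocurve)

lemma good_add: assumes "good c" "good d" shows "good (c + d)"
proof -
  obtain M M' where b: "bnd c M" "bnd d M'" using assms unfolding good_def by blast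
  have 0: "0 \<in> {0..T}" using T by simp
  let ?f = "\<lambda>c t. Hs_norm s (tocurve c t - tocurve c 0)"
  have "((\<lambda>t. ?f c t + ?f d t) \<longlongrightarrow> 0 + 0) (at 0 within {0..T})"
    using assms unfolding good_def by (intro tendsto_add) auto
  then have lim: "((\<lambda>t. ?f c t + ?f d t) \<longlongrightarrow> 0) (at 0 within {0..T})" by simp
  have "eventually (\<lambda>t. norm (?f (c + d) t) \<le> ?f c t + ?f d t) (at 0 within {0..T})"
    unfolding eventually_at_topological
  proof (intro exI[of _ UNIV] conjI ballI impI)
    fix t assume t: "t \<in> {0..T}"
    have "tocurve (c + d) t - tocurve (c + d) 0 = (tocurve c t - tocurve c 0) + (tocurve d t - tocurve d 0)"
      by (simp add: tocurve_add[OF b])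
    then show "norm (?f (c + d) t) \<le> ?f c t + ?f d t"
      using Hs_norm_add[OF Hs_diff(1)[OF tocurve_Hs(1)[OF b(1) t] tocurve_Hs(1)[OF b(1) 0]]
        Hs_diff(1)[OF tocurve_Hs(1)[OF b(2) t] tocurve_Hs(1)[OF b(2) 0]]] Hs_norm_nonneg by simp
  qed auto
  from Lim_null_comparison[OF this lim] have "(?f (c + d) \<longlongrightarrow> 0) (at 0 within {0..T})" .
  then show ?thesis using assms bnd_add[OF b] unfolding good_def by (auto intro!: continuous_intros)
qed

lemma good_zero: "good 0"
proof -
  have "Hs_norm s 0 = 0" by (simp add: Hs_norm_eq)
  moreover have z: "tocurve 0 t = 0" for t
  proof (cases "t \<in> {0..T}")
    case True then show ?thesis by (intro pdist_eqI) (simp add: fc_tocurve[OF bnd_zero])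
  qed (rule tocurve_outside)
  ultimately show ?thesis using bnd_zero unfolding good_def by (auto simp: z)
qed

lemma good_sum: "finite A \<Longrightarrow> (\<And>i. i \<in> A \<Longrightarrow> good (f i)) \<Longrightarrow> good (sum f A)"
  by (induction A rule: finite_induct) (simp_all add: good_zero good_add)

lemma lin_0: "lin \<phi> 0 k = fourier_coeff \<phi> k" by (simp add: lin_def)

text \<open>At time 0 the datum itself is the square summable majorant, because the semigroup
  multiplier has modulus at most 1.\<close>

lemma good_lo: assumes p: "\<phi> \<in> Hs s" shows "good (lo \<phi>)"
proof -
  have e: "lo \<phi> t k = lin \<phi> t k" if "t \<in> {0..T}" for t k using that by (simp add: lo_def)
  have 0: "0 \<in> {0..T}" using T by simp
  have c: "continuous_on {0..T} (\<lambda>t. lo \<phi> t k)" for k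
    using lin_continuous by (rule continuous_on_eq) (simp add: e)
  have le: "J k powr (s/2) * cmod (lo \<phi> t k) \<le> J k powr (s/2) * cmod (fourier_coeff \<phi> k)" if "t \<in> {0..T}" for t k
  proof -
    have "cmod (exp (al k * of_real t)) \<le> 1" using al_Re(2)[of k] that by (simp add: mult_nonpos_nonneg)
    then have "cmod (lo \<phi> t k) \<le> 1 * cmod (fourier_coeff \<phi> k)"
      unfolding e[OF that] lin_def norm_mult by (rule mult_right_mono) simp
    then show ?thesis by (intro mult_left_mono) auto
  qed
  have "((\<lambda>t. Hs_norm s (tocurve (lo \<phi>) t - tocurve (lo \<phi>) 0)) \<longlongrightarrow> 0) (at 0 within {0..T})"
  proof (rule Hs_tendsto[OF fc_tocurve[OF bnd_lo[OF p]] 0 _ Hs_l2b'[OF p]])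
    show "((\<lambda>t. lo \<phi> t k) \<longlongrightarrow> lo \<phi> 0 k) (at 0 within {0..T})" for k
      using c[of k] 0 by (simp add: continuous_on_def)
    show "eventually (\<lambda>t. \<forall>k. J k powr (s/2) * cmod (lo \<phi> t k) \<le> J k powr (s/2) * cmod (fourier_coeff \<phi> k)) (at 0 within {0..T})"
      unfolding eventually_at_topological by (intro exI[of _ UNIV]) (auto intro: le)
    show "J k powr (s/2) * cmod (lo \<phi> 0 k) \<le> J k powr (s/2) * cmod (fourier_coeff \<phi> k)" for k by (rule le[OF 0])
  qed
  then show ?thesis using c bnd_lo[OF p] unfolding good_def by blast
qed

text \<open>The Duhamel term vanishes at time 0 and its norm in \<open>H\<^sup>s\<close> is at most
  a constant times t^theta.\<close>

lemma good_Bo: "good (Bo z z')"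
proof -
  have 0: "0 \<in> {0..T}" using T by simp
  have c: "continuous_on {0..T} (\<lambda>t. Bo z z' t k)" for k
    using duhamel_dec_continuous by (rule continuous_on_eq) (simp add: Bo_def)
  let ?C = "sqrt (2 * pi) * (CB * norm z * norm z')"
  have z0: "tocurve (Bo z z') 0 = 0"
    by (rule pdist_eqI) (simp add: fc_tocurve[OF bnd_Bo 0], simp add: Bo_def)
  have "((\<lambda>t. ?C * t powr \<theta>) \<longlongrightarrow> ?C * 0 powr \<theta>) (at 0 within {0..T})"
  proof (rule tendsto_mult_left, rule tendsto_powr2)
    show "eventually (\<lambda>t. 0 \<le> t) (at 0 within {0..T})"
      unfolding eventually_at_topological by (intro exI[of _ UNIV]) auto
  qed (use theta in auto)
  then have lim: "((\<lambda>t. ?C * t powr \<theta>) \<longlongrightarrow> 0) (at 0 within {0..T})" by simp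
  have "eventually (\<lambda>t. norm (Hs_norm s (tocurve (Bo z z') t - tocurve (Bo z z') 0)) \<le> ?C * t powr \<theta>) (at 0 within {0..T})"
    unfolding eventually_at_topological
  proof (intro exI[of _ UNIV] conjI ballI impI)
    fix t assume t: "t \<in> {0..T}" "t \<noteq> 0"
    then have t': "0 < t" "t \<le> T" by auto
    have l: "l2b (\<lambda>k. J k powr (s/2) * cmod (fourier_coeff (tocurve (Bo z z') t) k)) (CB * norm z * norm z' * t powr \<theta>)"
    proof (rule l2b_mono[OF BZ_bound(2)[OF t', of z z']])
      fix k
      have "1 \<le> exp (t * \<bar>of_int k\<bar>)" using t' by simp
      from mult_left_mono[OF this, of "J k powr (s/2) * cmod (Bo z z' t k)"]
      have "J k powr (s/2) * cmod (Bo z z' t k) \<le> sm t k * cmod (Bo z z' t k)" by (simp add: sm_eq ac_simps)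
      then show "J k powr (s/2) * cmod (fourier_coeff (tocurve (Bo z z') t) k) \<le> sm t k * cmod (duhamel al (dec z) (dec z') t k)"
        unfolding fc_tocurve[OF bnd_Bo t(1)] using t' by (simp add: Bo_def)
    qed simp
    show "norm (Hs_norm s (tocurve (Bo z z') t - tocurve (Bo z z') 0)) \<le> ?C * t powr \<theta>"
      using HsI(2)[OF l] Hs_norm_nonneg unfolding z0 by (simp add: ac_simps)
  qed auto
  from Lim_null_comparison[OF this lim] show ?thesis using c bnd_Bo unfolding good_def by blast
qed

lemma good_Do: assumes "x \<in> X" "finite I" "e ` I \<subseteq> Hs s" shows "good (qo.Do x e I)"
proof -
  have x: "x \<in> Hs s" using assms by (simp add: X_def)
  have "good (qo.dir lo x e I)"
  proof (cases "I = {}")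
    case True then show ?thesis using good_lo[OF x] by (simp add: qo.dir_def)
  next
    case False
    show ?thesis
    proof (cases "card I = 1")
      case True
      then obtain i where "I = {i}" by (auto simp: card_1_singleton_iff)
      then show ?thesis using assms good_lo by (simp add: qo.dir_def)
    qed (use False good_zero in \<open>simp add: qo.dir_def\<close>)
  qed
  then show ?thesis unfolding qo.Do_def using assms by (intro good_add good_sum good_Bo) auto
qed

text \<open>For times above t0 / 2 the bound in the Sobolev space of order r + 2 yields the majorant
  C M / J k, which is square summable.\<close>

lemma good_continuous: assumes g: "good c" and t0: "0 < t0" "t0 \<in> S" and S: "S \<subseteq> {0..T}"
  shows "tocurve c t0 \<in> Hs r" "((\<lambda>t. Hs_norm r (tocurve c t - tocurve c t0)) \<longlongrightarrow> 0) (at t0 within S)"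
proof -
  obtain M where b: "bnd c M" using g unfolding good_def by blast
  have a: "0 < t0 / 2" using t0 by simp
  obtain C where C: "0 \<le> C" "\<forall>c M t. bnd c M \<and> t0 / 2 \<le> t \<and> t \<le> T \<longrightarrow> l2b (\<lambda>k. J k powr ((r + 2)/2) * cmod (c t k)) (C * M)"
    using bnd_exp[OF a, of "r + 2"] by blast
  obtain C' where C': "0 \<le> C'" "\<forall>c M t. bnd c M \<and> t0 / 2 \<le> t \<and> t \<le> T \<longrightarrow> l2b (\<lambda>k. J k powr (r/2) * cmod (c t k)) (C' * M)"
    using bnd_exp[OF a, of r] by blast
  have t0T: "t0 \<in> {0..T}" "t0 / 2 \<le> t0" using t0 S by auto
  show "tocurve c t0 \<in> Hs r"
    using C'(2)[rule_format, of c M t0] b t0T by (intro HsI(1)[where M = "C' * M"]) (simp add: fc_tocurve[OF b])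
  obtain G where G: "l2b (\<lambda>k. 1 / J k) G" using l2b_inverse_J by blast
  have CM: "0 \<le> C * M" using C(1) bnd_nonneg[OF b] by simp
  have le: "J k powr (r/2) * cmod (c t k) \<le> C * M * (1 / J k)" if "t0 / 2 \<le> t" "t \<le> T" for t k
  proof -
    have "J k powr ((r + 2)/2) * cmod (c t k) \<le> C * M"
      using C(2)[rule_format, of c M t] b that by (intro l2b_term[of "\<lambda>k. J k powr ((r + 2)/2) * cmod (c t k)"]) simp
    moreover have "J k powr ((r + 2)/2) = J k powr (r/2) * J k"
      using J_pos[of k] powr_add[of "J k" "r/2" 1] by (simp add: add_divide_distrib)
    ultimately show ?thesis using J_pos[of k] by (simp add: field_simps)
  qed
  show "((\<lambda>t. Hs_norm r (tocurve c t - tocurve c t0)) \<longlongrightarrow> 0) (at t0 within S)"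
  proof (rule Hs_tendsto[OF _ t0(2) _ l2b_cmult[OF G CM]])
    show "fourier_coeff (tocurve c t) k = c t k" if "t \<in> S" for t k using that S by (intro fc_tocurve[OF b]) auto
    show "((\<lambda>t. c t k) \<longlongrightarrow> c t0 k) (at t0 within S)" for k
      using g t0T S unfolding good_def continuous_on_def by (meson tendsto_within_subset)
    have "eventually (\<lambda>t. t \<in> {t0 / 2<..}) (nhds t0)" using t0 by (intro eventually_nhds_in_open) auto
    then have "eventually (\<lambda>t. t \<in> {t0 / 2<..}) (at t0 within S)" by (rule filter_leD[OF at_within_le_nhds])
    moreover have "eventually (\<lambda>t. t \<in> S) (at t0 within S)"
      unfolding eventually_at_topological by (intro exI[of _ UNIV]) auto
    ultimately show "eventually (\<lambda>t. \<forall>k. J k powr (r/2) * cmod (c t k) \<le> C * M * (1 / J k)) (at t0 within S)"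
      by eventually_elim (use le S in auto)
    show "J k powr (r/2) * cmod (c t0 k) \<le> C * M * (1 / J k)" for k using le t0T by auto
  qed
qed

lemma good_C_Hs: assumes g: "good c" shows "tocurve c \<in> C_Hs s T"
proof -
  obtain M where b: "bnd c M" using g unfolding good_def by blast
  have "((\<lambda>t'. Hs_norm s (tocurve c t' - tocurve c t)) \<longlongrightarrow> 0) (at t within {0..T})" if "t \<in> {0..T}" for t
  proof (cases "t = 0")
    case True then show ?thesis using g unfolding good_def by simp
  next
    case False then show ?thesis using that by (intro good_continuous(2)[OF g]) auto
  qed
  then show ?thesis unfolding C_Hs_def continuous_Hs_def using tocurve_Hs(1)[OF b] by (simp add: tocurve_def)
qed

lemma good_Hinf: "good c \<Longrightarrow> continuous_Hinf {0<..T} (tocurve c)"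
  unfolding continuous_Hinf_def continuous_Hs_def
proof (intro allI ballI conjI)
  fix r t assume g: "good c" and t: "t \<in> {0<..T}"
  have S: "0 < t" "{0<..T} \<subseteq> {0..T}" using t by auto
  show "tocurve c t \<in> Hs r" by (rule good_continuous(1)[OF g S(1) t S(2)])
  show "((\<lambda>t'. Hs_norm r (tocurve c t' - tocurve c t)) \<longlongrightarrow> 0) (at t within {0<..T})"
    by (rule good_continuous(2)[OF g S(1) t S(2)])
qed

lemma L2_tocurve: assumes b: "bnd c M" and t: "t \<in> {0<..T}"
  shows "tocurve c t \<in> L2_dist" "t powr \<mu> * L2_norm (tocurve c t) \<le> sqrt (2 * pi) * M"
proof -
  have t': "t \<in> {0..T}" "0 < t" "t \<le> T" using t by auto
  have fc: "fourier_coeff (tocurve c t) = c t" using fc_tocurve[OF b t'(1)] by (simp add: fun_eq_iff)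
  have as: "abs_sum (fourier_coeff (tocurve c t))" unfolding fc by (rule bnd_abs_sum[OF b t'(2,3)])
  show "tocurve c t \<in> L2_dist" by (rule L2_abs_sum[OF as])
  have "l2b (\<lambda>k. t powr - \<mu> * (om t k * cmod (c t k))) (t powr - \<mu> * M)"
    by (rule l2b_cmult[OF bndD(2)[OF b t'(2,3)]]) simp
  then have "l2b (\<lambda>k. J k powr (0/2) * cmod (fourier_coeff (tocurve c t) k)) (t powr - \<mu> * M)"
  proof (rule l2b_mono)
    fix k
    have "J k powr (0/2) * cmod (fourier_coeff (tocurve c t) k) = 1 * cmod (c t k)"
      unfolding fc using J_pos[of k] by simp
    also have "\<dots> \<le> wgt \<nu> 1 t k * cmod (c t k)"
      using t' nu by (intro mult_right_mono wgt_ge_1) auto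
    also have "\<dots> = t powr - \<mu> * (om t k * cmod (c t k))"
      unfolding om_def using t' by (simp add: powr_minus)
    finally show "J k powr (0/2) * cmod (fourier_coeff (tocurve c t) k) \<le> t powr - \<mu> * (om t k * cmod (c t k))" .
  qed simp
  then have "L2_norm (tocurve c t) \<le> sqrt (2 * pi) * (t powr - \<mu> * M)" unfolding L2_abs_sum(2)[OF as] by (rule HsI(2))
  then have "t powr \<mu> * L2_norm (tocurve c t) \<le> t powr \<mu> * (sqrt (2 * pi) * (t powr - \<mu> * M))" by (intro mult_left_mono) auto
  also have "\<dots> = sqrt (2 * pi) * M" using t' by (simp add: powr_minus)
  finally show "t powr \<mu> * L2_norm (tocurve c t) \<le> sqrt (2 * pi) * M" .
qed

lemma X_pointwise: assumes "s < 0" "bnd c M" "t \<in> {0<..T}"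
  shows "Hs_norm s (tocurve c t) + t powr (\<bar>s\<bar>/2) * L2_norm (tocurve c t) \<le> 2 * sqrt (2 * pi) * M"
proof -
  have m: "\<bar>s\<bar>/2 = \<mu>" using assms(1) by (simp add: \<mu>_def)
  have "t \<in> {0..T}" using assms(3) by auto
  from L2_tocurve(2)[OF assms(2,3)] tocurve_Hs(2)[OF assms(2) this] show ?thesis unfolding m by simp
qed

lemma good_flow_space: assumes g: "good c" shows "tocurve c \<in> flow_space s T"
proof -
  obtain M where b: "bnd c M" using g unfolding good_def by blast
  have "tocurve c \<in> frakX_space s T"
  proof (cases "s < 0")
    case True
    have "bdd_above ((\<lambda>t. Hs_norm s (tocurve c t) + t powr (\<bar>s\<bar>/2) * L2_norm (tocurve c t)) ` {0<..T})"
      by (rule bdd_aboveI2) (rule X_pointwise[OF True b])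
    then show ?thesis using True good_C_Hs[OF g] L2_tocurve(1)[OF b] by (simp add: frakX_space_def X_space_def)
  qed (simp add: frakX_space_def good_C_Hs[OF g])
  then show ?thesis using good_C_Hs[OF g] good_Hinf[OF g] by (simp add: flow_space_def)
qed

text \<open>All seminorms of the target space are dominated by the single quantity
  \<open>bnd\<close>, so smoothness has to be proved only for coefficient curves.\<close>

lemma seminorm_bound: assumes "p \<in> flow_seminorms s T"
  shows "\<exists>C\<ge>0. \<forall>c M. bnd c M \<longrightarrow> p (tocurve c) \<le> C * M"
proof -
  have C: "\<exists>C\<ge>0. \<forall>c M. bnd c M \<longrightarrow> C_Hs_norm s T (tocurve c) \<le> C * M"
    unfolding C_Hs_norm_def
    by (rule exI[of _ "sqrt (2 * pi)"]) (use T in \<open>auto intro!: cSUP_least tocurve_Hs(2)\<close>)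
  from assms consider "p = C_Hs_norm s T" | "p = frakX_norm s T" |
    r a where "a \<in> {0<..T}" "p = (\<lambda>u. SUP t\<in>{a..T}. Hs_norm r (u t))"
    unfolding flow_seminorms_def by blast
  then show ?thesis
  proof cases
    case 1 then show ?thesis using C by simp
  next
    case 2
    show ?thesis
    proof (cases "s < 0")
      case True
      have "X_norm s T (tocurve c) \<le> 2 * sqrt (2 * pi) * M" if "bnd c M" for c M
        unfolding X_norm_def by (rule cSUP_least) (use T X_pointwise[OF True that] in auto)
      then show ?thesis using 2 True by (intro exI[of _ "2 * sqrt (2 * pi)"]) (simp add: frakX_norm_def)
    qed (use 2 C in \<open>simp add: frakX_norm_def\<close>)
  next
    case 3
    have a: "0 < a" "a \<le> T" using 3 by auto
    obtain C where C: "0 \<le> C" "\<forall>c M t. bnd c M \<and> a \<le> t \<and> t \<le> T \<longrightarrow> l2b (\<lambda>k. J k powr (r/2) * cmod (c t k)) (C * M)"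
      using bnd_exp[OF a(1), of r] by blast
    have "(SUP t\<in>{a..T}. Hs_norm r (tocurve c t)) \<le> sqrt (2 * pi) * C * M" if b: "bnd c M" for c M
    proof (rule cSUP_least)
      fix t assume t: "t \<in> {a..T}"
      then have "l2b (\<lambda>k. J k powr (r/2) * cmod (fourier_coeff (tocurve c t) k)) (C * M)"
        using C(2)[rule_format, of c M t] b a by (simp add: fc_tocurve[OF b])
      then show "Hs_norm r (tocurve c t) \<le> sqrt (2 * pi) * C * M" using HsI(2) by (simp add: mult.assoc)
    qed (use a in auto)
    then show ?thesis using 3 C(1) by (intro exI[of _ "sqrt (2 * pi) * C"]) simp
  qed
qed

end

subsection \<open>Existence and uniqueness\<close>

context bo_burgers
begin

text \<open>Integrability is recorded because the restart splits the integral, and an integral that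
  does not exist has the value 0. The factor stays inside the integral since a solution comes with
  integrability of the coefficients of \<open>u_ux\<close> only, which says nothing about the square
  at k = 0.\<close>

definition is_mild :: "real \<Rightarrow> pdist \<Rightarrow> (real \<Rightarrow> int \<Rightarrow> complex) \<Rightarrow> bool" where
  "is_mild T \<phi> c \<longleftrightarrow> (\<forall>t\<in>{0..T}. \<forall>k.
     set_integrable lborel {0<..<t} (\<lambda>r. (\<i> * of_int k / 2) * (exp (al k * of_real (t - r)) * conv (c r) (c r) k)) \<and>
     c t k = lin \<phi> t k + duhamel al c c t k)"

lemma duhamel_eq: "duhamel al c d t k = - (LINT r:{0<..<t}|lborel. (\<i> * of_int k / 2) * (exp (al k * of_real (t - r)) * conv (c r) (d r) k))"
  by (simp add: duhamel_def)

lemma solution_integrand: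
  assumes "continuous_Hinf {0<..<T} u" "r \<in> {0<..<t}" "t \<le> T"
  shows "fourier_coeff (S_op \<beta> \<eta> (t - r) (u_ux (u r))) k =
    (\<i> * of_int k / 2) * (exp (al k * of_real (t - r)) * conv (fourier_coeff (u r)) (fourier_coeff (u r)) k)"
proof -
  have "u r \<in> Hs 2" using assms unfolding continuous_Hinf_def continuous_Hs_def by auto
  then have as: "abs_sum (fourier_coeff (u r))" by (rule Hs_abs_sum)
  have "0 \<le> t - r" using assms by auto
  from fourier_coeff_S_op[OF eta this] fourier_coeff_u_ux[OF as] show ?thesis by (simp add: al_def)
qed

lemma solution_mild:
  assumes u: "is_solution \<beta> \<eta> s T \<phi> u"
  shows "is_mild T \<phi> (\<lambda>t. fourier_coeff (u t))"
  unfolding is_mild_def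
proof (intro ballI allI)
  fix t k assume t: "t \<in> {0..T}"
  let ?G = "\<lambda>r. S_op \<beta> \<eta> (t - r) (u_ux (u r))"
  let ?h = "\<lambda>r. (\<i> * of_int k / 2) * (exp (al k * of_real (t - r)) * conv (fourier_coeff (u r)) (fourier_coeff (u r)) k)"
  have Hi: "continuous_Hinf {0<..<T} u" and sv: "solves \<beta> \<eta> T \<phi> u" using u by (simp_all add: is_solution_def)
  have eq: "fourier_coeff (?G r) k = ?h r" if "r \<in> {0<..<t}" for r
    by (rule solution_integrand[OF Hi that]) (use t in auto)
  obtain I where I: "has_pdist_integral ?G I 0 t" "u t = S_op \<beta> \<eta> t \<phi> - I"
    using sv t unfolding solves_def by blast
  have "set_integrable lborel {0<..<t} (\<lambda>r. fourier_coeff (?G r) k)"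
    by (rule set_integrable_subset[OF has_pdist_integral_coeff(1)[OF I(1)]]) auto
  moreover have "set_integrable lborel {0<..<t} (\<lambda>r. fourier_coeff (?G r) k) \<longleftrightarrow> set_integrable lborel {0<..<t} ?h"
    by (rule set_integrable_cong) (simp_all add: eq)
  ultimately have ih: "set_integrable lborel {0<..<t} ?h" and iG: "set_integrable lborel {0<..<t} (\<lambda>r. fourier_coeff (?G r) k)"
    by auto
  have "fourier_coeff I k = (LINT r:{0..t}|lborel. fourier_coeff (?G r) k)"
    by (rule has_pdist_integral_coeff(2)[OF I(1)])
  also have "\<dots> = (LINT r:{0<..<t}|lborel. fourier_coeff (?G r) k)" by (rule set_integral_Icc_Ioo(2)[OF iG])
  also have "\<dots> = (LINT r:{0<..<t}|lborel. ?h r)"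
    by (rule set_lebesgue_integral_cong) (simp_all add: eq)
  also have "\<dots> = - duhamel al (\<lambda>t. fourier_coeff (u t)) (\<lambda>t. fourier_coeff (u t)) t k" unfolding duhamel_eq by simp
  finally have "fourier_coeff (u t) k = lin \<phi> t k + duhamel al (\<lambda>t. fourier_coeff (u t)) (\<lambda>t. fourier_coeff (u t)) t k"
    using fourier_coeff_S_op[OF eta, of t \<beta> \<phi> k] t unfolding I(2) fourier_coeff_diff by (simp add: lin_def al_def)
  with ih show "set_integrable lborel {0<..<t} ?h \<and>
      fourier_coeff (u t) k = lin \<phi> t k + duhamel al (\<lambda>t. fourier_coeff (u t)) (\<lambda>t. fourier_coeff (u t)) t k" by blast
qed

text \<open>The integral is split at \<open>t0\<close>. By the semigroup law the part before
  \<open>t0\<close> joins the linear part to give the evolution of \<open>c t0\<close>, and the part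
  after it is a Duhamel term of the shifted curve.\<close>

lemma mild_restart:
  assumes m: "is_mild T \<phi> c" and t: "0 \<le> t0" "0 \<le> \<tau>" "t0 + \<tau> \<le> T"
  shows "c (t0 + \<tau>) k = exp (al k * of_real \<tau>) * c t0 k + duhamel al (\<lambda>r. c (t0 + r)) (\<lambda>r. c (t0 + r)) \<tau> k"
proof -
  let ?h = "\<lambda>t r. (\<i> * of_int k / 2) * (exp (al k * of_real (t - r)) * conv (c r) (c r) k)"
  have mem: "t0 + \<tau> \<in> {0..T}" "t0 \<in> {0..T}" using t by auto
  have i: "set_integrable lborel {0<..<t0 + \<tau>} (?h (t0 + \<tau>))"
    and e1: "c (t0 + \<tau>) k = lin \<phi> (t0 + \<tau>) k + duhamel al c c (t0 + \<tau>) k"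
    and e0: "c t0 k = lin \<phi> t0 k + duhamel al c c t0 k"
    using m mem unfolding is_mild_def by blast+
  have ex: "exp (al k * of_real (t0 + \<tau> - r)) = exp (al k * of_real \<tau>) * exp (al k * of_real (t0 - r))" for r
    by (simp add: exp_add[symmetric] algebra_simps)
  have sh: "t0 + \<tau> - (t0 + r) = \<tau> - r" for r by simp
  have "(LINT r:{0<..<t0 + \<tau>}|lborel. ?h (t0 + \<tau>) r) =
      (LINT r:{0<..<t0}|lborel. ?h (t0 + \<tau>) r) + (LINT r:{t0<..<t0 + \<tau>}|lborel. ?h (t0 + \<tau>) r)"
    by (rule set_integral_split[OF i t(1,2)])
  also have "(LINT r:{0<..<t0}|lborel. ?h (t0 + \<tau>) r) = (LINT r:{0<..<t0}|lborel. exp (al k * of_real \<tau>) * ?h t0 r)"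
    unfolding ex by (simp only: ac_simps)
  also have "\<dots> = exp (al k * of_real \<tau>) * (LINT r:{0<..<t0}|lborel. ?h t0 r)" by (rule set_integral_mult_right)
  also have "(LINT r:{t0<..<t0 + \<tau>}|lborel. ?h (t0 + \<tau>) r) = (LINT r:{0<..<\<tau>}|lborel. ?h (t0 + \<tau>) (t0 + r))"
    by (rule set_integral_shift)
  also have "\<dots> = (LINT r:{0<..<\<tau>}|lborel. (\<i> * of_int k / 2) * (exp (al k * of_real (\<tau> - r)) * conv (c (t0 + r)) (c (t0 + r)) k))"
    unfolding sh ..
  finally have "duhamel al c c (t0 + \<tau>) k = exp (al k * of_real \<tau>) * duhamel al c c t0 k + duhamel al (\<lambda>r. c (t0 + r)) (\<lambda>r. c (t0 + r)) \<tau> k"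
    unfolding duhamel_eq by (simp only: minus_add_distrib mult_minus_right)
  moreover have "lin \<phi> (t0 + \<tau>) k = exp (al k * of_real \<tau>) * lin \<phi> t0 k"
    by (simp add: lin_def algebra_simps flip: exp_add)
  ultimately show ?thesis unfolding e1 by (subst e0) (simp add: distrib_left)
qed

lemma wgt_0: "wgt \<nu> 0 t k = J k powr (\<nu>/2)" by (simp add: wgt_def)

lemma adm_of_bounded:
  assumes cont: "\<And>k. continuous_on {0<..<T} (\<lambda>t. c t k)" and T: "T \<le> 1"
    and b: "\<And>t. t \<in> {0<..<T} \<Longrightarrow> l2b (\<lambda>k. t powr \<mu> * (J k powr (\<nu>/2) * cmod (c t k))) M"
  shows "adm \<mu> \<nu> 0 0 T c M"
  unfolding adm_def
proof (intro conjI allI ballI)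
  show "(\<lambda>t. indicator {0<..<T} t *\<^sub>R c t k) \<in> borel_measurable borel" for k
    by (rule borel_measurable_continuous_on_indicator[OF _ cont]) auto
  show "l2b (\<lambda>k. t powr \<mu> * exp (- 0 * t) * wgt \<nu> 0 t k * cmod (c t k)) M" if "t \<in> {0<..<T}" for t
    using b[OF that] by (simp add: wgt_0 mult.assoc)
qed

end

context bo_time
begin

section \<open>The constructed solution\<close>

definition sol_coeffs :: "pdist \<Rightarrow> real \<Rightarrow> int \<Rightarrow> complex" where "sol_coeffs x = qo.Do x (\<lambda>i. 0) {}"

lemma sol_coeffs_eq: "sol_coeffs x = lo x + Bo (qo.sol x) (qo.sol x)"
  by (simp add: sol_coeffs_def qo.Do_empty)

lemma sol_coeffs_good: "x \<in> X \<Longrightarrow> good (sol_coeffs x)"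
  unfolding sol_coeffs_def by (rule good_Do) auto

lemma dec_sol: assumes x: "x \<in> X" and t: "0 < t" "t \<le> T" shows "dec (qo.sol x) t k = sol_coeffs x t k"
proof -
  have xs: "x \<in> Hs s" using x by (simp add: X_def)
  have "dec (qo.sol x) t k = dec (LZ x + BZ (qo.sol x) (qo.sol x)) t k" using qo.sol(2)[OF x] by simp
  also have "\<dots> = lin x t k + duhamel al (dec (qo.sol x)) (dec (qo.sol x)) t k"
    unfolding dec_add using t by (simp add: LZ(3)[OF xs] BZ(3))
  also have "\<dots> = sol_coeffs x t k" unfolding sol_coeffs_eq using t by (simp add: lo_def Bo_def)
  finally show ?thesis .
qed

lemma sol_coeffs_mild_eq: assumes x: "x \<in> X" and t: "0 \<le> t" "t \<le> T" shows "sol_coeffs x t k = lin x t k + duhamel al (sol_coeffs x) (sol_coeffs x) t k"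
proof -
  have "duhamel al (dec (qo.sol x)) (dec (qo.sol x)) t k = duhamel al (sol_coeffs x) (sol_coeffs x) t k"
    by (rule duhamel_cong) (use t in \<open>auto intro!: dec_sol[OF x]\<close>)
  then show ?thesis using t by (simp add: sol_coeffs_eq[of x] lo_def Bo_def flip: sol_coeffs_eq)
qed

lemma sol_coeffs_adm: assumes x: "x \<in> X" shows "adm \<mu> \<nu> 1 0 T (sol_coeffs x) (2 * (CL * R + 1))"
proof -
  have "adm \<mu> \<nu> 1 0 T (dec (qo.sol x)) (norm (qo.sol x))" by (rule adm_dec)
  then show ?thesis
    unfolding adm_def
  proof (elim conjE, intro conjI allI ballI)
    fix k assume "\<forall>k. (\<lambda>t. indicator {0<..<T} t *\<^sub>R dec (qo.sol x) t k) \<in> borel_measurable borel"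
    moreover have "(\<lambda>t. indicator {0<..<T} t *\<^sub>R sol_coeffs x t k) = (\<lambda>t. indicator {0<..<T} t *\<^sub>R dec (qo.sol x) t k)"
      by (auto simp: fun_eq_iff indicator_def dec_sol[OF x])
    ultimately show "(\<lambda>t. indicator {0<..<T} t *\<^sub>R sol_coeffs x t k) \<in> borel_measurable borel" by (simp only:)
  next
    fix t assume t: "t \<in> {0<..<T}"
    assume "\<forall>t\<in>{0<..<T}. l2b (\<lambda>k. t powr \<mu> * exp (- 0 * t) * wgt \<nu> 1 t k * cmod (dec (qo.sol x) t k)) (norm (qo.sol x))"
    then have "l2b (\<lambda>k. t powr \<mu> * exp (- 0 * t) * wgt \<nu> 1 t k * cmod (dec (qo.sol x) t k)) (norm (qo.sol x))" using t by blast
    then have "l2b (\<lambda>k. t powr \<mu> * exp (- 0 * t) * wgt \<nu> 1 t k * cmod (sol_coeffs x t k)) (norm (qo.sol x))"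
      using t by (simp add: dec_sol[OF x])
    then show "l2b (\<lambda>k. t powr \<mu> * exp (- 0 * t) * wgt \<nu> 1 t k * cmod (sol_coeffs x t k)) (2 * (CL * R + 1))"
      by (rule l2b_le) (rule qo.sol(1)[OF x])
  qed
qed

lemma adm_sigma_0: assumes "adm \<mu> \<nu> 1 0 T' c M" shows "adm \<mu> \<nu> 0 0 T' c M"
  unfolding adm_def
proof (intro conjI allI ballI)
  show "(\<lambda>t. indicator {0<..<T'} t *\<^sub>R c t k) \<in> borel_measurable borel" for k using assms unfolding adm_def by blast
  fix t assume t: "t \<in> {0<..<T'}"
  then have "l2b (\<lambda>k. t powr \<mu> * exp (- 0 * t) * wgt \<nu> 1 t k * cmod (c t k)) M" using assms unfolding adm_def by blast
  then show "l2b (\<lambda>k. t powr \<mu> * exp (- 0 * t) * wgt \<nu> 0 t k * cmod (c t k)) M"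
  proof (rule l2b_mono)
    fix k
    show "0 \<le> t powr \<mu> * exp (- 0 * t) * wgt \<nu> 0 t k * cmod (c t k)" using wgt_pos[of \<nu> 0 t k] by simp
    have "1 \<le> exp (t * \<bar>of_int k\<bar>)" using t by simp
    from mult_left_mono[OF this, of "J k powr (\<nu>/2)"]
    have "wgt \<nu> 0 t k \<le> wgt \<nu> 1 t k" by (simp add: wgt_def)
    then show "t powr \<mu> * exp (- 0 * t) * wgt \<nu> 0 t k * cmod (c t k) \<le> t powr \<mu> * exp (- 0 * t) * wgt \<nu> 1 t k * cmod (c t k)"
      by (intro mult_right_mono mult_left_mono) auto
  qed
qed

lemma adm_restrict: assumes "adm \<mu> \<nu> \<sigma> l T1 c M" "T2 \<le> T1" shows "adm \<mu> \<nu> \<sigma> l T2 c M"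
  unfolding adm_def
proof (intro conjI allI ballI)
  fix k
  have "(\<lambda>t. indicator {0<..<T2} t *\<^sub>R (indicator {0<..<T1} t *\<^sub>R c t k)) \<in> borel_measurable borel"
  proof (rule borel_measurable_scaleR)
    show "(\<lambda>t. indicator {0<..<T1} t *\<^sub>R c t k) \<in> borel_measurable borel" using assms(1) unfolding adm_def by blast
  qed simp
  moreover have "(\<lambda>t. indicator {0<..<T2} t *\<^sub>R (indicator {0<..<T1} t *\<^sub>R c t k)) = (\<lambda>t. indicator {0<..<T2} t *\<^sub>R c t k)"
    using assms(2) by (auto simp: fun_eq_iff indicator_def)
  ultimately show "(\<lambda>t. indicator {0<..<T2} t *\<^sub>R c t k) \<in> borel_measurable borel" by (simp only:)
qed (use assms in \<open>auto simp: adm_def\<close>)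

lemma sol_coeffs_solution: assumes x: "x \<in> X" shows "is_solution \<beta> \<eta> s T x (tocurve (sol_coeffs x))"
proof -
  let ?u = "tocurve (sol_coeffs x)"
  have g: "good (sol_coeffs x)" by (rule sol_coeffs_good[OF x])
  obtain M where b: "bnd (sol_coeffs x) M" using g unfolding good_def by blast
  have Hi: "continuous_Hinf {0<..<T} ?u"
    unfolding continuous_Hinf_def
  proof
    fix r
    show "continuous_Hs r {0<..<T} ?u"
      by (rule continuous_Hs_subset[OF good_Hinf[OF g, unfolded continuous_Hinf_def, rule_format, of r]]) auto
  qed
  have fc: "fourier_coeff (?u t) = sol_coeffs x t" if "t \<in> {0..T}" for t using fc_tocurve[OF b that] by (simp add: fun_eq_iff)
  define N where "N = 2 * (CL * R + 1)"
  note adm = sol_coeffs_adm[OF x, folded N_def]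
  have N0: "0 \<le> N" using CL(1) R by (simp add: N_def)
  have "solves \<beta> \<eta> T x ?u"
    unfolding solves_def
  proof
    fix t assume t: "t \<in> {0..T}"
    let ?G = "\<lambda>r. S_op \<beta> \<eta> (t - r) (u_ux (?u r))"
    \<comment> \<open>The integral equation forces this value; what remains is that it is the
      integral, which is checked on coefficients.\<close>
    let ?I = "S_op \<beta> \<eta> t x - ?u t"
    let ?h = "\<lambda>k r. (\<i> * of_int k / 2) * (exp (al k * of_real (t - r)) * conv (sol_coeffs x r) (sol_coeffs x r) k)"
    have eq: "fourier_coeff (?G r) k = ?h k r" if "r \<in> {0<..<t}" for r k
    proof -
      have "r \<in> {0..T}" "t \<le> T" using that t by auto
      from solution_integrand[OF Hi that this(2)] fc[OF this(1)] show ?thesis by simp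
    qed
    have ih: "set_integrable lborel {0<..<t} (?h k)" for k
      using t by (intro set_integrable_mult_right duhamel_integrable[OF al_Re(2) mu nu _ adm adm]) auto
    have iG: "set_integrable lborel {0<..<t} (\<lambda>r. fourier_coeff (?G r) k)" for k
    proof -
      have "set_integrable lborel {0<..<t} (\<lambda>r. fourier_coeff (?G r) k) \<longleftrightarrow> set_integrable lborel {0<..<t} (?h k)"
        by (rule set_integrable_cong) (simp_all add: eq)
      then show ?thesis using ih by blast
    qed
    have "has_pdist_integral ?G ?I 0 t"
    proof (rule has_pdist_integralI)
      show i: "set_integrable lborel {0..t} (\<lambda>r. fourier_coeff (?G r) k)" for k by (rule set_integral_Icc_Ioo(1)[OF iG])
      show "fourier_coeff ?I k = (LINT r:{0..t}|lborel. fourier_coeff (?G r) k)" for k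
      proof -
        have "(LINT r:{0..t}|lborel. fourier_coeff (?G r) k) = (LINT r:{0<..<t}|lborel. fourier_coeff (?G r) k)"
          by (rule set_integral_Icc_Ioo(2)[OF iG])
        also have "\<dots> = (LINT r:{0<..<t}|lborel. ?h k r)"
          by (rule set_lebesgue_integral_cong) (simp_all add: eq)
        also have "\<dots> = - duhamel al (sol_coeffs x) (sol_coeffs x) t k" unfolding duhamel_eq by simp
        finally show ?thesis
          using t fourier_coeff_S_op[OF eta, of t \<beta> x k] sol_coeffs_mild_eq[OF x, of t k]
          unfolding fourier_coeff_diff fc[OF t] by (simp add: lin_def al_def)
      qed
      \<comment> \<open>The power 1 of 1 + |k| is the derivative in the nonlinearity; the
        convolutions are bounded uniformly in k.\<close>
      show "(LINT r:{0..t}|lborel. cmod (fourier_coeff (?G r) k)) \<le>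
          (2 powr (\<nu> / 2) * N * N * Beta (1 - 2 * \<mu>) 1) * (1 + \<bar>real_of_int k\<bar>) ^ 1" for k
      proof -
        define A where "A = 2 powr (\<nu> / 2) * N * N"
        have A: "0 \<le> A" using N0 by (simp add: A_def)
        have ni: "set_integrable lborel {0<..<t} (\<lambda>r. complex_of_real (cmod (fourier_coeff (?G r) k)))"
          using set_integrable_norm[OF iG, of k] by (simp add: set_integrable_def complex_of_real_integrable_eq scaleR_conv_of_real flip: of_real_mult)
        have "complex_of_real (LINT r:{0..t}|lborel. cmod (fourier_coeff (?G r) k)) = complex_of_real (LINT r:{0<..<t}|lborel. cmod (fourier_coeff (?G r) k))"
          unfolding set_integral_complex_of_real[symmetric] by (rule set_integral_Icc_Ioo(2)[OF ni])
        then have "(LINT r:{0..t}|lborel. cmod (fourier_coeff (?G r) k)) = (LINT r:{0<..<t}|lborel. cmod (fourier_coeff (?G r) k))"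
          by (simp only: of_real_eq_iff)
        also have "\<dots> = (LINT r:{0<..<t}|lborel. cmod (?h k r))"
          by (rule set_lebesgue_integral_cong) (simp_all add: eq)
        also have "\<dots> \<le> (1 + \<bar>real_of_int k\<bar>) * A * Beta (1 - 2 * \<mu>) 1"
        proof (cases "t = 0")
          case True
          have "0 \<le> Beta (1 - 2 * \<mu>) (1::real)" using mu by (simp add: Beta_def Gamma_real_nonneg)
          then show ?thesis using True A by (simp add: set_lebesgue_integral_def)
        next
          case False
          then have t0: "0 < t" "t \<le> T" "t \<le> 1" using t T by auto
          have bi: "set_integrable lborel {0<..<t} (\<lambda>r. (t - r) powr - 0 * r powr - (2 * \<mu>))"
            by (rule beta_integral(1)) (use t0 mu in auto)
          have "(LINT r:{0<..<t}|lborel. cmod (?h k r)) \<le>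
              (LINT r:{0<..<t}|lborel. ((1 + \<bar>real_of_int k\<bar>) * A) * ((t - r) powr - 0 * r powr - (2 * \<mu>)))"
          proof (intro set_integral_mono set_integrable_norm ih set_integrable_mult_right bi)
            fix r assume r: "r \<in> {0<..<t}"
            then have rT: "r \<in> {0<..<T}" "0 \<le> r" using t0 by auto
            have "cmod (conv (sol_coeffs x r) (sol_coeffs x r) k) \<le> wgt \<nu> 1 r k * cmod (conv (sol_coeffs x r) (sol_coeffs x r) k)"
              using mult_right_mono[OF wgt_ge_1[OF nu _ rT(2), of 1 k], of "cmod (conv (sol_coeffs x r) (sol_coeffs x r) k)"] by simp
            also have "\<dots> \<le> 2 powr (\<nu> / 2) * N * N * exp (0 * r) * r powr - (2 * \<mu>)"
              by (rule adm_conv(2)[OF al_Re(2) mu nu _ adm adm rT(1)]) simp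
            finally have c: "cmod (conv (sol_coeffs x r) (sol_coeffs x r) k) \<le> A * r powr - (2 * \<mu>)" by (simp add: A_def)
            have e: "cmod (exp (al k * of_real (t - r))) \<le> 1" using al_Re(2)[of k] r by (simp add: mult_nonpos_nonneg)
            have "cmod (?h k r) = (\<bar>real_of_int k\<bar> / 2) * (cmod (exp (al k * of_real (t - r))) * cmod (conv (sol_coeffs x r) (sol_coeffs x r) k))"
              by (simp add: norm_mult)
            also have "\<dots> \<le> (1 + \<bar>real_of_int k\<bar>) * (1 * (A * r powr - (2 * \<mu>)))"
              using c e A by (intro mult_mono) auto
            finally show "cmod (?h k r) \<le> ((1 + \<bar>real_of_int k\<bar>) * A) * ((t - r) powr - 0 * r powr - (2 * \<mu>))"
              using r by simp
          qed
          also have "\<dots> = ((1 + \<bar>real_of_int k\<bar>) * A) * (Beta (1 - 2 * \<mu>) (1 - 0) * t powr (1 - 0 - 2 * \<mu>))"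
            using beta_integral(2)[of t 0 "2 * \<mu>"] t0 mu by simp
          also have "\<dots> \<le> ((1 + \<bar>real_of_int k\<bar>) * A) * (Beta (1 - 2 * \<mu>) (1 - 0) * 1)"
          proof (intro mult_left_mono)
            show "t powr (1 - 0 - 2 * \<mu>) \<le> 1" using t0 mu by (intro powr_le1) auto
            show "0 \<le> Beta (1 - 2 * \<mu>) (1 - 0 :: real)" using mu by (simp add: Beta_def Gamma_real_nonneg)
          qed (use A in simp)
          finally show ?thesis by simp
        qed
        finally show ?thesis by (simp add: A_def ac_simps)
      qed
    qed
    then show "\<exists>I. has_pdist_integral ?G I 0 t \<and> ?u t = S_op \<beta> \<eta> t x - I"
      by (intro exI[of _ ?I]) simp
  qed
  then show ?thesis using good_C_Hs[OF g] Hi by (simp add: is_solution_def)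
qed

section \<open>Uniqueness among all solutions\<close>

lemma solution_unique: assumes x: "x \<in> X" and u: "is_solution \<beta> \<eta> s T x u" shows "u = tocurve (sol_coeffs x)"
proof -
  define c where "c t = fourier_coeff (u t)" for t
  have xs: "x \<in> Hs s" "Hs_norm s x < R" using x by (auto simp: X_def)
  have m: "is_mild T x c" using solution_mild[OF u] by (simp add: c_def[abs_def])
  have CH: "continuous_Hs s {0..T} u" and Hi: "\<And>r. continuous_Hs r {0<..<T} u" and out: "\<And>t. t \<notin> {0..T} \<Longrightarrow> u t = 0"
    using u unfolding is_solution_def C_Hs_def continuous_Hinf_def by auto
  have cont: "continuous_on {0..T} (\<lambda>t. c t k)" for k using continuous_Hs_coeff[OF CH, of k] by (simp add: c_def)
  define N where "N = 2 * (CL * R + 1)"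
  have N0: "0 \<le> N" using CL(1) R by (simp add: N_def)
  have csa: "adm \<mu> \<nu> 0 0 T (sol_coeffs y) N" if "y \<in> X" for y using adm_sigma_0[OF sol_coeffs_adm[OF that]] by (simp add: N_def)
  have c0: "c 0 k = fourier_coeff x k" for k
    using m T unfolding is_mild_def by (auto simp: lin_0)
  have u0: "u 0 = x" by (rule pdist_eqI) (simp add: c0[unfolded c_def])
  have bounded: "\<exists>M\<ge>0. \<forall>t\<in>{a..b}. l2b (\<lambda>k. J k powr (\<nu>/2) * cmod (c t k)) M" if ab: "0 < a" "b < T" for a b
  proof -
    have "{a..b} \<subseteq> {0<..<T}" using ab by auto
    from continuous_Hs_bounded[OF Hi this] obtain M where M: "\<And>t. t \<in> {a..b} \<Longrightarrow> Hs_norm \<nu> (u t) \<le> M" by blast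
    have "l2b (\<lambda>k. J k powr (\<nu>/2) * cmod (c t k)) \<bar>M\<bar>" if t: "t \<in> {a..b}" for t
    proof -
      have "u t \<in> Hs \<nu>" using Hi[of \<nu>] t ab unfolding continuous_Hs_def by auto
      from l2b_le[OF Hs_l2b'[OF this], of "\<bar>M\<bar>"] show ?thesis using M[OF t] by (simp add: c_def)
    qed
    then show ?thesis by (intro exI[of _ "\<bar>M\<bar>"]) auto
  qed
  \<comment> \<open>By continuity at 0 the solution stays in the open ball \<open>X\<close> for a
    short time, so each \<open>u t0\<close> with t0 < t1 is an admissible datum for the construction
    on the same interval.\<close>
  obtain t1 where t1: "0 < t1" "t1 < T" and small: "\<And>t. 0 \<le> t \<Longrightarrow> t < t1 \<Longrightarrow> u t \<in> X"
  proof -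
    have 0: "0 \<in> {0..T}" using T by simp
    have "((\<lambda>t. Hs_norm s (u t)) \<longlongrightarrow> Hs_norm s (u 0)) (at 0 within {0..T})"
      using continuous_Hs_norm[OF CH] 0 unfolding continuous_on_def by blast
    then have "eventually (\<lambda>t. Hs_norm s (u t) < R) (at 0 within {0..T})"
      using xs(2) unfolding u0 by (rule order_tendstoD(2))
    then obtain d where d: "d > 0" "\<And>t. t \<in> {0..T} \<Longrightarrow> t \<noteq> 0 \<Longrightarrow> dist t 0 < d \<Longrightarrow> Hs_norm s (u t) < R"
      unfolding eventually_at by blast
    show thesis
    proof (rule that[of "min (d / 2) (T / 2)"])
      fix t assume t: "0 \<le> t" "t < min (d / 2) (T / 2)"
      then have "t \<in> {0..T}" using T by auto
      moreover have "Hs_norm s (u t) < R"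
      proof (cases "t = 0")
        case True then show ?thesis using xs u0 by simp
      next
        case False then show ?thesis using d t T by (intro d(2)) (auto simp: dist_real_def)
      qed
      ultimately show "u t \<in> X" using CH unfolding X_def continuous_Hs_def by blast
    qed (use d T in auto)
  qed
  text \<open>Restarting at \<open>t0 > 0\<close> gives a bound independent of \<open>t0\<close>, so that \<open>t0\<close> can tend to \<open>0\<close>.\<close>
  have near: "l2b (\<lambda>k. (t - t0) powr \<mu> * (J k powr (\<nu>/2) * cmod (c t k))) N" if t: "0 < t0" "t0 < t" "t < t1" for t t0
  proof -
    have t0X: "u t0 \<in> X" using small[of t0] t by simp
    let ?w = "\<lambda>\<tau>. c (t0 + \<tau>)"
    define T1 where "T1 = t1 - t0"
    have T1: "0 < T1" "T1 \<le> T" "T1 \<le> 1" using t t1 T by (auto simp: T1_def)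
    obtain M where M: "0 \<le> M" "\<And>t. t \<in> {t0..t1} \<Longrightarrow> l2b (\<lambda>k. J k powr (\<nu>/2) * cmod (c t k)) M"
      using bounded[of t0 t1] t t1 by blast
    \<comment> \<open>\<open>M\<close> may grow without bound as t0 tends to 0; its purpose is to
      place the restarted curve in the uniqueness class. The uniform bound \<open>N\<close> is then
      inherited from the constructed solution.\<close>
    have w: "adm \<mu> \<nu> 0 0 T1 ?w M"
    proof (rule adm_of_bounded)
      show "continuous_on {0<..<T1} (\<lambda>\<tau>. ?w \<tau> k)" for k
        by (rule continuous_on_compose2[OF cont, of _ "\<lambda>\<tau>. t0 + \<tau>"]) (use t t1 in \<open>auto simp: T1_def intro!: continuous_intros\<close>)
      fix \<tau> assume \<tau>: "\<tau> \<in> {0<..<T1}"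
      have "l2b (\<lambda>k. \<tau> powr \<mu> * (J k powr (\<nu>/2) * cmod (?w \<tau> k))) (\<tau> powr \<mu> * M)"
        by (rule l2b_cmult[OF M(2)]) (use \<tau> in \<open>auto simp: T1_def\<close>)
      moreover have "\<tau> powr \<mu> * M \<le> M"
        using M(1) \<tau> T1 mu by (intro mult_left_le_one_le powr_le1) auto
      ultimately show "l2b (\<lambda>k. \<tau> powr \<mu> * (J k powr (\<nu>/2) * cmod (?w \<tau> k))) M" by (rule l2b_le)
    qed (rule T1)
    have v: "adm \<mu> \<nu> 0 0 T1 (sol_coeffs (u t0)) N" by (rule adm_restrict[OF csa[OF t0X] T1(2)])
    have "?w (t - t0) k = sol_coeffs (u t0) (t - t0) k" for k
    proof (rule uniqueness_adm[OF T1(1,3) w v])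
      show "?w \<tau> k = lin (u t0) \<tau> k + duhamel al ?w ?w \<tau> k" if "\<tau> \<in> {0<..<T1}" for \<tau> k
        using mild_restart[OF m, of t0 \<tau> k] that t t1 by (auto simp: T1_def lin_def c_def)
      show "sol_coeffs (u t0) \<tau> k = lin (u t0) \<tau> k + duhamel al (sol_coeffs (u t0)) (sol_coeffs (u t0)) \<tau> k" if "\<tau> \<in> {0<..<T1}" for \<tau> k
        using that T1 by (intro sol_coeffs_mild_eq[OF t0X]) auto
      show "t - t0 \<in> {0<..<T1}" using t by (auto simp: T1_def)
    qed
    then have e: "c t k = sol_coeffs (u t0) (t - t0) k" for k by simp
    have "t - t0 \<in> {0<..<T1}" using t by (auto simp: T1_def)
    then have "l2b (\<lambda>k. (t - t0) powr \<mu> * exp (- 0 * (t - t0)) * wgt \<nu> 0 (t - t0) k * cmod (sol_coeffs (u t0) (t - t0) k)) N"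
      using v unfolding adm_def by (elim conjE) (rule bspec)
    then show ?thesis by (simp add: e wgt_0 mult.assoc)
  qed
  have near0: "l2b (\<lambda>k. t powr \<mu> * (J k powr (\<nu>/2) * cmod (c t k))) N" if t: "0 < t" "t < t1" for t
    unfolding l2b_def
  proof (intro allI impI)
    fix F :: "int set" assume F: "finite F"
    \<comment> \<open>For a finite set of frequencies the weighted norm is continuous in t0, so the
      bound \<open>N\<close> survives t0 -> 0 and gives the bound for the uniqueness class at the
      original starting time.\<close>
    have "((\<lambda>t0. L2_set (\<lambda>k. (t - t0) powr \<mu> * (J k powr (\<nu>/2) * cmod (c t k))) F) \<longlongrightarrow>
        L2_set (\<lambda>k. (t - 0) powr \<mu> * (J k powr (\<nu>/2) * cmod (c t k))) F) (at_right 0)"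
      unfolding L2_set_def using t by (intro tendsto_intros) auto
    moreover have "eventually (\<lambda>t0. L2_set (\<lambda>k. (t - t0) powr \<mu> * (J k powr (\<nu>/2) * cmod (c t k))) F \<le> N) (at_right 0)"
      using eventually_at_right_less[of 0] eventually_at_right_real[OF t(1)]
      by eventually_elim (use near t F l2bD in auto)
    ultimately show "L2_set (\<lambda>k. t powr \<mu> * (J k powr (\<nu>/2) * cmod (c t k))) F \<le> N"
      using tendsto_upperbound[OF _ _ trivial_limit_at_right_real] by fastforce
  qed
  have inside: "c t k = sol_coeffs x t k" if t: "0 < t" "t < T" for t k
  proof -
    \<comment> \<open>T2 lies strictly below T, because the bounds in \<open>H\<^sup>\<nu>\<close>
      away from 0 come from compact subintervals of the open interval (0, T).\<close>
    define T2 where "T2 = (t + T) / 2"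
    have T2: "0 < T2" "T2 \<le> 1" "t < T2" "T2 < T" using t T by (auto simp: T2_def)
    obtain M where M: "0 \<le> M" "\<And>t. t \<in> {t1/2..T2} \<Longrightarrow> l2b (\<lambda>k. J k powr (\<nu>/2) * cmod (c t k)) M"
      using bounded[of "t1/2" T2] t1 T2 by auto
    have ca: "adm \<mu> \<nu> 0 0 T2 c (max N M)"
    proof (rule adm_of_bounded)
      show "continuous_on {0<..<T2} (\<lambda>t. c t k)" for k
        by (rule continuous_on_subset[OF cont]) (use T2 in auto)
      fix t assume t: "t \<in> {0<..<T2}"
      show "l2b (\<lambda>k. t powr \<mu> * (J k powr (\<nu>/2) * cmod (c t k))) (max N M)"
      proof (cases "t < t1")
        case True
        have "l2b (\<lambda>k. t powr \<mu> * (J k powr (\<nu>/2) * cmod (c t k))) N" using near0[of t] t True by auto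
        then show ?thesis by (rule l2b_le) simp
      next
        case False
        have "l2b (\<lambda>k. t powr \<mu> * (J k powr (\<nu>/2) * cmod (c t k))) (t powr \<mu> * M)"
          by (rule l2b_cmult[OF M(2)]) (use t False t1 in auto)
        moreover have "t powr \<mu> * M \<le> max N M"
        proof -
          have "t powr \<mu> * M \<le> M" using M(1) t T2 mu by (intro mult_left_le_one_le powr_le1) auto
          then show ?thesis by simp
        qed
        ultimately show ?thesis by (rule l2b_le)
      qed
    qed (rule T2)
    have va: "adm \<mu> \<nu> 0 0 T2 (sol_coeffs x) N" by (rule adm_restrict[OF csa[OF x]]) (use T2 in simp)
    show ?thesis
    proof (rule uniqueness_adm[OF T2(1,2) ca va])
      show "c t k = lin x t k + duhamel al c c t k" if "t \<in> {0<..<T2}" for t k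
        using m that T2 unfolding is_mild_def by auto
      show "sol_coeffs x t k = lin x t k + duhamel al (sol_coeffs x) (sol_coeffs x) t k" if "t \<in> {0<..<T2}" for t k
        using that T2 by (intro sol_coeffs_mild_eq[OF x]) auto
      show "t \<in> {0<..<T2}" using t T2 by simp
    qed
  qed
  obtain M where b: "bnd (sol_coeffs x) M" and gc: "\<And>k. continuous_on {0..T} (\<lambda>t. sol_coeffs x t k)"
    using sol_coeffs_good[OF x] unfolding good_def by blast
  \<comment> \<open>Both coefficient curves are continuous on the closed interval, which adds the
    two endpoints.\<close>
  have all: "c t k = sol_coeffs x t k" if t: "t \<in> {0..T}" for t k
  proof -
    have cl: "closure {0<..<T} = {0..T}" using T by simp
    have "c t k - sol_coeffs x t k = 0"
    proof (rule continuous_constant_on_closure[where S = "{0<..<T}"])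
      show "continuous_on (closure {0<..<T}) (\<lambda>t. c t k - sol_coeffs x t k)"
        unfolding cl by (intro continuous_intros cont gc)
      show "c t k - sol_coeffs x t k = 0" if "t \<in> {0<..<T}" for t using inside that by simp
      show "t \<in> closure {0<..<T}" using t unfolding cl .
    qed
    then show ?thesis by simp
  qed
  show ?thesis
  proof
    fix t
    show "u t = tocurve (sol_coeffs x) t"
    proof (cases "t \<in> {0..T}")
      case True
      show ?thesis by (rule pdist_eqI) (simp only: fc_tocurve[OF b True] all[OF True, unfolded c_def])
    next
      case False
      show ?thesis by (simp only: tocurve_outside[OF False] out[OF False])
    qed
  qed
qed

lemma ex1_solution: "x \<in> X \<Longrightarrow> \<exists>!u. is_solution \<beta> \<eta> s T x u"
  using sol_coeffs_solution solution_unique by (intro ex1I[of _ "tocurve (sol_coeffs x)"])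

lemma flow_map_eq: "x \<in> X \<Longrightarrow> flow_map \<beta> \<eta> s T x = tocurve (sol_coeffs x)"
  unfolding flow_map_def using sol_coeffs_solution solution_unique by (intro the_equality)

subsection \<open>Smoothness of the flow map\<close>

text \<open>By the reversal, prolonging the list at its head adds \<open>length hs\<close> to the index set and leaves the other
  directions in place.\<close>

definition dirs :: "pdist list \<Rightarrow> nat \<Rightarrow> pdist" where "dirs hs i = rev hs ! i"

lemma dirs_Cons: "i < length hs \<Longrightarrow> dirs (h # hs) i = dirs hs i" "dirs (h # hs) (length hs) = h"
  by (simp_all add: dirs_def nth_append)

lemma dirs_in: assumes "hs \<in> lists V" shows "dirs hs ` {..<length hs} \<subseteq> V"
proof
  fix y assume "y \<in> dirs hs ` {..<length hs}"
  then obtain i where "i < length (rev hs)" "y = rev hs ! i" by (auto simp: dirs_def)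
  then have "y \<in> set (rev hs)" by (metis nth_mem)
  then show "y \<in> V" using assms by auto
qed

lemma pN_dirs: "qo.pN (dirs hs) {..<length hs} = prod_list (map (Hs_norm s) hs)"
proof (induction hs)
  case (Cons h hs)
  have "(\<Prod>i\<in>{..<length hs}. Hs_norm s (dirs (h # hs) i)) = (\<Prod>i\<in>{..<length hs}. Hs_norm s (dirs hs i))"
    by (rule prod.cong) (auto simp: dirs_Cons)
  then show ?case using Cons by (simp add: qo.pN_def lessThan_Suc dirs_Cons)
qed (simp add: qo.pN_def)

definition Dflow :: "pdist \<Rightarrow> pdist list \<Rightarrow> real \<Rightarrow> pdist" where
  "Dflow x hs = tocurve (qo.Do x (dirs hs) {..<length hs})"

lemma Do_bnd: assumes "x \<in> X" "hs \<in> lists (Hs s)"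
  shows "good (qo.Do x (dirs hs) {..<length hs})" "\<exists>M. bnd (qo.Do x (dirs hs) {..<length hs}) M"
proof -
  show "good (qo.Do x (dirs hs) {..<length hs})" by (rule good_Do[OF assms(1) _ dirs_in[OF assms(2)]]) simp
  then show "\<exists>M. bnd (qo.Do x (dirs hs) {..<length hs}) M" unfolding good_def by blast
qed

lemma dirs_append: "dirs (hs @ h # ks) i = (if i < length ks then rev ks ! i else if i = length ks then h else rev hs ! (i - Suc (length ks)))"
  by (auto simp: dirs_def nth_append nth_Cons')

lemma Dflow_linear: assumes x: "x \<in> X" and hs: "hs \<in> lists (Hs s)" "ks \<in> lists (Hs s)"
  shows "linear_on_subspace (Hs s) (\<lambda>h. Dflow x (hs @ h # ks))"
  unfolding linear_on_subspace_def
proof (intro conjI ballI allI)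
  let ?n = "length ks" and ?I = "{..<Suc (length hs + length ks)}"
  have I: "length (hs @ h # ks) = Suc (length hs + length ks)" for h by simp
  have i: "?n \<in> ?I" "finite ?I" by auto
  have l: "hs @ h # ks \<in> lists (Hs s)" if "h \<in> Hs s" for h using that hs by auto
  have at: "dirs (hs @ h # ks) ?n = h" for h by (simp add: dirs_append)
  fix h k assume hk: "h \<in> Hs s" "k \<in> Hs s"
  obtain M M' where b: "bnd (qo.Do x (dirs (hs @ h # ks)) ?I) M" "bnd (qo.Do x (dirs (hs @ k # ks)) ?I) M'"
    using Do_bnd(2)[OF x l[OF hk(1)]] Do_bnd(2)[OF x l[OF hk(2)]] unfolding I by blast
  have "qo.Do x (dirs (hs @ (h + k) # ks)) ?I = qo.Do x (dirs (hs @ h # ks)) ?I + qo.Do x (dirs (hs @ k # ks)) ?I"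
    by (rule qo.Do_add[OF i(2) x i(1)]) (use hk in \<open>auto simp: at dirs_append\<close>)
  then show "Dflow x (hs @ (h + k) # ks) = Dflow x (hs @ h # ks) + Dflow x (hs @ k # ks)"
    unfolding Dflow_def I by (simp only: tocurve_add[OF b])
next
  let ?n = "length ks" and ?I = "{..<Suc (length hs + length ks)}"
  have I: "length (hs @ h # ks) = Suc (length hs + length ks)" for h by simp
  have i: "?n \<in> ?I" "finite ?I" by auto
  have l: "hs @ h # ks \<in> lists (Hs s)" if "h \<in> Hs s" for h using that hs by auto
  have at: "dirs (hs @ h # ks) ?n = h" for h by (simp add: dirs_append)
  fix a h assume h: "h \<in> Hs s"
  obtain M where b: "bnd (qo.Do x (dirs (hs @ h # ks)) ?I) M"
    using Do_bnd(2)[OF x l[OF h]] unfolding I by blast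
  have "qo.Do x (dirs (hs @ (a *\<^sub>R h) # ks)) ?I = a *\<^sub>R qo.Do x (dirs (hs @ h # ks)) ?I"
    by (rule qo.Do_scale[OF i(2) x i(1)]) (use h in \<open>auto simp: at dirs_append\<close>)
  then show "Dflow x (hs @ a *\<^sub>R h # ks) = a *\<^sub>R Dflow x (hs @ h # ks)"
    unfolding Dflow_def I by (simp only: tocurve_scale[OF b])
qed

text \<open>The remainder at each order is quadratic in the increment, by
  \<open>Do_remainder\<close>, uniformly over \<open>P\<close>. This is stronger than the required
  o(h), and \<open>seminorm_bound\<close> carries it over to every seminorm of the flow
  space.\<close>

lemma flow_smooth: assumes B: "B \<subseteq> X"
  shows "smooth_map (Hs s) (Hs_norm s) (flow_space s T) (flow_seminorms s T) B (flow_map \<beta> \<eta> s T)"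
  unfolding smooth_map_def
proof (intro exI[of _ Dflow] conjI ballI allI impI)
  fix x assume xB: "x \<in> B"
  then have x: "x \<in> X" using B by blast
  show "Dflow x [] = flow_map \<beta> \<eta> s T x"
  proof -
    have "qo.Do x (dirs []) {} = sol_coeffs x" unfolding sol_coeffs_def by (rule qo.Do_cong) auto
    then show ?thesis by (simp add: Dflow_def flow_map_eq[OF x])
  qed
  show "Dflow x hs \<in> flow_space s T" if "hs \<in> lists (Hs s)" for hs
    unfolding Dflow_def by (rule good_flow_space[OF Do_bnd(1)[OF x that]])
  show "linear_on_subspace (Hs s) (\<lambda>h. Dflow x (hs @ h # ks))"
    if "hs \<in> lists (Hs s)" "ks \<in> lists (Hs s)" for hs ks by (rule Dflow_linear[OF x that])
next
  fix x n p assume xB: "x \<in> B" and p: "p \<in> flow_seminorms s T"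
  then have x: "x \<in> X" using B by blast
  obtain C where C: "0 \<le> C" "\<And>c M. bnd c M \<Longrightarrow> p (tocurve c) \<le> C * M" using seminorm_bound[OF p] by blast
  obtain A where A: "\<forall>p\<in>P. \<forall>e I. finite I \<and> card I \<le> n \<and> e ` I \<subseteq> Hs s \<longrightarrow> p (qo.Do x e I) \<le> A * qo.pN e I"
    using qo.Do_bound[OF x, of n] by (elim exE)
  show "\<exists>C. \<forall>hs\<in>lists (Hs s). length hs = n \<longrightarrow> p (Dflow x hs) \<le> C * prod_list (map (Hs_norm s) hs)"
  proof (intro exI ballI impI)
    fix hs assume hs: "hs \<in> lists (Hs s)" "length hs = n"
    have "bnd (qo.Do x (dirs hs) {..<length hs}) (A * prod_list (map (Hs_norm s) hs))"
      unfolding bnd_iff using A dirs_in[OF hs(1)] hs(2) by (auto simp flip: pN_dirs)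
    from C(2)[OF this] show "p (Dflow x hs) \<le> (C * A) * prod_list (map (Hs_norm s) hs)"
      unfolding Dflow_def by (simp add: mult.assoc)
  qed
next
  fix x n p and \<epsilon> :: real assume xB: "x \<in> B" and p: "p \<in> flow_seminorms s T" and e: "0 < \<epsilon>"
  then have x: "x \<in> X" using B by blast
  obtain C where C: "0 \<le> C" "\<And>c M. bnd c M \<Longrightarrow> p (tocurve c) \<le> C * M" using seminorm_bound[OF p] by blast
  obtain A where A0: "0 \<le> A" and A: "\<forall>p\<in>P. \<forall>h\<in>Hs s. \<forall>e I i. x + h \<in> X \<and> finite I \<and> card I \<le> n \<and> e ` I \<subseteq> Hs s \<and> i \<notin> I \<and> e i = h \<longrightarrow>
     p (qo.Do (x + h) e I - qo.Do x e I - qo.Do x e (insert i I)) \<le> A * (Hs_norm s h)\<^sup>2 * qo.pN e I"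
    using qo.Do_remainder[OF x, of n] by (elim exE conjE)
  \<comment> \<open>Chosen so that one factor of the quadratic remainder, C A times the norm of h,
    is at most epsilon; the 1 avoids division by 0.\<close>
  define \<delta> where "\<delta> = \<epsilon> / (C * A + 1)"
  have CA: "0 \<le> C * A" using C(1) A0 by simp
  have d: "0 < \<delta>" using e CA by (simp add: \<delta>_def add_nonneg_pos)
  show "\<exists>\<delta>>0. \<forall>h\<in>Hs s. Hs_norm s h < \<delta> \<and> x + h \<in> B \<longrightarrow>
       (\<forall>hs\<in>lists (Hs s). length hs = n \<longrightarrow>
           p (Dflow (x + h) hs - Dflow x hs - Dflow x (h # hs)) \<le> \<epsilon> * Hs_norm s h * prod_list (map (Hs_norm s) hs))"
  proof (intro exI[of _ \<delta>] conjI ballI impI d)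
    fix h hs assume h: "h \<in> Hs s" "Hs_norm s h < \<delta> \<and> x + h \<in> B" and hs: "hs \<in> lists (Hs s)" "length hs = n"
    have xh: "x + h \<in> X" using h B by blast
    let ?I = "{..<length hs}" and ?e = "dirs (h # hs)"
    define W where "W = prod_list (map (Hs_norm s) hs)"
    have P0: "0 \<le> W" unfolding W_def by (rule prod_list_nonneg) (auto simp: Hs_norm_nonneg)
    have ce: "qo.Do y (dirs hs) ?I = qo.Do y ?e ?I" for y by (rule qo.Do_cong) (auto simp: dirs_Cons)
    have I': "{..<length (h # hs)} = insert (length hs) ?I" by (simp add: lessThan_Suc)
    have hhs: "h # hs \<in> lists (Hs s)" using h hs by simp
    obtain M1 M2 M3 where b: "bnd (qo.Do (x + h) ?e ?I) M1" "bnd (qo.Do x ?e ?I) M2" "bnd (qo.Do x ?e (insert (length hs) ?I)) M3"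
      using Do_bnd(2)[OF xh hs(1)] Do_bnd(2)[OF x hs(1)] Do_bnd(2)[OF x hhs] unfolding ce I' by blast
    have minus: "c - d = c + (-1) *\<^sub>R d" for c d :: "real \<Rightarrow> int \<Rightarrow> complex" by simp
    have tm: "tocurve (c - d) = tocurve c - tocurve d \<and> bnd (c - d) (M + M')" if "bnd c M" "bnd d M'" for c d M M'
      using tocurve_add[OF that(1) bnd_scale[OF that(2), of "-1"]] tocurve_scale[OF that(2), of "-1"]
        bnd_add[OF that(1) bnd_scale[OF that(2), of "-1"]] unfolding minus by simp
    have t1: "Dflow (x + h) hs - Dflow x hs - Dflow x (h # hs) =
        tocurve (qo.Do (x + h) ?e ?I - qo.Do x ?e ?I - qo.Do x ?e (insert (length hs) ?I))"
      unfolding Dflow_def ce I' using tm[OF b(1,2)] tm[OF tm[OF b(1,2), THEN conjunct2] b(3)] by simp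
    have pe: "qo.pN ?e ?I = W"
    proof -
      have "qo.pN ?e ?I = qo.pN (dirs hs) ?I" unfolding qo.pN_def by (rule prod.cong) (auto simp: dirs_Cons)
      then show ?thesis by (simp add: pN_dirs W_def)
    qed
    have eI: "?e ` ?I \<subseteq> Hs s" using dirs_in[OF hhs] by auto
    have "bnd (qo.Do (x + h) ?e ?I - qo.Do x ?e ?I - qo.Do x ?e (insert (length hs) ?I)) (A * (Hs_norm s h)\<^sup>2 * W)"
      unfolding bnd_iff
    proof
      fix q assume q: "q \<in> P"
      show "q (qo.Do (x + h) ?e ?I - qo.Do x ?e ?I - qo.Do x ?e (insert (length hs) ?I)) \<le> A * (Hs_norm s h)\<^sup>2 * W"
        unfolding pe[symmetric] by (rule A[rule_format, OF q h(1)]) (use xh eI hs dirs_Cons(2)[of h hs] in simp)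
    qed
    from C(2)[OF this] have "p (Dflow (x + h) hs - Dflow x hs - Dflow x (h # hs)) \<le> (C * A * Hs_norm s h) * (Hs_norm s h * W)"
      unfolding t1 by (simp add: power2_eq_square ac_simps)
    also have "\<dots> \<le> \<epsilon> * (Hs_norm s h * W)"
    proof (rule mult_right_mono)
      have "C * A * Hs_norm s h \<le> (C * A + 1) * \<delta>"
        using h CA Hs_norm_nonneg[of s h] by (intro mult_mono) auto
      also have "\<dots> = \<epsilon>" using CA by (simp add: \<delta>_def)
      finally show "C * A * Hs_norm s h \<le> \<epsilon>" .
    qed (use P0 Hs_norm_nonneg in simp)
    finally show "p (Dflow (x + h) hs - Dflow x hs - Dflow x (h # hs)) \<le> \<epsilon> * Hs_norm s h * prod_list (map (Hs_norm s) hs)"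
      by (simp add: W_def mult.assoc)
  qed
qed

end

text \<open>T is chosen with T^theta = 1 / (A + 1), which makes the smallness condition read A / (A
  + 1) < 1.\<close>

lemma (in bo_burgers) ex_time: assumes "0 \<le> R" shows "\<exists>T. 0 < T \<and> T \<le> 1 \<and> bo_time \<beta> \<eta> s T R"
proof -
  define A where "A = 4 * CB * (CL * R + 1)"
  have A: "0 \<le> A" using CB(1) CL(1) assms by (simp add: A_def)
  define T where "T = (1 / (A + 1)) powr (1 / \<theta>)"
  have T: "0 < T" "T \<le> 1" using A theta by (auto simp: T_def intro!: powr_le1)
  have "T powr \<theta> = 1 / (A + 1)" using A theta by (simp add: T_def powr_powr)
  then have "4 * (CB * T powr \<theta>) * (CL * R + 1) = A / (A + 1)" by (simp add: A_def)
  also have "\<dots> < 1" using A by simp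
  finally have "bo_time \<beta> \<eta> s T R" using T assms by unfold_locales
  then show ?thesis using T by blast
qed

theorem theorem1p1:
  fixes \<beta> \<eta> s :: real
  assumes "\<beta> \<ge> 0" and "\<eta> > 0" and "s > - 1 / 2"
  shows "(\<exists>T :: real \<Rightarrow> real. \<forall>\<phi>\<in>Hs s. T (Hs_norm s \<phi>) > 0 \<and>
            (\<exists>!u. is_solution \<beta> \<eta> s (T (Hs_norm s \<phi>)) \<phi> u)) \<and>
         (\<forall>\<phi>0\<in>Hs s. \<exists>T \<rho>. 0 < T \<and> T \<le> 1 \<and> \<rho> > 0 \<and>
            (\<forall>\<phi>\<in>Hs_ball s \<phi>0 \<rho>. \<exists>!u. is_solution \<beta> \<eta> s T \<phi> u) \<and>
            smooth_map (Hs s) (Hs_norm s) (flow_space s T) (flow_seminorms s T)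
              (Hs_ball s \<phi>0 \<rho>) (flow_map \<beta> \<eta> s T))"
proof -
  interpret bo_burgers \<beta> \<eta> s using assms by unfold_locales auto
  \<comment> \<open>The time is selected as a function of \<open>R\<close> alone. With R equal to
    the norm of the datum plus 1, the datum and the whole open unit ball around it lie in
    \<open>X\<close>.\<close>
  have "\<forall>R. \<exists>T. 0 \<le> R \<longrightarrow> 0 < T \<and> T \<le> 1 \<and> bo_time \<beta> \<eta> s T R" using ex_time by blast
  then obtain \<T> where \<T>: "\<And>R. 0 \<le> R \<Longrightarrow> 0 < \<T> R \<and> \<T> R \<le> 1 \<and> bo_time \<beta> \<eta> s (\<T> R) R" by metis
  have nn: "0 \<le> Hs_norm s \<phi> + 1" for \<phi> using Hs_norm_nonneg[of s \<phi>] by simp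
  have "\<forall>\<phi>\<in>Hs s. \<T> (Hs_norm s \<phi> + 1) > 0 \<and> (\<exists>!u. is_solution \<beta> \<eta> s (\<T> (Hs_norm s \<phi> + 1)) \<phi> u)"
  proof
    fix \<phi> assume p: "\<phi> \<in> Hs s"
    interpret bo_time \<beta> \<eta> s "\<T> (Hs_norm s \<phi> + 1)" "Hs_norm s \<phi> + 1" using \<T>[OF nn] by blast
    have "\<phi> \<in> X" using p by (simp add: X_def)
    from ex1_solution[OF this] \<T>[OF nn]
    show "\<T> (Hs_norm s \<phi> + 1) > 0 \<and> (\<exists>!u. is_solution \<beta> \<eta> s (\<T> (Hs_norm s \<phi> + 1)) \<phi> u)" by blast
  qed
  moreover have "\<exists>T \<rho>. 0 < T \<and> T \<le> 1 \<and> \<rho> > 0 \<and>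
            (\<forall>\<phi>\<in>Hs_ball s \<phi>0 \<rho>. \<exists>!u. is_solution \<beta> \<eta> s T \<phi> u) \<and>
            smooth_map (Hs s) (Hs_norm s) (flow_space s T) (flow_seminorms s T)
              (Hs_ball s \<phi>0 \<rho>) (flow_map \<beta> \<eta> s T)" if p: "\<phi>0 \<in> Hs s" for \<phi>0
  proof -
    interpret bo_time \<beta> \<eta> s "\<T> (Hs_norm s \<phi>0 + 1)" "Hs_norm s \<phi>0 + 1" using \<T>[OF nn] by blast
    have sub: "Hs_ball s \<phi>0 1 \<subseteq> X"
    proof
      fix \<phi> assume "\<phi> \<in> Hs_ball s \<phi>0 1"
      then have q: "\<phi> \<in> Hs s" "Hs_norm s (\<phi> - \<phi>0) < 1" by (auto simp: Hs_ball_def)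
      then show "\<phi> \<in> X" using Hs_norm_triangle[OF q(1) p] by (simp add: X_def)
    qed
    have "\<forall>\<phi>\<in>Hs_ball s \<phi>0 1. \<exists>!u. is_solution \<beta> \<eta> s (\<T> (Hs_norm s \<phi>0 + 1)) \<phi> u"
    proof
      fix \<phi> assume "\<phi> \<in> Hs_ball s \<phi>0 1"
      then show "\<exists>!u. is_solution \<beta> \<eta> s (\<T> (Hs_norm s \<phi>0 + 1)) \<phi> u"
        by (intro ex1_solution subsetD[OF sub])
    qed
    with flow_smooth[OF sub] \<T>[OF nn, of \<phi>0] show ?thesis
      by - (rule exI[of _ "\<T> (Hs_norm s \<phi>0 + 1)"], rule exI[of _ "1::real"], simp)
  qed
  ultimately show ?thesis
    by - (rule conjI[OF exI[of _ "\<lambda>r. \<T> (r + 1)"]], simp, rule ballI)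
qed

end
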